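(* Let $0<p,q,u,v<\infty$, $\alpha,\beta>-1$, and let $\varphi:\mathbb{C}\to\mathbb{C}$ be a function. Then the superposition operator $S_\varphi$ maps $\mathscr{H}^{p,q}_\alpha$ into $\mathscr{H}^{u,v}_\beta$ if and only if $\varphi$ is a polynomial of degree $N$, where $N$ satisfies (i) $N\leq\min\left\{\frac{p}{u},\frac{q(\beta+1)}{v(\alpha+1)}\right\}$ in the case $\alpha\leq\beta$; (ii) $N\leq\frac{p}{u}$ and $N<\frac{q(\beta+1)}{v(\alpha+1)}$ in the case $\alpha>\beta$. Moreover, if $S_\varphi$ maps $\mathscr{H}^{p,q}_\alpha$ into $\mathscr{H}^{u,v}_\beta$, then it is bounded and continuous.
   Context: For a function $\varphi$ on $\mathbb{C}$, the (nonlinear) superposition operator is $S_\varphi f=\varphi\circ f$ for complex-valued functions $f$. Bounded means mapping bounded sets to bounded sets. $\mathcal{P}$ is the space of Dirichlet polynomials $\sum_{n=1}^Na_nn^{-s}$ ($a_n\in\mathbb{C}$). Let $p_j$ be the $j$th prime and write $n=\prod_j p_j^{\nu_j(n)}$. The Bohr lift of $P(s)=\sum_{n=1}^N a_nn^{-s}$ is $\mathscr{B}P(z)=\sum_{n=1}^N a_nz^{\nu(n)}$, where $z=(z_1,z_2,\dots)$ and $z^{\nu(n)}=\prod_jz_j^{\nu_j(n)}$. For $0<p<\infty$ and $P\in\mathcal{P}$, $\|P\|_{\mathscr{H}^p}=\left(\int_{\mathbb{T}^\infty}|\mathscr{B}P(z)|^p\,dm_\infty(z)\right)^{1/p}$,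 where $m_\infty$ is the Haar probability measure on the infinite torus $\mathbb{T}^\infty$. For $\sigma\ge0$, $P_\sigma(s)=P(s+\sigma)$. For $0<p,q<\infty$ and $\alpha>-1$, the mixed norm space $\mathscr{H}^{p,q}_\alpha$ is the completion of $\mathcal{P}$ with respect to the (quasi-)norm $\|P\|_{\mathscr{H}^{p,q}_\alpha}=\left(\int_0^{+\infty}\|P_\sigma\|_{\mathscr{H}^p}^q\,d\mu_\alpha(\sigma)\right)^{1/q}$, where $d\mu_\alpha(\sigma)=\frac{2^{\alpha+1}}{\Gamma(\alpha+1)}\sigma^\alpha e^{-2\sigma}d\sigma$. Its elements are identified with Dirichlet series converging on $\mathbb{C}_{1/2}=\{s\in\mathbb{C}:\Re s>1/2\}$, i.e. with analytic functions on $\mathbb{C}_{1/2}$. *)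

theory Defs
  imports
    "HOL-Probability.Probability"
    "HOL-Computational_Algebra.Computational_Algebra"
begin

text \<open>
  A Dirichlet polynomial is represented by its coefficient function. The index set of
  Dirichlet series is $n \ge 1$, so the coefficient at 0 is required to vanish.
\<close>

definition dirichlet_polys :: "(nat \<Rightarrow> complex) set" where
  "dirichlet_polys = {a. a 0 = 0 \<and> finite {n. a n \<noteq> 0}}"

definition dirichlet_eval :: "(nat \<Rightarrow> complex) \<Rightarrow> complex \<Rightarrow> complex" where
  "dirichlet_eval a s = (\<Sum>n | a n \<noteq> 0. a n * of_nat n powr (-s))"

definition dirichlet_shift :: "real \<Rightarrow> (nat \<Rightarrow> complex) \<Rightarrow> nat \<Rightarrow> complex" where
  "dirichlet_shift \<sigma> a = (\<lambda>n. a n * of_real (real n powr (-\<sigma>)))"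

lemma dirichlet_shift_in_polys:
  "a \<in> dirichlet_polys \<Longrightarrow> dirichlet_shift \<sigma> a \<in> dirichlet_polys"
  unfolding dirichlet_polys_def dirichlet_shift_def
  by (auto elim: rev_finite_subset)

lemma dirichlet_eval_shift:
  assumes "a \<in> dirichlet_polys"
  shows "dirichlet_eval (dirichlet_shift \<sigma> a) s = dirichlet_eval a (s + of_real \<sigma>)"
proof -
  have pos: "n > 0" if "a n \<noteq> 0" for n
    using that assms by (cases n) (auto simp: dirichlet_polys_def)
  have eq: "{n. dirichlet_shift \<sigma> a n \<noteq> 0} = {n. a n \<noteq> 0}"
    using pos by (auto simp: dirichlet_shift_def)
  show ?thesis
    unfolding dirichlet_eval_def eq
  proof (rule sum.cong)
    fix n assume "n \<in> {n. a n \<noteq> 0}"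
    hence n: "n > 0" using pos by simp
    have "complex_of_real (real n powr (-\<sigma>)) = of_nat n powr (- of_real \<sigma>)"
      using powr_of_real[of "real n" "-\<sigma>"] by simp
    moreover have "(of_nat n :: complex) powr (- (s + of_real \<sigma>))
        = of_nat n powr (- of_real \<sigma>) * of_nat n powr (-s)"
      by (simp flip: powr_add add: algebra_simps)
    ultimately show "dirichlet_shift \<sigma> a n * of_nat n powr (-s)
        = a n * of_nat n powr (- (s + of_real \<sigma>))"
      by (simp add: dirichlet_shift_def)
  qed simp
qed

text \<open>Primes and torus coordinates are numbered from 0.\<close>

definition prime_exponent :: "nat \<Rightarrow> nat \<Rightarrow> nat" where
  "prime_exponent j n = multiplicity (enumerate {p::nat. prime p} j) n"

definition bohr_lift :: "(nat \<Rightarrow> complex) \<Rightarrow> (nat \<Rightarrow> complex) \<Rightarrow> complex" where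
  "bohr_lift a z =
     (\<Sum>n | a n \<noteq> 0. a n * (\<Prod>j | prime_exponent j n \<noteq> 0. z j ^ prime_exponent j n))"

text \<open>
  The Haar probability measure of the circle is normalized arc length, and that of the
  infinite torus is the countable product of copies of it.
\<close>

definition circle_measure :: "complex measure" where
  "circle_measure =
     distr (uniform_measure lborel {0..<1::real}) (restrict_space borel (sphere 0 1))
       (\<lambda>t. cis (2 * pi * t))"

definition torus_measure :: "(nat \<Rightarrow> complex) measure" where
  "torus_measure = (\<Pi>\<^sub>M j\<in>UNIV. circle_measure)"

lemma prob_space_circle_measure: "prob_space circle_measure"
proof -
  interpret U: prob_space "uniform_measure lborel {0..<1::real}"
    by (rule prob_space_uniform_measure) auto
  have "(\<lambda>t. cis (2 * pi * t)) \<in> borel_measurable borel"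
    by (intro borel_measurable_continuous_onI continuous_intros)
  then show ?thesis
    unfolding circle_measure_def
    by (intro U.prob_space_distr measurable_restrict_space2) auto
qed

lemma prob_space_torus_measure: "prob_space torus_measure"
  unfolding torus_measure_def by (intro prob_space_PiM prob_space_circle_measure)

lemma space_torus_measure: "space torus_measure = {z. \<forall>j. norm (z j) = 1}"
  by (auto simp: torus_measure_def circle_measure_def space_PiM space_restrict_space
      PiE_def Pi_def)

definition hardy_norm :: "real \<Rightarrow> (nat \<Rightarrow> complex) \<Rightarrow> real" where
  "hardy_norm p a = (\<integral>z. norm (bohr_lift a z) powr p \<partial>torus_measure) powr (1 / p)"

definition weight_measure :: "real \<Rightarrow> real measure" where
  "weight_measure \<alpha> = density lborel (\<lambda>\<sigma>. ennreal
     (indicator {0<..} \<sigma> * (2 powr (\<alpha> + 1) / Gamma (\<alpha> + 1) * \<sigma> powr \<alpha> * exp (- 2 * \<sigma>))))"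

definition mixed_norm :: "real \<Rightarrow> real \<Rightarrow> real \<Rightarrow> (nat \<Rightarrow> complex) \<Rightarrow> real" where
  "mixed_norm p q \<alpha> a =
     (\<integral>\<sigma>. hardy_norm p (dirichlet_shift \<sigma> a) powr q \<partial>weight_measure \<alpha>) powr (1 / q)"

text \<open>
  The completion of the Dirichlet polynomials is realized as a space of functions on
  the half-plane $\Re s > 1/2$: point evaluations there are bounded for the mixed norm, so
  every Cauchy sequence of Dirichlet polynomials converges pointwise there, and the class of
  the sequence is identified with its limit function. Functions are total in HOL, but
  membership and norm depend only on the values on that half-plane.
\<close>

definition mixed_approx ::
    "real \<Rightarrow> real \<Rightarrow> real \<Rightarrow> (nat \<Rightarrow> nat \<Rightarrow> complex) \<Rightarrow> (complex \<Rightarrow> complex) \<Rightarrow> bool" where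
  "mixed_approx p q \<alpha> A f \<longleftrightarrow>
     (\<forall>k. A k \<in> dirichlet_polys) \<and>
     (\<forall>\<epsilon>>0. \<exists>K. \<forall>k\<ge>K. \<forall>l\<ge>K. mixed_norm p q \<alpha> (\<lambda>n. A k n - A l n) < \<epsilon>) \<and>
     (\<forall>s. Re s > 1 / 2 \<longrightarrow> (\<lambda>k. dirichlet_eval (A k) s) \<longlonglongrightarrow> f s)"

definition mixed_space :: "real \<Rightarrow> real \<Rightarrow> real \<Rightarrow> (complex \<Rightarrow> complex) set" where
  "mixed_space p q \<alpha> = {f. \<exists>A. mixed_approx p q \<alpha> A f}"

definition mixed_space_norm :: "real \<Rightarrow> real \<Rightarrow> real \<Rightarrow> (complex \<Rightarrow> complex) \<Rightarrow> real" where
  "mixed_space_norm p q \<alpha> f =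
     (THE r. \<forall>A. mixed_approx p q \<alpha> A f \<longrightarrow> (\<lambda>k. mixed_norm p q \<alpha> (A k)) \<longlonglongrightarrow> r)"

definition superposition :: "(complex \<Rightarrow> complex) \<Rightarrow> (complex \<Rightarrow> complex) \<Rightarrow> complex \<Rightarrow> complex" where
  "superposition \<phi> f = \<phi> \<circ> f"

definition bounded_operator ::
    "'a set \<Rightarrow> ('a \<Rightarrow> real) \<Rightarrow> ('b \<Rightarrow> real) \<Rightarrow> ('a \<Rightarrow> 'b) \<Rightarrow> bool" where
  "bounded_operator X nX nY T \<longleftrightarrow>
     (\<forall>B\<subseteq>X. (\<exists>M. \<forall>f\<in>B. nX f \<le> M) \<longrightarrow> (\<exists>M. \<forall>g\<in>T ` B. nY g \<le> M))"

definition continuous_operator ::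
    "(complex \<Rightarrow> complex) set \<Rightarrow> ((complex \<Rightarrow> complex) \<Rightarrow> real) \<Rightarrow> ((complex \<Rightarrow> complex) \<Rightarrow> real)
      \<Rightarrow> ((complex \<Rightarrow> complex) \<Rightarrow> complex \<Rightarrow> complex) \<Rightarrow> bool" where
  "continuous_operator X nX nY T \<longleftrightarrow>
     (\<forall>f\<in>X. \<forall>\<epsilon>>0. \<exists>\<delta>>0. \<forall>g\<in>X.
        nX (\<lambda>s. g s - f s) < \<delta> \<longrightarrow> nY (\<lambda>s. T g s - T f s) < \<epsilon>)"

end

theory Submission
  imports Defs "HOL-Complex_Analysis.Complex_Analysis" "HOL-Real_Asymp.Real_Asymp"
begin

text \<open>
The Bohr lift turns Dirichlet polynomials into polynomials on the infinite torus. Sub-mean-value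
inequalities for \<open>|h|\<^sup>p\<close> in one variable, applied to one prime at a time, show that the means
\<open>\<parallel>P\<^sub>\<sigma>\<parallel>\<^sub>p\<close> decrease in \<open>\<sigma>\<close>, that the projections to fewer primes and to fixed exponents of a prime
are contractive, and that point evaluations on \<open>Re s > 1/2\<close> are bounded.

Sufficiency: the scalar inequality \<open>|P(x + h) - P(x)| \<le> \<epsilon> (1 + |x|\<^sup>N) + C |h|\<^sup>N\<close> is integrated over
the torus and combined with an embedding between the mixed means. The embedding covers the endpoint
\<open>N v (\<alpha> + 1) = q (\<beta> + 1)\<close> only for \<open>\<alpha> \<le> \<beta>\<close>; it rests on the monotonicity in \<open>\<sigma>\<close>.

Necessity: composing \<open>\<phi>\<close> with the locally invertible functions \<open>c + P P\<^sup>-\<^sup>s\<close> shows that \<open>\<phi>\<close> is entire.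
For a series of polynomials on disjoint sets of primes, each linear in one of its primes, the
contractive projections extract from the image the Taylor monomials \<open>c\<^sub>m f\<^sup>m\<close> of each summand \<open>f\<close>.
Humps built from \<open>((1 + p\<^sup>-\<^sup>s)/2)\<^sup>n\<close> then force \<open>m u \<le> p\<close>, hence \<open>\<phi>\<close> is a polynomial, and lacunary
sums over primes force the condition on the weights.
\<close>

section \<open>The Bohr correspondence\<close>

text \<open>Exponents below 1 are allowed, so no triangle inequality is available: the arguments
  work with p-th powers of means and q-th powers of mixed norms, and a perturbation bound |x^k -
  y^k| <= eps y^k + C |x - y|^k stands in for it. An element of the completion is seen only through
  its values on Re s > 1/2, while the norm involves all heights \<sigma> > 0 on the torus. The link
  is the coefficients: uniform convergence on a half-plane gives them one by one, and if only
  finitely many primes occur and the means at each height are bounded, coefficientwise convergence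
  is uniform at every positive height. Hence the projections to finitely many primes before each
  passage to the limit. For m u <= p, humps over one prime do not suffice when \<beta> is large: a
  hump of width n^(-1/2) gains a power of n with exponent (v/2) (m/p - 1/u), but it is visible only
  up to heights of order 1/n, which costs n^(-(\<beta>+1)). With d primes the exponent of the gain
  is multiplied by d, and d is chosen to outweigh the cost.\<close>

definition prime_at :: "nat \<Rightarrow> nat" where
  "prime_at j = enumerate {p::nat. prime p} j"

lemma prime_prime_at [simp]: "prime (prime_at j)"
  using enumerate_in_set[OF primes_infinite] by (simp add: prime_at_def)

lemma prime_at_gt_1: "1 < prime_at j"
  by (rule prime_gt_1_nat) simp

lemma prime_at_pos [simp]: "0 < prime_at j"
  using prime_at_gt_1[of j] by simp

lemma strict_mono_prime_at: "strict_mono prime_at"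
  unfolding prime_at_def[abs_def] by (rule strict_mono_enumerate[OF primes_infinite])

lemma prime_at_eq_iff [simp]: "prime_at i = prime_at j \<longleftrightarrow> i = j"
  using strict_mono_prime_at by (auto simp: strict_mono_eq)

lemma le_prime_at: "j \<le> prime_at j"
  by (rule strict_mono_imp_increasing[OF strict_mono_prime_at])

lemma prime_at_surj: "prime p \<Longrightarrow> \<exists>j. p = prime_at j"
  using enumerate_Ex[OF primes_infinite, of p] by (auto simp: prime_at_def)

lemma prime_exponent_eq: "prime_exponent j n = multiplicity (prime_at j) n"
  by (simp add: prime_exponent_def prime_at_def)

lemma prime_exponent_mult:
  "0 < m \<Longrightarrow> 0 < n \<Longrightarrow> prime_exponent j (m * n) = prime_exponent j m + prime_exponent j n"
  by (simp add: prime_exponent_eq prime_elem_multiplicity_mult_distrib)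

lemma prime_exponent_1 [simp]: "prime_exponent j (Suc 0) = 0"
  by (simp add: prime_exponent_eq)

lemma prime_exponent_prime_at: "prime_exponent j (prime_at i) = (if i = j then 1 else 0)"
  by (auto simp: prime_exponent_eq prime_multiplicity_other)

lemma prime_exponent_support: "{j. prime_exponent j n \<noteq> 0} \<subseteq> {..n}"
proof
  fix j assume "j \<in> {j. prime_exponent j n \<noteq> 0}"
  then have d: "prime_at j dvd n" and "n \<noteq> 0"
    by (auto simp: prime_exponent_eq not_dvd_imp_multiplicity_0 intro: ccontr)
  then have "prime_at j \<le> n" by (simp add: dvd_imp_le)
  with le_prime_at[of j] show "j \<in> {..n}" by simp
qed

lemma finite_prime_exponent_support [simp]: "finite {j. prime_exponent j n \<noteq> 0}"
  "finite {j. 0 < prime_exponent j n}"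
  using finite_subset[OF prime_exponent_support[of n]] by auto

lemma prime_exponent_inject:
  assumes "0 < m" "0 < n" "\<And>j. prime_exponent j m = prime_exponent j n"
  shows "m = n"
proof (rule multiplicity_eq_nat)
  fix p :: nat assume "prime p"
  then obtain j where "p = prime_at j" using prime_at_surj by blast
  with assms(3)[of j] show "multiplicity p m = multiplicity p n"
    by (simp add: prime_exponent_eq)
qed (use assms in auto)

section \<open>Monomials on the torus and the Bohr lift\<close>

definition torus_monom :: "nat \<Rightarrow> (nat \<Rightarrow> complex) \<Rightarrow> complex" where
  "torus_monom n z = (\<Prod>j | prime_exponent j n \<noteq> 0. z j ^ prime_exponent j n)"

lemma torus_monom_superset:
  assumes "finite A" "{j. prime_exponent j n \<noteq> 0} \<subseteq> A"
  shows "torus_monom n z = (\<Prod>j\<in>A. z j ^ prime_exponent j n)"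
  unfolding torus_monom_def using assms by (intro prod.mono_neutral_left) auto

lemma torus_monom_mult:
  assumes "0 < m" "0 < n"
  shows "torus_monom (m * n) z = torus_monom m z * torus_monom n z"
proof -
  have "m \<le> m * n" "n \<le> m * n" using assms by auto
  then have "{j. prime_exponent j m \<noteq> 0} \<subseteq> {..m*n}" "{j. prime_exponent j n \<noteq> 0} \<subseteq> {..m*n}"
    using prime_exponent_support[of m] prime_exponent_support[of n]
    by (meson atMost_subset_iff subset_trans)+
  then show ?thesis
    using prime_exponent_support[of "m*n"] assms
    by (subst (1 2 3) torus_monom_superset[of "{..m*n}"])
       (auto simp: prime_exponent_mult power_add prod.distrib)
qed

lemma torus_monom_1 [simp]: "torus_monom (Suc 0) z = 1"
  by (simp add: torus_monom_def)

lemma torus_monom_prime_at [simp]: "torus_monom (prime_at j) z = z j"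
  by (subst torus_monom_superset[of "{j}"]) (auto simp: prime_exponent_prime_at)

lemma torus_monom_times: "torus_monom n (\<lambda>j. w j * z j) = torus_monom n w * torus_monom n z"
  by (simp add: torus_monom_def power_mult_distrib prod.distrib)

lemma completely_multiplicative_eq:
  fixes f g :: "nat \<Rightarrow> complex"
  assumes "0 < n" "f 1 = 1" "g 1 = 1" "\<And>p. prime p \<Longrightarrow> f p = g p"
    and "\<And>m n. 0 < m \<Longrightarrow> 0 < n \<Longrightarrow> f (m * n) = f m * f n"
    and "\<And>m n. 0 < m \<Longrightarrow> 0 < n \<Longrightarrow> g (m * n) = g m * g n"
  shows "f n = g n"
  using assms(1)
proof (induction n rule: prime_divisors_induct)
  case (factor p x)
  then have "0 < x" "0 < p" by auto
  with factor assms show ?case by auto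
qed (use assms in auto)

text \<open>Both sides are completely multiplicative in n and agree at the primes. Hence a Dirichlet
  polynomial at s is its Bohr lift at the point with coordinates p^(-s).\<close>

lemma torus_monom_powr:
  assumes "0 < n"
  shows "torus_monom n (\<lambda>j. of_nat (prime_at j) powr s) = of_nat n powr s"
proof (rule completely_multiplicative_eq[OF assms])
  fix p :: nat assume "prime p"
  then show "torus_monom p (\<lambda>j. of_nat (prime_at j) powr s) = of_nat p powr s"
    using prime_at_surj[of p] by auto
next
  fix m n :: nat assume "0 < m" "0 < n"
  then show "complex_of_nat (m * n) powr s = of_nat m powr s * of_nat n powr s"
    using powr_times_real[of "of_nat m" "of_nat n" s] by simp
qed (auto simp: torus_monom_mult)

lemma norm_torus_monom_le:
  assumes "\<And>j. norm (z j) \<le> 1"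
  shows "norm (torus_monom n z) \<le> 1"
  unfolding torus_monom_def prod_norm[symmetric] norm_power
  using assms by (intro prod_le_1) (auto intro: power_le_one)

lemma dirichlet_polys_pos: "a \<in> dirichlet_polys \<Longrightarrow> a n \<noteq> 0 \<Longrightarrow> 0 < n"
  by (cases n) (auto simp: dirichlet_polys_def)

lemma dirichlet_polys_finite: "a \<in> dirichlet_polys \<Longrightarrow> finite {n. a n \<noteq> 0}"
  by (simp add: dirichlet_polys_def)

lemma dirichlet_polysI:
  assumes "finite A" "\<And>n. n \<notin> A \<Longrightarrow> a n = 0" "a 0 = 0"
  shows "a \<in> dirichlet_polys"
  using assms finite_subset[of "{n. a n \<noteq> 0}" A] by (auto simp: dirichlet_polys_def)

lemma bohr_lift_superset:
  assumes "finite A" "{n. a n \<noteq> 0} \<subseteq> A"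
  shows "bohr_lift a z = (\<Sum>n\<in>A. a n * torus_monom n z)"
  unfolding bohr_lift_def torus_monom_def[symmetric] using assms
  by (intro sum.mono_neutral_left) auto

lemma dirichlet_eval_eq:
  assumes "a \<in> dirichlet_polys"
  shows "dirichlet_eval a s = bohr_lift a (\<lambda>j. of_nat (prime_at j) powr (-s))"
  unfolding dirichlet_eval_def bohr_lift_def torus_monom_def[symmetric]
  using dirichlet_polys_pos[OF assms] by (intro sum.cong) (auto simp: torus_monom_powr)

text \<open>The lift of P_\<sigma> is the lift of P at these coordinates; for \<sigma> > 0 they
  carry the torus into the open polydisc.\<close>

definition shift_coords :: "real \<Rightarrow> (nat \<Rightarrow> complex) \<Rightarrow> nat \<Rightarrow> complex" where
  "shift_coords \<sigma> z j = of_real (real (prime_at j) powr (-\<sigma>)) * z j"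

lemma torus_monom_shift_coords:
  assumes "0 < n"
  shows "torus_monom n (shift_coords \<sigma> z) = of_real (real n powr (-\<sigma>)) * torus_monom n z"
proof -
  have *: "of_real (real n powr (-\<sigma>)) = of_nat n powr (- of_real \<sigma> :: complex)" for n :: nat
    using powr_of_real[of "real n" "-\<sigma>"] by simp
  show ?thesis
    unfolding shift_coords_def[abs_def] * torus_monom_times torus_monom_powr[OF assms] ..
qed

lemma bohr_lift_shift:
  assumes "a \<in> dirichlet_polys"
  shows "bohr_lift (dirichlet_shift \<sigma> a) z = bohr_lift a (shift_coords \<sigma> z)"
proof -
  have "bohr_lift (dirichlet_shift \<sigma> a) z = (\<Sum>n | a n \<noteq> 0. dirichlet_shift \<sigma> a n * torus_monom n z)"
    by (intro bohr_lift_superset) (auto simp: dirichlet_shift_def dirichlet_polys_finite[OF assms])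
  also have "\<dots> = (\<Sum>n | a n \<noteq> 0. a n * torus_monom n (shift_coords \<sigma> z))"
    using dirichlet_polys_pos[OF assms]
    by (intro sum.cong) (auto simp: torus_monom_shift_coords dirichlet_shift_def)
  finally show ?thesis unfolding bohr_lift_def torus_monom_def .
qed

lemma shift_coords_add: "shift_coords \<sigma> (shift_coords \<tau> z) = shift_coords (\<sigma> + \<tau>) z"
proof
  fix j
  have "real (prime_at j) powr (-\<sigma> - \<tau>) = real (prime_at j) powr (-\<sigma>) * real (prime_at j) powr (-\<tau>)"
    by (metis powr_add uminus_add_conv_diff diff_conv_add_uminus)
  then show "shift_coords \<sigma> (shift_coords \<tau> z) j = shift_coords (\<sigma> + \<tau>) z j"
    by (simp add: shift_coords_def)
qed

lemma shift_coords_0 [simp]: "shift_coords 0 z = z"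
proof
  show "shift_coords 0 z j = z j" for j
    using prime_at_pos[of j] by (simp add: shift_coords_def del: prime_at_pos)
qed

lemma prime_at_powr_le_1: "0 \<le> \<sigma> \<Longrightarrow> real (prime_at j) powr (-\<sigma>) \<le> 1"
  using prime_at_gt_1[of j] powr_mono[of "-\<sigma>" 0 "real (prime_at j)"] by simp

lemma dirichlet_polys_add: "a \<in> dirichlet_polys \<Longrightarrow> b \<in> dirichlet_polys \<Longrightarrow> (\<lambda>n. a n + b n) \<in> dirichlet_polys"
  by (rule dirichlet_polysI[of "{n. a n \<noteq> 0} \<union> {n. b n \<noteq> 0}"]) (auto simp: dirichlet_polys_def)

lemma dirichlet_polys_diff: "a \<in> dirichlet_polys \<Longrightarrow> b \<in> dirichlet_polys \<Longrightarrow> (\<lambda>n. a n - b n) \<in> dirichlet_polys"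
  by (rule dirichlet_polysI[of "{n. a n \<noteq> 0} \<union> {n. b n \<noteq> 0}"]) (auto simp: dirichlet_polys_def)

lemma dirichlet_polys_restrict: "a \<in> dirichlet_polys \<Longrightarrow> (\<lambda>n. if P n then a n else 0) \<in> dirichlet_polys"
  by (rule dirichlet_polysI[of "{n. a n \<noteq> 0}"]) (auto simp: dirichlet_polys_def)

lemma bohr_lift_add:
  assumes "a \<in> dirichlet_polys" "b \<in> dirichlet_polys"
  shows "bohr_lift (\<lambda>n. a n + b n) z = bohr_lift a z + bohr_lift b z"
  using assms[THEN dirichlet_polys_finite]
  by (subst (1 2 3) bohr_lift_superset[of "{n. a n \<noteq> 0} \<union> {n. b n \<noteq> 0}"])
     (auto simp: sum.distrib algebra_simps)

lemma bohr_lift_diff: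
  assumes "a \<in> dirichlet_polys" "b \<in> dirichlet_polys"
  shows "bohr_lift (\<lambda>n. a n - b n) z = bohr_lift a z - bohr_lift b z"
  using assms[THEN dirichlet_polys_finite]
  by (subst (1 2 3) bohr_lift_superset[of "{n. a n \<noteq> 0} \<union> {n. b n \<noteq> 0}"])
     (auto simp: sum_subtractf algebra_simps)

lemma dirichlet_eval_diff:
  assumes "a \<in> dirichlet_polys" "b \<in> dirichlet_polys"
  shows "dirichlet_eval (\<lambda>n. a n - b n) s = dirichlet_eval a s - dirichlet_eval b s"
  using assms by (simp add: dirichlet_eval_eq dirichlet_polys_diff bohr_lift_diff)

text \<open>Bohr lifts as functions. Products and substitutions are immediate here, whereas a
  product of coefficient functions is a Dirichlet convolution.\<close>

definition torus_polys :: "((nat \<Rightarrow> complex) \<Rightarrow> complex) set" where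
  "torus_polys = bohr_lift ` dirichlet_polys"

lemma bohr_lift_in_torus_polys [simp]: "a \<in> dirichlet_polys \<Longrightarrow> bohr_lift a \<in> torus_polys"
  by (simp add: torus_polys_def)

lemma torus_polys_monom: "(\<lambda>z. c * torus_monom n z) \<in> torus_polys" if "0 < n"
proof -
  have "(\<lambda>k. if k = n then c else 0) \<in> dirichlet_polys"
    using that by (intro dirichlet_polysI[of "{n}"]) auto
  moreover have "bohr_lift (\<lambda>k. if k = n then c else 0) z = c * torus_monom n z" for z
    by (subst bohr_lift_superset[of "{n}"]) auto
  ultimately show ?thesis unfolding torus_polys_def by (metis (no_types, lifting) image_iff ext)
qed

lemma torus_polys_const [simp]: "(\<lambda>z. c) \<in> torus_polys"
  using torus_polys_monom[of 1 c] by simp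

lemma torus_polys_coord [simp]: "(\<lambda>z. z j) \<in> torus_polys"
  using torus_polys_monom[of "prime_at j" 1] by simp

lemma torus_polys_add:
  assumes "G \<in> torus_polys" "H \<in> torus_polys"
  shows "(\<lambda>z. G z + H z) \<in> torus_polys"
proof -
  obtain a b where "a \<in> dirichlet_polys" "b \<in> dirichlet_polys" "G = bohr_lift a" "H = bohr_lift b"
    using assms by (auto simp: torus_polys_def)
  then have "(\<lambda>n. a n + b n) \<in> dirichlet_polys" "bohr_lift (\<lambda>n. a n + b n) = (\<lambda>z. G z + H z)"
    by (auto simp: dirichlet_polys_add bohr_lift_add)
  then show ?thesis unfolding torus_polys_def by (metis image_eqI)
qed

lemma torus_polys_sum:
  "(\<And>i. i \<in> I \<Longrightarrow> G i \<in> torus_polys) \<Longrightarrow> (\<lambda>z. \<Sum>i\<in>I. G i z) \<in> torus_polys"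
  by (induction I rule: infinite_finite_induct) (auto intro: torus_polys_add)

lemma torus_polys_eq_sum:
  assumes "G \<in> torus_polys"
  obtains A a where "finite A" "\<And>n. n \<in> A \<Longrightarrow> 0 < n" "\<And>z. G z = (\<Sum>n\<in>A. a n * torus_monom n z)"
proof -
  obtain a where a: "a \<in> dirichlet_polys" "G = bohr_lift a"
    using assms by (auto simp: torus_polys_def)
  show ?thesis
    using a dirichlet_polys_pos[of a] bohr_lift_superset[of "{n. a n \<noteq> 0}" a]
    by (intro that[of "{n. a n \<noteq> 0}" a]) (auto simp: dirichlet_polys_finite)
qed

lemma torus_polys_mult:
  assumes "G \<in> torus_polys" "H \<in> torus_polys"
  shows "(\<lambda>z. G z * H z) \<in> torus_polys"
proof -
  obtain A a where A: "finite A" "\<And>n. n \<in> A \<Longrightarrow> 0 < n" "\<And>z. G z = (\<Sum>n\<in>A. a n * torus_monom n z)"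
    using torus_polys_eq_sum[OF assms(1)] by metis
  obtain B b where B: "finite B" "\<And>n. n \<in> B \<Longrightarrow> 0 < n" "\<And>z. H z = (\<Sum>n\<in>B. b n * torus_monom n z)"
    using torus_polys_eq_sum[OF assms(2)] by metis
  have "G z * H z = (\<Sum>m\<in>A. \<Sum>n\<in>B. (a m * b n) * torus_monom (m * n) z)" for z
    unfolding A(3) B(3) sum_product using A(2) B(2)
    by (intro sum.cong refl) (auto simp: torus_monom_mult)
  then show ?thesis using A(2) B(2)
    by (auto intro!: torus_polys_sum torus_polys_monom)
qed

lemma torus_polys_diff:
  "G \<in> torus_polys \<Longrightarrow> H \<in> torus_polys \<Longrightarrow> (\<lambda>z. G z - H z) \<in> torus_polys"
  using torus_polys_add[of G "\<lambda>z. -1 * H z"] torus_polys_mult[of "\<lambda>_. -1" H] by auto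

lemma torus_polys_prod:
  "(\<And>i. i \<in> I \<Longrightarrow> G i \<in> torus_polys) \<Longrightarrow> (\<lambda>z. \<Prod>i\<in>I. G i z) \<in> torus_polys"
  by (induction I rule: infinite_finite_induct) (auto intro: torus_polys_mult)

lemma torus_polys_power: "G \<in> torus_polys \<Longrightarrow> (\<lambda>z. G z ^ n) \<in> torus_polys"
  by (induction n) (auto intro: torus_polys_mult)

lemma torus_polys_poly: "G \<in> torus_polys \<Longrightarrow> (\<lambda>z. poly P (G z)) \<in> torus_polys"
  unfolding poly_altdef by (intro torus_polys_sum torus_polys_mult torus_polys_power) auto

lemma torus_polys_subst:
  assumes "G \<in> torus_polys" "\<And>j. h j \<in> torus_polys"
  shows "(\<lambda>z. G (\<lambda>j. h j z)) \<in> torus_polys"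
proof -
  obtain A a where A: "\<And>z. G z = (\<Sum>n\<in>A. a n * torus_monom n z)"
    using torus_polys_eq_sum[OF assms(1)] by metis
  show ?thesis
    unfolding A torus_monom_def using assms(2)
    by (intro torus_polys_sum torus_polys_mult torus_polys_prod torus_polys_power) auto
qed

lemma torus_polys_shift: "G \<in> torus_polys \<Longrightarrow> (\<lambda>z. G (shift_coords \<sigma> z)) \<in> torus_polys"
  unfolding shift_coords_def[abs_def]
  by (rule torus_polys_subst[of G "\<lambda>j z. of_real (real (prime_at j) powr (-\<sigma>)) * z j"])
     (auto intro: torus_polys_mult[OF torus_polys_const torus_polys_coord])

text \<open>Estimates for polynomials in one variable reach the torus through these slices, with all
  other coordinates frozen at z.\<close>

lemma torus_polys_slice:
  assumes "G \<in> torus_polys"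
  obtains h :: "complex poly" where "\<And>x. G (z(j := x)) = poly h x"
proof -
  obtain A a where A: "\<And>z. G z = (\<Sum>n\<in>A. a n * torus_monom n z)"
    using torus_polys_eq_sum[OF assms(1)] by metis
  show ?thesis
    by (rule that[of "\<Sum>n\<in>A. smult (a n) (\<Prod>i | prime_exponent i n \<noteq> 0.
                       (if i = j then [:0, 1:] else [:z i:]) ^ prime_exponent i n)"])
       (auto simp: A torus_monom_def poly_sum poly_prod intro!: sum.cong prod.cong)
qed

lemma torus_polys_finite_support:
  assumes "G \<in> torus_polys"
  obtains V where "finite V" "\<And>z z'. (\<And>j. j \<in> V \<Longrightarrow> z j = z' j) \<Longrightarrow> G z = G z'"
proof -
  obtain A a where A: "finite A" "\<And>z. G z = (\<Sum>n\<in>A. a n * torus_monom n z)"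
    using torus_polys_eq_sum[OF assms(1)] by metis
  show ?thesis
  proof (rule that[of "\<Union>n\<in>A. {j. prime_exponent j n \<noteq> 0}"])
    fix z z' :: "nat \<Rightarrow> complex"
    assume "\<And>j. j \<in> (\<Union>n\<in>A. {j. prime_exponent j n \<noteq> 0}) \<Longrightarrow> z j = z' j"
    then show "G z = G z'"
      unfolding A(2) torus_monom_def
      by (intro sum.cong prod.cong arg_cong2[where f = "(*)"] arg_cong2[where f = power] refl) auto
  qed (use A in auto)
qed

lemma torus_polys_bounded:
  assumes "G \<in> torus_polys"
  obtains B where "0 < B" "\<And>z. (\<And>j. norm (z j) \<le> 1) \<Longrightarrow> norm (G z) \<le> B"
proof -
  obtain A a where A: "finite A" "\<And>z. G z = (\<Sum>n\<in>A. a n * torus_monom n z)"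
    using torus_polys_eq_sum[OF assms(1)] by metis
  show ?thesis
  proof (rule that[of "1 + (\<Sum>n\<in>A. norm (a n))"])
    fix z :: "nat \<Rightarrow> complex" assume z: "\<And>j. norm (z j) \<le> 1"
    have "norm (G z) \<le> (\<Sum>n\<in>A. norm (a n))"
      unfolding A(2) using norm_torus_monom_le[of z] z
      by (intro sum_norm_le) (auto simp: norm_mult mult_left_le)
    then show "norm (G z) \<le> 1 + (\<Sum>n\<in>A. norm (a n))" by simp
  qed (auto intro!: add_pos_nonneg sum_nonneg)
qed

lemma measurable_torus_coord: "(\<lambda>z. z j) \<in> borel_measurable torus_measure"
proof -
  have "(\<lambda>z. z j) \<in> measurable torus_measure circle_measure"
    unfolding torus_measure_def by (rule measurable_component_singleton) simp
  moreover have "(\<lambda>x. x) \<in> borel_measurable circle_measure"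
    by (simp add: circle_measure_def measurable_restrict_space1)
  ultimately show ?thesis by (rule measurable_compose)
qed

lemma torus_polys_measurable [measurable]:
  assumes "G \<in> torus_polys"
  shows "G \<in> borel_measurable torus_measure"
proof -
  obtain A a where A: "finite A" "\<And>z. G z = (\<Sum>n\<in>A. a n * torus_monom n z)"
    using torus_polys_eq_sum[OF assms(1)] by metis
  have "(\<lambda>z. \<Sum>n\<in>A. a n * torus_monom n z) \<in> borel_measurable torus_measure"
    unfolding torus_monom_def
    by (intro borel_measurable_sum borel_measurable_times borel_measurable_prod borel_measurable_power
        measurable_torus_coord) auto
  then show ?thesis by (simp add: A(2)[abs_def])
qed

section \<open>Means of polynomials over the circle\<close>

definition circ :: "real \<Rightarrow> complex" where
  "circ t = cis (2 * pi * t)"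

lemma norm_circ [simp]: "norm (circ t) = 1"
  by (simp add: circ_def)

lemma circ_nz [simp]: "circ t \<noteq> 0"
  by (simp add: circ_def)

lemma continuous_on_circ [continuous_intros]: "continuous_on S circ"
  unfolding circ_def[abs_def] by (intro continuous_intros)

lemma continuous_on_circ' [continuous_intros]:
  "continuous_on S f \<Longrightarrow> continuous_on S (\<lambda>x. circ (f x))"
  using continuous_on_compose2[OF continuous_on_circ[of UNIV], of S f] by auto

lemma norm_diff_le_norm_one_minus:
  fixes a z :: complex
  assumes "norm a \<le> 1" "norm z \<le> 1"
  shows "norm (z - a) \<le> norm (1 - cnj a * z)"
proof -
  have "norm (1 - cnj a * z) ^ 2 - norm (z - a) ^ 2 = (1 - norm a ^ 2) * (1 - norm z ^ 2)"
    unfolding cmod_power2 by (simp add: algebra_simps power2_eq_square)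
  moreover have "0 \<le> (1 - norm a ^ 2) * (1 - norm z ^ 2)"
    using assms by (intro mult_nonneg_nonneg) (auto simp: power_le_one)
  ultimately have "norm (z - a) ^ 2 \<le> norm (1 - cnj a * z) ^ 2" by linarith
  then show ?thesis by (rule power2_le_imp_le) simp
qed

lemma norm_one_minus_cnj:
  fixes a z :: complex
  assumes "norm z = 1"
  shows "norm (1 - cnj a * z) = norm (z - a)"
proof -
  have "z * cnj z = 1" using assms by (simp add: complex_norm_square[symmetric])
  then have "1 - cnj a * z = z * cnj (z - a)" by (simp add: algebra_simps)
  then show ?thesis using assms by (simp only: norm_mult complex_mod_cnj)
qed

text \<open>A substitute for the subharmonicity of \<open>|h|\<^sup>u\<close>: reflecting the zeros of \<open>h\<close> in the disc gives a
  zero-free function with the same modulus on the circle, which has a holomorphic \<open>u\<close>-th power \<open>g\<close>, to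
  which Cauchy's formula applies. Continuity up to the circle is only needed for \<open>G = |g|\<close>.\<close>

definition disc_majorant :: "real \<Rightarrow> (complex \<Rightarrow> complex) \<Rightarrow> (complex \<Rightarrow> real) \<Rightarrow> (complex \<Rightarrow> complex) \<Rightarrow> bool" where
  "disc_majorant u h G g \<longleftrightarrow> g holomorphic_on ball 0 1 \<and> continuous_on (cball 0 1) G \<and>
     (\<forall>z\<in>ball 0 1. norm (g z) = G z) \<and> (\<forall>z\<in>cball 0 1. norm (h z) powr u \<le> G z) \<and>
     (\<forall>z\<in>sphere 0 1. G z = norm (h z) powr u)"

lemma disc_majorant_mult:
  assumes "disc_majorant u h1 G1 g1" "disc_majorant u h2 G2 g2"
  shows "disc_majorant u (\<lambda>z. h1 z * h2 z) (\<lambda>z. G1 z * G2 z) (\<lambda>z. g1 z * g2 z)"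
  using assms unfolding disc_majorant_def
  by (auto intro!: holomorphic_intros continuous_intros mult_mono powr_ge_zero
           simp: norm_mult powr_mult intro: order_trans[OF powr_ge_zero])

lemma disc_majorant_const: "0 < u \<Longrightarrow> disc_majorant u (\<lambda>z. c) (\<lambda>z. norm c powr u) (\<lambda>z. of_real (norm c powr u))"
  by (auto simp: disc_majorant_def)

text \<open>The real part of 1 - b z is positive on the open disc, so the principal power is
  holomorphic there. For |b| = 1 there is a zero on the circle, where the modulus is still
  continuous.\<close>

lemma disc_majorant_one_minus:
  assumes "0 < u" "norm b \<le> 1"
  shows "disc_majorant u (\<lambda>z. 1 - b * z) (\<lambda>z. norm (1 - b * z) powr u) (\<lambda>z. (1 - b * z) powr of_real u)"
proof -
  have "1 - b * z \<notin> \<real>\<^sub>\<le>\<^sub>0" if "z \<in> ball 0 1" for z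
  proof -
    have "norm (b * z) < 1"
      using assms(2) that mult_right_mono[of "norm b" 1 "norm z"] by (auto simp: norm_mult)
    then have "Re (b * z) < 1" using complex_Re_le_cmod[of "b * z"] by linarith
    then show ?thesis by (auto simp: complex_nonpos_Reals_iff)
  qed
  then show ?thesis
    using assms(1) unfolding disc_majorant_def
    by (auto intro!: holomorphic_intros continuous_intros continuous_on_powr' simp: norm_powr_real_powr')
qed

lemma disc_majorant_linear:
  assumes "0 < u"
  shows "\<exists>G g. disc_majorant u (\<lambda>z. z - a) G g"
proof (cases "norm a < 1")
  case True
  then have "disc_majorant u (\<lambda>z. 1 - cnj a * z) (\<lambda>z. norm (1 - cnj a * z) powr u) (\<lambda>z. (1 - cnj a * z) powr of_real u)"
    by (intro disc_majorant_one_minus assms) auto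
  then have "disc_majorant u (\<lambda>z. z - a) (\<lambda>z. norm (1 - cnj a * z) powr u) (\<lambda>z. (1 - cnj a * z) powr of_real u)"
    using True norm_diff_le_norm_one_minus[of a] assms
    by (auto simp: disc_majorant_def norm_one_minus_cnj intro!: powr_mono2)
  then show ?thesis by blast
next
  case False
  then have "a \<noteq> 0" by auto
  then have "(\<lambda>z. z - a) = (\<lambda>z. (-a) * (1 - (1/a) * z))" by (auto simp: field_simps)
  moreover have "norm (1/a) \<le> 1" using False by (auto simp: norm_divide divide_simps)
  ultimately show ?thesis
    using disc_majorant_mult[OF disc_majorant_const[OF assms] disc_majorant_one_minus[OF assms]] by metis
qed

lemma disc_majorant_poly:
  assumes "0 < u"
  shows "\<exists>G g. disc_majorant u (poly h) G g"
proof (cases "h = 0")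
  case True
  then have "poly h = (\<lambda>z. 0)" by auto
  then show ?thesis using disc_majorant_const[OF assms, of 0] by auto
next
  case False
  then obtain A where "h = smult (lead_coeff h) (\<Prod>x\<in>#A. [:-x, 1:])"
    using alg_closed_imp_factorization by blast
  from arg_cong[OF this, of poly]
  have A: "poly h = (\<lambda>z. lead_coeff h * poly (\<Prod>x\<in>#A. [:-x, 1:]) z)"
    by auto
  have "\<exists>G g. disc_majorant u (\<lambda>z. poly (\<Prod>x\<in>#A. [:-x, 1:]) z) G g" for A
  proof (induction A)
    case empty
    then show ?case using disc_majorant_const[OF assms, of 1] by auto
  next
    case (add x A)
    then obtain G g G' g' where "disc_majorant u (\<lambda>z. poly (\<Prod>x\<in>#A. [:-x, 1:]) z) G g"
      "disc_majorant u (\<lambda>z. z - x) G' g'"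
      using disc_majorant_linear[OF assms] by metis
    from disc_majorant_mult[OF this(2,1)] show ?case by (auto simp: algebra_simps)
  qed
  then obtain G g where "disc_majorant u (\<lambda>z. poly (\<Prod>x\<in>#A. [:-x, 1:]) z) G g" by metis
  from disc_majorant_mult[OF disc_majorant_const[OF assms] this, of "lead_coeff h"]
  show ?thesis by (subst A) blast
qed

section \<open>Cauchy and Poisson bounds for powers of the modulus of a polynomial\<close>

lemma circlepath_circ: "circlepath 0 r t = of_real r * circ t"
  by (simp add: circlepath circ_def cis_conv_exp mult_ac)

lemma vector_derivative_circlepath_circ:
  "t \<in> {0..1} \<Longrightarrow> vector_derivative (circlepath 0 r) (at t within {0..1}) =
     (2 * of_real pi * \<i>) * (of_real r * circ t)"
  by (simp add: vector_derivative_circlepath01 circ_def cis_conv_exp mult_ac)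

lemma div_mult_cancel: "c \<noteq> 0 \<Longrightarrow> (1 / c) * (A / B * (c * X)) = A * X / B" for A B c X :: complex
  by simp

lemma Cauchy_circ:
  assumes "f holomorphic_on ball 0 1" "norm w < r" "r < 1"
  shows "((\<lambda>t. f (of_real r * circ t) * (of_real r * circ t) / (of_real r * circ t - w)) has_integral f w) {0..1}"
proof -
  have "cball 0 r \<subseteq> ball (0::complex) 1" "ball 0 r \<subseteq> ball (0::complex) 1" using assms by auto
  then have "continuous_on (cball 0 r) f" "f holomorphic_on ball 0 r"
    using assms(1) by (auto intro: holomorphic_on_imp_continuous_on holomorphic_on_subset)
  then have "((\<lambda>u. f u / (u - w)) has_contour_integral (2 * of_real pi * \<i> * f w)) (circlepath 0 r)"
    using assms(2) by (intro Cauchy_integral_circlepath) auto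
  then have "((\<lambda>t. (1 / (2 * of_real pi * \<i>)) * (f (circlepath 0 r t) / (circlepath 0 r t - w) *
      vector_derivative (circlepath 0 r) (at t within {0..1}))) has_integral
      (1 / (2 * of_real pi * \<i>)) * (2 * of_real pi * \<i> * f w)) {0..1}"
    unfolding has_contour_integral_def by (rule has_integral_mult_right)
  moreover have "(1 / (2 * of_real pi * \<i>)) * (f (circlepath 0 r t) / (circlepath 0 r t - w) *
      vector_derivative (circlepath 0 r) (at t within {0..1})) =
      f (of_real r * circ t) * (of_real r * circ t) / (of_real r * circ t - w)" if "t \<in> {0..1}" for t
    unfolding circlepath_circ vector_derivative_circlepath_circ[OF that] by (rule div_mult_cancel) simp
  ultimately show ?thesis
    by (auto elim!: has_integral_eq_rhs[OF has_integral_eq[rotated]])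
qed

text \<open>The free factor k turns the Cauchy kernel into other kernels: on the circle
  \<open>1 - cnj w * z\<close> cancels its modulus, which gives the point evaluation, and the
  reciprocal makes it the Poisson kernel. Cauchy's formula is applied to g k on circles of radius r
  < 1; only the moduli are continued to r = 1, since g need not extend continuously.\<close>

lemma poly_norm_powr_Cauchy:
  assumes u: "0 < u" and w: "norm w < 1"
    and k: "continuous_on (cball 0 1) k" "k holomorphic_on ball 0 1"
  shows "norm (poly h w) powr u * norm (k w) \<le>
     integral {0..1} (\<lambda>t. norm (poly h (circ t)) powr u * norm (k (circ t)) / norm (circ t - w))"
proof -
  obtain G g where Gg: "g holomorphic_on ball 0 1" "continuous_on (cball 0 1) G"
    "\<And>z. z \<in> ball 0 1 \<Longrightarrow> norm (g z) = G z" "\<And>z. z \<in> cball 0 1 \<Longrightarrow> norm (poly h z) powr u \<le> G z"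
    "\<And>z. z \<in> sphere 0 1 \<Longrightarrow> G z = norm (poly h z) powr u"
    using disc_majorant_poly[OF u, of h] unfolding disc_majorant_def by blast
  \<comment> \<open>Circles of radius in [r0, 1] keep a positive distance from w, so
    \<open>F\<close> is jointly continuous up to radius 1.\<close>
  define r0 where "r0 = (1 + norm w) / 2"
  have r0: "norm w < r0" "r0 < 1" "0 < r0" using w by (auto simp: r0_def add_pos_nonneg field_simps)
  define F where "F = (\<lambda>r t. G (of_real r * circ t) * norm (k (of_real r * circ t)) * r / norm (of_real r * circ t - w))"
  have nz: "of_real r * circ t - w \<noteq> 0" if "r \<in> {r0..1}" for r t
  proof
    assume "of_real r * circ t - w = 0"
    then have "norm (of_real r * circ t) = norm w" by simp
    with that r0 show False by (simp add: norm_mult)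
  qed
  have contF: "continuous_on ({r0..1} \<times> cbox 0 1) (\<lambda>(r,t). F r t)"
    unfolding F_def split_def using nz r0
    by (intro continuous_intros continuous_on_compose2[OF Gg(2)] continuous_on_compose2[OF k(1)])
       (auto simp: norm_mult)
  have "continuous_on (closure {r0<..<1}) (\<lambda>r. integral (cbox 0 1) (F r))"
    using integral_continuous_on_param[OF contF] r0 by simp
  then have "norm (poly h w) powr u * norm (k w) \<le> integral (cbox 0 1) (F 1)"
  proof (rule continuous_ge_on_closure)
    show "1 \<in> closure {r0<..<1}" using r0 by simp
    fix r assume r: "r \<in> {r0<..<1}"
    have "continuous_on (cbox 0 1) (F r)"
      using continuous_on_compose2[OF contF, of "cbox 0 1" "\<lambda>t. (r, t)"] r
        continuous_on_Pair[OF continuous_on_const continuous_on_id, of "{0..1}" r]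
      by (auto simp: image_subset_iff)
    then have int: "F r integrable_on cbox 0 1" by (rule integrable_continuous)
    have hi: "((\<lambda>t. g (of_real r * circ t) * k (of_real r * circ t) * (of_real r * circ t) /
         (of_real r * circ t - w)) has_integral g w * k w) {0..1}"
      by (rule Cauchy_circ) (use Gg(1) k(2) r r0 in \<open>auto intro!: holomorphic_intros\<close>)
    have "norm (poly h w) powr u * norm (k w) \<le> norm (g w * k w)"
      using Gg(3,4)[of w] w by (simp add: norm_mult mult_right_mono)
    also have "g w * k w = integral (cbox 0 1) (\<lambda>t. g (of_real r * circ t) * k (of_real r * circ t) * (of_real r * circ t) /
         (of_real r * circ t - w))"
      using hi by (simp add: integral_unique)
    also have "norm \<dots> \<le> integral (cbox 0 1) (F r)"
    proof (rule integral_norm_bound_integral)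
      show "(\<lambda>t. g (of_real r * circ t) * k (of_real r * circ t) * (of_real r * circ t) /
         (of_real r * circ t - w)) integrable_on cbox 0 1" using hi by auto
      show "norm (g (of_real r * circ t) * k (of_real r * circ t) * (of_real r * circ t) /
         (of_real r * circ t - w)) \<le> F r t" for t
        using r r0 Gg(3)[of "of_real r * circ t"] by (simp add: F_def norm_mult norm_divide)
    qed (rule int)
    finally show "norm (poly h w) powr u * norm (k w) \<le> integral (cbox 0 1) (F r)" .
  qed
  also have "F 1 = (\<lambda>t. norm (poly h (circ t)) powr u * norm (k (circ t)) / norm (circ t - w))"
    using Gg(5) by (auto simp: F_def)
  finally show ?thesis by simp
qed

text \<open>The form \<open>1 - norm w ^ 2\<close> of the loss matters: over the primes the losses
  multiply, and their infinite product is positive exactly when the |w j|^2 are summable. For w j =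
  p^(-s) this is Re s > 1/2; a loss of order |w| would need Re s > 1.\<close>

lemma poly_point_eval_bound:
  assumes "0 < u" "norm w < 1"
  shows "norm (poly h w) powr u * (1 - norm w ^ 2) \<le> integral {0..1} (\<lambda>t. norm (poly h (circ t)) powr u)"
proof -
  have "norm (poly h w) powr u * norm (1 - cnj w * w) \<le>
     integral {0..1} (\<lambda>t. norm (poly h (circ t)) powr u * norm (1 - cnj w * circ t) / norm (circ t - w))"
    using assms by (intro poly_norm_powr_Cauchy) (auto intro!: continuous_intros holomorphic_intros)
  also have "(\<lambda>t. norm (poly h (circ t)) powr u * norm (1 - cnj w * circ t) / norm (circ t - w)) =
     (\<lambda>t. norm (poly h (circ t)) powr u)"
    using assms(2) by (auto simp: norm_one_minus_cnj fun_eq_iff)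
  also have "1 - cnj w * w = of_real (1 - norm w ^ 2)"
    by (metis complex_norm_square mult.commute of_real_1 of_real_diff)
  also have "norm (of_real (1 - norm w ^ 2) :: complex) = 1 - norm w ^ 2"
    using assms(2) by (simp add: abs_square_le_1 del: of_real_diff)
  finally show ?thesis .
qed

lemma poly_Poisson_bound:
  assumes "0 < u" "norm w < 1"
  shows "norm (poly h w) powr u \<le>
     integral {0..1} (\<lambda>t. norm (poly h (circ t)) powr u * ((1 - norm w ^ 2) / norm (circ t - w) ^ 2))"
proof -
  have n: "norm (of_real (1 - norm w ^ 2) :: complex) = 1 - norm w ^ 2"
    using assms(2) by (simp add: abs_square_le_1 del: of_real_diff)
  have e: "1 - cnj w * w = of_real (1 - norm w ^ 2)"
    by (metis complex_norm_square mult.commute of_real_1 of_real_diff)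
  have pos: "0 < 1 - norm w ^ 2" using assms(2) by (simp add: abs_square_less_1)
  have nz: "1 - cnj w * z \<noteq> 0" if "norm z \<le> 1" for z
  proof
    assume "1 - cnj w * z = 0"
    then have "norm w * norm z = 1" by (metis complex_mod_cnj norm_mult norm_one right_minus_eq)
    moreover have "norm w * norm z \<le> norm w * 1" using that by (intro mult_left_mono) auto
    ultimately show False using assms(2) by simp
  qed
  have "norm (poly h w) powr u * norm (of_real (1 - norm w ^ 2) / (1 - cnj w * w)) \<le>
     integral {0..1} (\<lambda>t. norm (poly h (circ t)) powr u * norm (of_real (1 - norm w ^ 2) / (1 - cnj w * circ t)) / norm (circ t - w))"
    using assms nz by (intro poly_norm_powr_Cauchy) (auto intro!: continuous_intros holomorphic_intros)
  also have "(\<lambda>t. norm (poly h (circ t)) powr u * norm (of_real (1 - norm w ^ 2) / (1 - cnj w * circ t)) / norm (circ t - w)) =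
     (\<lambda>t. norm (poly h (circ t)) powr u * ((1 - norm w ^ 2) / norm (circ t - w) ^ 2))"
    unfolding norm_divide n by (simp add: norm_one_minus_cnj power2_eq_square)
  also have "of_real (1 - norm w ^ 2) / (1 - cnj w * w) = 1"
    unfolding e using pos by (simp del: of_real_diff)
  finally show ?thesis by simp
qed

lemma Poisson_kernel_integral:
  assumes "norm w < 1"
  shows "((\<lambda>t. (1 - norm w ^ 2) / norm (circ t - w) ^ 2) has_integral 1) {0..1}"
proof -
  have pos: "0 < 1 - norm w ^ 2" using assms by (simp add: abs_square_less_1)
  have e: "1 - cnj w * w = of_real (1 - norm w ^ 2)"
    by (metis complex_norm_square mult.commute of_real_1 of_real_diff)
  define f where "f = (\<lambda>z. of_real (1 - norm w ^ 2) / (1 - cnj w * z))"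
  have nz: "1 - cnj w * z \<noteq> 0" if "norm z \<le> 1" for z
  proof
    assume "1 - cnj w * z = 0"
    then have "norm w * norm z = 1" by (metis complex_mod_cnj norm_mult norm_one right_minus_eq)
    moreover have "norm w * norm z \<le> norm w * 1" using that by (intro mult_left_mono) auto
    ultimately show False using assms by simp
  qed
  have "((\<lambda>u. f u / (u - w)) has_contour_integral (2 * of_real pi * \<i> * f w)) (circlepath 0 1)"
    unfolding f_def using assms nz
    by (intro Cauchy_integral_circlepath) (auto intro!: holomorphic_intros continuous_intros)
  then have "((\<lambda>t. (1 / (2 * of_real pi * \<i>)) * (f (circlepath 0 1 t) / (circlepath 0 1 t - w) *
      vector_derivative (circlepath 0 1) (at t within {0..1}))) has_integral
      (1 / (2 * of_real pi * \<i>)) * (2 * of_real pi * \<i> * f w)) {0..1}"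
    unfolding has_contour_integral_def by (rule has_integral_mult_right)
  moreover have "(1 / (2 * of_real pi * \<i>)) * (f (circlepath 0 1 t) / (circlepath 0 1 t - w) *
      vector_derivative (circlepath 0 1) (at t within {0..1})) =
      of_real ((1 - norm w ^ 2) / norm (circ t - w) ^ 2)" if "t \<in> {0..1}" for t
  proof -
    have "circ t * cnj (circ t) = 1" by (simp add: complex_norm_square[symmetric])
    then have "1 - cnj w * circ t = circ t * cnj (circ t - w)" by (simp add: algebra_simps)
    then have "f (circ t) * circ t / (circ t - w) = of_real (1 - norm w ^ 2) / ((circ t - w) * cnj (circ t - w))"
      by (simp add: f_def del: of_real_diff complex_cnj_diff)
    also have "(circ t - w) * cnj (circ t - w) = of_real (norm (circ t - w) ^ 2)"
      by (metis complex_norm_square of_real_power)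
    finally have *: "f (circ t) * circ t / (circ t - w) =
      of_real ((1 - norm w ^ 2) / norm (circ t - w) ^ 2)" by simp
    show ?thesis
      unfolding circlepath_circ vector_derivative_circlepath_circ[OF that] *[symmetric]
      using div_mult_cancel[of "2 * of_real pi * \<i>" "f (circ t)" "circ t - w" "circ t"] by simp
  qed
  ultimately have "((\<lambda>t. of_real ((1 - norm w ^ 2) / norm (circ t - w) ^ 2) :: complex) has_integral f w) {0..1}"
    by (auto elim!: has_integral_eq_rhs[OF has_integral_eq[rotated]])
  moreover have "f w = of_real 1" using pos unfolding f_def e by (simp del: of_real_diff)
  ultimately show ?thesis using has_integral_linear[OF _ bounded_linear_Re] by (force simp: o_def)
qed

text \<open>The Poisson bound is averaged over the circle of radius r and the integrals are
  interchanged. The Poisson kernel is symmetric in the two angles (\<open>sym\<close>), so the inner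
  integral is 1.\<close>

lemma poly_mean_mono:
  assumes "0 < u" "0 \<le> r" "r \<le> 1"
  shows "integral {0..1} (\<lambda>t. norm (poly h (of_real r * circ t)) powr u) \<le>
         integral {0..1} (\<lambda>t. norm (poly h (circ t)) powr u)"
proof (cases "r = 1")
  case False
  then have r: "r < 1" "norm (of_real r :: complex) < 1" using assms by auto
  define F where "F = (\<lambda>s t. norm (poly h (circ t)) powr u * ((1 - r ^ 2) / norm (circ t - of_real r * circ s) ^ 2))"
  have nz: "norm (circ t - of_real r * circ s) \<noteq> 0" for s t
  proof
    assume "norm (circ t - of_real r * circ s) = 0"
    then have "norm (circ t) = norm (of_real r * circ s)" by simp
    with r assms(2) show False by (simp add: norm_mult)
  qed
  have cont: "continuous_on S (\<lambda>(s,t). F s t)" for S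
    unfolding F_def split_def using nz assms(1)
    by (intro continuous_intros continuous_on_powr') auto
  have sym: "norm (circ t - of_real r * circ s) = norm (circ s - of_real r * circ t)" for s t
  proof -
    have "norm (circ t - of_real r * circ s) = norm (1 - cnj (of_real r * circ s) * circ t)"
      by (simp only: norm_one_minus_cnj norm_circ)
    also have "\<dots> = norm (cnj (1 - cnj (of_real r * circ s) * circ t))"
      by (rule complex_mod_cnj[symmetric])
    also have "cnj (1 - cnj (of_real r * circ s) * circ t) = 1 - cnj (of_real r * circ t) * circ s"
      by simp
    also have "norm \<dots> = norm (circ s - of_real r * circ t)" by (simp only: norm_one_minus_cnj norm_circ)
    finally show ?thesis .
  qed
  have "integral {0..1} (\<lambda>s. norm (poly h (of_real r * circ s)) powr u) \<le> integral {0..1} (\<lambda>s. integral {0..1} (F s))"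
  proof (rule integral_le)
    show "(\<lambda>s. norm (poly h (of_real r * circ s)) powr u) integrable_on {0..1}"
      using assms(1) by (intro integrable_continuous_real continuous_intros continuous_on_powr') auto
    have "continuous_on {0..1} (\<lambda>s. integral (cbox 0 1) (F s))"
      by (intro integral_continuous_on_param cont)
    then show "(\<lambda>s. integral {0..1} (F s)) integrable_on {0..1}"
      by (simp add: integrable_continuous_real)
    show "norm (poly h (of_real r * circ s)) powr u \<le> integral {0..1} (F s)" for s
      using poly_Poisson_bound[OF assms(1), of "of_real r * circ s" h] r assms(2)
      by (simp add: F_def norm_mult)
  qed
  also have "\<dots> = integral {0..1} (\<lambda>t. integral {0..1} (\<lambda>s. F s t))"
    using integral_swap_continuous[of 0 0 1 1 F] cont by simp
  also have "\<dots> = integral {0..1} (\<lambda>t. norm (poly h (circ t)) powr u)"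
  proof (rule integral_cong)
    fix t
    have "((\<lambda>s. norm (poly h (circ t)) powr u * ((1 - norm (of_real r * circ t) ^ 2) / norm (circ s - of_real r * circ t) ^ 2))
      has_integral norm (poly h (circ t)) powr u * 1) {0..1}"
      using r assms(2) by (intro has_integral_mult_right Poisson_kernel_integral) (auto simp: norm_mult)
    then show "integral {0..1} (\<lambda>s. F s t) = norm (poly h (circ t)) powr u"
      using assms(2) by (simp add: integral_unique F_def sym[of _ t] norm_mult)
  qed
  finally show ?thesis .
qed simp

section \<open>Means over the infinite torus\<close>

lemma circle_measurable:
  fixes g :: "complex \<Rightarrow> 'b::topological_space"
  assumes "g \<in> borel_measurable borel"
  shows "g \<in> borel_measurable circle_measure"
  using assms by (simp add: circle_measure_def measurable_restrict_space1)

interpretation circle: prob_space circle_measure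
  by (rule prob_space_circle_measure)

interpretation torus: prob_space torus_measure
  by (rule prob_space_torus_measure)

lemma integral_circle:
  fixes g :: "complex \<Rightarrow> real"
  assumes g: "continuous_on UNIV g"
  shows "(\<integral>x. g x \<partial>circle_measure) = integral {0..1} (\<lambda>t. g (circ t))"
proof -
  have "continuous_on {0..1} (\<lambda>t. g (circ t))"
    by (rule continuous_on_compose2[OF g]) (auto intro!: continuous_intros)
  then have int: "set_integrable lborel {0..1} (\<lambda>t. g (circ t))"
    using borel_integrable_atLeastAtMost'[of 0 1] by auto
  have gm: "g \<in> borel_measurable borel" using g by (rule borel_measurable_continuous_onI)
  have cm: "circ \<in> borel_measurable borel"
    by (intro borel_measurable_continuous_onI continuous_on_circ)
  have "(\<integral>x. g x \<partial>circle_measure) = (\<integral>t. g (circ t) \<partial>uniform_measure lborel {0..<1})"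
    unfolding circle_measure_def circ_def[symmetric]
    by (intro integral_distr measurable_restrict_space2 measurable_restrict_space1 gm) (use cm in auto)
  also have "uniform_measure lborel {0..<1} = density lborel (\<lambda>x. ennreal (indicator {0..<1::real} x))"
    unfolding uniform_measure_def by (intro arg_cong2[where f = density]) (auto simp: indicator_def)
  also have "(\<integral>t. g (circ t) \<partial>\<dots>) = (\<integral>t. indicator {0..<1} t *\<^sub>R g (circ t) \<partial>lborel)"
    using measurable_compose[OF cm gm] by (intro integral_density) auto
  also have "\<dots> = (\<integral>t. indicator {0..1} t *\<^sub>R g (circ t) \<partial>lborel)"
  proof (rule integral_cong_AE)
    have "AE t in lborel. t \<noteq> (1::real)" by (rule AE_lborel_singleton)
    then show "AE t in lborel. indicator {0..<1} t *\<^sub>R g (circ t) = indicator {0..1} t *\<^sub>R g (circ t)"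
      by eventually_elim (auto simp: indicator_def)
  qed (use measurable_compose[OF cm gm] in auto)
  also have "\<dots> = integral {0..1} (\<lambda>t. g (circ t))"
    using set_borel_integral_eq_integral(2)[OF int] by (simp add: set_lebesgue_integral_def)
  finally show ?thesis .
qed

lemma continuous_poly_powr:
  "0 < u \<Longrightarrow> continuous_on S (\<lambda>x. norm (poly h (f x)) powr u)" if "continuous_on S f" for f :: "'a::topological_space \<Rightarrow> complex"
  using that by (intro continuous_on_powr' continuous_intros) auto

lemma AE_circle: "AE x in circle_measure. norm x = 1"
  by (rule AE_I2) (simp add: circle_measure_def space_restrict_space)

lemma nn_integral_circle_poly:
  assumes "0 < u"
  shows "(\<integral>\<^sup>+x. ennreal (norm (poly h x) powr u) \<partial>circle_measure) =
    ennreal (integral {0..1} (\<lambda>t. norm (poly h (circ t)) powr u))"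
proof -
  have cont: "continuous_on UNIV (\<lambda>x. norm (poly h x) powr u)"
    by (intro continuous_poly_powr assms continuous_on_id)
  have "compact ((\<lambda>x. norm (poly h x) powr u) ` sphere 0 1)"
    by (intro compact_continuous_image continuous_on_subset[OF cont]) auto
  then obtain B where B: "\<And>x. norm x = 1 \<Longrightarrow> norm (norm (poly h x) powr u) \<le> B"
    by (metis (no_types, lifting) bounded_iff compact_imp_bounded image_eqI mem_sphere_0)
  have "integrable circle_measure (\<lambda>x. norm (poly h x) powr u)"
    using AE_circle B cont
    by (intro circle.integrable_const_bound[of _ B] circle_measurable borel_measurable_continuous_onI)
       (auto elim: AE_mp)
  then show ?thesis
    by (subst nn_integral_eq_integral) (auto simp: integral_circle[OF cont])
qed

lemma measurable_fun_upd_torus: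
  "(\<lambda>(x, z). z(j := x)) \<in> measurable (circle_measure \<Otimes>\<^sub>M torus_measure) torus_measure"
  unfolding torus_measure_def split_beta'
  by (rule measurable_fun_upd[where I = UNIV]) auto

text \<open>Replacing one coordinate of a Haar-distributed point by an independent Haar-distributed
  one does not change the distribution. In this form no splitting of the index set is
  needed.\<close>

lemma torus_Fubini:
  assumes f: "f \<in> borel_measurable torus_measure"
  shows "(\<integral>\<^sup>+z. f z \<partial>torus_measure) = (\<integral>\<^sup>+z. \<integral>\<^sup>+x. f (z(j := x)) \<partial>circle_measure \<partial>torus_measure)"
proof -
  interpret P: pair_sigma_finite circle_measure torus_measure
    by unfold_locales
  have d: "distr (circle_measure \<Otimes>\<^sub>M torus_measure) torus_measure (\<lambda>(x, z). z(j := x)) = torus_measure"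
    using distr_pair_PiM_eq_PiM[of UNIV "\<lambda>_. circle_measure" j] prob_space_circle_measure
    by (simp add: torus_measure_def)
  have "(\<integral>\<^sup>+z. f z \<partial>torus_measure) = (\<integral>\<^sup>+z. f z \<partial>distr (circle_measure \<Otimes>\<^sub>M torus_measure) torus_measure (\<lambda>(x, z). z(j := x)))"
    unfolding d ..
  also have "\<dots> = (\<integral>\<^sup>+(x, z). f (z(j := x)) \<partial>(circle_measure \<Otimes>\<^sub>M torus_measure))"
    using measurable_fun_upd_torus f by (subst nn_integral_distr) (auto simp: split_beta')
  also have "\<dots> = (\<integral>\<^sup>+z. \<integral>\<^sup>+x. f (z(j := x)) \<partial>circle_measure \<partial>torus_measure)"
    using measurable_compose[OF measurable_fun_upd_torus f]
    by (subst P.nn_integral_snd[symmetric]) (auto simp: split_beta')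
  finally show ?thesis .
qed

section \<open>Means of torus polynomials, one coordinate at a time\<close>

definition torus_mean :: "real \<Rightarrow> ((nat \<Rightarrow> complex) \<Rightarrow> complex) \<Rightarrow> real" where
  "torus_mean p G = (\<integral>z. norm (G z) powr p \<partial>torus_measure)"

lemma torus_mean_nonneg [simp]: "0 \<le> torus_mean p G"
  by (simp add: torus_mean_def)

lemma AE_torus: "AE z in torus_measure. \<forall>j. norm (z j) = 1"
  by (rule AE_I2) (simp add: space_torus_measure)

lemma integrable_torus_poly:
  assumes "G \<in> torus_polys" "0 < p"
  shows "integrable torus_measure (\<lambda>z. norm (G z) powr p)"
proof -
  obtain B where B: "0 < B" "\<And>z. (\<And>j. norm (z j) \<le> 1) \<Longrightarrow> norm (G z) \<le> B"
    using torus_polys_bounded[OF assms(1)] by metis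
  show ?thesis
  proof (rule torus.integrable_const_bound[of _ "B powr p"])
    show "AE z in torus_measure. norm (norm (G z) powr p) \<le> B powr p"
      using AE_torus by eventually_elim (use B assms(2) in \<open>auto intro!: powr_mono2\<close>)
  qed (use torus_polys_measurable[OF assms(1)] in measurable)
qed

lemma nn_integral_torus_mean:
  assumes "G \<in> torus_polys" "0 < p"
  shows "(\<integral>\<^sup>+z. ennreal (norm (G z) powr p) \<partial>torus_measure) = ennreal (torus_mean p G)"
  unfolding torus_mean_def by (rule nn_integral_eq_integral[OF integrable_torus_poly[OF assms]]) simp

text \<open>Transfers an inequality in one circle variable, the others being frozen, to the torus.
  The scaling, point-evaluation and exponent bounds all pass through it.\<close>

lemma torus_mean_slice_le:
  assumes "G \<in> torus_polys" "H \<in> torus_polys" "0 < p" "0 \<le> c"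
    and "\<And>z. ennreal c * (\<integral>\<^sup>+x. ennreal (norm (H (z(j := x))) powr p) \<partial>circle_measure) \<le>
           (\<integral>\<^sup>+x. ennreal (norm (G (z(j := x))) powr p) \<partial>circle_measure)"
  shows "c * torus_mean p H \<le> torus_mean p G"
proof -
  have m: "(\<lambda>z. ennreal (norm (G z) powr p)) \<in> borel_measurable torus_measure" if "G \<in> torus_polys" for G
    using torus_polys_measurable[OF that] by measurable
  interpret P: pair_sigma_finite torus_measure circle_measure by unfold_locales
  have m2: "(\<lambda>z. \<integral>\<^sup>+x. ennreal (norm (H (z(j := x))) powr p) \<partial>circle_measure) \<in> borel_measurable torus_measure"
  proof -
    have "(\<lambda>(z, x). z(j := x)) \<in> measurable (torus_measure \<Otimes>\<^sub>M circle_measure) torus_measure"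
      using measurable_compose[OF measurable_pair_swap' measurable_fun_upd_torus[of j]] by (simp add: split_beta')
    from measurable_compose[OF this m[OF assms(2)]]
    show ?thesis by (intro circle.borel_measurable_nn_integral) (simp add: split_beta')
  qed
  have "ennreal (c * torus_mean p H) = ennreal c * (\<integral>\<^sup>+z. ennreal (norm (H z) powr p) \<partial>torus_measure)"
    using assms by (simp add: nn_integral_torus_mean ennreal_mult)
  also have "\<dots> = ennreal c * (\<integral>\<^sup>+z. \<integral>\<^sup>+x. ennreal (norm (H (z(j := x))) powr p) \<partial>circle_measure \<partial>torus_measure)"
    by (subst torus_Fubini[of _ j]) (use m[OF assms(2)] in auto)
  also have "\<dots> = (\<integral>\<^sup>+z. ennreal c * (\<integral>\<^sup>+x. ennreal (norm (H (z(j := x))) powr p) \<partial>circle_measure) \<partial>torus_measure)"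
    by (rule nn_integral_cmult[symmetric, OF m2])
  also have "\<dots> \<le> (\<integral>\<^sup>+z. \<integral>\<^sup>+x. ennreal (norm (G (z(j := x))) powr p) \<partial>circle_measure \<partial>torus_measure)"
    by (intro nn_integral_mono assms(5))
  also have "\<dots> = ennreal (torus_mean p G)"
    using assms by (simp add: nn_integral_torus_mean[symmetric] torus_Fubini[OF m[OF assms(1)], of j])
  finally show ?thesis by (simp add: ennreal_le_iff)
qed

lemma torus_polys_if_subst:
  assumes "G \<in> torus_polys" "\<And>j. h j \<in> torus_polys"
  shows "(\<lambda>z. G (\<lambda>j. if j \<in> S then h j z else z j)) \<in> torus_polys"
proof (rule torus_polys_subst[OF assms(1), of "\<lambda>j z. if j \<in> S then h j z else z j"])
  show "(\<lambda>z. if j \<in> S then h j z else z j) \<in> torus_polys" for j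
    using assms(2)[of j] by (cases "j \<in> S") auto
qed

text \<open>The factors are left arbitrary in [0, 1] for two uses: negative powers of the primes
  give monotonicity in \<sigma>, and the values 0 and 1 give the projection to a set of primes. Only
  finitely many coordinates matter, so they can be scaled one after the other.\<close>

lemma torus_mean_scale_le:
  assumes "G \<in> torus_polys" "0 < p" "\<And>j. 0 \<le> \<rho> j" "\<And>j. \<rho> j \<le> 1"
  shows "torus_mean p (\<lambda>z. G (\<lambda>j. of_real (\<rho> j) * z j)) \<le> torus_mean p G"
proof -
  define GS where "GS = (\<lambda>S z. G (\<lambda>j. if j \<in> S then of_real (\<rho> j) * z j else z j))"
  have GS: "GS S \<in> torus_polys" for S
    unfolding GS_def
    by (rule torus_polys_if_subst[OF assms(1)]) (auto intro: torus_polys_mult[OF torus_polys_const torus_polys_coord])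
  have *: "torus_mean p (GS S) \<le> torus_mean p G" if "finite S" for S
    using that
  proof (induction S)
    case empty
    then show ?case by (simp add: GS_def)
  next
    case (insert j S)
    have "1 * torus_mean p (GS (insert j S)) \<le> torus_mean p (GS S)"
    proof (rule torus_mean_slice_le[OF GS GS assms(2), where j = j])
      fix z
      obtain h where h: "\<And>x. GS S (z(j := x)) = poly h x"
        using torus_polys_slice[OF GS] by metis
      have "GS (insert j S) (z(j := x)) = GS S (z(j := of_real (\<rho> j) * x))" for x
        unfolding GS_def using insert.hyps by (intro arg_cong[where f = G]) auto
      then have "GS (insert j S) (z(j := x)) = poly (h \<circ>\<^sub>p [:0, of_real (\<rho> j):]) x" for x
        by (simp add: h poly_pcompose mult.commute)
      then show "ennreal 1 * (\<integral>\<^sup>+x. ennreal (norm (GS (insert j S) (z(j := x))) powr p) \<partial>circle_measure)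
         \<le> (\<integral>\<^sup>+x. ennreal (norm (GS S (z(j := x))) powr p) \<partial>circle_measure)"
        using poly_mean_mono[OF assms(2), of "\<rho> j" h] assms(2,3,4)
          nn_integral_circle_poly[OF assms(2), of "h \<circ>\<^sub>p [:0, of_real (\<rho> j):]"]
        by (simp add: h nn_integral_circle_poly poly_pcompose mult.commute ennreal_leI)
    qed simp
    with insert show ?case by simp
  qed
  obtain V where V: "finite V" "\<And>z z'. (\<And>j. j \<in> V \<Longrightarrow> z j = z' j) \<Longrightarrow> G z = G z'"
    using torus_polys_finite_support[OF assms(1)] by metis
  have "(\<lambda>z. G (\<lambda>j. of_real (\<rho> j) * z j)) = GS V"
    unfolding GS_def by (rule ext, rule V(2)) simp
  with *[OF V(1)] show ?thesis by simp
qed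

lemma torus_mean_const [simp]: "torus_mean p (\<lambda>z. c) = norm c powr p"
  by (simp add: torus_mean_def torus.prob_space)

lemma torus_point_eval_bound:
  assumes "G \<in> torus_polys" "0 < p" "finite V" "\<And>j. j \<in> V \<Longrightarrow> norm (w j) < 1"
    and "\<And>z z'. (\<And>j. j \<in> V \<Longrightarrow> z j = z' j) \<Longrightarrow> G z = G z'"
  shows "norm (G w) powr p * (\<Prod>j\<in>V. 1 - norm (w j) ^ 2) \<le> torus_mean p G"
proof -
  \<comment> \<open>In \<open>GS S\<close> the coordinates in S are already frozen at w. Freezing
    one more costs its factor, and \<open>GS V\<close> is constant.\<close>
  define GS where "GS = (\<lambda>S z. G (\<lambda>j. if j \<in> S then w j else z j))"
  have GS: "GS S \<in> torus_polys" for S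
    unfolding GS_def by (rule torus_polys_if_subst[OF assms(1)]) auto
  have pos: "0 \<le> 1 - norm (w j) ^ 2" if "j \<in> V" for j
    using assms(4)[OF that] by (simp add: power_le_one)
  have *: "torus_mean p (GS S) * (\<Prod>j\<in>S. 1 - norm (w j) ^ 2) \<le> torus_mean p G" if "finite S" "S \<subseteq> V" for S
    using that
  proof (induction S)
    case empty
    then show ?case by (simp add: GS_def)
  next
    case (insert j S)
    have "(1 - norm (w j) ^ 2) * torus_mean p (GS (insert j S)) \<le> torus_mean p (GS S)"
    proof (rule torus_mean_slice_le[OF GS GS assms(2), where j = j])
      show "0 \<le> 1 - norm (w j) ^ 2" using pos insert.prems by auto
      fix z
      obtain h where h: "\<And>x. GS S (z(j := x)) = poly h x"
        using torus_polys_slice[OF GS] by metis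
      have "GS (insert j S) (z(j := x)) = GS S (z(j := w j))" for x
        unfolding GS_def using insert.hyps by (intro arg_cong[where f = G]) auto
      then have e: "GS (insert j S) (z(j := x)) = poly h (w j)" for x
        by (simp add: h)
      show "ennreal (1 - norm (w j) ^ 2) * (\<integral>\<^sup>+x. ennreal (norm (GS (insert j S) (z(j := x))) powr p) \<partial>circle_measure)
         \<le> (\<integral>\<^sup>+x. ennreal (norm (GS S (z(j := x))) powr p) \<partial>circle_measure)"
        unfolding e h
        using poly_point_eval_bound[OF assms(2), of "w j" h] assms(2) assms(4)[of j] insert.prems pos[of j]
        by (simp add: nn_integral_circle_poly circle.emeasure_space_1 ennreal_leI mult.commute flip: ennreal_mult)
    qed
    then have "(1 - norm (w j) ^ 2) * torus_mean p (GS (insert j S)) * (\<Prod>j\<in>S. 1 - norm (w j) ^ 2) \<le>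
      torus_mean p (GS S) * (\<Prod>j\<in>S. 1 - norm (w j) ^ 2)"
      using insert.prems pos by (intro mult_right_mono prod_nonneg) auto
    with insert show ?case by (simp add: mult_ac)
  qed
  have "GS V = (\<lambda>z. G w)"
    unfolding GS_def by (rule ext, rule assms(5)) simp
  with *[OF assms(3)] show ?thesis by simp
qed

lemma powr_add_le_2:
  fixes x y u :: real
  assumes "0 \<le> x" "0 \<le> y" "0 < u"
  shows "(x + y) powr u \<le> 2 powr u * (x powr u + y powr u)"
proof -
  have "(x + y) powr u \<le> (2 * max x y) powr u"
    using assms by (intro powr_mono2) auto
  also have "\<dots> = 2 powr u * max x y powr u" using assms by (simp add: powr_mult)
  also have "\<dots> \<le> 2 powr u * (x powr u + y powr u)"
    by (intro mult_left_mono) (auto simp: max_def)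
  finally show ?thesis .
qed

text \<open>Subtracting h(0) and dividing by the variable costs a factor \<open>2 * 2 powr u\<close>
  in the mean, because the variable has modulus 1 and |h(0)|^u is at most the mean. Doing this m
  times brings the m-th coefficient to the constant term. Cauchy's integral for the coefficient
  would give a bound of this kind only for u >= 1.\<close>

lemma poly_coeff_mean_bound:
  assumes u: "0 < u"
  shows "norm (coeff h m) powr u \<le>
    (2 * 2 powr u) ^ m * integral {0..1} (\<lambda>t. norm (poly h (circ t)) powr u)"
proof (induction m arbitrary: h)
  case 0
  then show ?case using poly_point_eval_bound[OF u, of 0 h] by (simp add: poly_0_coeff_0)
next
  case (Suc m)
  obtain a g where h: "h = pCons a g" by (cases h)
  have int: "(\<lambda>t. norm (poly h (circ t)) powr u) integrable_on {0..1}" for h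
    by (intro integrable_continuous_real continuous_poly_powr u continuous_on_circ)
  have a: "norm a powr u \<le> integral {0..1} (\<lambda>t. norm (poly h (circ t)) powr u)"
    using poly_point_eval_bound[OF u, of 0 h] by (simp add: h)
  have "integral {0..1} (\<lambda>t. norm (poly g (circ t)) powr u) \<le>
     integral {0..1} (\<lambda>t. 2 powr u * (norm (poly h (circ t)) powr u + norm a powr u))"
  proof (intro integral_le int integrable_on_mult_right integrable_add integrable_const_ivl)
    fix t :: real
    have "poly g (circ t) * circ t = poly h (circ t) - a" by (simp add: h)
    then have "norm (poly g (circ t)) = norm (poly h (circ t) - a)"
      by (metis mult.right_neutral norm_circ norm_mult)
    also have "\<dots> \<le> norm (poly h (circ t)) + norm a" by (rule norm_triangle_ineq4)
    finally have "norm (poly g (circ t)) powr u \<le> (norm (poly h (circ t)) + norm a) powr u"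
      using u by (intro powr_mono2) auto
    then show "norm (poly g (circ t)) powr u \<le> 2 powr u * (norm (poly h (circ t)) powr u + norm a powr u)"
      using powr_add_le_2[of "norm (poly h (circ t))" "norm a" u] u by simp
  qed
  also have "\<dots> = 2 powr u * (integral {0..1} (\<lambda>t. norm (poly h (circ t)) powr u) + norm a powr u)"
    using Henstock_Kurzweil_Integration.integral_add[OF int[of h] integrable_const_ivl, of "norm a powr u"] by simp
  also have "\<dots> \<le> 2 powr u * (2 * integral {0..1} (\<lambda>t. norm (poly h (circ t)) powr u))"
    using a by (intro mult_left_mono) auto
  finally have "(2 * 2 powr u) ^ m * integral {0..1} (\<lambda>t. norm (poly g (circ t)) powr u) \<le>
    (2 * 2 powr u) ^ m * ((2 * 2 powr u) * integral {0..1} (\<lambda>t. norm (poly h (circ t)) powr u))"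
    by (intro mult_left_mono) auto
  from order_trans[OF Suc.IH[of g] this] show ?case
    by (simp only: h coeff_pCons_Suc power_Suc2 mult.assoc)
qed

section \<open>Projections to a set of primes and to one exponent of a prime\<close>

definition supported_on :: "nat set \<Rightarrow> nat \<Rightarrow> bool" where
  "supported_on V n \<longleftrightarrow> (\<forall>j. prime_exponent j n \<noteq> 0 \<longrightarrow> j \<in> V)"

lemma bohr_lift_supported_on:
  assumes "a \<in> dirichlet_polys"
  shows "bohr_lift (\<lambda>n. if supported_on V n then a n else 0) z =
    bohr_lift a (\<lambda>j. of_real (if j \<in> V then 1 else 0) * z j)"
proof -
  have *: "torus_monom n (\<lambda>j. of_real (if j \<in> V then 1 else 0)) = (if supported_on V n then 1 else 0)" for n
  proof (cases "supported_on V n")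
    case True
    then show ?thesis by (auto simp: torus_monom_def supported_on_def intro!: prod.neutral)
  next
    case False
    then show ?thesis by (auto simp: torus_monom_def supported_on_def)
  qed
  show ?thesis
    using dirichlet_polys_finite[OF assms]
    by (subst (1 2) bohr_lift_superset[of "{n. a n \<noteq> 0}"])
       (auto simp: torus_monom_times * intro!: sum.cong)
qed

lemma bohr_lift_exponent_part:
  assumes a: "a \<in> dirichlet_polys" and h: "\<And>x. bohr_lift a (z(J := x)) = poly h x"
  shows "bohr_lift (\<lambda>n. if prime_exponent J n = m then a n else 0) (z(J := x)) = x ^ m * coeff h m"
proof -
  let ?S = "{n. a n \<noteq> 0}"
  define c where "c n = a n * (\<Prod>i\<in>{i. prime_exponent i n \<noteq> 0} - {J}. z i ^ prime_exponent i n)" for n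
  have fin: "finite ?S" by (rule dirichlet_polys_finite[OF a])
  have mon: "a n * torus_monom n (z(J := x)) = c n * x ^ prime_exponent J n" for n x
  proof -
    have "torus_monom n (z(J := x)) = (\<Prod>i\<in>insert J {i. prime_exponent i n \<noteq> 0}. (z(J := x)) i ^ prime_exponent i n)"
      by (rule torus_monom_superset) auto
    also have "\<dots> = x ^ prime_exponent J n * (\<Prod>i\<in>{i. prime_exponent i n \<noteq> 0} - {J}. (z(J := x)) i ^ prime_exponent i n)"
      by (subst prod.insert_remove) auto
    also have "(\<Prod>i\<in>{i. prime_exponent i n \<noteq> 0} - {J}. (z(J := x)) i ^ prime_exponent i n) =
       (\<Prod>i\<in>{i. prime_exponent i n \<noteq> 0} - {J}. z i ^ prime_exponent i n)"
      by (intro prod.cong) auto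
    finally show ?thesis unfolding c_def by (simp only: mult_ac)
  qed
  have "poly h x = poly (\<Sum>n\<in>?S. monom (c n) (prime_exponent J n)) x" for x
    using h[of x] fin by (simp add: bohr_lift_superset[of ?S] mon poly_sum poly_monom)
  then have "h = (\<Sum>n\<in>?S. monom (c n) (prime_exponent J n))"
    by (simp add: poly_eq_poly_eq_iff[symmetric] fun_eq_iff)
  then have "coeff h m = (\<Sum>n\<in>?S. if prime_exponent J n = m then c n else 0)"
    by (simp add: coeff_sum)
  then show ?thesis
    using fin by (subst bohr_lift_superset[of ?S])
      (auto simp: sum_distrib_left mon intro!: sum.cong)
qed

lemma torus_mean_exponent_part_le:
  assumes a: "a \<in> dirichlet_polys" and u: "0 < u"
  shows "torus_mean u (bohr_lift (\<lambda>n. if prime_exponent J n = m then a n else 0)) \<le>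
    (2 * 2 powr u) ^ m * torus_mean u (bohr_lift a)"
proof -
  let ?b = "\<lambda>n. if prime_exponent J n = m then a n else 0"
  let ?c = "1 / (2 * 2 powr u) ^ m"
  have b: "?b \<in> dirichlet_polys" by (rule dirichlet_polys_restrict[OF a])
  have "?c * torus_mean u (bohr_lift ?b) \<le> torus_mean u (bohr_lift a)"
  proof (rule torus_mean_slice_le[where j = J])
    fix z
    obtain h where h: "\<And>x. bohr_lift a (z(J := x)) = poly h x"
      using torus_polys_slice[of "bohr_lift a"] a by auto
    have "(\<integral>\<^sup>+x. ennreal (norm (bohr_lift ?b (z(J := x))) powr u) \<partial>circle_measure) =
      (\<integral>\<^sup>+x. ennreal (norm (coeff h m) powr u) \<partial>circle_measure)"
      using AE_circle
      by (intro nn_integral_cong_AE) (auto elim!: AE_mp simp: bohr_lift_exponent_part[OF a h] norm_mult norm_power)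
    then show "ennreal ?c * (\<integral>\<^sup>+x. ennreal (norm (bohr_lift ?b (z(J := x))) powr u) \<partial>circle_measure) \<le>
      (\<integral>\<^sup>+x. ennreal (norm (bohr_lift a (z(J := x))) powr u) \<partial>circle_measure)"
      using poly_coeff_mean_bound[OF u, of h m]
      by (simp add: h nn_integral_circle_poly[OF u] circle.emeasure_space_1 field_simps ennreal_leI flip: ennreal_mult)
  qed (use a b u in auto)
  then show ?thesis by (simp add: field_simps)
qed

section \<open>Coefficients from values on a vertical line\<close>

lemma tendsto_average_unit:
  fixes \<omega> :: complex
  assumes "norm \<omega> = 1" "\<omega> \<noteq> 1"
  shows "(\<lambda>K. (\<Sum>k<K. \<omega> ^ k) / of_nat K) \<longlonglongrightarrow> 0"
proof (rule Lim_null_comparison)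
  show "\<forall>\<^sub>F K in sequentially. norm ((\<Sum>k<K. \<omega> ^ k) / of_nat K) \<le> (2 / norm (1 - \<omega>)) / real K"
  proof (rule always_eventually, rule allI)
    fix K
    have "norm (\<Sum>k<K. \<omega> ^ k) = norm (1 - \<omega> ^ K) / norm (1 - \<omega>)"
      using assms(2) by (simp add: sum_gp_strict norm_divide)
    also have "\<dots> \<le> 2 / norm (1 - \<omega>)"
      using norm_triangle_ineq4[of 1 "\<omega> ^ K"] assms(1)
      by (intro divide_right_mono) (auto simp: norm_power)
    finally show "norm ((\<Sum>k<K. \<omega> ^ k) / of_nat K) \<le> (2 / norm (1 - \<omega>)) / real K"
      unfolding norm_divide norm_of_nat by (rule divide_right_mono) simp
  qed
  show "(\<lambda>K. (2 / norm (1 - \<omega>)) / real K) \<longlonglongrightarrow> 0" by real_asymp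
qed

text \<open>The mean of the twisted polynomial over a vertical line isolates its n-th term. The mean
  is taken over an arithmetic progression of heights, so that only geometric sums of unimodular
  numbers occur.\<close>

lemma dirichlet_coeff_le_sup:
  assumes a: "a \<in> dirichlet_polys" and n: "0 < n"
    and B: "\<And>t. norm (dirichlet_eval a (Complex \<sigma> t)) \<le> B"
  shows "norm (a n) * real n powr (-\<sigma>) \<le> B"
proof -
  let ?S = "insert n {n. a n \<noteq> 0}"
  have fin: "finite ?S" using dirichlet_polys_finite[OF a] by simp
  have pos: "0 < l" if "l \<in> ?S" for l using that n dirichlet_polys_pos[OF a] by auto
  define L where "L = Max ((\<lambda>l. \<bar>ln (real n) - ln (real l)\<bar>) ` ?S)"
  have L: "\<bar>ln (real n) - ln (real l)\<bar> \<le> L" if "l \<in> ?S" for l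
    unfolding L_def using fin that by (intro Max_ge) auto
  have L0: "0 \<le> L" using L[of n] by simp
  \<comment> \<open>The spacing is so small that sampling confuses no other frequency of the finite
    support with that of n: every \<open>\<theta> l\<close> lies in (-1, 1), so
    \<open>cis (\<theta> l) = 1\<close> forces l = n.\<close>
  define \<delta> where "\<delta> = 1 / (1 + L)"
  have \<delta>: "0 < \<delta>" using L0 by (simp add: \<delta>_def)
  define \<theta> where "\<theta> l = \<delta> * (ln (real n) - ln (real l))" for l
  have \<theta>1: "\<bar>\<theta> l\<bar> < 1" if "l \<in> ?S" for l
    using L[OF that] L0 by (simp add: \<theta>_def \<delta>_def abs_mult field_simps)
  have cis1: "cis (\<theta> l) \<noteq> 1" if l: "l \<in> ?S" "l \<noteq> n" for l
  proof
    assume "cis (\<theta> l) = 1"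
    then have s: "sin (\<theta> l) = 0" by (metis Im_complex_of_real cis.simps(2) of_real_1)
    have "ln (real n) \<noteq> ln (real l)" using l n pos[OF l(1)] by simp
    then have "\<theta> l \<noteq> 0" using \<delta> by (simp add: \<theta>_def)
    moreover have "\<bar>\<theta> l\<bar> < pi" using \<theta>1[OF l(1)] pi_gt3 by linarith
    ultimately show False
      using s sin_gt_zero[of "\<theta> l"] sin_gt_zero[of "- \<theta> l"] by (auto simp: abs_if split: if_splits)
  qed
  define b where "b l = a l * of_real (real l powr (-\<sigma>))" for l
  have term_eq: "a l * of_nat l powr (- Complex \<sigma> (real k * \<delta>)) * cis (real k * \<delta> * ln (real n)) = b l * cis (\<theta> l) ^ k"
    if "l \<in> ?S" for l k
  proof -
    have l: "0 < real l" using pos[OF that] by simp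
    have "of_nat l powr (- Complex \<sigma> (real k * \<delta>)) = exp (- Complex \<sigma> (real k * \<delta>) * of_real (ln (real l)))"
      unfolding Ln_of_real[OF l, symmetric] using l by (simp add: powr_def)
    also have "\<dots> = of_real (exp (-\<sigma> * ln (real l))) * cis (- (real k * \<delta> * ln (real l)))"
      by (simp add: exp_eq_polar)
    also have "exp (-\<sigma> * ln (real l)) = real l powr (-\<sigma>)" using l by (simp add: powr_def)
    finally have "a l * of_nat l powr (- Complex \<sigma> (real k * \<delta>)) * cis (real k * \<delta> * ln (real n)) =
      b l * (cis (- (real k * \<delta> * ln (real l))) * cis (real k * \<delta> * ln (real n)))"
      by (simp add: b_def)
    also have "cis (- (real k * \<delta> * ln (real l))) * cis (real k * \<delta> * ln (real n)) = cis (\<theta> l) ^ k"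
      unfolding Complex.DeMoivre cis_mult \<theta>_def by (simp add: algebra_simps)
    finally show ?thesis .
  qed
  have avg: "(\<Sum>k<K. dirichlet_eval a (Complex \<sigma> (real k * \<delta>)) * cis (real k * \<delta> * ln (real n))) / of_nat K =
    (\<Sum>l\<in>?S. b l * ((\<Sum>k<K. cis (\<theta> l) ^ k) / of_nat K))" for K
  proof -
    have "dirichlet_eval a s = (\<Sum>l\<in>?S. a l * of_nat l powr (- s))" for s
      unfolding dirichlet_eval_def using fin by (intro sum.mono_neutral_left) auto
    then have "(\<Sum>k<K. dirichlet_eval a (Complex \<sigma> (real k * \<delta>)) * cis (real k * \<delta> * ln (real n))) =
       (\<Sum>k<K. \<Sum>l\<in>?S. b l * cis (\<theta> l) ^ k)"
      by (simp only: sum_distrib_right) (intro sum.cong refl term_eq, auto)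
    also have "\<dots> = (\<Sum>l\<in>?S. b l * (\<Sum>k<K. cis (\<theta> l) ^ k))"
      by (subst sum.swap) (simp only: sum_distrib_left)
    finally show ?thesis unfolding times_divide_eq_right by (simp only: sum_divide_distrib[of _ ?S])
  qed
  have "(\<lambda>K. \<Sum>l\<in>?S. b l * ((\<Sum>k<K. cis (\<theta> l) ^ k) / of_nat K)) \<longlonglongrightarrow> (\<Sum>l\<in>?S. b l * (if l = n then 1 else 0))"
  proof (intro tendsto_sum tendsto_mult tendsto_const)
    fix l assume l: "l \<in> ?S"
    show "(\<lambda>K. (\<Sum>k<K. cis (\<theta> l) ^ k) / of_nat K) \<longlonglongrightarrow> (if l = n then 1 else 0)"
    proof (cases "l = n")
      case True
      then have "\<forall>\<^sub>F K in sequentially. (\<Sum>k<K. cis (\<theta> l) ^ k) / of_nat K = 1"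
        using eventually_gt_at_top[of 0] by (auto simp: \<theta>_def elim!: eventually_mono)
      then show ?thesis using True by (simp add: tendsto_eventually)
    next
      case False
      then show ?thesis using tendsto_average_unit[OF _ cis1[OF l]] by simp
    qed
  qed
  moreover have "(\<Sum>l\<in>?S. b l * (if l = n then 1 else 0)) = b n"
  proof -
    have "(\<Sum>l\<in>?S. b l * (if l = n then 1 else 0)) = (\<Sum>l\<in>?S. if l = n then b l else 0)"
      by (intro sum.cong) auto
    also have "\<dots> = b n" using fin by (subst sum.delta) auto
    finally show ?thesis .
  qed
  ultimately have lim: "(\<lambda>K. (\<Sum>k<K. dirichlet_eval a (Complex \<sigma> (real k * \<delta>)) * cis (real k * \<delta> * ln (real n))) / of_nat K) \<longlonglongrightarrow> b n"
    by (simp only: avg)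
  have "norm (b n) \<le> B"
  proof (rule LIMSEQ_le_const2[OF tendsto_norm[OF lim]], intro exI[of _ 1] allI impI)
    fix K :: nat assume K: "1 \<le> K"
    have "norm (\<Sum>k<K. dirichlet_eval a (Complex \<sigma> (real k * \<delta>)) * cis (real k * \<delta> * ln (real n))) \<le> (\<Sum>k<K. B)"
      using B by (intro sum_norm_le) (simp add: norm_mult)
    then show "norm ((\<Sum>k<K. dirichlet_eval a (Complex \<sigma> (real k * \<delta>)) * cis (real k * \<delta> * ln (real n))) / of_nat K) \<le> B"
      using K by (simp add: norm_divide field_simps)
  qed
  then show ?thesis by (simp add: b_def norm_mult)
qed

section \<open>Point evaluations on the half-plane\<close>

lemma norm_of_nat_powr: "0 < n \<Longrightarrow> norm ((of_nat n :: complex) powr s) = real n powr Re s"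
  by (simp add: norm_powr_real_powr)

lemma real_powr_eq_prod:
  assumes "0 < n" "finite V" "supported_on V n"
  shows "real n powr x = (\<Prod>j\<in>V. (real (prime_at j) powr x) ^ prime_exponent j n)"
proof -
  have "real n powr x = norm (torus_monom n (\<lambda>j. of_nat (prime_at j) powr of_real x))"
    using assms(1) by (simp add: torus_monom_powr norm_of_nat_powr)
  also have "\<dots> = (\<Prod>j\<in>V. norm ((of_nat (prime_at j) :: complex) powr of_real x) ^ prime_exponent j n)"
    using assms by (subst torus_monom_superset[of V])
      (auto simp: supported_on_def prod_norm[symmetric] norm_power)
  finally show ?thesis by (simp add: norm_of_nat_powr)
qed

lemma prime_exponent_le: "0 < n \<Longrightarrow> prime_exponent j n \<le> n"
proof -
  assume n: "0 < n"
  have "prime_at j ^ prime_exponent j n dvd n" by (simp add: prime_exponent_eq multiplicity_dvd)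
  then have "prime_at j ^ prime_exponent j n \<le> n" using n by (rule dvd_imp_le)
  moreover have "prime_exponent j n < prime_at j ^ prime_exponent j n"
    by (rule power_gt_expt) (use prime_at_gt_1[of j] in simp)
  ultimately show ?thesis by linarith
qed

lemma prime_at_powr_less_1: "0 < \<tau> \<Longrightarrow> real (prime_at j) powr (-\<tau>) < 1"
  using prime_at_gt_1[of j] powr_less_mono[of "-\<tau>" 0 "real (prime_at j)"] by simp

text \<open>A finite Euler product of geometric series. It converges for every \<tau> > 0, whereas
  the sum over all n needs \<tau> > 1; this is what makes heights near 0 accessible.\<close>

lemma summable_supported_on:
  assumes V: "finite V" and \<tau>: "0 < \<tau>"
  shows "summable (\<lambda>n. if 0 < n \<and> supported_on V n then real n powr (-\<tau>) else 0)"
proof (rule summableI_nonneg_bounded)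
  fix X
  define N where "N = {n. 0 < n \<and> n < X \<and> supported_on V n}"
  define x where "x j = real (prime_at j) powr (-\<tau>)" for j
  define g where "g n = restrict (\<lambda>j. prime_exponent j n) V" for n
  have x: "0 \<le> x j" "x j < 1" for j
    using prime_at_powr_less_1[OF \<tau>] by (auto simp: x_def)
  \<comment> \<open>Unique factorization: an integer supported on V is determined by its exponents
    on V.\<close>
  have inj: "inj_on g N"
  proof (rule inj_onI)
    fix m n assume mn: "m \<in> N" "n \<in> N" "g m = g n"
    show "m = n"
    proof (rule prime_exponent_inject)
      fix j
      show "prime_exponent j m = prime_exponent j n"
      proof (cases "j \<in> V")
        case True
        then show ?thesis using fun_cong[OF mn(3), of j] by (simp add: g_def)
      next
        case False
        then have "prime_exponent j m = 0" "prime_exponent j n = 0"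
          using mn(1,2) by (auto simp: N_def supported_on_def)
        then show ?thesis by simp
      qed
    qed (use mn in \<open>auto simp: N_def\<close>)
  qed
  have "(\<Sum>n<X. if 0 < n \<and> supported_on V n then real n powr (-\<tau>) else 0) = (\<Sum>n\<in>N. real n powr (-\<tau>))"
    unfolding N_def by (subst sum.inter_filter[symmetric]) (auto intro!: sum.cong)
  also have "\<dots> = (\<Sum>n\<in>N. \<Prod>j\<in>V. x j ^ g n j)"
    using V by (intro sum.cong refl) (auto simp: N_def g_def x_def real_powr_eq_prod)
  also have "\<dots> = (\<Sum>e\<in>g ` N. \<Prod>j\<in>V. x j ^ e j)"
    by (subst sum.reindex[OF inj]) simp
  \<comment> \<open>Exponents of integers below X are at most X, so the sum is dominated by a sum
    over a full box, which factors.\<close>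
  also have "\<dots> \<le> (\<Sum>e\<in>PiE V (\<lambda>_. {..X}). \<Prod>j\<in>V. x j ^ e j)"
  proof (rule sum_mono2)
    have "prime_exponent j n \<le> X" if "n \<in> N" for n j
      using prime_exponent_le[of n j] that by (simp add: N_def)
    then show "g ` N \<subseteq> PiE V (\<lambda>_. {..X})" by (auto simp: g_def)
  qed (use V x in \<open>auto intro!: finite_PiE prod_nonneg\<close>)
  also have "\<dots> = (\<Prod>j\<in>V. \<Sum>e\<le>X. x j ^ e)"
    by (subst prod_sum_PiE[OF V]) auto
  also have "\<dots> \<le> (\<Prod>j\<in>V. 1 / (1 - x j))"
  proof (rule prod_mono)
    fix j
    have "(\<Sum>e\<le>X. x j ^ e) \<le> (\<Sum>e. x j ^ e)"
      using x by (intro sum_le_suminf summable_geometric) auto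
    also have "\<dots> = 1 / (1 - x j)" using x by (intro suminf_geometric) auto
    finally show "0 \<le> (\<Sum>e\<le>X. x j ^ e) \<and> (\<Sum>e\<le>X. x j ^ e) \<le> 1 / (1 - x j)"
      using x by (auto intro: sum_nonneg)
  qed
  finally show "(\<Sum>n<X. if 0 < n \<and> supported_on V n then real n powr (-\<tau>) else 0) \<le> (\<Prod>j\<in>V. 1 / (1 - x j))" .
qed auto

text \<open>The p-th power, without the root, of the norm of P_\<sigma>, where G is the lift of
  P.\<close>

definition hardy_mean :: "real \<Rightarrow> ((nat \<Rightarrow> complex) \<Rightarrow> complex) \<Rightarrow> real \<Rightarrow> real" where
  "hardy_mean p G \<sigma> = torus_mean p (\<lambda>z. G (shift_coords \<sigma> z))"

lemma hardy_mean_nonneg [simp]: "0 \<le> hardy_mean p G \<sigma>"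
  by (simp add: hardy_mean_def)

lemma hardy_mean_0 [simp]: "hardy_mean p G 0 = torus_mean p G"
  by (simp add: hardy_mean_def)

lemma hardy_mean_antimono:
  assumes "G \<in> torus_polys" "0 < p" "\<sigma> \<le> \<tau>"
  shows "hardy_mean p G \<tau> \<le> hardy_mean p G \<sigma>"
proof -
  have *: "shift_coords \<tau> z = shift_coords \<sigma> (\<lambda>j. of_real (real (prime_at j) powr (-(\<tau>-\<sigma>))) * z j)" for z
    using shift_coords_add[of \<sigma> "\<tau> - \<sigma>" z] by (simp add: shift_coords_def[abs_def])
  show ?thesis
    unfolding hardy_mean_def *[abs_def]
    by (rule torus_mean_scale_le[OF torus_polys_shift[OF assms(1)], of p "\<lambda>j. real (prime_at j) powr (-(\<tau>-\<sigma>))"])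
       (use assms prime_at_powr_le_1[of "\<tau> - \<sigma>"] in auto)
qed

lemma bohr_lift_finite_support:
  assumes "\<And>n. a n \<noteq> 0 \<Longrightarrow> supported_on V n" "\<And>j. j \<in> V \<Longrightarrow> z j = z' j"
  shows "bohr_lift a z = bohr_lift a z'"
  unfolding bohr_lift_def using assms
  by (intro sum.cong prod.cong arg_cong2[where f = "(*)"] arg_cong2[where f = power] refl)
     (auto simp: supported_on_def)

text \<open>The shift 2\<tau> is spent in two halves: one lowers the mean to height \<tau>, the
  other moves the point of evaluation into the polydisc, to coordinates of modulus p^(-\<tau>). The
  product of the losses is finite, so every \<tau> > 0 is allowed.\<close>

lemma dirichlet_coeff_bound_supported:
  assumes a: "a \<in> dirichlet_polys" and V: "finite V" "\<And>n. a n \<noteq> 0 \<Longrightarrow> supported_on V n"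
    and u: "0 < u" and \<tau>: "0 < \<tau>" and n: "0 < n"
  shows "norm (a n) * real n powr (-(2*\<tau>)) \<le>
    (hardy_mean u (bohr_lift a) \<tau> / (\<Prod>j\<in>V. 1 - real (prime_at j) powr (-(2*\<tau>)))) powr (1/u)"
proof (rule dirichlet_coeff_le_sup[OF a n])
  fix t
  let ?G = "\<lambda>z. bohr_lift a (shift_coords \<tau> z)"
  define w where "w j = (of_nat (prime_at j) :: complex) powr (- Complex \<tau> t)" for j
  have nw: "norm (w j) = real (prime_at j) powr (-\<tau>)" for j
    by (simp add: w_def norm_of_nat_powr)
  have pos: "0 < (\<Prod>j\<in>V. 1 - real (prime_at j) powr (-(2*\<tau>)))"
    using prime_at_powr_less_1[of "2*\<tau>"] \<tau> by (intro prod_pos) auto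
  have e: "dirichlet_eval a (Complex (2*\<tau>) t) = ?G w"
  proof -
    have "(of_nat (prime_at j) :: complex) powr (- Complex (2*\<tau>) t) = shift_coords \<tau> w j" for j
    proof -
      have "- Complex (2*\<tau>) t = of_real (-\<tau>) + (- Complex \<tau> t)" by (simp add: complex_eq_iff)
      then have "(of_nat (prime_at j) :: complex) powr (- Complex (2*\<tau>) t) =
        of_nat (prime_at j) powr of_real (-\<tau>) * of_nat (prime_at j) powr (- Complex \<tau> t)"
        by (metis powr_add)
      then show ?thesis using powr_of_real[of "real (prime_at j)" "-\<tau>"] by (simp add: shift_coords_def w_def)
    qed
    then show ?thesis unfolding dirichlet_eval_eq[OF a] by (intro arg_cong[where f = "bohr_lift a"]) auto
  qed
  have "norm (?G w) powr u * (\<Prod>j\<in>V. 1 - norm (w j) ^ 2) \<le> torus_mean u ?G"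
  proof (rule torus_point_eval_bound[OF _ u V(1)])
    show "?G \<in> torus_polys" by (intro torus_polys_shift bohr_lift_in_torus_polys a)
    show "norm (w j) < 1" for j using nw prime_at_powr_less_1[OF \<tau>] by simp
    show "?G z = ?G z'" if "\<And>j. j \<in> V \<Longrightarrow> z j = z' j" for z z'
      by (rule bohr_lift_finite_support[OF V(2)]) (use that in \<open>auto simp: shift_coords_def\<close>)
  qed
  moreover have "norm (w j) ^ 2 = real (prime_at j) powr (-(2*\<tau>))" for j
    by (simp add: nw power2_eq_square flip: powr_add)
  ultimately have "norm (?G w) powr u \<le> hardy_mean u (bohr_lift a) \<tau> / (\<Prod>j\<in>V. 1 - real (prime_at j) powr (-(2*\<tau>)))"
    using pos by (simp add: hardy_mean_def field_simps)
  then have "(norm (?G w) powr u) powr (1/u) \<le> (hardy_mean u (bohr_lift a) \<tau> / (\<Prod>j\<in>V. 1 - real (prime_at j) powr (-(2*\<tau>)))) powr (1/u)"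
    using u by (intro powr_mono2) auto
  then show "norm (dirichlet_eval a (Complex (2*\<tau>) t)) \<le> (hardy_mean u (bohr_lift a) \<tau> / (\<Prod>j\<in>V. 1 - real (prime_at j) powr (-(2*\<tau>)))) powr (1/u)"
    using u by (simp add: e powr_powr)
qed

text \<open>Dominated convergence over n. With \<tau> = \<sigma>/4 the coefficient bound uses up
  half of the decay n^(-\<sigma>), and the other half is summable because only primes of V occur.
  Information gathered far to the right thus reaches every positive height.\<close>

lemma uniform_convergence_supported:
  assumes R: "\<And>k. R k \<in> dirichlet_polys" and V: "finite V" "\<And>k n. R k n \<noteq> 0 \<Longrightarrow> supported_on V n"
    and u: "0 < u" and bdd: "\<And>\<tau>. 0 < \<tau> \<Longrightarrow> \<exists>B. \<forall>k. hardy_mean u (bohr_lift (R k)) \<tau> \<le> B"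
    and coeff: "\<And>n. (\<lambda>k. R k n) \<longlonglongrightarrow> 0" and \<sigma>: "0 < \<sigma>"
  obtains e where "e \<longlonglongrightarrow> 0" "\<And>k z. (\<And>j. norm (z j) \<le> 1) \<Longrightarrow> norm (bohr_lift (R k) (shift_coords \<sigma> z)) \<le> e k"
proof -
  define \<tau> where "\<tau> = \<sigma> / 4"
  have \<tau>: "0 < \<tau>" using \<sigma> by (simp add: \<tau>_def)
  obtain B where B: "\<And>k. hardy_mean u (bohr_lift (R k)) \<tau> \<le> B" using bdd[OF \<tau>] by blast
  define P where "P = (\<Prod>j\<in>V. 1 - real (prime_at j) powr (-(2*\<tau>)))"
  have P: "0 < P" unfolding P_def
    using prime_at_powr_less_1[of "2*\<tau>"] \<tau> by (intro prod_pos) auto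
  define C where "C = (B / P) powr (1/u)"
  have Rb: "norm (R k n) * real n powr (-\<sigma>) \<le> C * (if 0 < n \<and> supported_on V n then real n powr (-(\<sigma>/2)) else 0)" for k n
  proof (cases "R k n = 0")
    case False
    then have n: "0 < n" "supported_on V n" using dirichlet_polys_pos[OF R] V(2) by auto
    have "norm (R k n) * real n powr (-(2*\<tau>)) \<le> (hardy_mean u (bohr_lift (R k)) \<tau> / P) powr (1/u)"
      unfolding P_def by (rule dirichlet_coeff_bound_supported[OF R V(1) V(2) u \<tau> n(1)])
    also have "\<dots> \<le> C"
      unfolding C_def using u P B by (intro powr_mono2 divide_right_mono) auto
    finally have "norm (R k n) * real n powr (-(2*\<tau>)) * real n powr (-(\<sigma>/2)) \<le> C * real n powr (-(\<sigma>/2))"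
      by (intro mult_right_mono) auto
    moreover have "real n powr (-(2*\<tau>)) * real n powr (-(\<sigma>/2)) = real n powr (-\<sigma>)"
      by (simp add: \<tau>_def flip: powr_add)
    ultimately show ?thesis using n by (simp add: mult.assoc)
  qed (simp add: C_def)
  define e where "e k = (\<Sum>n. norm (R k n) * real n powr (-\<sigma>))" for k
  have sum: "summable (\<lambda>n. C * (if 0 < n \<and> supported_on V n then real n powr (-(\<sigma>/2)) else 0))"
    using \<sigma> by (intro summable_mult summable_supported_on V) auto
  show ?thesis
  proof (rule that)
    have "(\<lambda>k. \<Sum>n. norm (R k n) * real n powr (-\<sigma>)) \<longlonglongrightarrow> (\<Sum>n::nat. 0)"
    proof (rule tannerys_theorem[THEN conjunct2, THEN conjunct2])
      show "(\<lambda>k. norm (R k n) * real n powr - \<sigma>) \<longlonglongrightarrow> 0" for n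
        using tendsto_mult_right[OF tendsto_norm[OF coeff[of n]], of "real n powr - \<sigma>"] by simp
      show "\<forall>\<^sub>F (n, k) in at_top \<times>\<^sub>F sequentially. norm (norm (R k n) * real n powr - \<sigma>) \<le>
         C * (if 0 < n \<and> supported_on V n then real n powr (-(\<sigma>/2)) else 0)"
        using Rb by (intro always_eventually) auto
    qed (use sum in auto)
    then show "e \<longlonglongrightarrow> 0" by (simp add: e_def[abs_def])
    fix k and z :: "nat \<Rightarrow> complex" assume z: "\<And>j. norm (z j) \<le> 1"
    let ?S = "{n. R k n \<noteq> 0}"
    have fin: "finite ?S" by (rule dirichlet_polys_finite[OF R])
    have "norm (bohr_lift (R k) (shift_coords \<sigma> z)) \<le> (\<Sum>n\<in>?S. norm (R k n) * real n powr (-\<sigma>))"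
      unfolding bohr_lift_superset[OF fin order_refl]
    proof (rule sum_norm_le)
      fix n assume "n \<in> ?S"
      then have "0 < n" using dirichlet_polys_pos[OF R] by auto
      then show "norm (R k n * torus_monom n (shift_coords \<sigma> z)) \<le> norm (R k n) * real n powr (-\<sigma>)"
        using norm_torus_monom_le[of z n] z
        by (simp add: torus_monom_shift_coords norm_mult mult_left_le mult_left_mono)
    qed
    also have "\<dots> = e k"
      unfolding e_def using fin by (intro suminf_finite[symmetric]) auto
    finally show "norm (bohr_lift (R k) (shift_coords \<sigma> z)) \<le> e k" .
  qed
qed

text \<open>By 1 - x >= exp (-2 x) the product of the losses is at least
  \<open>exp (-(2*Z))\<close>, where \<open>Z\<close> already sums n^(-2\<theta>) over all n. So the
  constant does not depend on the primes that occur in the polynomial.\<close>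

lemma half_plane_eval_bound:
  assumes p: "0 < p" and \<theta>: "1 / 2 < \<theta>"
  obtains C where "0 < C" "\<And>a s. a \<in> dirichlet_polys \<Longrightarrow> \<theta> \<le> Re s \<Longrightarrow>
    norm (dirichlet_eval a s) powr p \<le> C * torus_mean p (bohr_lift a)"
proof -
  have sum: "summable (\<lambda>n. real n powr (-(2*\<theta>)))" using \<theta> by (simp add: summable_real_powr_iff)
  define Z where "Z = (\<Sum>n. real n powr (-(2*\<theta>)))"
  show ?thesis
  proof (rule that[of "exp (2 * Z)"])
    fix a s assume a: "a \<in> dirichlet_polys" and s: "\<theta> \<le> Re s"
    define w where "w j = (of_nat (prime_at j) :: complex) powr (- s)" for j
    have nw: "norm (w j) ^ 2 = real (prime_at j) powr (-(2 * Re s))" for j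
      by (simp add: w_def norm_of_nat_powr power2_eq_square flip: powr_add)
    have le\<theta>: "norm (w j) ^ 2 \<le> real (prime_at j) powr (-(2 * \<theta>))" for j
      unfolding nw using s prime_at_gt_1[of j] by (intro powr_mono) auto
    \<comment> \<open>The range on which 1 - x >= exp (-2 x) is used below; primes are at least 2
      and 2\<theta> > 1.\<close>
    have half: "norm (w j) ^ 2 \<le> 1 / 2" for j
    proof -
      have "real (prime_at j) powr (-(2 * \<theta>)) \<le> real (prime_at j) powr (-1)"
        using \<theta> prime_at_gt_1[of j] by (intro powr_mono) auto
      also have "\<dots> \<le> 1 / 2" using prime_at_gt_1[of j] by (simp add: powr_minus divide_simps)
      finally show ?thesis using le\<theta>[of j] by linarith
    qed
    have w1: "norm (w j) < 1" for j
    proof -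
      have "norm (w j) ^ 2 < 1" using half[of j] by linarith
      then show ?thesis by (simp add: abs_square_less_1)
    qed
    obtain V where V: "finite V" "\<And>z z'. (\<And>j. j \<in> V \<Longrightarrow> z j = z' j) \<Longrightarrow> bohr_lift a z = bohr_lift a z'"
      using torus_polys_finite_support[of "bohr_lift a"] a by auto
    have "exp (-(2*Z)) \<le> exp (\<Sum>j\<in>V. - (2 * norm (w j) ^ 2))"
    proof -
      have "(\<Sum>j\<in>V. norm (w j) ^ 2) \<le> (\<Sum>j\<in>V. real (prime_at j) powr (-(2 * \<theta>)))"
        by (intro sum_mono le\<theta>)
      also have "\<dots> = (\<Sum>n\<in>prime_at ` V. real n powr (-(2 * \<theta>)))"
        by (subst sum.reindex) (auto intro: inj_onI)
      also have "\<dots> \<le> Z" unfolding Z_def using V(1) by (intro sum_le_suminf sum) auto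
      finally show ?thesis by (simp add: sum_negf flip: sum_distrib_left)
    qed
    also have "\<dots> = (\<Prod>j\<in>V. exp (- (2 * norm (w j) ^ 2)))" using V(1) by (rule exp_sum)
    also have "\<dots> \<le> (\<Prod>j\<in>V. 1 - norm (w j) ^ 2)"
    proof (rule prod_mono)
      fix j
      define x where "x = norm (w j) ^ 2"
      have x: "0 \<le> x" "x \<le> 1 / 2" using half by (auto simp: x_def)
      have "x * x \<le> x * (1/2)" using x by (intro mult_left_mono) auto
      then have "- (2 * x) \<le> ln (1 - x)"
        using ln_one_minus_pos_lower_bound[OF x] by (simp add: power2_eq_square)
      then have "exp (- (2 * x)) \<le> 1 - x" using x by (simp add: ln_ge_iff)
      then show "0 \<le> exp (- (2 * norm (w j) ^ 2)) \<and> exp (- (2 * norm (w j) ^ 2)) \<le> 1 - norm (w j) ^ 2"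
        by (simp add: x_def)
    qed
    finally have P: "exp (-(2*Z)) \<le> (\<Prod>j\<in>V. 1 - norm (w j) ^ 2)" .
    have "norm (bohr_lift a w) powr p * exp (-(2*Z)) \<le> norm (bohr_lift a w) powr p * (\<Prod>j\<in>V. 1 - norm (w j) ^ 2)"
      using P by (intro mult_left_mono) auto
    also have "\<dots> \<le> torus_mean p (bohr_lift a)"
      by (rule torus_point_eval_bound[OF bohr_lift_in_torus_polys[OF a] p V(1) w1 V(2)])
    finally have "norm (bohr_lift a w) powr p \<le> exp (2*Z) * torus_mean p (bohr_lift a)"
      by (simp add: exp_minus field_simps)
    then show "norm (dirichlet_eval a s) powr p \<le> exp (2 * Z) * torus_mean p (bohr_lift a)"
      by (simp add: dirichlet_eval_eq[OF a] w_def[abs_def])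
  qed simp
qed

section \<open>Mixed means\<close>

lemma nn_integral_powr_exp:
  assumes \<kappa>: "0 < \<kappa>" and c: "0 < c"
  shows "(\<integral>\<^sup>+\<sigma>. ennreal (indicator {0<..} \<sigma> * (\<sigma> powr (\<kappa> - 1) * exp (- c * \<sigma>))) \<partial>lborel) =
    ennreal (Gamma \<kappa> * c powr (-\<kappa>))"
proof -
  have "ennreal (Gamma \<kappa>) = (\<integral>\<^sup>+t. ennreal (indicator {0..} t * t powr (\<kappa> - 1) / exp t) \<partial>lborel)"
    by (rule Gamma_conv_nn_integral_real[OF \<kappa>])
  also have "\<dots> = ennreal c * (\<integral>\<^sup>+t. ennreal (indicator {0..} (0 + c * t) * (0 + c * t) powr (\<kappa> - 1) / exp (0 + c * t)) \<partial>lborel)"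
    using c nn_integral_real_affine[of "\<lambda>t. ennreal (indicator {0..} t * t powr (\<kappa> - 1) / exp t)" c 0] by simp
  also have "\<dots> = ennreal c * (\<integral>\<^sup>+t. ennreal (c powr (\<kappa> - 1)) * ennreal (indicator {0<..} t * (t powr (\<kappa> - 1) * exp (- c * t))) \<partial>lborel)"
    using c by (intro arg_cong2[where f = "(*)"] nn_integral_cong refl)
      (auto simp: indicator_def powr_mult exp_minus divide_simps zero_le_mult_iff simp flip: ennreal_mult)
  also have "\<dots> = ennreal c * (ennreal (c powr (\<kappa> - 1)) * (\<integral>\<^sup>+t. ennreal (indicator {0<..} t * (t powr (\<kappa> - 1) * exp (- c * t))) \<partial>lborel))"
    by (subst nn_integral_cmult) auto
  also have "\<dots> = ennreal (c powr \<kappa>) * (\<integral>\<^sup>+t. ennreal (indicator {0<..} t * (t powr (\<kappa> - 1) * exp (- c * t))) \<partial>lborel)"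
    using c by (simp add: mult.assoc[symmetric] powr_diff flip: ennreal_mult)
  finally have *: "ennreal (Gamma \<kappa>) = ennreal (c powr \<kappa>) * (\<integral>\<^sup>+t. ennreal (indicator {0<..} t * (t powr (\<kappa> - 1) * exp (- c * t))) \<partial>lborel)" .
  have "ennreal (Gamma \<kappa> * c powr (-\<kappa>)) = ennreal (c powr (-\<kappa>)) * ennreal (Gamma \<kappa>)"
    using \<kappa> by (simp add: mult.commute Gamma_real_pos less_imp_le flip: ennreal_mult)
  also have "\<dots> = (\<integral>\<^sup>+t. ennreal (indicator {0<..} t * (t powr (\<kappa> - 1) * exp (- c * t))) \<partial>lborel)"
    using c unfolding * by (simp add: mult.assoc[symmetric] flip: ennreal_mult powr_add)
  finally show ?thesis ..
qed

section \<open>The weights on the half-line\<close>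

definition weight_const :: "real \<Rightarrow> real" where
  "weight_const \<alpha> = 2 powr (\<alpha> + 1) / Gamma (\<alpha> + 1)"

lemma weight_const_pos: "-1 < \<alpha> \<Longrightarrow> 0 < weight_const \<alpha>"
  by (simp add: weight_const_def Gamma_real_pos)

lemma sets_weight_measure [simp, measurable_cong]: "sets (weight_measure \<alpha>) = sets borel"
  by (simp add: weight_measure_def)

lemma space_weight_measure [simp]: "space (weight_measure \<alpha>) = UNIV"
  by (simp add: weight_measure_def)

lemma nn_integral_weight:
  assumes "f \<in> borel_measurable borel"
  shows "(\<integral>\<^sup>+\<sigma>. f \<sigma> \<partial>weight_measure \<alpha>) =
    (\<integral>\<^sup>+\<sigma>. ennreal (indicator {0<..} \<sigma> * (weight_const \<alpha> * \<sigma> powr \<alpha> * exp (- 2 * \<sigma>))) * f \<sigma> \<partial>lborel)"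
  unfolding weight_measure_def weight_const_def[symmetric]
  by (rule nn_integral_density) (use assms in auto)

lemma AE_weight_measure: "AE \<sigma> in weight_measure \<alpha>. 0 < \<sigma>"
proof -
  have "AE \<sigma> in lborel. 0 < ennreal (indicator {0<..} \<sigma> * (weight_const \<alpha> * \<sigma> powr \<alpha> * exp (- 2 * \<sigma>))) \<longrightarrow> 0 < \<sigma>"
    by (rule AE_I2) (auto simp: indicator_def split: if_splits)
  then show ?thesis
    unfolding weight_measure_def weight_const_def[symmetric] by (subst AE_density) auto
qed

lemma nn_integral_weight_powr_exp:
  assumes "-1 < \<alpha>" "-1 < \<alpha> + \<delta>" "0 \<le> c"
  shows "(\<integral>\<^sup>+\<sigma>. ennreal (\<sigma> powr \<delta> * exp (- c * \<sigma>)) \<partial>weight_measure \<alpha>) =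
    ennreal (weight_const \<alpha> * Gamma (\<alpha> + \<delta> + 1) * (2 + c) powr (-(\<alpha> + \<delta> + 1)))"
proof -
  have k: "0 \<le> weight_const \<alpha>" using weight_const_pos[OF assms(1)] by simp
  have "(\<integral>\<^sup>+\<sigma>. ennreal (\<sigma> powr \<delta> * exp (- c * \<sigma>)) \<partial>weight_measure \<alpha>) =
    (\<integral>\<^sup>+\<sigma>. ennreal (indicator {0<..} \<sigma> * (weight_const \<alpha> * \<sigma> powr \<alpha> * exp (- 2 * \<sigma>))) * ennreal (\<sigma> powr \<delta> * exp (- c * \<sigma>)) \<partial>lborel)"
    by (rule nn_integral_weight) simp
  also have "\<dots> = (\<integral>\<^sup>+\<sigma>. ennreal (weight_const \<alpha>) * ennreal (indicator {0<..} \<sigma> * (\<sigma> powr ((\<alpha> + \<delta> + 1) - 1) * exp (- (2 + c) * \<sigma>))) \<partial>lborel)"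
  proof (rule nn_integral_cong)
    fix \<sigma> :: real
    have "exp (- (2 + c) * \<sigma>) = exp (- 2 * \<sigma>) * exp (- c * \<sigma>)"
      by (simp add: algebra_simps flip: exp_add)
    then show "ennreal (indicator {0<..} \<sigma> * (weight_const \<alpha> * \<sigma> powr \<alpha> * exp (- 2 * \<sigma>))) * ennreal (\<sigma> powr \<delta> * exp (- c * \<sigma>)) =
      ennreal (weight_const \<alpha>) * ennreal (indicator {0<..} \<sigma> * (\<sigma> powr ((\<alpha> + \<delta> + 1) - 1) * exp (- (2 + c) * \<sigma>)))"
      using k by (auto simp: indicator_def powr_add mult_ac simp flip: ennreal_mult)
  qed
  also have "\<dots> = ennreal (weight_const \<alpha>) * ennreal (Gamma (\<alpha> + \<delta> + 1) * (2 + c) powr (-(\<alpha> + \<delta> + 1)))"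
    using assms by (subst nn_integral_cmult) (simp_all only: nn_integral_powr_exp, auto)
  finally show ?thesis
    using k assms by (simp add: ennreal_mult mult.assoc Gamma_real_pos less_imp_le)
qed

lemma prob_space_weight_measure:
  assumes "-1 < \<alpha>"
  shows "prob_space (weight_measure \<alpha>)"
proof
  have "emeasure (weight_measure \<alpha>) (space (weight_measure \<alpha>)) = (\<integral>\<^sup>+\<sigma>. 1 \<partial>weight_measure \<alpha>)"
    by simp
  also have "\<dots> = (\<integral>\<^sup>+\<sigma>. ennreal (\<sigma> powr 0 * exp (- 0 * \<sigma>)) \<partial>weight_measure \<alpha>)"
    by (intro nn_integral_cong_AE) (rule eventually_mono[OF AE_weight_measure], simp)
  also have "\<dots> = ennreal (weight_const \<alpha> * Gamma (\<alpha> + 0 + 1) * (2 + 0) powr (-(\<alpha> + 0 + 1)))"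
    using assms by (intro nn_integral_weight_powr_exp) auto
  also have "weight_const \<alpha> * Gamma (\<alpha> + 0 + 1) * (2 + 0) powr (-(\<alpha> + 0 + 1)) = 2 powr (\<alpha> + 1) * 2 powr (-(\<alpha> + 1))"
    using less_imp_neq[OF Gamma_real_pos[of "\<alpha> + 1"]] assms by (auto simp: weight_const_def simp del: minus_add_distrib)
  also have "\<dots> = 1" by (simp flip: powr_add)
  also have "ennreal 1 = 1" by simp
  finally show "emeasure (weight_measure \<alpha>) (space (weight_measure \<alpha>)) = 1" .
qed

lemma emeasure_weight_lower:
  assumes "-1 < \<alpha>"
  obtains c where "0 < c" "\<And>\<tau>. 0 < \<tau> \<Longrightarrow> \<tau> \<le> 1 \<Longrightarrow> ennreal (c * \<tau> powr (\<alpha> + 1)) \<le> emeasure (weight_measure \<alpha>) {\<tau>/2<..\<tau>}"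
proof (rule that)
  \<comment> \<open>On (\<tau>/2, \<tau>] the power of \<sigma> is at least
    \<open>2 powr (-\<bar>\<alpha>\<bar>)\<close> times that of \<tau> for either sign of \<alpha>,
    the exponential is at least \<open>exp (-2)\<close>, and the interval has length
    \<tau>/2.\<close>
  let ?c = "weight_const \<alpha> * exp (-2) * 2 powr (-\<bar>\<alpha>\<bar>) / 2"
  show "0 < ?c" using weight_const_pos[OF assms] by simp
  fix \<tau> :: real assume \<tau>: "0 < \<tau>" "\<tau> \<le> 1"
  have k: "0 \<le> weight_const \<alpha>" using weight_const_pos[OF assms] by simp
  have low: "2 powr (-\<bar>\<alpha>\<bar>) * \<tau> powr \<alpha> \<le> \<sigma> powr \<alpha>" if "\<sigma> \<in> {\<tau>/2<..\<tau>}" for \<sigma>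
  proof (cases "0 \<le> \<alpha>")
    case True
    then have "2 powr (-\<bar>\<alpha>\<bar>) * \<tau> powr \<alpha> = (\<tau> / 2) powr \<alpha>"
      using \<tau> by (simp add: powr_divide powr_minus field_simps)
    also have "\<dots> \<le> \<sigma> powr \<alpha>" using True that \<tau> by (intro powr_mono2) auto
    finally show ?thesis .
  next
    case False
    have "2 powr (-\<bar>\<alpha>\<bar>) * \<tau> powr \<alpha> \<le> 1 * \<tau> powr \<alpha>"
      using powr_mono[of "-\<bar>\<alpha>\<bar>" 0 2] by (intro mult_right_mono) auto
    also have "\<dots> \<le> \<sigma> powr \<alpha>" using False that \<tau> powr_mono2'[of \<alpha> \<sigma> \<tau>] by simp
    finally show ?thesis .
  qed
  have "ennreal (?c * \<tau> powr (\<alpha> + 1)) = ennreal (weight_const \<alpha> * (2 powr (-\<bar>\<alpha>\<bar>) * \<tau> powr \<alpha>) * exp (-2)) * ennreal (\<tau> / 2)"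
    using \<tau> k by (simp add: powr_add mult_ac flip: ennreal_mult)
  also have "\<dots> = (\<integral>\<^sup>+\<sigma>. ennreal (weight_const \<alpha> * (2 powr (-\<bar>\<alpha>\<bar>) * \<tau> powr \<alpha>) * exp (-2)) * indicator {\<tau>/2<..\<tau>} \<sigma> \<partial>lborel)"
    using \<tau> by (subst nn_integral_cmult_indicator) auto
  also have "\<dots> \<le> (\<integral>\<^sup>+\<sigma>. ennreal (indicator {0<..} \<sigma> * (weight_const \<alpha> * \<sigma> powr \<alpha> * exp (- 2 * \<sigma>))) * indicator {\<tau>/2<..\<tau>} \<sigma> \<partial>lborel)"
    using k \<tau> low by (intro nn_integral_mono) (auto simp: indicator_def intro!: ennreal_leI mult_mono)
  also have "\<dots> = (\<integral>\<^sup>+\<sigma>. indicator {\<tau>/2<..\<tau>} \<sigma> \<partial>weight_measure \<alpha>)"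
    by (rule nn_integral_weight[symmetric]) simp
  finally show "ennreal (?c * \<tau> powr (\<alpha> + 1)) \<le> emeasure (weight_measure \<alpha>) {\<tau>/2<..\<tau>}" by simp
qed

text \<open>The q-th power of the mixed norm. The exponent is q/p because \<open>hardy_mean\<close>
  is already a p-th power.\<close>

definition mixed_mean :: "real \<Rightarrow> real \<Rightarrow> real \<Rightarrow> ((nat \<Rightarrow> complex) \<Rightarrow> complex) \<Rightarrow> real" where
  "mixed_mean p q \<alpha> G = (\<integral>\<sigma>. hardy_mean p G \<sigma> powr (q / p) \<partial>weight_measure \<alpha>)"

lemma mixed_mean_nonneg [simp]: "0 \<le> mixed_mean p q \<alpha> G"
  by (simp add: mixed_mean_def)

lemma mixed_norm_eq:
  assumes "a \<in> dirichlet_polys" "0 < p" "0 < q"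
  shows "mixed_norm p q \<alpha> a = mixed_mean p q \<alpha> (bohr_lift a) powr (1 / q)"
proof -
  have "hardy_norm p (dirichlet_shift \<sigma> a) powr q = hardy_mean p (bohr_lift a) \<sigma> powr (q / p)" for \<sigma>
    using assms by (simp add: hardy_norm_def hardy_mean_def torus_mean_def bohr_lift_shift powr_powr)
  then show ?thesis by (simp add: mixed_norm_def mixed_mean_def)
qed

lemma hardy_mean_measurable:
  assumes "G \<in> torus_polys" "0 < p"
  shows "hardy_mean p G \<in> borel_measurable borel"
proof -
  have "(\<lambda>\<sigma>. - hardy_mean p G \<sigma>) \<in> borel_measurable borel"
    by (rule borel_measurable_mono) (use hardy_mean_antimono[OF assms] in \<open>auto intro!: monoI\<close>)
  from borel_measurable_uminus[OF this] show ?thesis by simp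
qed

lemma hardy_mean_powr_measurable:
  assumes "G \<in> torus_polys" "0 < p"
  shows "(\<lambda>\<sigma>. hardy_mean p G \<sigma> powr r) \<in> borel_measurable borel"
  using hardy_mean_measurable[OF assms] by measurable

lemma integrable_hardy_mean:
  assumes "G \<in> torus_polys" "0 < p" "0 < r" "-1 < \<alpha>"
  shows "integrable (weight_measure \<alpha>) (\<lambda>\<sigma>. hardy_mean p G \<sigma> powr r)"
proof -
  interpret prob_space "weight_measure \<alpha>" by (rule prob_space_weight_measure[OF assms(4)])
  show ?thesis
  proof (rule integrable_const_bound)
    show "AE \<sigma> in weight_measure \<alpha>. norm (hardy_mean p G \<sigma> powr r) \<le> hardy_mean p G 0 powr r"
      using AE_weight_measure
      by eventually_elim (use hardy_mean_antimono[OF assms(1,2), of 0] assms(3) in \<open>auto intro!: powr_mono2\<close>)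
  qed (simp only: measurable_cong_sets[OF sets_weight_measure refl] hardy_mean_powr_measurable[OF assms(1,2)])
qed

lemma nn_integral_hardy_mean:
  assumes "G \<in> torus_polys" "0 < p" "0 < q" "-1 < \<alpha>"
  shows "(\<integral>\<^sup>+\<sigma>. ennreal (hardy_mean p G \<sigma> powr (q / p)) \<partial>weight_measure \<alpha>) = ennreal (mixed_mean p q \<alpha> G)"
  unfolding mixed_mean_def using assms
  by (intro nn_integral_eq_integral integrable_hardy_mean) auto

lemma mixed_mean_le_torus_mean:
  assumes "G \<in> torus_polys" "0 < p" "0 < q" "-1 < \<alpha>"
  shows "mixed_mean p q \<alpha> G \<le> torus_mean p G powr (q / p)"
proof -
  interpret prob_space "weight_measure \<alpha>" by (rule prob_space_weight_measure[OF assms(4)])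
  have "mixed_mean p q \<alpha> G \<le> (\<integral>\<sigma>. torus_mean p G powr (q / p) \<partial>weight_measure \<alpha>)"
    unfolding mixed_mean_def
  proof (rule integral_mono_AE)
    show "AE \<sigma> in weight_measure \<alpha>. hardy_mean p G \<sigma> powr (q / p) \<le> torus_mean p G powr (q / p)"
      using AE_weight_measure
      by eventually_elim (use hardy_mean_antimono[OF assms(1,2), of 0] assms(2,3) in \<open>auto intro!: powr_mono2\<close>)
  qed (use assms in \<open>auto intro: integrable_hardy_mean\<close>)
  also have "\<dots> = torus_mean p G powr (q / p)" using prob_space by simp
  finally show ?thesis .
qed

text \<open>The mean decreases, so its value at \<sigma> is at most its values on (\<sigma>/2,
  \<sigma>], and this interval has weight at least a multiple of \<sigma>^(\<alpha>+1).\<close>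

lemma hardy_mean_le_mixed_mean:
  assumes p: "0 < p" and q: "0 < q" and \<alpha>: "-1 < \<alpha>"
  obtains C where "0 < C" "\<And>G \<sigma>. G \<in> torus_polys \<Longrightarrow> 0 < \<sigma> \<Longrightarrow> \<sigma> \<le> 1 \<Longrightarrow>
      hardy_mean p G \<sigma> powr (q / p) \<le> C * \<sigma> powr (-(\<alpha> + 1)) * mixed_mean p q \<alpha> G"
proof -
  obtain c where c: "0 < c" "\<And>\<tau>. 0 < \<tau> \<Longrightarrow> \<tau> \<le> 1 \<Longrightarrow> ennreal (c * \<tau> powr (\<alpha> + 1)) \<le> emeasure (weight_measure \<alpha>) {\<tau>/2<..\<tau>}"
    using emeasure_weight_lower[OF \<alpha>] by metis
  show ?thesis
  proof (rule that[of "1 / c"])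
    fix G and \<sigma> :: real assume G: "G \<in> torus_polys" and \<sigma>: "0 < \<sigma>" "\<sigma> \<le> 1"
    have "ennreal (hardy_mean p G \<sigma> powr (q / p) * (c * \<sigma> powr (\<alpha> + 1))) \<le>
      ennreal (hardy_mean p G \<sigma> powr (q / p)) * emeasure (weight_measure \<alpha>) {\<sigma>/2<..\<sigma>}"
      using c \<sigma> by (simp add: ennreal_mult mult_left_mono)
    also have "\<dots> = (\<integral>\<^sup>+t. ennreal (hardy_mean p G \<sigma> powr (q / p)) * indicator {\<sigma>/2<..\<sigma>} t \<partial>weight_measure \<alpha>)"
      by (subst nn_integral_cmult_indicator) auto
    also have "\<dots> \<le> (\<integral>\<^sup>+t. ennreal (hardy_mean p G t powr (q / p)) \<partial>weight_measure \<alpha>)"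
      using hardy_mean_antimono[OF G p] p q
      by (intro nn_integral_mono) (auto simp: indicator_def intro!: ennreal_leI powr_mono2)
    also have "\<dots> = ennreal (mixed_mean p q \<alpha> G)" by (rule nn_integral_hardy_mean[OF G p q \<alpha>])
    finally have "hardy_mean p G \<sigma> powr (q / p) * (c * \<sigma> powr (\<alpha> + 1)) \<le> mixed_mean p q \<alpha> G"
      by (simp add: ennreal_le_iff)
    then have "hardy_mean p G \<sigma> powr (q / p) \<le> mixed_mean p q \<alpha> G / (c * \<sigma> powr (\<alpha> + 1))"
      using c(1) \<sigma> by (simp add: pos_le_divide_eq)
    also have "\<dots> = 1 / c * \<sigma> powr (-(\<alpha> + 1)) * mixed_mean p q \<alpha> G"
      unfolding powr_minus_divide by simp
    finally show "hardy_mean p G \<sigma> powr (q / p) \<le> 1 / c * \<sigma> powr (-(\<alpha> + 1)) * mixed_mean p q \<alpha> G" .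
  qed (use c in auto)
qed

text \<open>If x is within relative distance \<delta> of y, continuity of the power at 1 gives the
  first term. Otherwise both x and y are at most (1 + 1/\<delta>) |x - y|, which gives the
  second.\<close>

lemma powr_diff_eps:
  fixes \<kappa> \<epsilon> :: real
  assumes \<kappa>: "0 < \<kappa>" and \<epsilon>: "0 < \<epsilon>"
  obtains C where "0 < C" "\<And>x y. 0 \<le> x \<Longrightarrow> 0 \<le> y \<Longrightarrow>
    \<bar>x powr \<kappa> - y powr \<kappa>\<bar> \<le> \<epsilon> * y powr \<kappa> + C * \<bar>x - y\<bar> powr \<kappa>"
proof -
  have "isCont (\<lambda>s::real. s powr \<kappa>) 1" by (intro continuous_intros) auto
  then obtain \<delta> where \<delta>: "0 < \<delta>" "\<And>s. \<bar>s - 1\<bar> < \<delta> \<Longrightarrow> \<bar>s powr \<kappa> - 1\<bar> < \<epsilon>"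
    using \<epsilon> unfolding continuous_at_eps_delta dist_real_def by force
  show ?thesis
  proof (rule that[of "(1 + 1 / \<delta>) powr \<kappa>"])
    fix x y :: real assume xy: "0 \<le> x" "0 \<le> y"
    show "\<bar>x powr \<kappa> - y powr \<kappa>\<bar> \<le> \<epsilon> * y powr \<kappa> + (1 + 1 / \<delta>) powr \<kappa> * \<bar>x - y\<bar> powr \<kappa>"
    proof (cases "\<bar>x - y\<bar> < \<delta> * y")
      case True
      then have "0 < \<delta> * y" using abs_ge_zero[of "x - y"] by linarith
      then have y: "0 < y" using \<delta>(1) by (rule zero_less_mult_pos)
      have "x / y - 1 = (x - y) / y" using y by (simp add: diff_divide_distrib)
      then have "\<bar>x / y - 1\<bar> < \<delta>" using True y by (simp add: pos_divide_less_eq)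
      from less_imp_le[OF \<delta>(2)[OF this]] have "\<bar>(x / y) powr \<kappa> - 1\<bar> * y powr \<kappa> \<le> \<epsilon> * y powr \<kappa>"
        by (rule mult_right_mono) simp
      moreover have "\<bar>(x / y) powr \<kappa> - 1\<bar> * y powr \<kappa> = \<bar>x powr \<kappa> - y powr \<kappa>\<bar>"
      proof -
        have "((x / y) powr \<kappa> - 1) * y powr \<kappa> = x powr \<kappa> - y powr \<kappa>"
          using y xy by (simp add: left_diff_distrib powr_divide)
        then show ?thesis by (metis abs_mult abs_of_nonneg powr_ge_zero)
      qed
      ultimately show ?thesis by (smt (verit) mult_nonneg_nonneg powr_ge_zero)
    next
      case False
      then have y: "y \<le> \<bar>x - y\<bar> / \<delta>" using \<delta>(1) by (simp add: field_simps)
      let ?d = "(1 + 1 / \<delta>) * \<bar>x - y\<bar>"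
      have "x \<le> ?d" "y \<le> ?d" using y xy by (auto simp: algebra_simps abs_if split: if_splits)
      then have "x powr \<kappa> \<le> ?d powr \<kappa>" "y powr \<kappa> \<le> ?d powr \<kappa>"
        using \<kappa> xy by (auto intro: powr_mono2)
      then have "\<bar>x powr \<kappa> - y powr \<kappa>\<bar> \<le> ?d powr \<kappa>"
        using powr_ge_zero[of x \<kappa>] powr_ge_zero[of y \<kappa>] by linarith
      also have "\<dots> = (1 + 1 / \<delta>) powr \<kappa> * \<bar>x - y\<bar> powr \<kappa>"
        using \<delta>(1) by (simp add: powr_mult)
      finally show ?thesis using \<epsilon> by (smt (verit) mult_nonneg_nonneg powr_ge_zero)
    qed
  next
    have "0 < 1 + 1 / \<delta>" using \<delta>(1) by (simp add: add_pos_pos)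
    then show "0 < (1 + 1 / \<delta>) powr \<kappa>" by simp
  qed
qed

lemma torus_mean_eps:
  assumes p: "0 < p" and \<epsilon>: "0 < \<epsilon>"
  obtains C where "0 < C" "\<And>G H. G \<in> torus_polys \<Longrightarrow> H \<in> torus_polys \<Longrightarrow>
    \<bar>torus_mean p G - torus_mean p H\<bar> \<le> \<epsilon> * torus_mean p H + C * torus_mean p (\<lambda>z. G z - H z)"
proof -
  obtain C where C: "0 < C" "\<And>x y. 0 \<le> x \<Longrightarrow> 0 \<le> y \<Longrightarrow>
    \<bar>x powr p - y powr p\<bar> \<le> \<epsilon> * y powr p + C * \<bar>x - y\<bar> powr p"
    using powr_diff_eps[OF p \<epsilon>] by metis
  show ?thesis
  proof (rule that[OF C(1)])
    fix G H assume GH: "G \<in> torus_polys" "H \<in> torus_polys"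
    have D: "(\<lambda>z. G z - H z) \<in> torus_polys" by (rule torus_polys_diff[OF GH])
    note int = integrable_torus_poly[OF GH(1) p] integrable_torus_poly[OF GH(2) p] integrable_torus_poly[OF D p]
    have "\<bar>torus_mean p G - torus_mean p H\<bar> = \<bar>\<integral>z. norm (G z) powr p - norm (H z) powr p \<partial>torus_measure\<bar>"
      unfolding torus_mean_def using int by (simp add: Bochner_Integration.integral_diff)
    also have "\<dots> \<le> (\<integral>z. \<bar>norm (G z) powr p - norm (H z) powr p\<bar> \<partial>torus_measure)"
      by (rule integral_abs_bound)
    also have "\<dots> \<le> (\<integral>z. \<epsilon> * norm (H z) powr p + C * norm (G z - H z) powr p \<partial>torus_measure)"
    proof (rule integral_mono)
      fix z
      have "\<bar>norm (G z) - norm (H z)\<bar> powr p \<le> norm (G z - H z) powr p"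
        using p norm_triangle_ineq3[of "G z" "H z"] by (intro powr_mono2) auto
      then have "C * \<bar>norm (G z) - norm (H z)\<bar> powr p \<le> C * norm (G z - H z) powr p"
        using C(1) by (intro mult_left_mono) auto
      with C(2)[of "norm (G z)" "norm (H z)"]
      show "\<bar>norm (G z) powr p - norm (H z) powr p\<bar> \<le> \<epsilon> * norm (H z) powr p + C * norm (G z - H z) powr p"
        by simp
    qed (use int in auto)
    also have "\<dots> = \<epsilon> * torus_mean p H + C * torus_mean p (\<lambda>z. G z - H z)"
      unfolding torus_mean_def using int by simp
    finally show "\<bar>torus_mean p G - torus_mean p H\<bar> \<le> \<epsilon> * torus_mean p H + C * torus_mean p (\<lambda>z. G z - H z)" .
  qed
qed

lemma hardy_mean_eps:
  assumes p: "0 < p" and \<epsilon>: "0 < \<epsilon>"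
  obtains C where "0 < C" "\<And>G H \<sigma>. G \<in> torus_polys \<Longrightarrow> H \<in> torus_polys \<Longrightarrow>
    \<bar>hardy_mean p G \<sigma> - hardy_mean p H \<sigma>\<bar> \<le> \<epsilon> * hardy_mean p H \<sigma> + C * hardy_mean p (\<lambda>z. G z - H z) \<sigma>"
proof -
  obtain C where C: "0 < C" "\<And>G H. G \<in> torus_polys \<Longrightarrow> H \<in> torus_polys \<Longrightarrow>
    \<bar>torus_mean p G - torus_mean p H\<bar> \<le> \<epsilon> * torus_mean p H + C * torus_mean p (\<lambda>z. G z - H z)"
    using torus_mean_eps[OF assms] by metis
  show ?thesis
  proof (rule that[OF C(1)])
    fix G H \<sigma> assume "G \<in> torus_polys" "H \<in> torus_polys"
    from C(2)[OF torus_polys_shift[OF this(1)] torus_polys_shift[OF this(2)]]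
    show "\<bar>hardy_mean p G \<sigma> - hardy_mean p H \<sigma>\<bar> \<le> \<epsilon> * hardy_mean p H \<sigma> + C * hardy_mean p (\<lambda>z. G z - H z) \<sigma>"
      by (simp add: hardy_mean_def)
  qed
qed

text \<open>The scalar inequality is applied twice, inside with exponent p and outside with exponent
  q/p. As \<epsilon> is arbitrary, mixed means converge along Cauchy sequences also when p or q is
  below 1; a quasi-triangle inequality alone would only give boundedness.\<close>

lemma mixed_mean_eps:
  assumes p: "0 < p" and q: "0 < q" and \<alpha>: "-1 < \<alpha>" and \<epsilon>: "0 < \<epsilon>"
  obtains C where "0 < C" "\<And>G H. G \<in> torus_polys \<Longrightarrow> H \<in> torus_polys \<Longrightarrow>
    \<bar>mixed_mean p q \<alpha> G - mixed_mean p q \<alpha> H\<bar> \<le> \<epsilon> * mixed_mean p q \<alpha> H + C * mixed_mean p q \<alpha> (\<lambda>z. G z - H z)"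
proof -
  define \<kappa> where "\<kappa> = q / p"
  have \<kappa>: "0 < \<kappa>" using p q by (simp add: \<kappa>_def)
  obtain C1 where C1: "0 < C1" "\<And>x y. 0 \<le> x \<Longrightarrow> 0 \<le> y \<Longrightarrow>
    \<bar>x powr \<kappa> - y powr \<kappa>\<bar> \<le> (\<epsilon>/2) * y powr \<kappa> + C1 * \<bar>x - y\<bar> powr \<kappa>"
    using powr_diff_eps[OF \<kappa>, of "\<epsilon>/2"] \<epsilon> by auto
  \<comment> \<open>The inner error passes through the outer constant \<open>C1\<close> and the
    exponent \<kappa>; this choice makes its contribution \<epsilon>/2 (see
    \<open>\<eta>\<kappa>\<close>).\<close>
  define \<eta> where "\<eta> = (\<epsilon> / (2 * C1 * 2 powr \<kappa>)) powr (1 / \<kappa>)"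
  have \<eta>: "0 < \<eta>" using \<epsilon> C1(1) by (simp add: \<eta>_def)
  have \<eta>\<kappa>: "C1 * (2 powr \<kappa> * \<eta> powr \<kappa>) = \<epsilon> / 2"
    using \<epsilon> C1(1) \<kappa> by (simp add: \<eta>_def powr_powr)
  obtain C2 where C2: "0 < C2" "\<And>G H \<sigma>. G \<in> torus_polys \<Longrightarrow> H \<in> torus_polys \<Longrightarrow>
    \<bar>hardy_mean p G \<sigma> - hardy_mean p H \<sigma>\<bar> \<le> \<eta> * hardy_mean p H \<sigma> + C2 * hardy_mean p (\<lambda>z. G z - H z) \<sigma>"
    using hardy_mean_eps[OF p \<eta>] by metis
  define C where "C = C1 * (2 powr \<kappa> * C2 powr \<kappa>)"
  show ?thesis
  proof (rule that[of C])
    show "0 < C" using C1(1) C2(1) by (simp add: C_def)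
    fix G H assume GH: "G \<in> torus_polys" "H \<in> torus_polys"
    have D: "(\<lambda>z. G z - H z) \<in> torus_polys" by (rule torus_polys_diff[OF GH])
    have int: "integrable (weight_measure \<alpha>) (\<lambda>\<sigma>. hardy_mean p F \<sigma> powr \<kappa>)" if "F \<in> torus_polys" for F
      by (rule integrable_hardy_mean[OF that p \<kappa> \<alpha>])
    have pw: "\<bar>hardy_mean p G \<sigma> powr \<kappa> - hardy_mean p H \<sigma> powr \<kappa>\<bar> \<le>
      \<epsilon> * hardy_mean p H \<sigma> powr \<kappa> + C * hardy_mean p (\<lambda>z. G z - H z) \<sigma> powr \<kappa>" for \<sigma>
    proof -
      let ?X = "hardy_mean p G \<sigma>" and ?Y = "hardy_mean p H \<sigma>" and ?Z = "hardy_mean p (\<lambda>z. G z - H z) \<sigma>"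
      have "\<bar>?X - ?Y\<bar> powr \<kappa> \<le> (\<eta> * ?Y + C2 * ?Z) powr \<kappa>"
        using C2(2)[OF GH] \<kappa> by (intro powr_mono2) auto
      also have "\<dots> \<le> 2 powr \<kappa> * ((\<eta> * ?Y) powr \<kappa> + (C2 * ?Z) powr \<kappa>)"
        using \<eta> C2(1) \<kappa> by (intro powr_add_le_2) auto
      finally have "C1 * \<bar>?X - ?Y\<bar> powr \<kappa> \<le> C1 * (2 powr \<kappa> * ((\<eta> * ?Y) powr \<kappa> + (C2 * ?Z) powr \<kappa>))"
        using C1(1) by (intro mult_left_mono) auto
      also have "\<dots> = C1 * (2 powr \<kappa> * \<eta> powr \<kappa>) * ?Y powr \<kappa> + C * ?Z powr \<kappa>"
        using \<eta> C2(1) by (simp add: C_def powr_mult algebra_simps)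
      finally show ?thesis using C1(2)[of ?X ?Y] unfolding \<eta>\<kappa> by simp
    qed
    have "\<bar>mixed_mean p q \<alpha> G - mixed_mean p q \<alpha> H\<bar> =
      \<bar>\<integral>\<sigma>. hardy_mean p G \<sigma> powr \<kappa> - hardy_mean p H \<sigma> powr \<kappa> \<partial>weight_measure \<alpha>\<bar>"
      unfolding mixed_mean_def \<kappa>_def[symmetric] using int GH by (simp add: Bochner_Integration.integral_diff)
    also have "\<dots> \<le> (\<integral>\<sigma>. \<bar>hardy_mean p G \<sigma> powr \<kappa> - hardy_mean p H \<sigma> powr \<kappa>\<bar> \<partial>weight_measure \<alpha>)"
      by (rule integral_abs_bound)
    also have "\<dots> \<le> (\<integral>\<sigma>. \<epsilon> * hardy_mean p H \<sigma> powr \<kappa> + C * hardy_mean p (\<lambda>z. G z - H z) \<sigma> powr \<kappa> \<partial>weight_measure \<alpha>)"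
      using int GH D by (intro integral_mono pw) auto
    also have "\<dots> = \<epsilon> * mixed_mean p q \<alpha> H + C * mixed_mean p q \<alpha> (\<lambda>z. G z - H z)"
      unfolding mixed_mean_def \<kappa>_def[symmetric] using int[OF GH(2)] int[OF D] by simp
    finally show "\<bar>mixed_mean p q \<alpha> G - mixed_mean p q \<alpha> H\<bar> \<le>
      \<epsilon> * mixed_mean p q \<alpha> H + C * mixed_mean p q \<alpha> (\<lambda>z. G z - H z)" .
  qed
qed

lemma mixed_mean_add_le:
  assumes "0 < p" "0 < q" "-1 < \<alpha>"
  obtains K where "1 \<le> K" "\<And>G H. G \<in> torus_polys \<Longrightarrow> H \<in> torus_polys \<Longrightarrow>
    mixed_mean p q \<alpha> (\<lambda>z. G z + H z) \<le> K * (mixed_mean p q \<alpha> G + mixed_mean p q \<alpha> H)"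
proof -
  obtain C where C: "0 < C" "\<And>G H. G \<in> torus_polys \<Longrightarrow> H \<in> torus_polys \<Longrightarrow>
    \<bar>mixed_mean p q \<alpha> G - mixed_mean p q \<alpha> H\<bar> \<le> 1 * mixed_mean p q \<alpha> H + C * mixed_mean p q \<alpha> (\<lambda>z. G z - H z)"
    using mixed_mean_eps[OF assms, of 1] by (auto simp del: mult_1)
  show ?thesis
  proof (rule that[of "2 + C"])
    fix G H assume GH: "G \<in> torus_polys" "H \<in> torus_polys"
    have "mixed_mean p q \<alpha> (\<lambda>z. G z + H z) \<le> 2 * mixed_mean p q \<alpha> H + C * mixed_mean p q \<alpha> G"
      using C(2)[OF torus_polys_add[OF GH] GH(2)] by simp
    also have "\<dots> \<le> (2 + C) * mixed_mean p q \<alpha> H + (2 + C) * mixed_mean p q \<alpha> G"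
      using C(1) by (intro add_mono mult_right_mono) auto
    finally show "mixed_mean p q \<alpha> (\<lambda>z. G z + H z) \<le> (2 + C) * (mixed_mean p q \<alpha> G + mixed_mean p q \<alpha> H)"
      by (simp add: algebra_simps)
  qed (use C in auto)
qed

lemma hardy_mean_tendsto:
  assumes p: "0 < p" and G: "G \<in> torus_polys" "\<And>k. Gk k \<in> torus_polys"
    and e: "e \<longlonglongrightarrow> 0" "\<And>k z. (\<And>j. norm (z j) \<le> 1) \<Longrightarrow> norm (Gk k (shift_coords \<sigma> z) - G (shift_coords \<sigma> z)) \<le> e k"
  shows "(\<lambda>k. hardy_mean p (Gk k) \<sigma>) \<longlonglongrightarrow> hardy_mean p G \<sigma>"
proof -
  have D: "(\<lambda>z. Gk k z - G z) \<in> torus_polys" for k by (rule torus_polys_diff[OF G(2) G(1)])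
  have small: "hardy_mean p (\<lambda>z. Gk k z - G z) \<sigma> \<le> \<bar>e k\<bar> powr p" for k
  proof -
    have "hardy_mean p (\<lambda>z. Gk k z - G z) \<sigma> \<le> (\<integral>z. \<bar>e k\<bar> powr p \<partial>torus_measure)"
      unfolding hardy_mean_def torus_mean_def
    proof (rule integral_mono_AE)
      show "AE z in torus_measure. norm (Gk k (shift_coords \<sigma> z) - G (shift_coords \<sigma> z)) powr p \<le> \<bar>e k\<bar> powr p"
        using AE_torus
      proof eventually_elim
        case (elim z)
        then have "norm (Gk k (shift_coords \<sigma> z) - G (shift_coords \<sigma> z)) \<le> e k"
          by (intro e(2)) simp
        then show ?case using p by (intro powr_mono2) auto
      qed
    qed (use integrable_torus_poly[OF torus_polys_shift[OF D] p] in auto)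
    then show ?thesis by (simp add: torus.prob_space)
  qed
  have null: "(\<lambda>k. \<bar>e k\<bar> powr p) \<longlonglongrightarrow> 0"
  proof -
    have "(\<lambda>k. \<bar>e k\<bar> powr p) \<longlonglongrightarrow> 0 powr p"
      using e(1) p by (intro tendsto_powr' tendsto_rabs_zero tendsto_const) auto
    then show ?thesis by simp
  qed
  show ?thesis
  proof (rule LIMSEQ_I)
    fix r :: real assume r: "0 < r"
    define \<epsilon> where "\<epsilon> = r / (2 * (1 + hardy_mean p G \<sigma>))"
    have \<epsilon>: "0 < \<epsilon>" using r by (simp add: \<epsilon>_def add_pos_nonneg)
    have e2: "\<epsilon> * hardy_mean p G \<sigma> \<le> r / 2"
    proof -
      have "\<epsilon> * hardy_mean p G \<sigma> \<le> \<epsilon> * (1 + hardy_mean p G \<sigma>)" using \<epsilon> by (intro mult_left_mono) auto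
      also have "\<dots> = r / 2"
      proof -
        have "1 + hardy_mean p G \<sigma> \<noteq> 0" using hardy_mean_nonneg[of p G \<sigma>] by linarith
        then show ?thesis by (simp only: \<epsilon>_def times_divide_eq_left) (simp del: distrib_left_numeral)
      qed
      finally show ?thesis .
    qed
    obtain C where C: "0 < C" "\<And>G H \<sigma>. G \<in> torus_polys \<Longrightarrow> H \<in> torus_polys \<Longrightarrow>
      \<bar>hardy_mean p G \<sigma> - hardy_mean p H \<sigma>\<bar> \<le> \<epsilon> * hardy_mean p H \<sigma> + C * hardy_mean p (\<lambda>z. G z - H z) \<sigma>"
      using hardy_mean_eps[OF p \<epsilon>] by metis
    obtain K where K: "\<And>k. k \<ge> K \<Longrightarrow> \<bar>e k\<bar> powr p < r / (2 * C)"
      using LIMSEQ_D[OF null, of "r / (2 * C)"] r C(1) by auto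
    show "\<exists>K. \<forall>k\<ge>K. norm (hardy_mean p (Gk k) \<sigma> - hardy_mean p G \<sigma>) < r"
    proof (intro exI allI impI)
      fix k assume "K \<le> k"
      then have "C * hardy_mean p (\<lambda>z. Gk k z - G z) \<sigma> < C * (r / (2 * C))"
        using small[of k] K[of k] C(1) by (intro mult_strict_left_mono) auto
      also have "\<dots> = r / 2" using C(1) by simp
      finally show "norm (hardy_mean p (Gk k) \<sigma> - hardy_mean p G \<sigma>) < r"
        using C(2)[OF G(2) G(1), of k \<sigma>] e2 by simp
    qed
  qed
qed

section \<open>The completion as a function space\<close>

text \<open>The mixed norm controls means at positive heights only, with a bound that blows up at 0.
  So part of the distance from \<theta> to 1/2 is spent on a shift by \<tau> before the point
  evaluation.\<close>

lemma mixed_eval_bound: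
  assumes p: "0 < p" and q: "0 < q" and \<alpha>: "-1 < \<alpha>" and \<theta>: "1 / 2 < \<theta>"
  obtains C where "0 < C" "\<And>a s. a \<in> dirichlet_polys \<Longrightarrow> \<theta> \<le> Re s \<Longrightarrow>
    norm (dirichlet_eval a s) powr q \<le> C * mixed_mean p q \<alpha> (bohr_lift a)"
proof -
  define \<tau> where "\<tau> = min 1 ((\<theta> - 1/2) / 2)"
  have \<tau>: "0 < \<tau>" "\<tau> \<le> 1" "1/2 < \<theta> - \<tau>" using \<theta> by (auto simp: \<tau>_def min_def field_simps)
  obtain C1 where C1: "0 < C1" "\<And>a s. a \<in> dirichlet_polys \<Longrightarrow> \<theta> - \<tau> \<le> Re s \<Longrightarrow>
    norm (dirichlet_eval a s) powr p \<le> C1 * torus_mean p (bohr_lift a)"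
    using half_plane_eval_bound[OF p \<tau>(3)] by metis
  obtain C2 where C2: "0 < C2" "\<And>G \<sigma>. G \<in> torus_polys \<Longrightarrow> 0 < \<sigma> \<Longrightarrow> \<sigma> \<le> 1 \<Longrightarrow>
      hardy_mean p G \<sigma> powr (q / p) \<le> C2 * \<sigma> powr (-(\<alpha> + 1)) * mixed_mean p q \<alpha> G"
    using hardy_mean_le_mixed_mean[OF p q \<alpha>] by metis
  show ?thesis
  proof (rule that[of "C1 powr (q / p) * (C2 * \<tau> powr (-(\<alpha> + 1)))"])
    show "0 < C1 powr (q / p) * (C2 * \<tau> powr (-(\<alpha> + 1)))" using C1 C2 \<tau> by simp
    fix a s assume a: "a \<in> dirichlet_polys" and s: "\<theta> \<le> Re s"
    have "bohr_lift (dirichlet_shift \<tau> a) = (\<lambda>z. bohr_lift a (shift_coords \<tau> z))"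
      by (rule ext) (rule bohr_lift_shift[OF a])
    then have "norm (dirichlet_eval a s) powr p \<le> C1 * hardy_mean p (bohr_lift a) \<tau>"
      using C1(2)[OF dirichlet_shift_in_polys[OF a], of "s - of_real \<tau>" \<tau>] s
      by (simp add: dirichlet_eval_shift[OF a] hardy_mean_def)
    then have "(norm (dirichlet_eval a s) powr p) powr (q / p) \<le> (C1 * hardy_mean p (bohr_lift a) \<tau>) powr (q / p)"
      using p q by (intro powr_mono2) auto
    also have "\<dots> = C1 powr (q / p) * hardy_mean p (bohr_lift a) \<tau> powr (q / p)"
      using C1(1) by (simp add: powr_mult)
    also have "\<dots> \<le> C1 powr (q / p) * (C2 * \<tau> powr (-(\<alpha> + 1)) * mixed_mean p q \<alpha> (bohr_lift a))"
      using C2(2)[of "bohr_lift a" \<tau>] a \<tau> by (intro mult_left_mono) auto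
    finally show "norm (dirichlet_eval a s) powr q \<le> C1 powr (q / p) * (C2 * \<tau> powr (-(\<alpha> + 1))) * mixed_mean p q \<alpha> (bohr_lift a)"
      using p by (simp add: powr_powr mult.assoc)
  qed
qed

section \<open>Cauchy sequences of polynomials and their limit functions\<close>

definition mixed_Cauchy :: "real \<Rightarrow> real \<Rightarrow> real \<Rightarrow> (nat \<Rightarrow> nat \<Rightarrow> complex) \<Rightarrow> bool" where
  "mixed_Cauchy p q \<alpha> A \<longleftrightarrow> (\<forall>\<epsilon>>0. \<exists>K. \<forall>k\<ge>K. \<forall>l\<ge>K.
     mixed_mean p q \<alpha> (\<lambda>z. bohr_lift (A k) z - bohr_lift (A l) z) < \<epsilon>)"

lemma powr_less_iff_less_powr:
  fixes x :: real
  assumes "0 \<le> x" "0 < \<epsilon>" "0 < q"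
  shows "x powr (1 / q) < \<epsilon> \<longleftrightarrow> x < \<epsilon> powr q"
proof -
  have "x = (x powr (1 / q)) powr q" using assms by (simp add: powr_powr)
  then show ?thesis using powr_less_mono2[OF assms(3), of "x powr (1/q)" \<epsilon>] powr_mono2[of q \<epsilon> "x powr (1/q)"] assms
    by (metis less_le_not_le linorder_not_le order_less_imp_le powr_ge_zero)
qed

lemma bohr_lift_diff_fun:
  "a \<in> dirichlet_polys \<Longrightarrow> b \<in> dirichlet_polys \<Longrightarrow>
    bohr_lift (\<lambda>n. a n - b n) = (\<lambda>z. bohr_lift a z - bohr_lift b z)"
  by (rule ext) (rule bohr_lift_diff)

lemma mixed_approx_iff:
  assumes "0 < p" "0 < q"
  shows "mixed_approx p q \<alpha> A f \<longleftrightarrow> (\<forall>k. A k \<in> dirichlet_polys) \<and> mixed_Cauchy p q \<alpha> A \<and>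
    (\<forall>s. Re s > 1 / 2 \<longrightarrow> (\<lambda>k. dirichlet_eval (A k) s) \<longlonglongrightarrow> f s)"
proof -
  have "(\<forall>\<epsilon>>0. \<exists>K. \<forall>k\<ge>K. \<forall>l\<ge>K. mixed_norm p q \<alpha> (\<lambda>n. A k n - A l n) < \<epsilon>) \<longleftrightarrow> mixed_Cauchy p q \<alpha> A"
    if A: "\<And>k. A k \<in> dirichlet_polys"
  proof -
    have *: "mixed_norm p q \<alpha> (\<lambda>n. A k n - A l n) < \<epsilon> \<longleftrightarrow>
       mixed_mean p q \<alpha> (\<lambda>z. bohr_lift (A k) z - bohr_lift (A l) z) < \<epsilon> powr q" if "0 < \<epsilon>" for k l \<epsilon>
      using assms that A by (simp add: mixed_norm_eq dirichlet_polys_diff bohr_lift_diff_fun powr_less_iff_less_powr)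
    show ?thesis
      unfolding mixed_Cauchy_def
    proof (intro iffI allI impI)
      fix \<epsilon> :: real assume \<epsilon>: "0 < \<epsilon>" and
        H: "\<forall>\<epsilon>>0. \<exists>K. \<forall>k\<ge>K. \<forall>l\<ge>K. mixed_norm p q \<alpha> (\<lambda>n. A k n - A l n) < \<epsilon>"
      have pos: "0 < \<epsilon> powr (1/q)" using \<epsilon> by simp
      have e: "(\<epsilon> powr (1/q)) powr q = \<epsilon>" using \<epsilon> assms by (simp add: powr_powr)
      show "\<exists>K. \<forall>k\<ge>K. \<forall>l\<ge>K. mixed_mean p q \<alpha> (\<lambda>z. bohr_lift (A k) z - bohr_lift (A l) z) < \<epsilon>"
        using H[rule_format, OF pos] unfolding *[OF pos] e .
    next
      fix \<epsilon> :: real assume \<epsilon>: "0 < \<epsilon>" and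
        H: "\<forall>\<epsilon>>0. \<exists>K. \<forall>k\<ge>K. \<forall>l\<ge>K. mixed_mean p q \<alpha> (\<lambda>z. bohr_lift (A k) z - bohr_lift (A l) z) < \<epsilon>"
      have "0 < \<epsilon> powr q" using \<epsilon> by simp
      from H[rule_format, OF this]
      show "\<exists>K. \<forall>k\<ge>K. \<forall>l\<ge>K. mixed_norm p q \<alpha> (\<lambda>n. A k n - A l n) < \<epsilon>"
        unfolding *[OF \<epsilon>] .
    qed
  qed
  then show ?thesis unfolding mixed_approx_def by blast
qed

lemma mixed_approx_uniform_limit:
  assumes p: "0 < p" and q: "0 < q" and \<alpha>: "-1 < \<alpha>" and A: "mixed_approx p q \<alpha> A f" and \<theta>: "1 / 2 < \<theta>"
  shows "uniform_limit {s. \<theta> \<le> Re s} (\<lambda>k s. dirichlet_eval (A k) s) f sequentially"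
proof (rule uniform_limitI)
  fix \<epsilon> :: real assume \<epsilon>: "0 < \<epsilon>"
  have AD: "\<And>k. A k \<in> dirichlet_polys" and AC: "mixed_Cauchy p q \<alpha> A"
    and Alim: "\<And>s. Re s > 1 / 2 \<Longrightarrow> (\<lambda>k. dirichlet_eval (A k) s) \<longlonglongrightarrow> f s"
    using A mixed_approx_iff[OF p q] by auto
  obtain C where C: "0 < C" "\<And>a s. a \<in> dirichlet_polys \<Longrightarrow> \<theta> \<le> Re s \<Longrightarrow>
    norm (dirichlet_eval a s) powr q \<le> C * mixed_mean p q \<alpha> (bohr_lift a)"
    using mixed_eval_bound[OF p q \<alpha> \<theta>] by metis
  have "0 < (\<epsilon>/2) powr q / C" using \<epsilon> C(1) by simp
  then obtain K where K: "\<And>k l. K \<le> k \<Longrightarrow> K \<le> l \<Longrightarrow>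
    mixed_mean p q \<alpha> (\<lambda>z. bohr_lift (A k) z - bohr_lift (A l) z) < (\<epsilon>/2) powr q / C"
    using AC unfolding mixed_Cauchy_def by meson
  show "\<forall>\<^sub>F k in sequentially. \<forall>s\<in>{s. \<theta> \<le> Re s}. dist (dirichlet_eval (A k) s) (f s) < \<epsilon>"
  proof (rule eventually_sequentiallyI[of K], rule ballI)
    fix k s assume k: "K \<le> k" and s: "s \<in> {s. \<theta> \<le> Re s}"
    have d: "norm (dirichlet_eval (A k) s - dirichlet_eval (A l) s) \<le> \<epsilon> / 2" if l: "K \<le> l" for l
    proof (rule ccontr)
      assume "\<not> norm (dirichlet_eval (A k) s - dirichlet_eval (A l) s) \<le> \<epsilon> / 2"
      then have "(\<epsilon>/2) powr q < norm (dirichlet_eval (\<lambda>n. A k n - A l n) s) powr q"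
        using q \<epsilon> AD by (intro powr_less_mono2) (auto simp: dirichlet_eval_diff)
      also have "\<dots> \<le> C * mixed_mean p q \<alpha> (bohr_lift (\<lambda>n. A k n - A l n))"
        using s AD by (intro C(2) dirichlet_polys_diff) auto
      also have "\<dots> \<le> C * ((\<epsilon>/2) powr q / C)"
        using K[OF k l] C(1) AD by (intro mult_left_mono) (auto simp: bohr_lift_diff_fun)
      finally show False using C(1) by simp
    qed
    have "norm (dirichlet_eval (A k) s - f s) \<le> \<epsilon> / 2"
    proof (rule LIMSEQ_le_const2)
      show "(\<lambda>l. norm (dirichlet_eval (A k) s - dirichlet_eval (A l) s)) \<longlonglongrightarrow> norm (dirichlet_eval (A k) s - f s)"
        using s \<theta> by (intro tendsto_intros Alim) auto
    qed (use d in auto)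
    then show "dist (dirichlet_eval (A k) s) (f s) < \<epsilon>" using \<epsilon> by (simp add: dist_norm)
  qed
qed

lemma dirichlet_coeff_tendsto_0:
  assumes R: "\<And>k. R k \<in> dirichlet_polys"
    and lim: "uniform_limit {s. \<theta> \<le> Re s} (\<lambda>k s. dirichlet_eval (R k) s) (\<lambda>_. 0) sequentially"
  shows "(\<lambda>k. R k n) \<longlonglongrightarrow> 0"
proof (cases "n = 0")
  case True
  then show ?thesis using R by (simp add: dirichlet_polys_def)
next
  case False
  then have n: "0 < n" by simp
  show ?thesis
  proof (rule LIMSEQ_I)
    fix r :: real assume r: "0 < r"
    let ?e = "r * real n powr (-\<theta>) / 2"
    have "0 < ?e" using r n by simp
    then obtain K where K: "\<And>k s. K \<le> k \<Longrightarrow> \<theta> \<le> Re s \<Longrightarrow> norm (dirichlet_eval (R k) s) < ?e"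
      using uniform_limitD[OF lim] unfolding eventually_sequentially by fastforce
    show "\<exists>K. \<forall>k\<ge>K. norm (R k n - 0) < r"
    proof (intro exI allI impI)
      fix k assume "K \<le> k"
      then have "norm (R k n) * real n powr (-\<theta>) \<le> ?e"
        using K by (intro dirichlet_coeff_le_sup[OF R n] less_imp_le) auto
      then show "norm (R k n - 0) < r" using n r by (simp add: field_simps)
    qed
  qed
qed

lemma mixed_Cauchy_bounded:
  assumes p: "0 < p" and q: "0 < q" and \<alpha>: "-1 < \<alpha>" and A: "\<And>k. A k \<in> dirichlet_polys" "mixed_Cauchy p q \<alpha> A"
  obtains M where "0 < M" "\<And>k. mixed_mean p q \<alpha> (bohr_lift (A k)) \<le> M"
proof -
  obtain K0 where K0: "\<And>G H. G \<in> torus_polys \<Longrightarrow> H \<in> torus_polys \<Longrightarrow>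
    mixed_mean p q \<alpha> (\<lambda>z. G z + H z) \<le> K0 * (mixed_mean p q \<alpha> G + mixed_mean p q \<alpha> H)" "1 \<le> K0"
    using mixed_mean_add_le[OF p q \<alpha>] by metis
  obtain K where K: "\<And>k l. K \<le> k \<Longrightarrow> K \<le> l \<Longrightarrow> mixed_mean p q \<alpha> (\<lambda>z. bohr_lift (A k) z - bohr_lift (A l) z) < 1"
    using A(2) unfolding mixed_Cauchy_def by (meson zero_less_one)
  let ?m = "\<lambda>k. mixed_mean p q \<alpha> (bohr_lift (A k))"
  have 1: "?m k \<le> K0 * (1 + ?m K)" if "K \<le> k" for k
  proof -
    have "mixed_mean p q \<alpha> (\<lambda>z. (bohr_lift (A k) z - bohr_lift (A K) z) + bohr_lift (A K) z) \<le>
      K0 * (mixed_mean p q \<alpha> (\<lambda>z. bohr_lift (A k) z - bohr_lift (A K) z) + ?m K)"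
      using A(1) by (intro K0 torus_polys_diff) auto
    also have "\<dots> \<le> K0 * (1 + ?m K)" using K[OF that order_refl] K0(2) by (intro mult_left_mono add_right_mono) auto
    finally show ?thesis by simp
  qed
  show ?thesis
  proof (rule that[of "1 + K0 * (1 + ?m K) + (\<Sum>k<K. ?m k)"])
    show "0 < 1 + K0 * (1 + ?m K) + (\<Sum>k<K. ?m k)"
      using K0(2) by (intro add_pos_nonneg sum_nonneg mult_nonneg_nonneg) auto
    fix k show "?m k \<le> 1 + K0 * (1 + ?m K) + (\<Sum>k<K. ?m k)"
    proof (cases "K \<le> k")
      case True
      then show ?thesis using 1[OF True] by (simp add: sum_nonneg add_increasing2)
    next
      case False
      then have "?m k \<le> (\<Sum>k<K. ?m k)" by (intro member_le_sum) auto
      moreover have "0 \<le> K0 * (1 + ?m K)" using K0(2) by auto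
      ultimately show ?thesis by linarith
    qed
  qed
qed

text \<open>The filter is arbitrary so that the statement serves single sequences as well as the
  pairs (k, l) of a Cauchy condition.\<close>

lemma mixed_mean_tendsto_diff:
  assumes p: "0 < p" and q: "0 < q" and \<alpha>: "-1 < \<alpha>" and G: "\<And>k. G k \<in> torus_polys" "\<And>k. H k \<in> torus_polys"
    and M: "\<And>k. mixed_mean p q \<alpha> (H k) \<le> M"
    and lim: "((\<lambda>k. mixed_mean p q \<alpha> (\<lambda>z. G k z - H k z)) \<longlongrightarrow> 0) F"
  shows "((\<lambda>k. mixed_mean p q \<alpha> (G k) - mixed_mean p q \<alpha> (H k)) \<longlongrightarrow> 0) F"
proof (rule tendstoI)
  fix r :: real assume r: "0 < r"
  define \<epsilon> where "\<epsilon> = r / (2 * (1 + \<bar>M\<bar>))"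
  have \<epsilon>: "0 < \<epsilon>" using r by (simp add: \<epsilon>_def add_pos_nonneg)
  obtain C where C: "0 < C" "\<And>G H. G \<in> torus_polys \<Longrightarrow> H \<in> torus_polys \<Longrightarrow>
    \<bar>mixed_mean p q \<alpha> G - mixed_mean p q \<alpha> H\<bar> \<le> \<epsilon> * mixed_mean p q \<alpha> H + C * mixed_mean p q \<alpha> (\<lambda>z. G z - H z)"
    using mixed_mean_eps[OF p q \<alpha> \<epsilon>] by metis
  have e: "\<epsilon> * mixed_mean p q \<alpha> (H k) \<le> r / 2" for k
  proof -
    have "\<epsilon> * mixed_mean p q \<alpha> (H k) \<le> \<epsilon> * (1 + \<bar>M\<bar>)" using M[of k] \<epsilon> by (intro mult_left_mono) auto
    also have "\<dots> = r / 2"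
    proof -
      have "1 + \<bar>M\<bar> \<noteq> 0" by linarith
      then show ?thesis by (simp only: \<epsilon>_def times_divide_eq_left) (simp del: distrib_left_numeral)
    qed
    finally show ?thesis .
  qed
  have "0 < r / (2 * C)" using r C(1) by simp
  from order_tendstoD(2)[OF lim this]
  show "\<forall>\<^sub>F k in F. dist (mixed_mean p q \<alpha> (G k) - mixed_mean p q \<alpha> (H k)) 0 < r"
  proof eventually_elim
    case (elim k)
    then have "C * mixed_mean p q \<alpha> (\<lambda>z. G k z - H k z) < r / 2" using C(1) by (simp add: field_simps)
    then show ?case using C(2)[OF G, of k k] e[of k] by simp
  qed
qed

lemma mixed_Cauchy_convergent:
  assumes p: "0 < p" and q: "0 < q" and \<alpha>: "-1 < \<alpha>" and A: "\<And>k. A k \<in> dirichlet_polys" "mixed_Cauchy p q \<alpha> A"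
  shows "convergent (\<lambda>k. mixed_mean p q \<alpha> (bohr_lift (A k)))"
proof (rule Cauchy_convergent, rule metric_CauchyI)
  fix r :: real assume r: "0 < r"
  obtain M where M: "\<And>k. mixed_mean p q \<alpha> (bohr_lift (A k)) \<le> M"
    using mixed_Cauchy_bounded[OF p q \<alpha> A] by metis
  have lim: "((\<lambda>(k, l). mixed_mean p q \<alpha> (\<lambda>z. bohr_lift (A k) z - bohr_lift (A l) z)) \<longlongrightarrow> 0) (sequentially \<times>\<^sub>F sequentially)"
  proof (rule tendstoI)
    fix \<epsilon> :: real assume "0 < \<epsilon>"
    then obtain K where "\<And>k l. K \<le> k \<Longrightarrow> K \<le> l \<Longrightarrow> mixed_mean p q \<alpha> (\<lambda>z. bohr_lift (A k) z - bohr_lift (A l) z) < \<epsilon>"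
      using A(2) unfolding mixed_Cauchy_def by meson
    then show "\<forall>\<^sub>F x in sequentially \<times>\<^sub>F sequentially. dist (case x of (k, l) \<Rightarrow> mixed_mean p q \<alpha> (\<lambda>z. bohr_lift (A k) z - bohr_lift (A l) z)) 0 < \<epsilon>"
      unfolding eventually_prod_sequentially by auto
  qed
  have "((\<lambda>x. mixed_mean p q \<alpha> (bohr_lift (A (fst x))) - mixed_mean p q \<alpha> (bohr_lift (A (snd x)))) \<longlongrightarrow> 0) (sequentially \<times>\<^sub>F sequentially)"
  proof (rule mixed_mean_tendsto_diff[OF p q \<alpha>, where M = M])
    show "((\<lambda>k. mixed_mean p q \<alpha> (\<lambda>z. bohr_lift (A (fst k)) z - bohr_lift (A (snd k)) z)) \<longlongrightarrow> 0) (sequentially \<times>\<^sub>F sequentially)"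
      using lim by (simp add: split_beta')
  qed (use A M in auto)
  from tendstoD[OF this r]
  obtain K where "\<And>k l. K \<le> k \<Longrightarrow> K \<le> l \<Longrightarrow>
    \<bar>mixed_mean p q \<alpha> (bohr_lift (A k)) - mixed_mean p q \<alpha> (bohr_lift (A l))\<bar> < r"
    unfolding eventually_prod_sequentially by auto
  then show "\<exists>K. \<forall>k\<ge>K. \<forall>l\<ge>K. dist (mixed_mean p q \<alpha> (bohr_lift (A k))) (mixed_mean p q \<alpha> (bohr_lift (A l))) < r"
    by (auto simp: dist_real_def)
qed

lemma torus_mean_uminus: "torus_mean p (\<lambda>z. - G z) = torus_mean p G"
  by (simp add: torus_mean_def)

lemma mixed_mean_uminus: "mixed_mean p q \<alpha> (\<lambda>z. - G z) = mixed_mean p q \<alpha> G"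
  by (simp add: mixed_mean_def hardy_mean_def torus_mean_uminus)

lemma mixed_mean_minus_commute: "mixed_mean p q \<alpha> (\<lambda>z. G z - H z) = mixed_mean p q \<alpha> (\<lambda>z. H z - G z)"
  using mixed_mean_uminus[of p q \<alpha> "\<lambda>z. G z - H z"] by simp

lemma torus_polys_uminus: "G \<in> torus_polys \<Longrightarrow> (\<lambda>z. - G z) \<in> torus_polys"
  using torus_polys_mult[OF torus_polys_const, of G "-1"] by simp

lemma mixed_mean_diff_le:
  assumes "0 < p" "0 < q" "-1 < \<alpha>"
  obtains K where "1 \<le> K" "\<And>G H. G \<in> torus_polys \<Longrightarrow> H \<in> torus_polys \<Longrightarrow>
    mixed_mean p q \<alpha> (\<lambda>z. G z - H z) \<le> K * (mixed_mean p q \<alpha> G + mixed_mean p q \<alpha> H)"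
proof -
  obtain K where K: "1 \<le> K" "\<And>G H. G \<in> torus_polys \<Longrightarrow> H \<in> torus_polys \<Longrightarrow>
    mixed_mean p q \<alpha> (\<lambda>z. G z + H z) \<le> K * (mixed_mean p q \<alpha> G + mixed_mean p q \<alpha> H)"
    using mixed_mean_add_le[OF assms] by metis
  show ?thesis
  proof (rule that[OF K(1)])
    fix G H assume "G \<in> torus_polys" "H \<in> torus_polys"
    from K(2)[OF this(1) torus_polys_uminus[OF this(2)]]
    show "mixed_mean p q \<alpha> (\<lambda>z. G z - H z) \<le> K * (mixed_mean p q \<alpha> G + mixed_mean p q \<alpha> H)"
      by (simp add: mixed_mean_uminus)
  qed
qed

lemma hardy_mean_supported_on_le:
  assumes "a \<in> dirichlet_polys" "0 < p"
  shows "hardy_mean p (bohr_lift (\<lambda>n. if supported_on V n then a n else 0)) \<sigma> \<le> hardy_mean p (bohr_lift a) \<sigma>"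
proof -
  have "bohr_lift (\<lambda>n. if supported_on V n then a n else 0) (shift_coords \<sigma> z) =
    bohr_lift a (shift_coords \<sigma> (\<lambda>j. of_real (if j \<in> V then 1 else 0) * z j))" for z
    unfolding bohr_lift_supported_on[OF assms(1)] by (intro arg_cong[where f = "bohr_lift a"]) (auto simp: shift_coords_def)
  then show ?thesis
    unfolding hardy_mean_def
    using torus_mean_scale_le[of "\<lambda>z. bohr_lift a (shift_coords \<sigma> z)" p "\<lambda>j. if j \<in> V then 1 else 0"] assms
    by (simp add: torus_polys_shift)
qed

lemma hardy_mean_bounded:
  assumes p: "0 < p" and q: "0 < q" and \<alpha>: "-1 < \<alpha>" and G: "\<And>k. G k \<in> torus_polys"
    and M: "\<And>k. mixed_mean p q \<alpha> (G k) \<le> M" and \<tau>: "0 < \<tau>"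
  shows "\<exists>B. \<forall>k. hardy_mean p (G k) \<tau> \<le> B"
proof -
  obtain C where C: "0 < C" "\<And>G \<sigma>. G \<in> torus_polys \<Longrightarrow> 0 < \<sigma> \<Longrightarrow> \<sigma> \<le> 1 \<Longrightarrow>
      hardy_mean p G \<sigma> powr (q / p) \<le> C * \<sigma> powr (-(\<alpha> + 1)) * mixed_mean p q \<alpha> G"
    using hardy_mean_le_mixed_mean[OF p q \<alpha>] by metis
  define \<sigma> where "\<sigma> = min 1 \<tau>"
  have \<sigma>: "0 < \<sigma>" "\<sigma> \<le> 1" "\<sigma> \<le> \<tau>" using \<tau> by (auto simp: \<sigma>_def)
  show ?thesis
  proof (intro exI allI)
    fix k
    have "hardy_mean p (G k) \<tau> \<le> hardy_mean p (G k) \<sigma>" by (rule hardy_mean_antimono[OF G p \<sigma>(3)])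
    also have "\<dots> = (hardy_mean p (G k) \<sigma> powr (q / p)) powr (p / q)"
      using p q by (simp add: powr_powr)
    also have "\<dots> \<le> (C * \<sigma> powr (-(\<alpha> + 1)) * mixed_mean p q \<alpha> (G k)) powr (p / q)"
      using C(2)[OF G \<sigma>(1,2)] p q by (intro powr_mono2) auto
    also have "\<dots> \<le> (C * \<sigma> powr (-(\<alpha> + 1)) * M) powr (p / q)"
      using M C(1) p q by (intro powr_mono2 mult_left_mono) auto
    finally show "hardy_mean p (G k) \<tau> \<le> (C * \<sigma> powr (-(\<alpha> + 1)) * M) powr (p / q)" .
  qed
qed

lemma finite_supported_on:
  assumes "a \<in> dirichlet_polys"
  obtains V where "finite V" "\<And>n. a n \<noteq> 0 \<Longrightarrow> supported_on V n"
  by (rule that[of "\<Union>n\<in>{n. a n \<noteq> 0}. {j. prime_exponent j n \<noteq> 0}"])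
     (use dirichlet_polys_finite[OF assms] in \<open>auto simp: supported_on_def\<close>)

lemma nn_integral_Fatou_le:
  fixes f :: "real \<Rightarrow> real" and fk :: "nat \<Rightarrow> real \<Rightarrow> real"
  assumes meas: "\<And>k. fk k \<in> borel_measurable M"
    and lim: "AE \<sigma> in M. (\<lambda>k. fk k \<sigma>) \<longlonglongrightarrow> f \<sigma>"
    and B: "\<forall>\<^sub>F k in sequentially. (\<integral>\<^sup>+\<sigma>. ennreal (fk k \<sigma>) \<partial>M) \<le> B"
  shows "(\<integral>\<^sup>+\<sigma>. ennreal (f \<sigma>) \<partial>M) \<le> B"
proof -
  have "(\<integral>\<^sup>+\<sigma>. ennreal (f \<sigma>) \<partial>M) = (\<integral>\<^sup>+\<sigma>. liminf (\<lambda>k. ennreal (fk k \<sigma>)) \<partial>M)"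
  proof (rule nn_integral_cong_AE)
    show "AE \<sigma> in M. ennreal (f \<sigma>) = liminf (\<lambda>k. ennreal (fk k \<sigma>))"
      using lim by eventually_elim (rule lim_imp_Liminf[symmetric, OF _ tendsto_ennrealI], auto)
  qed
  also have "\<dots> \<le> liminf (\<lambda>k. \<integral>\<^sup>+\<sigma>. ennreal (fk k \<sigma>) \<partial>M)"
    by (rule nn_integral_liminf) (use meas in measurable)
  also have "\<dots> \<le> B"
  proof -
    have "liminf (\<lambda>k. \<integral>\<^sup>+\<sigma>. ennreal (fk k \<sigma>) \<partial>M) \<le> liminf (\<lambda>k::nat. B)"
      by (rule Liminf_mono[OF B])
    then show ?thesis by (simp add: Liminf_const)
  qed
  finally show ?thesis .
qed

text \<open>Injectivity of the completion into the functions on the half-plane: each fixed \<open>A k\<close> involves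
  finitely many primes, and the projections of the \<open>A l\<close> to these primes tend to 0 uniformly at every
  height \<open>\<sigma> > 0\<close>.\<close>

lemma mixed_Cauchy_null:
  assumes p: "0 < p" and q: "0 < q" and \<alpha>: "-1 < \<alpha>"
    and A: "mixed_approx p q \<alpha> A f" and f: "\<And>s. Re s > 1 / 2 \<Longrightarrow> f s = 0"
  shows "(\<lambda>k. mixed_mean p q \<alpha> (bohr_lift (A k))) \<longlonglongrightarrow> 0"
proof (rule LIMSEQ_I)
  fix r :: real assume r: "0 < r"
  have AD: "\<And>k. A k \<in> dirichlet_polys" and AC: "mixed_Cauchy p q \<alpha> A"
    using A mixed_approx_iff[OF p q] by auto
  have "uniform_limit {s. 1 \<le> Re s} (\<lambda>k s. dirichlet_eval (A k) s) f sequentially"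
    by (rule mixed_approx_uniform_limit[OF p q \<alpha> A]) simp
  then have "uniform_limit {s. 1 \<le> Re s} (\<lambda>k s. dirichlet_eval (A k) s) (\<lambda>_. 0) sequentially"
    by (rule uniform_limit_cong'[THEN iffD1, rotated -1]) (use f in auto)
  then have coeff: "(\<lambda>k. A k n) \<longlonglongrightarrow> 0" for n
    by (rule dirichlet_coeff_tendsto_0[OF AD])
  obtain M where M: "\<And>k. mixed_mean p q \<alpha> (bohr_lift (A k)) \<le> M"
    using mixed_Cauchy_bounded[OF p q \<alpha> AD AC] by metis
  have "0 < r / 2" using r by simp
  then obtain K where K: "\<And>k l. K \<le> k \<Longrightarrow> K \<le> l \<Longrightarrow>
    mixed_mean p q \<alpha> (\<lambda>z. bohr_lift (A k) z - bohr_lift (A l) z) < r / 2"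
    using AC unfolding mixed_Cauchy_def by meson
  show "\<exists>K. \<forall>k\<ge>K. norm (mixed_mean p q \<alpha> (bohr_lift (A k)) - 0) < r"
  proof (intro exI allI impI)
    fix k assume k: "K \<le> k"
    obtain V where V: "finite V" "\<And>n. A k n \<noteq> 0 \<Longrightarrow> supported_on V n"
      using finite_supported_on[OF AD] by metis
    define R where "R l = (\<lambda>n. if supported_on V n then A l n else 0)" for l
    have RD: "R l \<in> dirichlet_polys" for l unfolding R_def by (rule dirichlet_polys_restrict[OF AD])
    have Rsupp: "\<And>l n. R l n \<noteq> 0 \<Longrightarrow> supported_on V n" by (auto simp: R_def split: if_splits)
    have Rbdd: "\<exists>B. \<forall>l. hardy_mean p (bohr_lift (R l)) \<tau> \<le> B" if "0 < \<tau>" for \<tau>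
    proof -
      have "\<exists>B. \<forall>l. hardy_mean p (bohr_lift (A l)) \<tau> \<le> B"
        by (rule hardy_mean_bounded[OF p q \<alpha> _ M that]) (simp add: AD)
      then show ?thesis
        using hardy_mean_supported_on_le[OF AD p] unfolding R_def by (meson order_trans)
    qed
    have Rcoeff: "(\<lambda>l. R l n) \<longlonglongrightarrow> 0" for n using coeff[of n] by (cases "supported_on V n") (simp_all add: R_def)
    have lim: "(\<lambda>l. hardy_mean p (\<lambda>z. bohr_lift (A k) z - bohr_lift (R l) z) \<sigma>) \<longlonglongrightarrow> hardy_mean p (bohr_lift (A k)) \<sigma>"
      if \<sigma>: "0 < \<sigma>" for \<sigma>
    proof -
      obtain e where e: "e \<longlonglongrightarrow> 0" "\<And>l z. (\<And>j. norm (z j) \<le> 1) \<Longrightarrow> norm (bohr_lift (R l) (shift_coords \<sigma> z)) \<le> e l"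
      proof (rule uniform_convergence_supported[of R V p \<sigma>])
        show "R l n \<noteq> 0 \<Longrightarrow> supported_on V n" for l n by (rule Rsupp)
        show "0 < \<tau> \<Longrightarrow> \<exists>B. \<forall>l. hardy_mean p (bohr_lift (R l)) \<tau> \<le> B" for \<tau> by (rule Rbdd)
      qed (use RD V(1) p Rcoeff \<sigma> that in blast)+
      show ?thesis
        by (rule hardy_mean_tendsto[OF p _ _ e(1)]) (use e(2) AD RD in \<open>auto intro: torus_polys_diff\<close>)
    qed
    have "(\<integral>\<^sup>+\<sigma>. ennreal (hardy_mean p (bohr_lift (A k)) \<sigma> powr (q / p)) \<partial>weight_measure \<alpha>) \<le> ennreal (r / 2)"
    proof (rule nn_integral_Fatou_le)
      fix l
      have T: "(\<lambda>z. bohr_lift (A k) z - bohr_lift (R l) z) \<in> torus_polys"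
        using AD RD by (intro torus_polys_diff) auto
      show "(\<lambda>\<sigma>. hardy_mean p (\<lambda>z. bohr_lift (A k) z - bohr_lift (R l) z) \<sigma> powr (q / p)) \<in> borel_measurable (weight_measure \<alpha>)"
        using borel_measurable_integrable[OF integrable_hardy_mean[OF T p _ \<alpha>]] p q by simp
    next
      show "AE \<sigma> in weight_measure \<alpha>. (\<lambda>l. hardy_mean p (\<lambda>z. bohr_lift (A k) z - bohr_lift (R l) z) \<sigma> powr (q / p))
         \<longlonglongrightarrow> hardy_mean p (bohr_lift (A k)) \<sigma> powr (q / p)"
        using AE_weight_measure
        by eventually_elim (use lim p q in \<open>auto intro!: tendsto_powr' tendsto_const\<close>)
    next
      show "\<forall>\<^sub>F l in sequentially. (\<integral>\<^sup>+\<sigma>. ennreal (hardy_mean p (\<lambda>z. bohr_lift (A k) z - bohr_lift (R l) z) \<sigma> powr (q / p)) \<partial>weight_measure \<alpha>) \<le> ennreal (r / 2)"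
      proof (rule eventually_sequentiallyI)
        fix l assume l: "K \<le> l"
        have D: "(\<lambda>n. A k n - A l n) \<in> dirichlet_polys" by (intro dirichlet_polys_diff AD)
        \<comment> \<open>Projecting to V leaves \<open>A k\<close> unchanged, so contractivity
          bounds its distance to \<open>R l\<close> by its distance to \<open>A l\<close>.\<close>
        have e: "(\<lambda>n. if supported_on V n then A k n - A l n else 0) = (\<lambda>n. A k n - R l n)"
        proof
          show "(if supported_on V n then A k n - A l n else 0) = A k n - R l n" for n
            using V(2)[of n] by (auto simp: R_def)
        qed
        have "(\<integral>\<^sup>+\<sigma>. ennreal (hardy_mean p (\<lambda>z. bohr_lift (A k) z - bohr_lift (R l) z) \<sigma> powr (q / p)) \<partial>weight_measure \<alpha>) \<le>
          (\<integral>\<^sup>+\<sigma>. ennreal (hardy_mean p (\<lambda>z. bohr_lift (A k) z - bohr_lift (A l) z) \<sigma> powr (q / p)) \<partial>weight_measure \<alpha>)"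
          using hardy_mean_supported_on_le[OF D p, of V] p q AD RD
          by (intro nn_integral_mono ennreal_leI powr_mono2) (auto simp: e bohr_lift_diff_fun)
        also have "\<dots> = ennreal (mixed_mean p q \<alpha> (\<lambda>z. bohr_lift (A k) z - bohr_lift (A l) z))"
          using AD by (intro nn_integral_hardy_mean p q \<alpha> torus_polys_diff) auto
        also have "\<dots> \<le> ennreal (r / 2)" using K[OF k l] by (intro ennreal_leI) simp
        finally show "(\<integral>\<^sup>+\<sigma>. ennreal (hardy_mean p (\<lambda>z. bohr_lift (A k) z - bohr_lift (R l) z) \<sigma> powr (q / p)) \<partial>weight_measure \<alpha>) \<le> ennreal (r / 2)" .
      qed
    qed
    then have "ennreal (mixed_mean p q \<alpha> (bohr_lift (A k))) \<le> ennreal (r / 2)"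
      using nn_integral_hardy_mean[of "bohr_lift (A k)", OF _ p q \<alpha>] AD by simp
    then show "norm (mixed_mean p q \<alpha> (bohr_lift (A k)) - 0) < r" using r by (simp add: ennreal_le_iff)
  qed
qed

lemma mixed_approx_diff:
  assumes p: "0 < p" and q: "0 < q" and \<alpha>: "-1 < \<alpha>"
    and A: "mixed_approx p q \<alpha> A f" and B: "mixed_approx p q \<alpha> B g"
  shows "mixed_approx p q \<alpha> (\<lambda>k n. A k n - B k n) (\<lambda>s. f s - g s)"
proof -
  have AD: "\<And>k. A k \<in> dirichlet_polys" and AC: "mixed_Cauchy p q \<alpha> A"
    and Al: "\<And>s. Re s > 1 / 2 \<Longrightarrow> (\<lambda>k. dirichlet_eval (A k) s) \<longlonglongrightarrow> f s"
    using A mixed_approx_iff[OF p q] by auto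
  have BD: "\<And>k. B k \<in> dirichlet_polys" and BC: "mixed_Cauchy p q \<alpha> B"
    and Bl: "\<And>s. Re s > 1 / 2 \<Longrightarrow> (\<lambda>k. dirichlet_eval (B k) s) \<longlonglongrightarrow> g s"
    using B mixed_approx_iff[OF p q] by auto
  obtain K where K: "1 \<le> K" "\<And>G H. G \<in> torus_polys \<Longrightarrow> H \<in> torus_polys \<Longrightarrow>
    mixed_mean p q \<alpha> (\<lambda>z. G z - H z) \<le> K * (mixed_mean p q \<alpha> G + mixed_mean p q \<alpha> H)"
    using mixed_mean_diff_le[OF p q \<alpha>] by metis
  have "mixed_Cauchy p q \<alpha> (\<lambda>k n. A k n - B k n)"
    unfolding mixed_Cauchy_def
  proof (intro allI impI)
    fix \<epsilon> :: real assume "0 < \<epsilon>"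
    then have e: "0 < \<epsilon> / (2 * K)" using K(1) by simp
    obtain N1 where N1: "\<And>k l. N1 \<le> k \<Longrightarrow> N1 \<le> l \<Longrightarrow> mixed_mean p q \<alpha> (\<lambda>z. bohr_lift (A k) z - bohr_lift (A l) z) < \<epsilon> / (2 * K)"
      using AC e unfolding mixed_Cauchy_def by meson
    obtain N2 where N2: "\<And>k l. N2 \<le> k \<Longrightarrow> N2 \<le> l \<Longrightarrow> mixed_mean p q \<alpha> (\<lambda>z. bohr_lift (B k) z - bohr_lift (B l) z) < \<epsilon> / (2 * K)"
      using BC e unfolding mixed_Cauchy_def by meson
    show "\<exists>N. \<forall>k\<ge>N. \<forall>l\<ge>N. mixed_mean p q \<alpha> (\<lambda>z. bohr_lift (\<lambda>n. A k n - B k n) z - bohr_lift (\<lambda>n. A l n - B l n) z) < \<epsilon>"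
    proof (intro exI[of _ "max N1 N2"] allI impI)
      fix k l assume kl: "max N1 N2 \<le> k" "max N1 N2 \<le> l"
      let ?DA = "\<lambda>z. bohr_lift (A k) z - bohr_lift (A l) z" and ?DB = "\<lambda>z. bohr_lift (B k) z - bohr_lift (B l) z"
      have "(\<lambda>z. bohr_lift (\<lambda>n. A k n - B k n) z - bohr_lift (\<lambda>n. A l n - B l n) z) = (\<lambda>z. ?DA z - ?DB z)"
        using AD BD by (auto simp: bohr_lift_diff)
      then have "mixed_mean p q \<alpha> (\<lambda>z. bohr_lift (\<lambda>n. A k n - B k n) z - bohr_lift (\<lambda>n. A l n - B l n) z) = mixed_mean p q \<alpha> (\<lambda>z. ?DA z - ?DB z)"
        by (rule arg_cong)
      also have "\<dots> \<le> K * (mixed_mean p q \<alpha> ?DA + mixed_mean p q \<alpha> ?DB)"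
        using AD BD by (intro K torus_polys_diff) auto
      also have "\<dots> < K * (\<epsilon> / (2 * K) + \<epsilon> / (2 * K))"
        using N1[of k l] N2[of k l] kl K(1) by (intro mult_strict_left_mono add_strict_mono) auto
      also have "\<dots> = \<epsilon>" using K(1) by simp
      finally show "mixed_mean p q \<alpha> (\<lambda>z. bohr_lift (\<lambda>n. A k n - B k n) z - bohr_lift (\<lambda>n. A l n - B l n) z) < \<epsilon>" .
    qed
  qed
  then show ?thesis
    unfolding mixed_approx_iff[OF p q] using AD BD Al Bl
    by (auto simp: dirichlet_polys_diff dirichlet_eval_diff intro!: tendsto_diff)
qed

lemma mixed_mean_tendsto_unique:
  assumes p: "0 < p" and q: "0 < q" and \<alpha>: "-1 < \<alpha>"
    and A: "mixed_approx p q \<alpha> A f" and B: "mixed_approx p q \<alpha> B f"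
    and L: "(\<lambda>k. mixed_mean p q \<alpha> (bohr_lift (A k))) \<longlonglongrightarrow> L"
  shows "(\<lambda>k. mixed_mean p q \<alpha> (bohr_lift (B k))) \<longlonglongrightarrow> L"
proof -
  have AD: "\<And>k. A k \<in> dirichlet_polys" and AC: "mixed_Cauchy p q \<alpha> A" and BD: "\<And>k. B k \<in> dirichlet_polys"
    using A B mixed_approx_iff[OF p q] by auto
  obtain M where M: "\<And>k. mixed_mean p q \<alpha> (bohr_lift (A k)) \<le> M"
    using mixed_Cauchy_bounded[OF p q \<alpha> AD AC] by metis
  have "(\<lambda>k. mixed_mean p q \<alpha> (bohr_lift (\<lambda>n. B k n - A k n))) \<longlonglongrightarrow> 0"
    by (rule mixed_Cauchy_null[OF p q \<alpha> mixed_approx_diff[OF p q \<alpha> B A]]) simp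
  then have "(\<lambda>k. mixed_mean p q \<alpha> (\<lambda>z. bohr_lift (B k) z - bohr_lift (A k) z)) \<longlonglongrightarrow> 0"
    using AD BD by (simp add: bohr_lift_diff_fun)
  then have "(\<lambda>k. mixed_mean p q \<alpha> (bohr_lift (B k)) - mixed_mean p q \<alpha> (bohr_lift (A k))) \<longlonglongrightarrow> 0"
    using AD BD M by (intro mixed_mean_tendsto_diff[OF p q \<alpha>]) auto
  from tendsto_add[OF this L] show ?thesis by simp
qed

text \<open>Justifies the definite description in \<open>mixed_space_norm\<close>: the limit exists
  by the Cauchy property, and two approximating sequences of one function differ by a sequence
  approximating 0, whose mixed means vanish in the limit.\<close>

lemma mixed_mean_tendsto_norm:
  assumes p: "0 < p" and q: "0 < q" and \<alpha>: "-1 < \<alpha>" and A: "mixed_approx p q \<alpha> A f"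
  shows "(\<lambda>k. mixed_mean p q \<alpha> (bohr_lift (A k))) \<longlonglongrightarrow> mixed_space_norm p q \<alpha> f powr q"
    and "0 \<le> mixed_space_norm p q \<alpha> f"
proof -
  have AD: "\<And>k. A k \<in> dirichlet_polys" and AC: "mixed_Cauchy p q \<alpha> A"
    using A mixed_approx_iff[OF p q] by auto
  obtain L where L: "(\<lambda>k. mixed_mean p q \<alpha> (bohr_lift (A k))) \<longlonglongrightarrow> L"
    using mixed_Cauchy_convergent[OF p q \<alpha> AD AC] by (auto simp: convergent_def)
  have L0: "0 \<le> L" by (rule LIMSEQ_le_const[OF L]) auto
  have lim: "(\<lambda>k. mixed_norm p q \<alpha> (B k)) \<longlonglongrightarrow> L powr (1 / q)" if B: "mixed_approx p q \<alpha> B f" for B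
  proof -
    have BD: "\<And>k. B k \<in> dirichlet_polys" using B mixed_approx_iff[OF p q] by auto
    have "(\<lambda>k. mixed_mean p q \<alpha> (bohr_lift (B k)) powr (1 / q)) \<longlonglongrightarrow> L powr (1 / q)"
      using q by (intro tendsto_powr' mixed_mean_tendsto_unique[OF p q \<alpha> A B L] tendsto_const) auto
    then show ?thesis using p q BD by (simp add: mixed_norm_eq)
  qed
  have n: "mixed_space_norm p q \<alpha> f = L powr (1 / q)"
    unfolding mixed_space_norm_def
  proof (rule the_equality)
    show "r = L powr (1 / q)" if "\<forall>A. mixed_approx p q \<alpha> A f \<longrightarrow> (\<lambda>k. mixed_norm p q \<alpha> (A k)) \<longlonglongrightarrow> r" for r
      using that A lim[OF A] LIMSEQ_unique by blast
  qed (use lim in auto)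
  show "(\<lambda>k. mixed_mean p q \<alpha> (bohr_lift (A k))) \<longlonglongrightarrow> mixed_space_norm p q \<alpha> f powr q"
    using L L0 q by (simp add: n powr_powr)
  show "0 \<le> mixed_space_norm p q \<alpha> f" by (simp add: n)
qed

section \<open>Superposition by polynomials\<close>

text \<open>If |h| <= \<delta> (1 + |x|), the factored difference of powers contains |h| and hence
  \<delta>; otherwise 1 + |x| is below |h|/\<delta> and |h|^N absorbs everything. No mixed products
  of |x| and |h| remain, so x and h can be integrated separately.\<close>

lemma norm_power_diff_eps:
  fixes x h :: complex
  assumes "m \<le> N" "0 < \<delta>" "\<delta> \<le> 1"
  shows "norm ((x + h) ^ m - x ^ m) \<le> \<delta> * (real N * 2 ^ N * 2 ^ N) * (1 + norm x ^ N) + 2 * (1 / \<delta> + 1) ^ N * norm h ^ N"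
proof -
  define b d where "b = norm x" and "d = norm h"
  have bd: "0 \<le> b" "0 \<le> d" by (auto simp: b_def d_def)
  have n1: "norm x \<le> b + d" "norm (x + h) \<le> b + d"
    using norm_triangle_ineq[of x h] by (auto simp: b_def d_def)
  have pos1: "0 \<le> \<delta> * (real N * 2 ^ N * 2 ^ N) * (1 + b ^ N)" using assms bd by auto
  have pos2: "0 \<le> 2 * (1 / \<delta> + 1) ^ N * d ^ N" using assms bd by auto
  show ?thesis
  proof (cases "m = 0")
    case True
    then show ?thesis using pos1 pos2 by (simp add: b_def d_def)
  next
    case m: False
    show ?thesis
    proof (cases "d \<le> \<delta> * (1 + b)")
      case True
      have bN: "(1 + b) ^ N \<le> 2 ^ N * (1 + b ^ N)"
      proof -
        have "(1 + b) ^ N \<le> (2 * max 1 b) ^ N" using bd by (intro power_mono) auto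
        also have "\<dots> = 2 ^ N * max 1 b ^ N" by (simp add: power_mult_distrib)
        also have "\<dots> \<le> 2 ^ N * (1 + b ^ N)" using bd by (intro mult_left_mono) (auto simp: max_def)
        finally show ?thesis .
      qed
      have "\<delta> * (1 + b) \<le> 1 * (1 + b)" using assms(3) bd by (intro mult_right_mono) auto
      from order_trans[OF True this] have d1: "b + d \<le> 2 * (1 + b)" using bd by simp
      have "(x + h) ^ m - x ^ m = h * (\<Sum>i<m. x ^ (m - Suc i) * (x + h) ^ i)"
        using power_diff_sumr2[of "x + h" m x] by simp
      then have "norm ((x + h) ^ m - x ^ m) = d * norm (\<Sum>i<m. x ^ (m - Suc i) * (x + h) ^ i)"
        by (simp only: norm_mult d_def)
      also have "\<dots> \<le> d * (\<Sum>i<m. (b + d) ^ (m - 1))"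
      proof (intro mult_left_mono bd sum_norm_le)
        fix i assume i: "i \<in> {..<m}"
        have "norm (x ^ (m - Suc i) * (x + h) ^ i) \<le> (b + d) ^ (m - Suc i) * (b + d) ^ i"
          unfolding norm_mult norm_power using n1 bd by (intro mult_mono power_mono) auto
        also have "\<dots> = (b + d) ^ (m - 1)" using i by (simp flip: power_add)
        finally show "norm (x ^ (m - Suc i) * (x + h) ^ i) \<le> (b + d) ^ (m - 1)" .
      qed
      also have "\<dots> = real m * (d * (b + d) ^ (m - 1))" by simp
      also have "\<dots> \<le> real N * ((\<delta> * (1 + b)) * (2 * (1 + b)) ^ (m - 1))"
        using assms True d1 bd by (intro mult_mono power_mono) auto
      also have "\<dots> = \<delta> * (real N * 2 ^ (m - 1) * (1 + b) ^ m)"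
      proof -
        have "(1 + b) ^ m = (1 + b) * (1 + b) ^ (m - 1)" using m by (cases m) auto
        then show ?thesis by (simp only: power_mult_distrib mult_ac)
      qed
      also have "\<dots> \<le> \<delta> * (real N * 2 ^ N * (1 + b) ^ N)"
        using assms bd by (intro mult_left_mono mult_mono power_increasing) auto
      also have "\<dots> \<le> \<delta> * (real N * 2 ^ N * (2 ^ N * (1 + b ^ N)))"
        using assms by (intro mult_left_mono bN) auto
      finally have "norm ((x + h) ^ m - x ^ m) \<le> \<delta> * (real N * 2 ^ N * 2 ^ N) * (1 + b ^ N)"
        by (simp only: mult_ac)
      with pos2 show ?thesis unfolding b_def d_def by linarith
    next
      case False
      then have "1 + b \<le> (1 / \<delta>) * d" using assms by (simp add: field_simps)
      then have *: "1 + b + d \<le> (1 / \<delta> + 1) * d" by (simp add: algebra_simps)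
      have "norm ((x + h) ^ m - x ^ m) \<le> norm (x + h) ^ m + norm x ^ m"
        using norm_triangle_ineq4[of "(x + h) ^ m" "x ^ m"] by (simp add: norm_power)
      also have "\<dots> \<le> (1 + b + d) ^ m + (1 + b + d) ^ m"
        using n1 bd by (intro add_mono power_mono) auto
      also have "\<dots> \<le> (1 + b + d) ^ N + (1 + b + d) ^ N"
        using assms bd by (intro add_mono power_increasing) auto
      also have "\<dots> \<le> 2 * ((1 / \<delta> + 1) * d) ^ N"
        using power_mono[OF *, of N] bd by simp
      also have "\<dots> = 2 * (1 / \<delta> + 1) ^ N * d ^ N" by (simp add: power_mult_distrib)
      finally show ?thesis using pos1 by (simp add: b_def d_def)
    qed
  qed
qed

lemma poly_diff_eps:
  fixes P :: "complex poly"
  assumes "0 < \<epsilon>"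
  obtains C where "0 < C" "\<And>x h. norm (poly P (x + h) - poly P x) \<le> \<epsilon> * (1 + norm x ^ degree P) + C * norm h ^ degree P"
proof -
  let ?N = "degree P"
  define S where "S = 1 + (\<Sum>m\<le>?N. norm (coeff P m))"
  have S: "1 \<le> S" by (simp add: S_def sum_nonneg)
  define L where "L = 1 + real ?N * 2 ^ ?N * 2 ^ ?N"
  have L: "1 \<le> L" by (simp add: L_def)
  \<comment> \<open>\<open>S\<close> dominates the sum of the moduli of the coefficients and
    \<open>L\<close> the constant of \<open>norm_power_diff_eps\<close>, so that S \<delta> L <=
    \<epsilon>.\<close>
  define \<delta> where "\<delta> = min 1 (\<epsilon> / (S * L))"
  have \<delta>: "0 < \<delta>" "\<delta> \<le> 1" using assms S L by (auto simp: \<delta>_def)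
  have \<delta>2: "S * (\<delta> * L) \<le> \<epsilon>"
  proof -
    have "\<delta> \<le> \<epsilon> / (S * L)" by (simp add: \<delta>_def)
    then show ?thesis using S L by (simp add: field_simps)
  qed
  define C where "C = 2 * (1 / \<delta> + 1) ^ ?N"
  have C0: "0 < C" unfolding C_def using \<delta> by (intro mult_pos_pos zero_less_power add_pos_pos) auto
  show ?thesis
  proof (rule that[of "S * C"])
    show "0 < S * C" using S C0 by simp
    fix x h :: complex
    let ?R = "\<delta> * L * (1 + norm x ^ ?N) + C * norm h ^ ?N"
    have R0: "0 \<le> ?R" using \<delta> L C0 by auto
    have "norm (poly P (x + h) - poly P x) = norm (\<Sum>m\<le>?N. coeff P m * ((x + h) ^ m - x ^ m))"
      by (simp add: poly_altdef right_diff_distrib sum_subtractf)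
    also have "\<dots> \<le> (\<Sum>m\<le>?N. norm (coeff P m) * ?R)"
    proof (rule sum_norm_le)
      fix m assume m: "m \<in> {..?N}"
      have "norm ((x + h) ^ m - x ^ m) \<le> \<delta> * (real ?N * 2 ^ ?N * 2 ^ ?N) * (1 + norm x ^ ?N) + C * norm h ^ ?N"
        using norm_power_diff_eps[of m ?N \<delta> x h] m \<delta> by (simp add: C_def)
      also have "\<dots> \<le> ?R" using \<delta> by (intro add_right_mono mult_right_mono mult_left_mono) (auto simp: L_def)
      finally show "norm (coeff P m * ((x + h) ^ m - x ^ m)) \<le> norm (coeff P m) * ?R"
        by (simp add: norm_mult mult_left_mono)
    qed
    also have "\<dots> = (\<Sum>m\<le>?N. norm (coeff P m)) * ?R" by (rule sum_distrib_right[symmetric])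
    also have "\<dots> \<le> S * ?R" using R0 by (intro mult_right_mono) (auto simp: S_def)
    also have "\<dots> = S * (\<delta> * L) * (1 + norm x ^ ?N) + S * C * norm h ^ ?N" by (simp add: algebra_simps)
    also have "\<dots> \<le> \<epsilon> * (1 + norm x ^ ?N) + S * C * norm h ^ ?N"
      using \<delta>2 by (intro add_right_mono mult_right_mono) auto
    finally show "norm (poly P (x + h) - poly P x) \<le> \<epsilon> * (1 + norm x ^ ?N) + S * C * norm h ^ ?N" .
  qed
qed

section \<open>Embedding of mixed means and the estimate for polynomial symbols\<close>

lemma powr_add3_le:
  fixes a b c :: real
  assumes "0 \<le> a" "0 \<le> b" "0 \<le> c" "0 < \<kappa>"
  shows "(a + b + c) powr \<kappa> \<le> 3 powr \<kappa> * (a powr \<kappa> + b powr \<kappa> + c powr \<kappa>)"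
proof -
  have "(a + b + c) powr \<kappa> \<le> (3 * max a (max b c)) powr \<kappa>"
    using assms by (intro powr_mono2) auto
  also have "\<dots> = 3 powr \<kappa> * max a (max b c) powr \<kappa>" using assms by (simp add: powr_mult)
  also have "\<dots> \<le> 3 powr \<kappa> * (a powr \<kappa> + b powr \<kappa> + c powr \<kappa>)"
    by (intro mult_left_mono) (auto simp: max_def)
  finally show ?thesis .
qed

text \<open>Concavity of t^\<theta> for \<theta> = s/p <= 1, in the form of its tangent at 1,
  applied to |G|^p divided by its mean. The condition N u <= p enters the sufficiency through this
  inequality.\<close>

lemma torus_mean_Jensen:
  assumes G: "G \<in> torus_polys" and s: "0 < s" "s \<le> p"
  shows "torus_mean s G \<le> torus_mean p G powr (s / p)"
proof -
  have p: "0 < p" using s by simp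
  define \<mu> where "\<mu> = torus_mean p G"
  define \<theta> where "\<theta> = s / p"
  have \<theta>: "0 < \<theta>" "\<theta> \<le> 1" using s p by (auto simp: \<theta>_def)
  note ip = integrable_torus_poly[OF G p] and is' = integrable_torus_poly[OF G s(1)]
  show ?thesis
  proof (cases "\<mu> = 0")
    case True
    then have "AE z in torus_measure. norm (G z) powr p = 0"
      using integral_nonneg_eq_0_iff_AE[OF ip] by (simp add: \<mu>_def torus_mean_def)
    then have "AE z in torus_measure. norm (G z) powr s = 0" by eventually_elim simp
    then have "torus_mean s G = 0"
      unfolding torus_mean_def by (rule integral_eq_zero_AE)
    then show ?thesis by simp
  next
    case False
    then have \<mu>: "0 < \<mu>" using torus_mean_nonneg[of p G] by (simp add: \<mu>_def del: torus_mean_nonneg)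
    have tangent: "t powr \<theta> \<le> \<theta> * t + (1 - \<theta>)" if "0 \<le> t" for t :: real
    proof (cases "t = 0")
      case False
      then show ?thesis using Youngs_inequality_0[of \<theta> "1 - \<theta>" t 1] \<theta> that by simp
    qed (use \<theta> in simp)
    have "torus_mean s G \<le> (\<integral>z. \<mu> powr \<theta> * (\<theta> * (norm (G z) powr p / \<mu>) + (1 - \<theta>)) \<partial>torus_measure)"
      unfolding torus_mean_def
    proof (rule integral_mono[OF is'])
      fix z
      have "norm (G z) powr s = \<mu> powr \<theta> * (norm (G z) powr p / \<mu>) powr \<theta>"
        using \<mu> p by (simp add: powr_divide powr_powr \<theta>_def)
      also have "\<dots> \<le> \<mu> powr \<theta> * (\<theta> * (norm (G z) powr p / \<mu>) + (1 - \<theta>))"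
        using \<mu> by (intro mult_left_mono tangent) auto
      finally show "norm (G z) powr s \<le> \<mu> powr \<theta> * (\<theta> * (norm (G z) powr p / \<mu>) + (1 - \<theta>))" .
    qed (use ip in auto)
    also have "\<dots> = \<mu> powr \<theta> * (\<theta> * (\<mu> / \<mu>) + (1 - \<theta>))"
      using ip torus.prob_space by (simp add: \<mu>_def torus_mean_def)
    also have "\<dots> = \<mu> powr \<theta>" using \<mu> by simp
    finally show ?thesis by (simp add: \<mu>_def \<theta>_def)
  qed
qed

text \<open>In the strict case the pointwise bound \<sigma>^(-s(\<alpha>+1)/q) is integrable against
  the weight \<beta>. At the endpoint it just fails to be; there only the power r = s/q - 1 of the
  q-th power of the norm is bounded pointwise, and the resulting power of \<sigma> turns the weight
  \<beta> into the weight \<alpha>. This needs r >= 0; for \<alpha> > \<beta> the endpoint has s <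
  q.\<close>

lemma mixed_mean_embedding:
  assumes p: "0 < p" and q: "0 < q" and s: "0 < s" and \<alpha>: "-1 < \<alpha>" and \<beta>: "-1 < \<beta>"
    and cond: "s * (\<alpha> + 1) < q * (\<beta> + 1) \<or> \<alpha> \<le> \<beta> \<and> s * (\<alpha> + 1) = q * (\<beta> + 1)"
  obtains C where "0 < C" "\<And>G. G \<in> torus_polys \<Longrightarrow> mixed_mean p s \<beta> G \<le> C * mixed_mean p q \<alpha> G powr (s / q)"
proof -
  obtain C1 where C1: "0 < C1" "\<And>G \<sigma>. G \<in> torus_polys \<Longrightarrow> 0 < \<sigma> \<Longrightarrow> \<sigma> \<le> 1 \<Longrightarrow>
      hardy_mean p G \<sigma> powr (q / p) \<le> C1 * \<sigma> powr (-(\<alpha> + 1)) * mixed_mean p q \<alpha> G"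
    using hardy_mean_le_mixed_mean[OF p q \<alpha>] by metis
  define D where "D = C1 powr (s / q)"
  have D: "0 < D" using C1(1) by (simp add: D_def)
  interpret W: prob_space "weight_measure \<beta>" by (rule prob_space_weight_measure[OF \<beta>])
  have gs: "hardy_mean p G \<sigma> powr (s / p) = (hardy_mean p G \<sigma> powr (q / p)) powr (s / q)" for G \<sigma>
    using q by (simp add: powr_powr)
  have small: "hardy_mean p G \<sigma> powr (s / p) \<le> D * \<sigma> powr (-(s * (\<alpha> + 1) / q)) * mixed_mean p q \<alpha> G powr (s / q)"
    if "G \<in> torus_polys" "0 < \<sigma>" "\<sigma> \<le> 1" for G \<sigma>
  proof -
    have "hardy_mean p G \<sigma> powr (s / p) \<le> (C1 * \<sigma> powr (-(\<alpha> + 1)) * mixed_mean p q \<alpha> G) powr (s / q)"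
      unfolding gs using s q by (intro powr_mono2 C1 that) auto
    also have "\<dots> = D * (\<sigma> powr (-(\<alpha> + 1))) powr (s / q) * mixed_mean p q \<alpha> G powr (s / q)"
      using C1(1) by (simp add: powr_mult D_def)
    also have "(\<sigma> powr (-(\<alpha> + 1))) powr (s / q) = \<sigma> powr (-(s * (\<alpha> + 1) / q))"
      unfolding powr_powr by (rule arg_cong[where f = "\<lambda>x. \<sigma> powr x"])
      (simp only: mult_minus_left times_divide_eq_right mult.commute[of s])
    finally show ?thesis .
  qed
  have large: "hardy_mean p G \<sigma> powr (s / p) \<le> D * mixed_mean p q \<alpha> G powr (s / q)"
    if "G \<in> torus_polys" "1 \<le> \<sigma>" for G \<sigma>
  proof -
    have "hardy_mean p G \<sigma> powr (s / p) \<le> hardy_mean p G 1 powr (s / p)"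
      using s p by (intro powr_mono2 hardy_mean_antimono that) auto
    also have "\<dots> \<le> D * 1 powr (-(s * (\<alpha> + 1) / q)) * mixed_mean p q \<alpha> G powr (s / q)"
      by (rule small) (use that in auto)
    finally show ?thesis by simp
  qed
  show ?thesis
  proof (cases "s * (\<alpha> + 1) < q * (\<beta> + 1)")
    case True
    define x where "x = s * (\<alpha> + 1) / q"
    have x: "-1 < \<beta> + - x" using True q by (simp add: x_def field_simps)
    define E where "E = weight_const \<beta> * Gamma (\<beta> + - x + 1) * (2 + 0) powr (-(\<beta> + - x + 1))"
    have E0: "0 \<le> E" unfolding E_def using weight_const_pos[OF \<beta>] Gamma_real_pos[of "\<beta> + - x + 1"] x
      by (intro mult_nonneg_nonneg) auto
    have E: "(\<integral>\<^sup>+\<sigma>. ennreal (\<sigma> powr (-x) * exp (- 0 * \<sigma>)) \<partial>weight_measure \<beta>) = ennreal E"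
      unfolding E_def by (rule nn_integral_weight_powr_exp) (use \<beta> x in auto)
    show ?thesis
    proof (rule that[of "D * (E + 1)"])
      show "0 < D * (E + 1)" using D E0 by simp
      fix G assume G: "G \<in> torus_polys"
      let ?m = "mixed_mean p q \<alpha> G powr (s / q)"
      have "ennreal (mixed_mean p s \<beta> G) = (\<integral>\<^sup>+\<sigma>. ennreal (hardy_mean p G \<sigma> powr (s / p)) \<partial>weight_measure \<beta>)"
        by (rule nn_integral_hardy_mean[OF G p s \<beta>, symmetric])
      also have "\<dots> \<le> (\<integral>\<^sup>+\<sigma>. ennreal (D * ?m) * (ennreal (\<sigma> powr (-x) * exp (- 0 * \<sigma>)) + 1) \<partial>weight_measure \<beta>)"
      proof (rule nn_integral_mono_AE)
        show "AE \<sigma> in weight_measure \<beta>. ennreal (hardy_mean p G \<sigma> powr (s / p)) \<le> ennreal (D * ?m) * (ennreal (\<sigma> powr (-x) * exp (- 0 * \<sigma>)) + 1)"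
          using AE_weight_measure
        proof eventually_elim
          case (elim \<sigma>)
          have "hardy_mean p G \<sigma> powr (s / p) \<le> (D * ?m) * (\<sigma> powr (-x) + 1)"
          proof (cases "\<sigma> \<le> 1")
            case True
            have "(D * ?m) * \<sigma> powr (-x) \<le> (D * ?m) * (\<sigma> powr (-x) + 1)"
              using D by (intro mult_left_mono) auto
            then show ?thesis using small[OF G elim True] by (simp add: x_def mult_ac)
          next
            case False
            have "(D * ?m) * 1 \<le> (D * ?m) * (\<sigma> powr (-x) + 1)"
              using D by (intro mult_left_mono) auto
            then show ?thesis using large[OF G, of \<sigma>] False by simp
          qed
          then have "ennreal (hardy_mean p G \<sigma> powr (s / p)) \<le> ennreal ((D * ?m) * (\<sigma> powr (-x) + 1))" by (rule ennreal_leI)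
          also have "\<dots> = ennreal (D * ?m) * (ennreal (\<sigma> powr (-x) * exp (- 0 * \<sigma>)) + 1)"
            using D by (simp add: ennreal_mult)
          finally show ?case .
        qed
      qed
      also have "\<dots> = ennreal (D * ?m) * (ennreal E + 1)"
        using W.emeasure_space_1 by (subst nn_integral_cmult) (auto simp: nn_integral_add E[simplified])
      also have "\<dots> = ennreal (D * (E + 1) * ?m)"
        using D E0 by (simp add: ennreal_mult[symmetric] ennreal_plus[symmetric] mult_ac del: ennreal_plus flip: ennreal_1)
      finally show "mixed_mean p s \<beta> G \<le> D * (E + 1) * ?m"
        using D E0 by (subst (asm) ennreal_le_iff) auto
    qed
  next
    case False
    with cond have eq: "\<alpha> \<le> \<beta>" "s * (\<alpha> + 1) = q * (\<beta> + 1)" by auto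
    have sq: "q \<le> s"
    proof (rule ccontr)
      assume "\<not> q \<le> s"
      then have "s * (\<alpha> + 1) < q * (\<beta> + 1)" using eq(1) \<alpha> s q by (intro mult_less_le_imp_less) auto
      with eq(2) show False by simp
    qed
    define r where "r = (s - q) / q"
    have r: "0 \<le> r" using sq q by (simp add: r_def)
    define E where "E = weight_const \<beta> / weight_const \<alpha> * C1 powr r"
    have E: "0 < E" unfolding E_def using weight_const_pos[OF \<alpha>] weight_const_pos[OF \<beta>] C1(1) by simp
    show ?thesis
    proof (rule that[of "E + D"])
      show "0 < E + D" using D E by simp
      fix G assume G: "G \<in> torus_polys"
      define m where "m = mixed_mean p q \<alpha> G"
      have m0: "0 \<le> m" by (simp add: m_def)
      define g where "g \<sigma> = hardy_mean p G \<sigma>" for \<sigma>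
      define w where "w \<gamma> \<sigma> = indicator {0<..} \<sigma> * (weight_const \<gamma> * \<sigma> powr \<gamma> * exp (- 2 * \<sigma>))" for \<gamma> \<sigma> :: real
      have w0: "0 \<le> w \<alpha> \<sigma>" "0 \<le> w \<beta> \<sigma>" for \<sigma>
        using weight_const_pos[OF \<alpha>] weight_const_pos[OF \<beta>] by (auto simp: w_def)
      have gm: "(\<lambda>\<sigma>. ennreal (g \<sigma> powr t)) \<in> borel_measurable borel" for t
        unfolding g_def using hardy_mean_powr_measurable[OF G p] by measurable
      have wm: "(\<lambda>\<sigma>. ennreal (w \<gamma> \<sigma>)) \<in> borel_measurable borel" for \<gamma>
        unfolding w_def by measurable
      \<comment> \<open>The \<open>E\<close>-term accounts for heights up to 1 and the
        \<open>D\<close>-term for heights above 1, where monotonicity alone suffices.\<close>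
      have pw: "w \<beta> \<sigma> * g \<sigma> powr (s / p) \<le> E * m powr r * (w \<alpha> \<sigma> * g \<sigma> powr (q / p)) + D * m powr (s / q) * w \<beta> \<sigma>" for \<sigma>
      proof -
        consider "\<sigma> \<le> 0" | "0 < \<sigma>" "\<sigma> \<le> 1" | "1 < \<sigma>" by linarith
        then show ?thesis
        proof cases
          case 1
          then show ?thesis by (simp add: w_def)
        next
          case 2
          have "g \<sigma> powr (s / p) = g \<sigma> powr (q / p) * (g \<sigma> powr (q / p)) powr r"
          proof -
            have "q / p + q / p * r = s / p" using p q by (simp add: r_def field_simps)
            then show ?thesis unfolding powr_powr powr_add[symmetric] by simp
          qed
          also have "\<dots> \<le> g \<sigma> powr (q / p) * (C1 * \<sigma> powr (-(\<alpha> + 1)) * m) powr r"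
            using C1(2)[OF G 2] r by (intro mult_left_mono powr_mono2) (auto simp: g_def m_def)
          also have "\<dots> = g \<sigma> powr (q / p) * (C1 powr r * (\<sigma> powr (-(\<alpha> + 1))) powr r * m powr r)"
            using C1(1) m0 by (simp add: powr_mult)
          finally have 3: "g \<sigma> powr (s / p) \<le> g \<sigma> powr (q / p) * (C1 powr r * (\<sigma> powr (-(\<alpha> + 1))) powr r * m powr r)" .
          \<comment> \<open>The change of weight: at the endpoint (\<alpha> + 1) r is exactly
            \<beta> - \<alpha>.\<close>
          have 4: "\<sigma> powr \<beta> * (\<sigma> powr (-(\<alpha> + 1))) powr r = \<sigma> powr \<alpha>"
          proof -
            have "(\<alpha> + 1) * r = \<beta> - \<alpha>" using eq(2) q by (simp add: r_def field_simps)
            then have "\<beta> + -(\<alpha> + 1) * r = \<alpha>" unfolding mult_minus_left by simp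
            then show ?thesis unfolding powr_powr powr_add[symmetric] by simp
          qed
          have "w \<beta> \<sigma> * g \<sigma> powr (s / p) \<le> w \<beta> \<sigma> * (g \<sigma> powr (q / p) * (C1 powr r * (\<sigma> powr (-(\<alpha> + 1))) powr r * m powr r))"
            by (rule mult_left_mono[OF 3 w0(2)])
          also have "\<dots> = (weight_const \<beta> * C1 powr r * m powr r) * ((\<sigma> powr \<beta> * (\<sigma> powr (-(\<alpha> + 1))) powr r) * exp (- 2 * \<sigma>) * g \<sigma> powr (q / p))"
            using 2 by (simp add: w_def mult_ac)
          also have "\<dots> = E * m powr r * (w \<alpha> \<sigma> * g \<sigma> powr (q / p))"
            unfolding 4 using 2 weight_const_pos[OF \<alpha>] by (simp add: w_def E_def mult_ac)
          finally show ?thesis using D w0(2)[of \<sigma>] by (simp add: add_increasing2)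
        next
          case 3
          have "w \<beta> \<sigma> * g \<sigma> powr (s / p) \<le> w \<beta> \<sigma> * (D * m powr (s / q))"
            using large[OF G, of \<sigma>] 3 by (intro mult_left_mono w0) (simp add: g_def m_def)
          moreover have "0 \<le> E * m powr r * (w \<alpha> \<sigma> * g \<sigma> powr (q / p))" using E w0 by auto
          ultimately show ?thesis by (simp add: mult_ac)
        qed
      qed
      have "ennreal (mixed_mean p s \<beta> G) = (\<integral>\<^sup>+\<sigma>. ennreal (g \<sigma> powr (s / p)) \<partial>weight_measure \<beta>)"
        unfolding g_def by (rule nn_integral_hardy_mean[OF G p s \<beta>, symmetric])
      also have "\<dots> = (\<integral>\<^sup>+\<sigma>. ennreal (w \<beta> \<sigma>) * ennreal (g \<sigma> powr (s / p)) \<partial>lborel)"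
        unfolding w_def by (rule nn_integral_weight[OF gm])
      also have "\<dots> \<le> (\<integral>\<^sup>+\<sigma>. ennreal (E * m powr r) * (ennreal (w \<alpha> \<sigma>) * ennreal (g \<sigma> powr (q / p))) + ennreal (D * m powr (s / q)) * ennreal (w \<beta> \<sigma>) \<partial>lborel)"
        using pw w0 E D by (intro nn_integral_mono)
          (auto simp: ennreal_mult[symmetric] ennreal_plus[symmetric] simp del: ennreal_plus intro!: ennreal_leI)
      also have "\<dots> = ennreal (E * m powr r) * (\<integral>\<^sup>+\<sigma>. ennreal (w \<alpha> \<sigma>) * ennreal (g \<sigma> powr (q / p)) \<partial>lborel) +
          ennreal (D * m powr (s / q)) * (\<integral>\<^sup>+\<sigma>. ennreal (w \<beta> \<sigma>) * 1 \<partial>lborel)"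
        using gm wm by (simp add: nn_integral_add nn_integral_cmult)
      also have "(\<integral>\<^sup>+\<sigma>. ennreal (w \<alpha> \<sigma>) * ennreal (g \<sigma> powr (q / p)) \<partial>lborel) = (\<integral>\<^sup>+\<sigma>. ennreal (g \<sigma> powr (q / p)) \<partial>weight_measure \<alpha>)"
        unfolding w_def by (rule nn_integral_weight[OF gm, symmetric])
      also have "\<dots> = ennreal m" unfolding g_def m_def by (rule nn_integral_hardy_mean[OF G p q \<alpha>])
      also have "(\<integral>\<^sup>+\<sigma>. ennreal (w \<beta> \<sigma>) * 1 \<partial>lborel) = (\<integral>\<^sup>+\<sigma>. 1 \<partial>weight_measure \<beta>)"
        unfolding w_def by (rule nn_integral_weight[symmetric]) simp
      also have "\<dots> = 1" using W.emeasure_space_1 by simp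
      also have "ennreal (E * m powr r) * ennreal m + ennreal (D * m powr (s / q)) * 1 = ennreal (E * (m powr r * m) + D * m powr (s / q))"
        using E D m0 by (simp add: ennreal_mult[symmetric] ennreal_plus[symmetric] mult_ac del: ennreal_plus)
      also have "m powr r * m = m powr (s / q)"
      proof (cases "m = 0")
        case False
        then have "m powr r * m = m powr (r + 1)" using m0 by (simp add: powr_add)
        also have "r + 1 = s / q" using q by (simp add: r_def field_simps)
        finally show ?thesis .
      qed simp
      finally have "mixed_mean p s \<beta> G \<le> E * m powr (s / q) + D * m powr (s / q)"
        using E D by (subst (asm) ennreal_le_iff) auto
      then show "mixed_mean p s \<beta> G \<le> (E + D) * mixed_mean p q \<alpha> G powr (s / q)"
        by (simp add: m_def algebra_simps)
    qed
  qed
qed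

lemma power_powr_eq:
  fixes x :: real
  assumes "0 \<le> x" "0 < N"
  shows "(x ^ N) powr u = x powr (real N * u)"
proof (cases "x = 0")
  case True
  with assms show ?thesis by (simp add: power_0_left)
next
  case False
  with assms show ?thesis by (simp add: powr_realpow[symmetric] powr_powr)
qed

lemma torus_mean_poly_diff:
  fixes P :: "complex poly"
  assumes X: "X \<in> torus_polys" "H \<in> torus_polys" and u: "0 < u" and N: "0 < N" "real N * u \<le> p"
    and \<eta>: "0 < \<eta>" and C: "0 < C" "\<And>x h. norm (poly P (x + h) - poly P x) \<le> \<eta> * (1 + norm x ^ N) + C * norm h ^ N"
  shows "torus_mean u (\<lambda>z. poly P (X z + H z) - poly P (X z)) \<le>
    3 powr u * (\<eta> powr u + \<eta> powr u * torus_mean p X powr (real N * u / p) + C powr u * torus_mean p H powr (real N * u / p))"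
proof -
  have Nu: "0 < real N * u" using N u by simp
  have D: "(\<lambda>z. poly P (X z + H z) - poly P (X z)) \<in> torus_polys"
    using X by (intro torus_polys_diff torus_polys_poly torus_polys_add)
  note int = integrable_torus_poly[OF X(1) Nu] integrable_torus_poly[OF X(2) Nu]
  have "torus_mean u (\<lambda>z. poly P (X z + H z) - poly P (X z)) \<le>
    (\<integral>z. 3 powr u * (\<eta> powr u + \<eta> powr u * norm (X z) powr (real N * u) + C powr u * norm (H z) powr (real N * u)) \<partial>torus_measure)"
    unfolding torus_mean_def
  proof (rule integral_mono[OF integrable_torus_poly[OF D u]])
    fix z
    have "norm (poly P (X z + H z) - poly P (X z)) powr u \<le> (\<eta> + \<eta> * norm (X z) ^ N + C * norm (H z) ^ N) powr u"
      using C(2)[of "X z" "H z"] u by (intro powr_mono2) (auto simp: algebra_simps)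
    also have "\<dots> \<le> 3 powr u * (\<eta> powr u + (\<eta> * norm (X z) ^ N) powr u + (C * norm (H z) ^ N) powr u)"
      using \<eta> C(1) u by (intro powr_add3_le) auto
    also have "\<dots> = 3 powr u * (\<eta> powr u + \<eta> powr u * norm (X z) powr (real N * u) + C powr u * norm (H z) powr (real N * u))"
      using \<eta> C(1) N(1) by (simp add: powr_mult power_powr_eq)
    finally show "norm (poly P (X z + H z) - poly P (X z)) powr u \<le> \<dots>" .
  qed (use int in auto)
  also have "\<dots> = 3 powr u * (\<eta> powr u + \<eta> powr u * torus_mean (real N * u) X + C powr u * torus_mean (real N * u) H)"
    using int torus.prob_space by (simp add: torus_mean_def)
  also have "\<dots> \<le> 3 powr u * (\<eta> powr u + \<eta> powr u * torus_mean p X powr (real N * u / p) + C powr u * torus_mean p H powr (real N * u / p))"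
    using X Nu N(2) by (intro mult_left_mono add_mono torus_mean_Jensen) auto
  finally show ?thesis .
qed

text \<open>The small factor \<epsilon> at the X-term is what yields continuity and not only
  boundedness. The bound N u <= p is used on the torus at each height; the weight condition is used
  through the embedding with s = N v.\<close>

lemma mixed_mean_poly_diff:
  fixes P :: "complex poly"
  assumes p: "0 < p" and q: "0 < q" and u: "0 < u" and v: "0 < v" and \<alpha>: "-1 < \<alpha>" and \<beta>: "-1 < \<beta>"
    and N: "real (degree P) * u \<le> p"
    and cond: "real (degree P) * v * (\<alpha> + 1) < q * (\<beta> + 1) \<or> \<alpha> \<le> \<beta> \<and> real (degree P) * v * (\<alpha> + 1) = q * (\<beta> + 1)"
  shows "\<exists>t>0. \<forall>\<epsilon>>0. \<exists>C>0. \<forall>X\<in>torus_polys. \<forall>H\<in>torus_polys.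
    mixed_mean u v \<beta> (\<lambda>z. poly P (X z + H z) - poly P (X z)) \<le>
      \<epsilon> * (1 + mixed_mean p q \<alpha> X powr t) + C * mixed_mean p q \<alpha> H powr t"
proof (cases "degree P = 0")
  case True
  then obtain c where "P = [:c:]" by (rule degree_eq_zeroE)
  then have "(\<lambda>z. poly P (X z + H z) - poly P (X z)) = (\<lambda>z. 0)" for X H :: "(nat \<Rightarrow> complex) \<Rightarrow> complex" by simp
  moreover have "mixed_mean u v \<beta> (\<lambda>z. 0) = 0" using u v by (simp add: mixed_mean_def hardy_mean_def)
  \<comment> \<open>For constant \<open>P\<close> the difference vanishes, so any t > 0 will
    do.\<close>
  ultimately show ?thesis
    by (intro exI[of _ 1] conjI allI impI) (auto intro!: exI[of _ 1] add_nonneg_nonneg mult_nonneg_nonneg)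
next
  case False
  let ?N = "degree P"
  define s where "s = real ?N * v"
  have s: "0 < s" using False v by (simp add: s_def)
  obtain E where E: "0 < E" "\<And>G. G \<in> torus_polys \<Longrightarrow> mixed_mean p s \<beta> G \<le> E * mixed_mean p q \<alpha> G powr (s / q)"
    using mixed_mean_embedding[OF p q s \<alpha> \<beta>] cond by (metis s_def)
  define \<kappa> where "\<kappa> = v / u"
  have \<kappa>: "0 < \<kappa>" "u * \<kappa> = v" using u v by (auto simp: \<kappa>_def)
  define K0 where "K0 = 3 powr v * 3 powr \<kappa>"
  have K0: "0 < K0" by (simp add: K0_def)
  show ?thesis
  proof (rule exI[of _ "s / q"], intro conjI allI impI)
    show "0 < s / q" using s q by simp
    fix \<epsilon> :: real assume \<epsilon>: "0 < \<epsilon>"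
    \<comment> \<open>Solves K0 \<eta>^v (1 + E) = \<epsilon>: \<open>K0\<close> collects the losses
      from splitting sums of three terms, \<open>E\<close> is the constant of the embedding.\<close>
    define \<eta> where "\<eta> = (\<epsilon> / (K0 * (1 + E))) powr (1 / v)"
    have e0: "0 < \<epsilon> / (K0 * (1 + E))" using \<epsilon> K0 E(1) by simp
    have \<eta>: "0 < \<eta>" unfolding \<eta>_def powr_gt_zero using e0 by linarith
    have \<eta>v: "K0 * \<eta> powr v * (1 + E) = \<epsilon>"
    proof -
      have "K0 \<noteq> 0" "1 + E \<noteq> 0" using K0 E(1) by auto
      moreover have "\<eta> powr v = \<epsilon> / (K0 * (1 + E))"
      proof -
        have "1 / v * v = 1" using v by simp
        then show ?thesis unfolding \<eta>_def powr_powr using powr_one[OF less_imp_le[OF e0]] by simp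
      qed
      ultimately show ?thesis by simp
    qed
    obtain C where C: "0 < C" "\<And>x h. norm (poly P (x + h) - poly P x) \<le> \<eta> * (1 + norm x ^ ?N) + C * norm h ^ ?N"
      using poly_diff_eps[OF \<eta>, of P] by metis
    show "\<exists>C>0. \<forall>X\<in>torus_polys. \<forall>H\<in>torus_polys.
      mixed_mean u v \<beta> (\<lambda>z. poly P (X z + H z) - poly P (X z)) \<le>
      \<epsilon> * (1 + mixed_mean p q \<alpha> X powr (s / q)) + C * mixed_mean p q \<alpha> H powr (s / q)"
    proof (intro exI[of _ "K0 * C powr v * E"] conjI ballI)
      show "0 < K0 * C powr v * E" using K0 C(1) E(1) by simp
      fix X H assume X: "X \<in> torus_polys" and H: "H \<in> torus_polys"
      let ?D = "\<lambda>z. poly P (X z + H z) - poly P (X z)"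
      have D: "?D \<in> torus_polys" using X H by (intro torus_polys_diff torus_polys_poly torus_polys_add)
      have int: "integrable (weight_measure \<beta>) (\<lambda>\<sigma>. hardy_mean p G \<sigma> powr (s / p))" if "G \<in> torus_polys" for G
        using s p by (intro integrable_hardy_mean that \<beta>) auto
      have pw: "hardy_mean u ?D \<sigma> powr \<kappa> \<le> K0 * (\<eta> powr v + \<eta> powr v * hardy_mean p X \<sigma> powr (s / p) + C powr v * hardy_mean p H \<sigma> powr (s / p))" for \<sigma>
      proof -
        let ?x = "hardy_mean p X \<sigma>" and ?h = "hardy_mean p H \<sigma>"
        have "hardy_mean u ?D \<sigma> \<le> 3 powr u * (\<eta> powr u + \<eta> powr u * ?x powr (real ?N * u / p) + C powr u * ?h powr (real ?N * u / p))"
          unfolding hardy_mean_def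
          using torus_mean_poly_diff[OF torus_polys_shift[OF X] torus_polys_shift[OF H] u _ N \<eta> C] False by simp
        then have "hardy_mean u ?D \<sigma> powr \<kappa> \<le> (3 powr u * (\<eta> powr u + \<eta> powr u * ?x powr (real ?N * u / p) + C powr u * ?h powr (real ?N * u / p))) powr \<kappa>"
          using \<kappa> by (intro powr_mono2) auto
        also have "\<dots> = 3 powr v * (\<eta> powr u + \<eta> powr u * ?x powr (real ?N * u / p) + C powr u * ?h powr (real ?N * u / p)) powr \<kappa>"
          using \<kappa> by (simp add: powr_mult powr_powr)
        also have "\<dots> \<le> 3 powr v * (3 powr \<kappa> * ((\<eta> powr u) powr \<kappa> + (\<eta> powr u * ?x powr (real ?N * u / p)) powr \<kappa> + (C powr u * ?h powr (real ?N * u / p)) powr \<kappa>))"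
          using \<kappa> by (intro mult_left_mono powr_add3_le) auto
        also have "\<dots> = K0 * (\<eta> powr v + \<eta> powr v * ?x powr (s / p) + C powr v * ?h powr (s / p))"
        proof -
          have "real ?N * u * \<kappa> = s" using \<kappa>(2) by (simp add: s_def mult.assoc)
          then show ?thesis using \<kappa> by (simp add: K0_def powr_mult powr_powr)
        qed
        finally show ?thesis .
      qed
      interpret W: prob_space "weight_measure \<beta>" by (rule prob_space_weight_measure[OF \<beta>])
      have "mixed_mean u v \<beta> ?D \<le> (\<integral>\<sigma>. K0 * (\<eta> powr v + \<eta> powr v * hardy_mean p X \<sigma> powr (s / p) + C powr v * hardy_mean p H \<sigma> powr (s / p)) \<partial>weight_measure \<beta>)"
        unfolding mixed_mean_def \<kappa>_def[symmetric]
        using int[OF X] int[OF H] \<kappa> by (intro integral_mono integrable_hardy_mean D u \<beta> pw) auto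
      also have "\<dots> = K0 * (\<eta> powr v + \<eta> powr v * mixed_mean p s \<beta> X + C powr v * mixed_mean p s \<beta> H)"
        using int[OF X] int[OF H] W.prob_space by (simp add: mixed_mean_def)
      also have "\<dots> \<le> K0 * (\<eta> powr v + \<eta> powr v * (E * mixed_mean p q \<alpha> X powr (s / q)) + C powr v * (E * mixed_mean p q \<alpha> H powr (s / q)))"
        using K0 by (intro mult_left_mono add_mono E X H) auto
      also have "\<dots> \<le> K0 * \<eta> powr v * (1 + E) * (1 + mixed_mean p q \<alpha> X powr (s / q)) + K0 * C powr v * E * mixed_mean p q \<alpha> H powr (s / q)"
      proof -
        have "K0 * \<eta> powr v * (1 + E * mixed_mean p q \<alpha> X powr (s / q)) \<le> K0 * \<eta> powr v * ((1 + E) * (1 + mixed_mean p q \<alpha> X powr (s / q)))"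
          using K0 E(1) by (intro mult_left_mono) (auto simp: algebra_simps)
        then show ?thesis by (simp add: algebra_simps)
      qed
      finally show "mixed_mean u v \<beta> ?D \<le> \<epsilon> * (1 + mixed_mean p q \<alpha> X powr (s / q)) + K0 * C powr v * E * mixed_mean p q \<alpha> H powr (s / q)"
        unfolding \<eta>v .
    qed
  qed
qed

section \<open>Passage to the completion\<close>

lemma torus_poly_coeffs:
  assumes "\<And>k. G k \<in> torus_polys"
  obtains A where "\<And>k. A k \<in> dirichlet_polys" "\<And>k. bohr_lift (A k) = G k"
proof -
  have "\<forall>k. \<exists>a. a \<in> dirichlet_polys \<and> bohr_lift a = G k" using assms unfolding torus_polys_def image_iff by metis
  then show ?thesis using that by metis
qed

lemma divide_twice_cancel: "c \<noteq> 0 \<Longrightarrow> e / (2 * c) * c = e / 2" for c e :: real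
  by simp

text \<open>Separates the estimate on polynomials from the limits: the mapping property, boundedness
  and continuity all follow from \<open>diff\<close> by applying it to approximating
  sequences.\<close>

locale poly_superposition =
  fixes p q u v \<alpha> \<beta> :: real and P :: "complex poly" and t :: real
  assumes pos: "0 < p" "0 < q" "0 < u" "0 < v" "-1 < \<alpha>" "-1 < \<beta>" and t: "0 < t"
    and diff: "\<forall>\<epsilon>>0. \<exists>C>0. \<forall>X\<in>torus_polys. \<forall>H\<in>torus_polys.
      mixed_mean u v \<beta> (\<lambda>z. poly P (X z + H z) - poly P (X z)) \<le>
      \<epsilon> * (1 + mixed_mean p q \<alpha> X powr t) + C * mixed_mean p q \<alpha> H powr t"
begin

lemma diff': "0 < \<epsilon> \<Longrightarrow> \<exists>C>0. \<forall>G\<in>torus_polys. \<forall>X\<in>torus_polys.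
      mixed_mean u v \<beta> (\<lambda>z. poly P (G z) - poly P (X z)) \<le>
      \<epsilon> * (1 + mixed_mean p q \<alpha> X powr t) + C * mixed_mean p q \<alpha> (\<lambda>z. G z - X z) powr t"
proof -
  assume "0 < \<epsilon>"
  then obtain C where C: "0 < C" "\<And>X H. X \<in> torus_polys \<Longrightarrow> H \<in> torus_polys \<Longrightarrow>
    mixed_mean u v \<beta> (\<lambda>z. poly P (X z + H z) - poly P (X z)) \<le>
      \<epsilon> * (1 + mixed_mean p q \<alpha> X powr t) + C * mixed_mean p q \<alpha> H powr t"
    using diff by meson
  show ?thesis
  proof (intro exI[of _ C] conjI ballI C(1))
    fix G X assume "G \<in> torus_polys" "X \<in> torus_polys"
    from C(2)[OF this(2) torus_polys_diff[OF this]]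
    show "mixed_mean u v \<beta> (\<lambda>z. poly P (G z) - poly P (X z)) \<le>
      \<epsilon> * (1 + mixed_mean p q \<alpha> X powr t) + C * mixed_mean p q \<alpha> (\<lambda>z. G z - X z) powr t"
      by simp
  qed
qed

lemma approx:
  assumes A: "mixed_approx p q \<alpha> A f"
  obtains B where "mixed_approx u v \<beta> B (superposition (poly P) f)" "\<And>k. bohr_lift (B k) = (\<lambda>z. poly P (bohr_lift (A k) z))"
proof -
  have AD: "\<And>k. A k \<in> dirichlet_polys" and AC: "mixed_Cauchy p q \<alpha> A"
    and Al: "\<And>s. Re s > 1 / 2 \<Longrightarrow> (\<lambda>k. dirichlet_eval (A k) s) \<longlonglongrightarrow> f s"
    using A mixed_approx_iff[of p q] pos by auto
  obtain B where B: "\<And>k. B k \<in> dirichlet_polys" "\<And>k. bohr_lift (B k) = (\<lambda>z. poly P (bohr_lift (A k) z))"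
    using torus_poly_coeffs[of "\<lambda>k z. poly P (bohr_lift (A k) z)"] AD torus_polys_poly by (metis bohr_lift_in_torus_polys)
  obtain M where M: "0 < M" "\<And>k. mixed_mean p q \<alpha> (bohr_lift (A k)) \<le> M"
    using mixed_Cauchy_bounded[OF pos(1,2,5) AD AC] by metis
  have "mixed_Cauchy u v \<beta> B"
    unfolding mixed_Cauchy_def
  proof (intro allI impI)
    fix \<epsilon> :: real assume \<epsilon>: "0 < \<epsilon>"
    define \<eta> where "\<eta> = \<epsilon> / (2 * (1 + M powr t))"
    have Mt: "0 < 1 + M powr t" by (intro add_pos_nonneg) auto
    have \<eta>: "0 < \<eta>" using \<epsilon> Mt by (simp add: \<eta>_def)
    have \<eta>M: "\<eta> * (1 + M powr t) = \<epsilon> / 2" unfolding \<eta>_def by (rule divide_twice_cancel) (use Mt in simp)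
    obtain C where C: "0 < C" "\<And>G X. G \<in> torus_polys \<Longrightarrow> X \<in> torus_polys \<Longrightarrow>
      mixed_mean u v \<beta> (\<lambda>z. poly P (G z) - poly P (X z)) \<le>
      \<eta> * (1 + mixed_mean p q \<alpha> X powr t) + C * mixed_mean p q \<alpha> (\<lambda>z. G z - X z) powr t"
      using diff'[OF \<eta>] by blast
    have e: "0 < (\<epsilon> / (2 * C)) powr (1 / t)" using \<epsilon> C(1) by simp
    obtain K where K: "\<And>k l. K \<le> k \<Longrightarrow> K \<le> l \<Longrightarrow>
      mixed_mean p q \<alpha> (\<lambda>z. bohr_lift (A k) z - bohr_lift (A l) z) < (\<epsilon> / (2 * C)) powr (1 / t)"
      using AC e unfolding mixed_Cauchy_def by meson
    show "\<exists>K. \<forall>k\<ge>K. \<forall>l\<ge>K. mixed_mean u v \<beta> (\<lambda>z. bohr_lift (B k) z - bohr_lift (B l) z) < \<epsilon>"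
    proof (intro exI[of _ K] allI impI)
      fix k l assume kl: "K \<le> k" "K \<le> l"
      let ?d = "mixed_mean p q \<alpha> (\<lambda>z. bohr_lift (A k) z - bohr_lift (A l) z)"
      have "?d powr t < ((\<epsilon> / (2 * C)) powr (1 / t)) powr t"
        using K[OF kl] t by (intro powr_less_mono2) auto
      also have "\<dots> = \<epsilon> / (2 * C)" using t \<epsilon> C(1) by (simp add: powr_powr)
      finally have "C * ?d powr t < C * (\<epsilon> / (2 * C))" using C(1) by (intro mult_strict_left_mono)
      then have 1: "C * ?d powr t < \<epsilon> / 2" using C(1) by simp
      have "\<eta> * (1 + mixed_mean p q \<alpha> (bohr_lift (A l)) powr t) \<le> \<eta> * (1 + M powr t)"
        using \<eta> M(2)[of l] t by (intro mult_left_mono add_left_mono powr_mono2) auto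
      then show "mixed_mean u v \<beta> (\<lambda>z. bohr_lift (B k) z - bohr_lift (B l) z) < \<epsilon>"
        using C(2)[of "bohr_lift (A k)" "bohr_lift (A l)"] AD 1 unfolding \<eta>M by (simp add: B(2))
    qed
  qed
  moreover have "(\<lambda>k. dirichlet_eval (B k) s) \<longlonglongrightarrow> superposition (poly P) f s" if "Re s > 1/2" for s
    using Al[OF that] AD B(1)
    by (simp add: dirichlet_eval_eq B(2) superposition_def tendsto_poly)
  ultimately have "mixed_approx u v \<beta> B (superposition (poly P) f)"
    unfolding mixed_approx_iff[OF pos(3,4)] using B(1) by blast
  then show ?thesis using B(2) that by blast
qed

lemma maps: "superposition (poly P) ` mixed_space p q \<alpha> \<subseteq> mixed_space u v \<beta>"
proof -
  have "superposition (poly P) f \<in> mixed_space u v \<beta>" if "mixed_approx p q \<alpha> A f" for A f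
    using approx[OF that] unfolding mixed_space_def by blast
  then show ?thesis by (auto simp: mixed_space_def)
qed

lemma bounded:
  "bounded_operator (mixed_space p q \<alpha>) (mixed_space_norm p q \<alpha>) (mixed_space_norm u v \<beta>) (superposition (poly P))"
proof -
  obtain C where C: "0 < C" "\<And>G X. G \<in> torus_polys \<Longrightarrow> X \<in> torus_polys \<Longrightarrow>
    mixed_mean u v \<beta> (\<lambda>z. poly P (G z) - poly P (X z)) \<le>
    1 * (1 + mixed_mean p q \<alpha> X powr t) + C * mixed_mean p q \<alpha> (\<lambda>z. G z - X z) powr t"
    using diff'[of 1] by (auto simp del: mult_1)
  obtain K where K: "1 \<le> K" "\<And>G H. G \<in> torus_polys \<Longrightarrow> H \<in> torus_polys \<Longrightarrow>
    mixed_mean u v \<beta> (\<lambda>z. G z + H z) \<le> K * (mixed_mean u v \<beta> G + mixed_mean u v \<beta> H)"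
    using mixed_mean_add_le[OF pos(3,4,6)] by metis
  define L where "L = mixed_mean u v \<beta> (\<lambda>z. poly P 0)"
  have "mixed_mean p q \<alpha> (\<lambda>z. 0) = 0" using pos by (simp add: mixed_mean_def hardy_mean_def)
  then have poly_le: "mixed_mean u v \<beta> (\<lambda>z. poly P (G z)) \<le> K * (1 + C * mixed_mean p q \<alpha> G powr t + L)"
    if "G \<in> torus_polys" for G
  proof -
    have "mixed_mean u v \<beta> (\<lambda>z. (poly P (G z) - poly P 0) + poly P 0) \<le>
      K * (mixed_mean u v \<beta> (\<lambda>z. poly P (G z) - poly P 0) + L)"
      unfolding L_def using that by (intro K torus_polys_diff torus_polys_poly) auto
    also have "\<dots> \<le> K * (1 + C * mixed_mean p q \<alpha> G powr t + L)"
      using C(2)[OF that torus_polys_const, of 0] K(1) \<open>mixed_mean p q \<alpha> (\<lambda>z. 0) = 0\<close>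
      by (intro mult_left_mono add_right_mono) auto
    finally show ?thesis by simp
  qed
  show ?thesis
    unfolding bounded_operator_def
  proof (intro allI impI)
    fix S assume S: "S \<subseteq> mixed_space p q \<alpha>" and "\<exists>M. \<forall>f\<in>S. mixed_space_norm p q \<alpha> f \<le> M"
    then obtain M where M: "\<And>f. f \<in> S \<Longrightarrow> mixed_space_norm p q \<alpha> f \<le> M" by blast
    let ?R = "K * (1 + C * (M powr q) powr t + L)"
    show "\<exists>M. \<forall>g\<in>superposition (poly P) ` S. mixed_space_norm u v \<beta> g \<le> M"
    proof (intro exI[of _ "?R powr (1 / v)"] ballI)
      fix g assume "g \<in> superposition (poly P) ` S"
      then obtain f where f: "f \<in> S" "g = superposition (poly P) f" by blast
      obtain A where A: "mixed_approx p q \<alpha> A f" using f S by (auto simp: mixed_space_def)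
      have AD: "\<And>k. A k \<in> dirichlet_polys" using A mixed_approx_iff[of p q] pos by auto
      obtain B where B: "mixed_approx u v \<beta> B g" "\<And>k. bohr_lift (B k) = (\<lambda>z. poly P (bohr_lift (A k) z))"
        using approx[OF A] f(2) by metis
      note limA = mixed_mean_tendsto_norm[OF pos(1,2,5) A] and limB = mixed_mean_tendsto_norm[OF pos(3,4,6) B(1)]
      have "mixed_space_norm u v \<beta> g powr v \<le> K * (1 + C * (mixed_space_norm p q \<alpha> f powr q) powr t + L)"
      proof (rule LIMSEQ_le[OF limB(1)])
        show "(\<lambda>k. K * (1 + C * mixed_mean p q \<alpha> (bohr_lift (A k)) powr t + L)) \<longlonglongrightarrow>
          K * (1 + C * (mixed_space_norm p q \<alpha> f powr q) powr t + L)"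
          using t by (intro tendsto_intros tendsto_powr' limA(1)) auto
      qed (use poly_le AD in \<open>auto simp: B(2)\<close>)
      also have "\<dots> \<le> ?R"
        using K(1) C(1) M[OF f(1)] limA(2) pos t by (intro mult_left_mono add_mono powr_mono2) auto
      finally have "(mixed_space_norm u v \<beta> g powr v) powr (1 / v) \<le> ?R powr (1 / v)"
        using pos by (intro powr_mono2) auto
      then show "mixed_space_norm u v \<beta> g \<le> ?R powr (1 / v)"
        using pos limB(2) by (simp add: powr_powr)
    qed
  qed
qed

lemma continuous:
  "continuous_operator (mixed_space p q \<alpha>) (mixed_space_norm p q \<alpha>) (mixed_space_norm u v \<beta>) (superposition (poly P))"
  unfolding continuous_operator_def
proof (intro ballI allI impI)
  fix f and \<epsilon> :: real assume "f \<in> mixed_space p q \<alpha>" and \<epsilon>: "0 < \<epsilon>"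
  then obtain A where A: "mixed_approx p q \<alpha> A f" by (auto simp: mixed_space_def)
  have AD: "\<And>k. A k \<in> dirichlet_polys" using A mixed_approx_iff[of p q] pos by auto
  note limA = mixed_mean_tendsto_norm[OF pos(1,2,5) A]
  define m where "m = (mixed_space_norm p q \<alpha> f powr q) powr t"
  have m: "0 < 1 + m" by (simp add: m_def add_pos_nonneg)
  define \<eta> where "\<eta> = \<epsilon> powr v / (2 * (1 + m))"
  have \<eta>: "0 < \<eta>" using \<epsilon> m by (simp add: \<eta>_def)
  have \<eta>m: "\<eta> * (1 + m) = \<epsilon> powr v / 2" unfolding \<eta>_def by (rule divide_twice_cancel) (use m in simp)
  obtain C where C: "0 < C" "\<And>G X. G \<in> torus_polys \<Longrightarrow> X \<in> torus_polys \<Longrightarrow>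
    mixed_mean u v \<beta> (\<lambda>z. poly P (G z) - poly P (X z)) \<le>
    \<eta> * (1 + mixed_mean p q \<alpha> X powr t) + C * mixed_mean p q \<alpha> (\<lambda>z. G z - X z) powr t"
    using diff'[OF \<eta>] by blast
  \<comment> \<open>Solves C (\<delta>^q)^t = \<epsilon>^v / 2; the other half is taken by
    \<open>\<eta>m\<close>.\<close>
  define \<delta> where "\<delta> = ((\<epsilon> powr v / (2 * C)) powr (1 / t)) powr (1 / q)"
  have \<delta>: "0 < \<delta>" "(\<delta> powr q) powr t = \<epsilon> powr v / (2 * C)"
    using \<epsilon> C(1) t pos by (auto simp: \<delta>_def powr_powr)
  show "\<exists>\<delta>>0. \<forall>g\<in>mixed_space p q \<alpha>. mixed_space_norm p q \<alpha> (\<lambda>s. g s - f s) < \<delta> \<longrightarrow>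
    mixed_space_norm u v \<beta> (\<lambda>s. superposition (poly P) g s - superposition (poly P) f s) < \<epsilon>"
  proof (intro exI[of _ \<delta>] conjI ballI impI \<delta>(1))
    fix g assume "g \<in> mixed_space p q \<alpha>" and close: "mixed_space_norm p q \<alpha> (\<lambda>s. g s - f s) < \<delta>"
    then obtain B where B: "mixed_approx p q \<alpha> B g" by (auto simp: mixed_space_def)
    have BD: "\<And>k. B k \<in> dirichlet_polys" using B mixed_approx_iff[of p q] pos by auto
    obtain PA where PA: "mixed_approx u v \<beta> PA (superposition (poly P) f)" "\<And>k. bohr_lift (PA k) = (\<lambda>z. poly P (bohr_lift (A k) z))"
      using approx[OF A] by metis
    obtain PB where PB: "mixed_approx u v \<beta> PB (superposition (poly P) g)" "\<And>k. bohr_lift (PB k) = (\<lambda>z. poly P (bohr_lift (B k) z))"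
      using approx[OF B] by metis
    have PD: "PA k \<in> dirichlet_polys" "PB k \<in> dirichlet_polys" for k
      using PA(1) PB(1) mixed_approx_iff[of u v] pos by auto
    let ?n = "mixed_space_norm p q \<alpha> (\<lambda>s. g s - f s)"
    let ?o = "mixed_space_norm u v \<beta> (\<lambda>s. superposition (poly P) g s - superposition (poly P) f s)"
    note limD = mixed_mean_tendsto_norm[OF pos(1,2,5) mixed_approx_diff[OF pos(1,2,5) B A]]
    note limP = mixed_mean_tendsto_norm[OF pos(3,4,6) mixed_approx_diff[OF pos(3,4,6) PB(1) PA(1)]]
    have "?o powr v \<le> \<eta> * (1 + m) + C * (?n powr q) powr t"
    proof (rule LIMSEQ_le[OF limP(1)])
      show "(\<lambda>k. \<eta> * (1 + mixed_mean p q \<alpha> (bohr_lift (A k)) powr t) + C * mixed_mean p q \<alpha> (bohr_lift (\<lambda>n. B k n - A k n)) powr t)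
        \<longlonglongrightarrow> \<eta> * (1 + m) + C * (?n powr q) powr t"
        unfolding m_def using t by (intro tendsto_intros tendsto_powr' limA(1) limD(1)) auto
      show "\<exists>N. \<forall>k\<ge>N. mixed_mean u v \<beta> (bohr_lift (\<lambda>n. PB k n - PA k n)) \<le>
        \<eta> * (1 + mixed_mean p q \<alpha> (bohr_lift (A k)) powr t) + C * mixed_mean p q \<alpha> (bohr_lift (\<lambda>n. B k n - A k n)) powr t"
        using C(2) AD BD PD by (auto simp: bohr_lift_diff_fun PA(2) PB(2))
    qed
    also have "C * (?n powr q) powr t < C * (\<epsilon> powr v / (2 * C))"
      unfolding \<delta>(2)[symmetric] using C(1) close limD(2) pos t
      by (intro mult_strict_left_mono powr_less_mono2) auto
    also have "\<eta> * (1 + m) + C * (\<epsilon> powr v / (2 * C)) = \<epsilon> powr v" unfolding \<eta>m using C(1) by simp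
    finally have "?o powr v < \<epsilon> powr v" by simp
    then show "?o < \<epsilon>"
      using powr_mono2[of v \<epsilon> ?o] pos \<epsilon> by force
  qed
qed

end

section \<open>Analyticity of the symbol\<close>

lemma mixed_space_affine:
  assumes "0 < p" "0 < q"
  shows "(\<lambda>s. c + d * of_nat (prime_at j) powr (-s)) \<in> mixed_space p q \<alpha>"
proof -
  have "(\<lambda>z. c + d * z j) \<in> torus_polys"
    by (intro torus_polys_add torus_polys_mult) auto
  then obtain a where a: "a \<in> dirichlet_polys" "bohr_lift a = (\<lambda>z. c + d * z j)"
    unfolding torus_polys_def by (metis imageE)
  have "mixed_approx p q \<alpha> (\<lambda>k. a) (\<lambda>s. c + d * of_nat (prime_at j) powr (-s))"
    unfolding mixed_approx_iff[OF assms] mixed_Cauchy_def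
    using a assms by (auto simp: dirichlet_eval_eq mixed_mean_def hardy_mean_def)
  then show ?thesis by (auto simp: mixed_space_def)
qed

lemma holomorphic_dirichlet_eval:
  assumes "a \<in> dirichlet_polys"
  shows "dirichlet_eval a holomorphic_on S"
proof -
  have "(\<lambda>s. \<Sum>n | a n \<noteq> 0. a n * of_nat n powr (-s)) holomorphic_on S"
    by (intro holomorphic_intros)
  then show ?thesis by (simp add: dirichlet_eval_def[abs_def])
qed

lemma holomorphic_mixed_space:
  assumes p: "0 < p" and q: "0 < q" and \<alpha>: "-1 < \<alpha>" and f: "f \<in> mixed_space p q \<alpha>"
  shows "f holomorphic_on {s. 1 / 2 < Re s}"
proof -
  obtain A where A: "mixed_approx p q \<alpha> A f" using f by (auto simp: mixed_space_def)
  have AD: "\<And>k. A k \<in> dirichlet_polys" using A mixed_approx_iff[OF p q] by auto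
  show ?thesis
  proof (rule holomorphic_uniform_sequence[where f = "\<lambda>k. dirichlet_eval (A k)"])
    show "open {s. 1 / 2 < Re s}" by (rule open_halfspace_Re_gt)
    show "dirichlet_eval (A k) holomorphic_on {s. 1 / 2 < Re s}" for k by (rule holomorphic_dirichlet_eval[OF AD])
    fix s assume "s \<in> {s. 1 / 2 < Re s}"
    then have s: "1 / 2 < Re s" by simp
    define d where "d = (Re s - 1 / 2) / 2"
    have d: "0 < d" "1 / 2 < Re s - d" using s by (auto simp: d_def field_simps)
    have "cball s d \<subseteq> {x. Re s - d \<le> Re x}"
    proof
      fix x assume "x \<in> cball s d"
      then have "\<bar>Re (s - x)\<bar> \<le> d" using abs_Re_le_cmod[of "s - x"] by (simp add: dist_norm)
      then show "x \<in> {x. Re s - d \<le> Re x}" by simp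
    qed
    moreover from this have "cball s d \<subseteq> {s. 1 / 2 < Re s}" using d by force
    ultimately show "\<exists>d>0. cball s d \<subseteq> {s. 1 / 2 < Re s} \<and> uniform_limit (cball s d) (\<lambda>k. dirichlet_eval (A k)) f sequentially"
      using d(1) uniform_limit_on_subset[OF mixed_approx_uniform_limit[OF p q \<alpha> A d(2)]] by blast
  qed
qed

text \<open>Near \<open>x0\<close>, the function \<open>\<phi>\<close> is recovered from \<open>\<phi> \<circ> f\<close> for \<open>f(s) = x0 - 1 + P P\<^sup>-\<^sup>s\<close> with
  \<open>P\<close> prime, since \<open>f\<close> is locally invertible at \<open>s = 1\<close>, where it takes the value \<open>x0\<close>.\<close>

lemma superposition_entire:
  assumes p: "0 < p" and q: "0 < q" and u: "0 < u" and v: "0 < v" and \<beta>: "-1 < \<beta>"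
    and maps: "superposition \<phi> ` mixed_space p q \<alpha> \<subseteq> mixed_space u v \<beta>"
  shows "\<phi> holomorphic_on UNIV"
  unfolding holomorphic_on_def
proof (intro ballI)
  fix x0 :: complex
  define P where "P = real (prime_at 0)"
  have P: "2 \<le> P" using prime_at_gt_1[of 0] by (simp add: P_def)
  define f where "f s = (x0 - 1) + of_real P * of_nat (prime_at 0) powr (-s)" for s
  \<comment> \<open>The branch of the inverse of \<open>f\<close> around \<open>x0\<close>. On the
    ball of radius 1/4 one has |x - x0 + 1| < 5/4, and (5/4)^2 < 2 <= P keeps its values in Re s >
    1/2.\<close>
  define g where "g x = - Ln ((x - x0 + 1) / of_real P) / of_real (ln P)" for x
  have lnP: "0 < ln P" using P by simp
  have y: "(x - x0 + 1) / of_real P \<notin> \<real>\<^sub>\<le>\<^sub>0" "(x - x0 + 1) / of_real P \<noteq> 0" "1/2 < Re (g x)" if x: "x \<in> ball x0 (1/4)" for x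
  proof -
    have n: "norm (x - x0) < 1/4" using x by (simp add: dist_norm norm_minus_commute)
    then have "-1/4 < Re (x - x0)" using abs_Re_le_cmod[of "x - x0"] by linarith
    then have "0 < Re ((x - x0 + 1) / of_real P)" using P by (simp add: Re_divide_of_real)
    then show nonpos: "(x - x0 + 1) / of_real P \<notin> \<real>\<^sub>\<le>\<^sub>0" by (auto simp: complex_nonpos_Reals_iff)
    then show nz: "(x - x0 + 1) / of_real P \<noteq> 0" by auto
    have nn: "norm (x - x0 + 1) < 5/4" using norm_triangle_ineq[of "x - x0" 1] n by simp
    have "0 < norm (x - x0 + 1)" using nz by auto
    then have "2 * ln (norm (x - x0 + 1)) = ln (norm (x - x0 + 1) ^ 2)" by (simp add: ln_realpow)
    also have "\<dots> < ln P"
    proof -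
      have "norm (x - x0 + 1) ^ 2 < (5/4)^2" using nn by (intro power_strict_mono) auto
      then have "norm (x - x0 + 1) ^ 2 < P" using P by (simp add: power2_eq_square)
      then show ?thesis using \<open>0 < norm (x - x0 + 1)\<close> P by (subst ln_less_cancel_iff) auto
    qed
    finally have "2 * (ln (norm (x - x0 + 1)) - ln P) < - ln P" by simp
    moreover have "Re (Ln ((x - x0 + 1) / of_real P)) = ln (norm (x - x0 + 1)) - ln P"
      using nz P \<open>0 < norm (x - x0 + 1)\<close> by (simp add: norm_divide ln_div)
    ultimately show "1/2 < Re (g x)"
      using lnP by (simp add: g_def Re_divide_of_real field_simps)
  qed
  have fg: "f (g x) = x" if x: "x \<in> ball x0 (1/4)" for x
  proof -
    have "of_nat (prime_at 0) powr (- g x) = exp (- g x * Ln (of_real P))"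
      using P by (simp add: P_def powr_def)
    also have "Ln (of_real P) = of_real (ln P)" using P by (intro Ln_of_real) auto
    also have "- g x * of_real (ln P) = Ln ((x - x0 + 1) / of_real P)" using lnP by (simp add: g_def)
    also have "exp \<dots> = (x - x0 + 1) / of_real P" using y(2)[OF x] by simp
    finally show ?thesis using P by (simp add: f_def)
  qed
  have "f \<in> mixed_space p q \<alpha>" unfolding f_def[abs_def] by (rule mixed_space_affine[OF p q])
  then have "\<phi> \<circ> f \<in> mixed_space u v \<beta>" using maps by (auto simp: superposition_def)
  then have hol: "\<phi> \<circ> f holomorphic_on {s. 1/2 < Re s}" by (rule holomorphic_mixed_space[OF u v \<beta>])
  have "g holomorphic_on ball x0 (1/4)"
    unfolding g_def using y(1) lnP P by (intro holomorphic_intros) auto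
  then have "(\<phi> \<circ> f) \<circ> g holomorphic_on ball x0 (1/4)"
    by (rule holomorphic_on_compose_gen[OF _ hol]) (use y(3) in auto)
  then have "\<phi> holomorphic_on ball x0 (1/4)"
    by (rule holomorphic_transform) (use fg in auto)
  then show "\<phi> field_differentiable at x0 within UNIV"
    using holomorphic_on_imp_differentiable_at[of \<phi> "ball x0 (1/4)" x0] by simp
qed

section \<open>Taylor polynomials of the symbol\<close>

definition taylor_coeff :: "(complex \<Rightarrow> complex) \<Rightarrow> nat \<Rightarrow> complex" where
  "taylor_coeff \<phi> n = (deriv ^^ n) \<phi> 0 / fact n"

definition taylor_poly :: "(complex \<Rightarrow> complex) \<Rightarrow> nat \<Rightarrow> complex poly" where
  "taylor_poly \<phi> k = (\<Sum>n<k. monom (taylor_coeff \<phi> n) n)"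

lemma poly_taylor_poly: "poly (taylor_poly \<phi> k) x = (\<Sum>n<k. taylor_coeff \<phi> n * x ^ n)"
  by (simp add: taylor_poly_def poly_sum poly_monom)

lemma taylor_sums:
  assumes "\<phi> holomorphic_on UNIV"
  shows "(\<lambda>n. taylor_coeff \<phi> n * x ^ n) sums \<phi> x"
  using holomorphic_power_series[of \<phi> 0 "norm x + 1" x] holomorphic_on_subset[OF assms]
  by (simp add: taylor_coeff_def)

lemma taylor_uniform_limit:
  assumes "\<phi> holomorphic_on UNIV"
  shows "uniform_limit (cball 0 R) (\<lambda>k. poly (taylor_poly \<phi> k)) \<phi> sequentially"
proof -
  have "conv_radius (taylor_coeff \<phi>) = \<infinity>"
    by (rule conv_radius_inftyI'') (use taylor_sums[OF assms] in \<open>auto intro: sums_summable\<close>)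
  then have "uniform_limit (cball 0 R) (\<lambda>n x. \<Sum>i<n. taylor_coeff \<phi> i * (x - 0) ^ i)
    (\<lambda>x. suminf (\<lambda>i. taylor_coeff \<phi> i * (x - 0) ^ i)) sequentially"
    by (intro powser_uniform_limit) simp
  moreover have "suminf (\<lambda>i. taylor_coeff \<phi> i * (x - 0) ^ i) = \<phi> x" for x
    using taylor_sums[OF assms, of x] by (simp add: sums_iff)
  ultimately show ?thesis by (simp add: poly_taylor_poly[abs_def])
qed

text \<open>The compositions of \<phi> with \<open>A k\<close> are in general not Dirichlet
  polynomials, so \<phi> is replaced by its k-th Taylor polynomial. On Re s >= 1 both
  \<open>Q k\<close> and \<open>B k\<close> then converge uniformly to \<phi> \<circ> f, and uniform
  convergence passes to coefficients.\<close>

lemma superposition_coeff_tendsto: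
  assumes p: "0 < p" and q: "0 < q" and u: "0 < u" and v: "0 < v" and \<alpha>: "-1 < \<alpha>" and \<beta>: "-1 < \<beta>"
    and hol: "\<phi> holomorphic_on UNIV"
    and A: "mixed_approx p q \<alpha> A f" and B: "mixed_approx u v \<beta> B (superposition \<phi> f)"
    and Q: "\<And>k. Q k \<in> dirichlet_polys" "\<And>k. bohr_lift (Q k) = (\<lambda>z. poly (taylor_poly \<phi> k) (bohr_lift (A k) z))"
  shows "(\<lambda>k. Q k n - B k n) \<longlonglongrightarrow> 0"
proof -
  have AD: "\<And>k. A k \<in> dirichlet_polys" and AC: "mixed_Cauchy p q \<alpha> A"
    and Alim: "\<And>s. Re s > 1 / 2 \<Longrightarrow> (\<lambda>k. dirichlet_eval (A k) s) \<longlonglongrightarrow> f s"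
    using A mixed_approx_iff[OF p q] by auto
  have BD: "\<And>k. B k \<in> dirichlet_polys" using B mixed_approx_iff[OF u v] by auto
  obtain C where C: "0 < C" "\<And>a s. a \<in> dirichlet_polys \<Longrightarrow> 1 \<le> Re s \<Longrightarrow>
    norm (dirichlet_eval a s) powr q \<le> C * mixed_mean p q \<alpha> (bohr_lift a)"
    using mixed_eval_bound[OF p q \<alpha>, of 1] by auto
  obtain M where M: "0 < M" "\<And>k. mixed_mean p q \<alpha> (bohr_lift (A k)) \<le> M"
    using mixed_Cauchy_bounded[OF p q \<alpha> AD AC] by metis
  \<comment> \<open>One disc contains all values of the \<open>A k\<close> and of f on Re s >= 1,
    and there the Taylor polynomials converge uniformly.\<close>
  define R where "R = (C * M) powr (1 / q)"
  have bd: "norm (dirichlet_eval (A k) s) \<le> R" if s: "1 \<le> Re s" for k s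
  proof -
    have "norm (dirichlet_eval (A k) s) powr q \<le> C * M"
      using C(2)[OF AD s] mult_left_mono[OF M(2), of C k] C(1) by (meson less_imp_le order_trans)
    then have "(norm (dirichlet_eval (A k) s) powr q) powr (1 / q) \<le> R"
      unfolding R_def using q by (intro powr_mono2) auto
    then show ?thesis using q by (simp add: powr_powr)
  qed
  have bdf: "norm (f s) \<le> R" if s: "1 \<le> Re s" for s
    by (rule LIMSEQ_le_const2[OF tendsto_norm[OF Alim]]) (use s bd in auto)
  have ulA: "uniform_limit {s. 1 \<le> Re s} (\<lambda>k s. dirichlet_eval (A k) s) f sequentially"
    by (rule mixed_approx_uniform_limit[OF p q \<alpha> A]) simp
  have ulB: "uniform_limit {s. 1 \<le> Re s} (\<lambda>k s. dirichlet_eval (B k) s) (superposition \<phi> f) sequentially"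
    by (rule mixed_approx_uniform_limit[OF u v \<beta> B]) simp
  have uc: "uniformly_continuous_on (cball 0 R) \<phi>"
    using hol by (intro compact_uniformly_continuous) (auto intro: holomorphic_on_imp_continuous_on holomorphic_on_subset)
  have eQ: "dirichlet_eval (Q k) s = poly (taylor_poly \<phi> k) (dirichlet_eval (A k) s)" for k s
    by (simp add: dirichlet_eval_eq Q AD)
  have "uniform_limit {s. 1 \<le> Re s} (\<lambda>k s. dirichlet_eval (\<lambda>n. Q k n - B k n) s) (\<lambda>_. 0) sequentially"
  proof (rule uniform_limitI)
    fix \<epsilon> :: real assume \<epsilon>: "0 < \<epsilon>"
    obtain d where d: "0 < d" "\<And>x y. x \<in> cball 0 R \<Longrightarrow> y \<in> cball 0 R \<Longrightarrow> dist x y < d \<Longrightarrow> dist (\<phi> x) (\<phi> y) < \<epsilon>/3"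
      using uc \<epsilon> unfolding uniformly_continuous_on_def by (metis dist_commute divide_pos_pos zero_less_numeral)
    have "\<forall>\<^sub>F k in sequentially. \<forall>x\<in>cball 0 R. dist (poly (taylor_poly \<phi> k) x) (\<phi> x) < \<epsilon>/3"
      by (rule uniform_limitD[OF taylor_uniform_limit[OF hol]]) (use \<epsilon> in simp)
    moreover have "\<forall>\<^sub>F k in sequentially. \<forall>s\<in>{s. 1 \<le> Re s}. dist (dirichlet_eval (A k) s) (f s) < d"
      using uniform_limitD[OF ulA d(1)] .
    moreover have "\<forall>\<^sub>F k in sequentially. \<forall>s\<in>{s. 1 \<le> Re s}. dist (dirichlet_eval (B k) s) (superposition \<phi> f s) < \<epsilon>/3"
      by (rule uniform_limitD[OF ulB]) (use \<epsilon> in simp)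
    ultimately show "\<forall>\<^sub>F k in sequentially. \<forall>s\<in>{s. 1 \<le> Re s}. dist (dirichlet_eval (\<lambda>n. Q k n - B k n) s) 0 < \<epsilon>"
    proof eventually_elim
      case (elim k)
      show ?case
      proof
        fix s assume s: "s \<in> {s. 1 \<le> Re s}"
        let ?x = "dirichlet_eval (A k) s"
        have "dist (poly (taylor_poly \<phi> k) ?x) (\<phi> ?x) < \<epsilon>/3" using elim(1) bd s by auto
        moreover have "dist (\<phi> ?x) (\<phi> (f s)) < \<epsilon>/3" using elim(2) bd bdf s by (intro d) auto
        moreover have "dist (dirichlet_eval (B k) s) (\<phi> (f s)) < \<epsilon>/3" using elim(3) s by (auto simp: superposition_def)
        ultimately have "dist (dirichlet_eval (Q k) s) (dirichlet_eval (B k) s) < \<epsilon>"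
          unfolding eQ using dist_triangle[of "poly (taylor_poly \<phi> k) ?x" "dirichlet_eval (B k) s" "\<phi> ?x"]
            dist_triangle[of "\<phi> ?x" "dirichlet_eval (B k) s" "\<phi> (f s)"] by (simp add: dist_commute)
        then show "dist (dirichlet_eval (\<lambda>n. Q k n - B k n) s) 0 < \<epsilon>"
          using Q(1) BD by (simp add: dirichlet_eval_diff dist_norm)
      qed
    qed
  qed
  then show ?thesis
    by (rule dirichlet_coeff_tendsto_0[rotated]) (intro dirichlet_polys_diff Q(1) BD)
qed

section \<open>Isolating a Taylor monomial\<close>

lemma torus_mean_diff_le:
  assumes G: "G \<in> torus_polys" and H: "H \<in> torus_polys" and u: "0 < u"
  shows "torus_mean u (\<lambda>z. G z - H z) \<le> 2 powr u * (torus_mean u G + torus_mean u H)"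
proof -
  note int = integrable_torus_poly[OF G u] integrable_torus_poly[OF H u] integrable_torus_poly[OF torus_polys_diff[OF G H] u]
  have "torus_mean u (\<lambda>z. G z - H z) \<le> (\<integral>z. 2 powr u * (norm (G z) powr u + norm (H z) powr u) \<partial>torus_measure)"
    unfolding torus_mean_def
  proof (rule integral_mono[OF int(3)])
    fix z
    have "norm (G z - H z) powr u \<le> (norm (G z) + norm (H z)) powr u"
      using u norm_triangle_ineq4[of "G z" "H z"] by (intro powr_mono2) auto
    also have "\<dots> \<le> 2 powr u * (norm (G z) powr u + norm (H z) powr u)"
      using u by (intro powr_add_le_2) auto
    finally show "norm (G z - H z) powr u \<le> 2 powr u * (norm (G z) powr u + norm (H z) powr u)" .
  qed (use int in auto)
  also have "\<dots> = 2 powr u * (torus_mean u G + torus_mean u H)"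
    using int by (simp add: torus_mean_def)
  finally show ?thesis .
qed

lemma hardy_mean_diff_le:
  assumes "G \<in> torus_polys" "H \<in> torus_polys" "0 < u"
  shows "hardy_mean u (\<lambda>z. G z - H z) \<sigma> \<le> 2 powr u * (hardy_mean u G \<sigma> + hardy_mean u H \<sigma>)"
  using torus_mean_diff_le[OF torus_polys_shift[OF assms(1)] torus_polys_shift[OF assms(2)] assms(3)]
  by (simp add: hardy_mean_def)

text \<open>Two projections composed: to the primes in V, which is contractive, and to exponent m of
  the prime J, which costs a factor depending on u and m only.\<close>

definition extract_part :: "nat set \<Rightarrow> nat \<Rightarrow> nat \<Rightarrow> (nat \<Rightarrow> complex) \<Rightarrow> nat \<Rightarrow> complex" where
  "extract_part V J m a = (\<lambda>n. if prime_exponent J n = m then (if supported_on V n then a n else 0) else 0)"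

lemma extract_part_in_polys: "a \<in> dirichlet_polys \<Longrightarrow> extract_part V J m a \<in> dirichlet_polys"
  unfolding extract_part_def by (intro dirichlet_polys_restrict)

lemma hardy_mean_eq_torus_mean_shift:
  "a \<in> dirichlet_polys \<Longrightarrow> hardy_mean p (bohr_lift a) \<sigma> = torus_mean p (bohr_lift (dirichlet_shift \<sigma> a))"
  unfolding hardy_mean_def by (intro arg_cong[where f = "torus_mean p"] ext) (simp add: bohr_lift_shift)

lemma hardy_mean_extract_part_le:
  assumes a: "a \<in> dirichlet_polys" and u: "0 < u"
  shows "hardy_mean u (bohr_lift (extract_part V J m a)) \<sigma> \<le> (2 * 2 powr u) ^ m * hardy_mean u (bohr_lift a) \<sigma>"
proof -
  let ?b = "\<lambda>n. if supported_on V n then a n else 0"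
  have b: "?b \<in> dirichlet_polys" by (rule dirichlet_polys_restrict[OF a])
  have e: "dirichlet_shift \<sigma> (extract_part V J m a) = (\<lambda>n. if prime_exponent J n = m then dirichlet_shift \<sigma> ?b n else 0)"
    by (auto simp: dirichlet_shift_def extract_part_def)
  have "hardy_mean u (bohr_lift (extract_part V J m a)) \<sigma> \<le> (2 * 2 powr u) ^ m * hardy_mean u (bohr_lift ?b) \<sigma>"
    unfolding hardy_mean_eq_torus_mean_shift[OF extract_part_in_polys[OF a]] hardy_mean_eq_torus_mean_shift[OF b] e
    by (rule torus_mean_exponent_part_le[OF dirichlet_shift_in_polys[OF b] u])
  also have "\<dots> \<le> (2 * 2 powr u) ^ m * hardy_mean u (bohr_lift a) \<sigma>"
    by (intro mult_left_mono hardy_mean_supported_on_le a u) auto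
  finally show ?thesis .
qed

lemma bohr_lift_extract_part:
  assumes Q: "Q \<in> dirichlet_polys" "\<And>z. bohr_lift Q z = poly (taylor_poly \<phi> k) (S z)"
    and S: "\<And>z. S (\<lambda>j. of_real (if j \<in> V then 1 else 0) * z j) = F z"
    and F: "\<And>z. F z = z J * g z" "\<And>z x. g (z(J := x)) = g z" and m: "m < k"
  shows "bohr_lift (extract_part V J m Q) z = taylor_coeff \<phi> m * F z ^ m"
proof -
  let ?b = "\<lambda>n. if supported_on V n then Q n else 0"
  let ?h = "\<Sum>n<k. monom (taylor_coeff \<phi> n * g z ^ n) n"
  have b: "?b \<in> dirichlet_polys" by (rule dirichlet_polys_restrict[OF Q(1)])
  have h: "bohr_lift ?b (z(J := x)) = poly ?h x" for x
  proof -
    have 1: "bohr_lift ?b (z(J := x)) = poly (taylor_poly \<phi> k) (F (z(J := x)))"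
      unfolding bohr_lift_supported_on[OF Q(1)] Q(2) S[of "z(J := x)"] ..
    have 2: "F (z(J := x)) = x * g z" unfolding F(1)[of "z(J := x)"] F(2) by simp
    show ?thesis unfolding 1 2
      by (simp add: poly_taylor_poly poly_sum poly_monom power_mult_distrib mult_ac)
  qed
  have "bohr_lift (extract_part V J m Q) (z(J := z J)) = z J ^ m * coeff ?h m"
    unfolding extract_part_def by (rule bohr_lift_exponent_part[OF b h])
  also have "coeff ?h m = taylor_coeff \<phi> m * g z ^ m"
    using m by (simp add: coeff_sum)
  finally show ?thesis by (simp add: F power_mult_distrib)
qed

lemma torus_mean_cmult: "torus_mean u (\<lambda>z. c * G z) = norm c powr u * torus_mean u G"
  by (simp add: torus_mean_def norm_mult powr_mult)

lemma hardy_mean_cmult: "hardy_mean u (\<lambda>z. c * G z) \<sigma> = norm c powr u * hardy_mean u G \<sigma>"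
  by (simp add: hardy_mean_def torus_mean_cmult)

text \<open>Lower bound for \<open>\<phi> \<circ> f\<close> when \<open>f\<close> is a sum of humps \<open>F i\<close> living on disjoint sets of primes.
  Projecting \<open>\<phi> \<circ> f\<close> to the primes in \<open>V i\<close> gives \<open>\<phi> \<circ> F i\<close>, and since \<open>F i\<close> is linear in the prime
  \<open>J i\<close>, the part of degree \<open>m\<close> in that prime is the Taylor monomial of degree \<open>m\<close> alone.\<close>

lemma superposition_hump_bound:
  fixes F g :: "nat \<Rightarrow> (nat \<Rightarrow> complex) \<Rightarrow> complex"
  assumes p: "0 < p" and q: "0 < q" and u: "0 < u" and v: "0 < v" and \<alpha>: "-1 < \<alpha>" and \<beta>: "-1 < \<beta>"
    and maps: "superposition \<phi> ` mixed_space p q \<alpha> \<subseteq> mixed_space u v \<beta>"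
    and A: "mixed_approx p q \<alpha> A f" "\<And>k z. bohr_lift (A k) z = (\<Sum>i<k. F i z)"
    and V: "\<And>i. finite (V i)" "\<And>i j. J j \<in> V i \<longleftrightarrow> i = j"
    and F: "\<And>i. F i \<in> torus_polys" "\<And>i z. F i z = z (J i) * g i z" "\<And>i z x. g i (z(J i := x)) = g i z"
      "\<And>i z. F i (\<lambda>j. of_real (if j \<in> V i then 1 else 0) * z j) = F i z"
  shows "\<exists>G\<in>borel_measurable borel. (\<integral>\<^sup>+\<sigma>. G \<sigma> \<partial>weight_measure \<beta>) < \<infinity> \<and>
    (\<forall>i. \<forall>\<sigma>>0. ennreal ((norm (taylor_coeff \<phi> m) powr u * hardy_mean u (\<lambda>z. F i z ^ m) \<sigma>) powr (v / u)) \<le> G \<sigma>)"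
proof -
  have hol: "\<phi> holomorphic_on UNIV" by (rule superposition_entire[OF p q u v \<beta> maps])
  have AD: "\<And>k. A k \<in> dirichlet_polys" using A(1) mixed_approx_iff[OF p q] by auto
  have "superposition \<phi> f \<in> mixed_space u v \<beta>" using maps A(1) by (auto simp: mixed_space_def)
  then obtain B where B: "mixed_approx u v \<beta> B (superposition \<phi> f)" by (auto simp: mixed_space_def)
  have BD: "\<And>k. B k \<in> dirichlet_polys" and BC: "mixed_Cauchy u v \<beta> B" using B mixed_approx_iff[OF u v] by auto
  obtain M where M: "0 < M" "\<And>k. mixed_mean u v \<beta> (bohr_lift (B k)) \<le> M"
    using mixed_Cauchy_bounded[OF u v \<beta> BD BC] by metis
  have TQ: "(\<lambda>z. poly (taylor_poly \<phi> k) (bohr_lift (A k) z)) \<in> torus_polys" for k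
    by (intro torus_polys_poly bohr_lift_in_torus_polys AD)
  obtain Q where Q: "\<And>k. Q k \<in> dirichlet_polys" "\<And>k. bohr_lift (Q k) = (\<lambda>z. poly (taylor_poly \<phi> k) (bohr_lift (A k) z))"
    using torus_poly_coeffs[of "\<lambda>k z. poly (taylor_poly \<phi> k) (bohr_lift (A k) z)", OF TQ] by metis
  have coeff: "(\<lambda>k. Q k n - B k n) \<longlonglongrightarrow> 0" for n
    by (rule superposition_coeff_tendsto[OF p q u v \<alpha> \<beta> hol A(1) B Q])
  define \<kappa> where "\<kappa> = v / u"
  have \<kappa>: "0 < \<kappa>" using u v by (simp add: \<kappa>_def)
  define L where "L = (2 * 2 powr u) ^ m"
  have L: "0 \<le> L" by (simp add: L_def)
  \<comment> \<open>The lower limit avoids constructing means of the limit function. The single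
    function \<open>G\<close> dominates the monomials of all humps at once, and Fatou's lemma bounds
    its integral.\<close>
  define G where "G \<sigma> = liminf (\<lambda>k. ennreal ((L * hardy_mean u (bohr_lift (B k)) \<sigma>) powr \<kappa>))" for \<sigma>
  have Gm: "(\<lambda>\<sigma>. ennreal ((L * hardy_mean u (bohr_lift (B k)) \<sigma>) powr \<kappa>)) \<in> borel_measurable borel" for k
    using hardy_mean_measurable[OF bohr_lift_in_torus_polys[OF BD] u] by measurable
  then have GM: "G \<in> borel_measurable borel" unfolding G_def by measurable
  have "(\<integral>\<^sup>+\<sigma>. G \<sigma> \<partial>weight_measure \<beta>) \<le> liminf (\<lambda>k. \<integral>\<^sup>+\<sigma>. ennreal ((L * hardy_mean u (bohr_lift (B k)) \<sigma>) powr \<kappa>) \<partial>weight_measure \<beta>)"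
    unfolding G_def by (rule nn_integral_liminf) (use Gm in \<open>simp cong: measurable_cong_sets\<close>)
  also have "\<dots> \<le> liminf (\<lambda>k::nat. ennreal (L powr \<kappa> * M))"
  proof (intro Liminf_mono always_eventually allI)
    fix k
    have "(\<integral>\<^sup>+\<sigma>. ennreal ((L * hardy_mean u (bohr_lift (B k)) \<sigma>) powr \<kappa>) \<partial>weight_measure \<beta>) =
      (\<integral>\<^sup>+\<sigma>. ennreal (L powr \<kappa>) * ennreal (hardy_mean u (bohr_lift (B k)) \<sigma> powr (v / u)) \<partial>weight_measure \<beta>)"
      using L by (simp add: powr_mult ennreal_mult \<kappa>_def)
    also have "\<dots> = ennreal (L powr \<kappa>) * (\<integral>\<^sup>+\<sigma>. ennreal (hardy_mean u (bohr_lift (B k)) \<sigma> powr (v / u)) \<partial>weight_measure \<beta>)"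
      using hardy_mean_measurable[OF bohr_lift_in_torus_polys[OF BD] u, of k] by (intro nn_integral_cmult) (simp cong: measurable_cong_sets)
    also have "\<dots> = ennreal (L powr \<kappa>) * ennreal (mixed_mean u v \<beta> (bohr_lift (B k)))"
      using BD by (simp add: nn_integral_hardy_mean u v \<beta>)
    also have "\<dots> \<le> ennreal (L powr \<kappa> * M)"
      using M by (simp add: ennreal_mult[symmetric] ennreal_leI mult_left_mono)
    finally show "(\<integral>\<^sup>+\<sigma>. ennreal ((L * hardy_mean u (bohr_lift (B k)) \<sigma>) powr \<kappa>) \<partial>weight_measure \<beta>) \<le> ennreal (L powr \<kappa> * M)" .
  qed
  also have "\<dots> < \<infinity>" by (simp add: Liminf_const)
  finally have Gfin: "(\<integral>\<^sup>+\<sigma>. G \<sigma> \<partial>weight_measure \<beta>) < \<infinity>" .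
  have "ennreal ((norm (taylor_coeff \<phi> m) powr u * hardy_mean u (\<lambda>z. F i z ^ m) \<sigma>) powr \<kappa>) \<le> G \<sigma>" if \<sigma>: "0 < \<sigma>" for i \<sigma>
  proof -
    define T where "T z = taylor_coeff \<phi> m * F i z ^ m" for z
    have TP: "T \<in> torus_polys" unfolding T_def by (intro torus_polys_mult torus_polys_power F) auto
    \<comment> \<open>From this index on, hump i is among the summands and the Taylor polynomial
      contains the monomial of degree m.\<close>
    define k0 where "k0 = Suc (i + m)"
    define E where "E a = extract_part (V i) (J i) m a" for a
    have ED: "E a \<in> dirichlet_polys" if "a \<in> dirichlet_polys" for a
      unfolding E_def by (rule extract_part_in_polys[OF that])
    have sumF: "(\<Sum>l<k. F l (\<lambda>j. of_real (if j \<in> V i then 1 else 0) * z j)) = F i z" if "i < k" for k z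
    proof -
      have "F l (\<lambda>j. of_real (if j \<in> V i then 1 else 0) * z j) = (if l = i then F i z else 0)" for l
      proof (cases "l = i")
        case False
        then have "J l \<notin> V i" using V(2)[of l i] by simp
        then show ?thesis using False by (simp add: F(2)[of l])
      qed (simp add: F(4))
      then show ?thesis using that by simp
    qed
    have EQ: "bohr_lift (E (Q k)) = T" if k: "k0 \<le> k" for k
    proof
      fix z
      show "bohr_lift (E (Q k)) z = T z"
        unfolding E_def T_def
      proof (rule bohr_lift_extract_part[where F = "F i" and g = "g i"])
        show "bohr_lift (Q k) z = poly (taylor_poly \<phi> k) (\<Sum>l<k. F l z)" for z
          by (simp add: Q A)
        show "(\<Sum>l<k. F l (\<lambda>j. of_real (if j \<in> V i then 1 else 0) * z j)) = F i z" for z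
          by (rule sumF) (use k in \<open>simp add: k0_def\<close>)
      qed (use Q(1) F(2,3) k in \<open>auto simp: k0_def\<close>)
    qed
    define R where "R k = (\<lambda>n. E (Q (k + k0)) n - E (B (k + k0)) n)" for k
    have RD: "R k \<in> dirichlet_polys" for k unfolding R_def by (intro dirichlet_polys_diff ED Q(1) BD)
    have Rlift: "bohr_lift (R k) = (\<lambda>z. T z - bohr_lift (E (B (k + k0))) z)" for k
      unfolding R_def by (simp add: bohr_lift_diff_fun ED Q(1) BD EQ)
    have Rsupp: "supported_on (V i) n" if "R k n \<noteq> 0" for k n
      using that by (auto simp: R_def E_def extract_part_def split: if_splits)
    have Rcoeff: "(\<lambda>k. R k n) \<longlonglongrightarrow> 0" for n
    proof (cases "prime_exponent (J i) n = m \<and> supported_on (V i) n")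
      case True
      then show ?thesis using LIMSEQ_ignore_initial_segment[OF coeff[of n], of k0]
        by (simp add: R_def E_def extract_part_def)
    next
      case False
      then have "R k n = 0" for k by (auto simp: R_def E_def extract_part_def)
      then show ?thesis by simp
    qed
    have EB: "hardy_mean u (bohr_lift (E (B k))) \<tau> \<le> L * hardy_mean u (bohr_lift (B k)) \<tau>" for k \<tau>
      unfolding E_def L_def by (rule hardy_mean_extract_part_le[OF BD u])
    have Rbdd: "\<exists>b. \<forall>k. hardy_mean u (bohr_lift (R k)) \<tau> \<le> b" if \<tau>: "0 < \<tau>" for \<tau>
    proof -
      have "\<exists>b. \<forall>k. hardy_mean u (bohr_lift (B k)) \<tau> \<le> b"
        by (rule hardy_mean_bounded[OF u v \<beta> _ M(2) \<tau>]) (simp add: BD)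
      then obtain b where b: "\<And>k. hardy_mean u (bohr_lift (B k)) \<tau> \<le> b" by blast
      have "hardy_mean u (bohr_lift (R k)) \<tau> \<le> 2 powr u * (hardy_mean u T \<tau> + L * b)" for k
      proof -
        have "hardy_mean u (bohr_lift (R k)) \<tau> \<le> 2 powr u * (hardy_mean u T \<tau> + hardy_mean u (bohr_lift (E (B (k + k0)))) \<tau>)"
          unfolding Rlift by (intro hardy_mean_diff_le TP bohr_lift_in_torus_polys ED BD u)
        also have "\<dots> \<le> 2 powr u * (hardy_mean u T \<tau> + L * b)"
          using order_trans[OF EB mult_left_mono[OF b L]] by (intro mult_left_mono add_left_mono) auto
        finally show ?thesis .
      qed
      then show ?thesis by blast
    qed
    obtain e where e: "e \<longlonglongrightarrow> 0" "\<And>k z. (\<And>j. norm (z j) \<le> 1) \<Longrightarrow> norm (bohr_lift (R k) (shift_coords \<sigma> z)) \<le> e k"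
    proof (rule uniform_convergence_supported[of R "V i" u \<sigma>])
      show "R k n \<noteq> 0 \<Longrightarrow> supported_on (V i) n" for k n by (rule Rsupp)
      show "0 < \<tau> \<Longrightarrow> \<exists>B. \<forall>k. hardy_mean u (bohr_lift (R k)) \<tau> \<le> B" for \<tau> by (rule Rbdd)
    qed (use RD V(1) u Rcoeff \<sigma> that in blast)+
    have "(\<lambda>k. hardy_mean u (bohr_lift (E (B (k + k0)))) \<sigma>) \<longlonglongrightarrow> hardy_mean u T \<sigma>"
    proof (rule hardy_mean_tendsto[OF u TP _ e(1)])
      show "bohr_lift (E (B (k + k0))) \<in> torus_polys" for k by (intro bohr_lift_in_torus_polys ED BD)
      show "norm (bohr_lift (E (B (k + k0))) (shift_coords \<sigma> z) - T (shift_coords \<sigma> z)) \<le> e k" if "\<And>j. norm (z j) \<le> 1" for k z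
        using e(2)[OF that, of k] by (simp add: Rlift norm_minus_commute)
    qed
    then have lim: "(\<lambda>k. ennreal (hardy_mean u (bohr_lift (E (B (k + k0)))) \<sigma> powr \<kappa>)) \<longlonglongrightarrow> ennreal (hardy_mean u T \<sigma> powr \<kappa>)"
      using \<kappa> by (intro tendsto_ennrealI tendsto_powr' tendsto_const) auto
    have "ennreal (hardy_mean u T \<sigma> powr \<kappa>) = liminf (\<lambda>k. ennreal (hardy_mean u (bohr_lift (E (B (k + k0)))) \<sigma> powr \<kappa>))"
      by (rule lim_imp_Liminf[OF _ lim, symmetric]) simp
    also have "\<dots> \<le> liminf (\<lambda>k. ennreal ((L * hardy_mean u (bohr_lift (B (k + k0))) \<sigma>) powr \<kappa>))"
      using EB \<kappa> by (intro Liminf_mono always_eventually allI ennreal_leI powr_mono2) auto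
    also have "\<dots> = G \<sigma>" unfolding G_def by (rule liminf_shift_k)
    finally show ?thesis by (simp add: T_def[abs_def] hardy_mean_cmult)
  qed
  then show ?thesis using GM Gfin unfolding \<kappa>_def by blast
qed

section \<open>Lacunary sums over primes\<close>

lemma sum_lessThan_diff:
  fixes F :: "nat \<Rightarrow> 'a::ab_group_add"
  shows "k \<le> l \<Longrightarrow> (\<Sum>i<l. F i) - (\<Sum>i<k. F i) = (\<Sum>i=k..<l. F i)"
  by (metis add_diff_cancel_left' lessThan_atLeast0 sum.atLeastLessThan_concat zero_le)

text \<open>The limit function comes from the completeness of the complex numbers: bounded point
  evaluations turn the Cauchy condition for the mixed means into one at each s with Re s >
  1/2.\<close>

lemma mixed_approx_series:
  assumes p: "0 < p" and q: "0 < q" and \<alpha>: "-1 < \<alpha>" and F: "\<And>i. F i \<in> torus_polys"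
    and e: "e \<longlonglongrightarrow> 0" "\<And>k l. k \<le> l \<Longrightarrow> mixed_mean p q \<alpha> (\<lambda>z. \<Sum>i=k..<l. F i z) \<le> e k"
  obtains A f where "mixed_approx p q \<alpha> A f" "\<And>k z. bohr_lift (A k) z = (\<Sum>i<k. F i z)"
proof -
  have "(\<lambda>z. \<Sum>i<k. F i z) \<in> torus_polys" for k by (intro torus_polys_sum F)
  then obtain A where A: "\<And>k. A k \<in> dirichlet_polys" "\<And>k. bohr_lift (A k) = (\<lambda>z. \<Sum>i<k. F i z)"
    using torus_poly_coeffs[of "\<lambda>k z. \<Sum>i<k. F i z"] by metis
  have *: "mixed_mean p q \<alpha> (\<lambda>z. bohr_lift (A l) z - bohr_lift (A k) z) \<le> e k" if "k \<le> l" for k l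
    using e(2)[OF that] by (simp add: A(2) sum_lessThan_diff[OF that])
  have C: "mixed_Cauchy p q \<alpha> A"
    unfolding mixed_Cauchy_def
  proof (intro allI impI)
    fix \<epsilon> :: real assume "0 < \<epsilon>"
    then obtain K where K: "\<And>k. K \<le> k \<Longrightarrow> e k < \<epsilon>"
      using order_tendstoD(2)[OF e(1)] unfolding eventually_sequentially by blast
    show "\<exists>K. \<forall>k\<ge>K. \<forall>l\<ge>K. mixed_mean p q \<alpha> (\<lambda>z. bohr_lift (A k) z - bohr_lift (A l) z) < \<epsilon>"
    proof (intro exI allI impI)
      fix k l assume kl: "K \<le> k" "K \<le> l"
      show "mixed_mean p q \<alpha> (\<lambda>z. bohr_lift (A k) z - bohr_lift (A l) z) < \<epsilon>"
      proof (cases "k \<le> l")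
        case True
        then show ?thesis using *[OF True] K[OF kl(1)] by (subst mixed_mean_minus_commute) simp
      next
        case False
        then show ?thesis using *[of l k] K[OF kl(2)] by simp
      qed
    qed
  qed
  have "convergent (\<lambda>k. dirichlet_eval (A k) s)" if s: "1 / 2 < Re s" for s
  proof (rule Cauchy_convergent, rule metric_CauchyI)
    fix r :: real assume r: "0 < r"
    obtain D where D: "0 < D" "\<And>a s'. a \<in> dirichlet_polys \<Longrightarrow> Re s \<le> Re s' \<Longrightarrow>
      norm (dirichlet_eval a s') powr q \<le> D * mixed_mean p q \<alpha> (bohr_lift a)"
      using mixed_eval_bound[OF p q \<alpha> s] by metis
    have "0 < r powr q / D" using r D(1) by simp
    then obtain K where K: "\<And>k l. K \<le> k \<Longrightarrow> K \<le> l \<Longrightarrow>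
      mixed_mean p q \<alpha> (\<lambda>z. bohr_lift (A k) z - bohr_lift (A l) z) < r powr q / D"
      using C unfolding mixed_Cauchy_def by meson
    show "\<exists>K. \<forall>k\<ge>K. \<forall>l\<ge>K. dist (dirichlet_eval (A k) s) (dirichlet_eval (A l) s) < r"
    proof (intro exI allI impI)
      fix k l assume kl: "K \<le> k" "K \<le> l"
      have "norm (dirichlet_eval (\<lambda>n. A k n - A l n) s) powr q \<le> D * mixed_mean p q \<alpha> (bohr_lift (\<lambda>n. A k n - A l n))"
        by (intro D(2) dirichlet_polys_diff A order_refl)
      also have "\<dots> < D * (r powr q / D)"
        using K[OF kl] D(1) by (intro mult_strict_left_mono) (simp_all add: bohr_lift_diff_fun A(1))
      finally have "norm (dirichlet_eval (A k) s - dirichlet_eval (A l) s) powr q < r powr q"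
        using D(1) by (simp add: dirichlet_eval_diff A(1))
      then have "norm (dirichlet_eval (A k) s - dirichlet_eval (A l) s) < r"
        using powr_mono2[of q r "norm (dirichlet_eval (A k) s - dirichlet_eval (A l) s)"] q r by force
      then show "dist (dirichlet_eval (A k) s) (dirichlet_eval (A l) s) < r" by (simp add: dist_norm)
    qed
  qed
  then have "mixed_approx p q \<alpha> A (\<lambda>s. lim (\<lambda>k. dirichlet_eval (A k) s))"
    unfolding mixed_approx_iff[OF p q] using A(1) C by (auto simp: convergent_LIMSEQ_iff)
  then show ?thesis using A(2) by (intro that) auto
qed

text \<open>The maximum, attained at x = a, is (a/e)^a; this cruder bound is enough.\<close>

lemma powr_exp_le:
  fixes a x :: real
  assumes "0 < a" "0 < x"
  shows "x powr a * exp (- x) \<le> a powr a"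
proof -
  have "ln (x / a) \<le> x / a - 1" using assms by (intro ln_le_minus_one) simp
  then have "a * (ln x - ln a) \<le> a * (x / a - 1)" using assms by (intro mult_left_mono) (auto simp: ln_div)
  then have "a * ln x - x \<le> a * ln a" using assms by (simp add: right_diff_distrib)
  then have "exp (a * ln x - x) \<le> exp (a * ln a)" by simp
  then show ?thesis using assms by (simp add: powr_def exp_diff exp_minus divide_inverse)
qed

text \<open>Telescoping against \<open>\<Psi>(x) = x\<^sup>\<gamma> / (1 + x\<^sup>\<gamma>)\<close>, which is bounded and increases by a fixed
  multiple of \<open>x\<^sup>\<gamma> e\<^sup>-\<^sup>x\<close> between \<open>x/2\<close> and \<open>x\<close>.\<close>

lemma lacunary_exp_sum_le:
  fixes \<gamma> :: real
  assumes \<gamma>: "0 < \<gamma>"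
  obtains C where "0 < C" "\<And>(N :: nat \<Rightarrow> real) n \<sigma>. (\<And>i. 0 < N i) \<Longrightarrow> (\<And>i. 2 * N i \<le> N (Suc i)) \<Longrightarrow> 0 < \<sigma> \<Longrightarrow>
    (\<Sum>i<n. N i powr \<gamma> * exp (- N i * \<sigma>)) \<le> C * \<sigma> powr (-\<gamma>)"
proof -
  define h where "h x = x powr \<gamma> * exp (- x)" for x :: real
  define \<Psi> where "\<Psi> x = x powr \<gamma> / (1 + x powr \<gamma>)" for x :: real
  define \<rho> where "\<rho> = 1 - 2 powr (-\<gamma>)"
  have \<rho>: "0 < \<rho>" using \<gamma> powr_less_mono[of "-\<gamma>" 0 2] by (simp add: \<rho>_def)
  \<comment> \<open>Bounds (1 + x^\<gamma>)^2 exp (-x) / \<rho>, which dominates the ratio of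
    x^\<gamma> exp (-x) to the increment of \<Psi> from x/2 to x.\<close>
  define C where "C = 4 * (1 + (2 * \<gamma>) powr (2 * \<gamma>)) / \<rho>"
  have C: "0 < C" using \<rho> by (auto simp: C_def intro!: divide_pos_pos add_pos_nonneg)
  have \<Psi>0: "0 \<le> \<Psi> x" and \<Psi>1: "\<Psi> x \<le> 1" for x
  proof -
    have "0 < 1 + x powr \<gamma>" by (intro add_pos_nonneg) auto
    then show "0 \<le> \<Psi> x" "\<Psi> x \<le> 1" by (auto simp: \<Psi>_def divide_simps)
  qed
  have \<Psi>mono: "\<Psi> x \<le> \<Psi> y" if "0 \<le> x" "x \<le> y" for x y
  proof -
    have "x powr \<gamma> \<le> y powr \<gamma>" using that \<gamma> by (intro powr_mono2) auto
    moreover have "\<Psi> t = 1 - 1 / (1 + t powr \<gamma>)" for t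
    proof -
      have "1 + t powr \<gamma> \<noteq> 0" using powr_ge_zero[of t \<gamma>] by linarith
      then show ?thesis by (simp add: \<Psi>_def field_simps)
    qed
    ultimately show ?thesis by (simp add: frac_le add_pos_nonneg)
  qed
  have key: "h x \<le> C * (\<Psi> x - \<Psi> (x / 2))" if x: "0 < x" for x
  proof -
    define y where "y = x powr \<gamma>"
    define c where "c = 2 powr (-\<gamma>)"
    have y: "0 < y" using x by (simp add: y_def)
    have c: "0 < c" "c < 1" using \<rho> by (auto simp: c_def \<rho>_def)
    have y2: "(x / 2) powr \<gamma> = y * c" 
      using x unfolding y_def c_def powr_minus_divide by (simp add: powr_divide)
    have "\<Psi> x - \<Psi> (x / 2) = y * (1 - c) / ((1 + y) * (1 + y * c))"
    proof -
      have "0 < y * c" using y c by simp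
      then have nz: "1 + y \<noteq> 0" "1 + y * c \<noteq> 0" using y by linarith+
      show ?thesis unfolding \<Psi>_def y2 y_def[symmetric] diff_frac_eq[OF nz] by (simp add: algebra_simps)
    qed
    also have "\<dots> \<ge> y * (1 - c) / ((1 + y) * (1 + y))"
    proof -
      have "y * c \<le> y * 1" using y c by (intro mult_left_mono) auto
      then have "(1 + y) * (1 + y * c) \<le> (1 + y) * (1 + y)" using y c by (intro mult_left_mono) auto
      then show ?thesis using y c by (intro divide_left_mono mult_nonneg_nonneg mult_pos_pos add_pos_pos) auto
    qed
    finally have 1: "y * \<rho> / ((1 + y) * (1 + y)) \<le> \<Psi> x - \<Psi> (x / 2)" by (simp add: \<rho>_def c_def)
    have "(1 + y) * (1 + y) * exp (- x) \<le> 4 * (1 + (2 * \<gamma>) powr (2 * \<gamma>))"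
    proof -
      have "(1 + y) * (1 + y) \<le> 4 * (1 + y * y)"
        using y sum_squares_bound[of 1 y] by (simp add: algebra_simps power2_eq_square)
      then have "(1 + y) * (1 + y) * exp (- x) \<le> 4 * (1 + y * y) * exp (- x)" by (intro mult_right_mono) auto
      also have "y * y = x powr (2 * \<gamma>)" by (simp add: y_def powr_add[symmetric])
      also have "4 * (1 + x powr (2 * \<gamma>)) * exp (- x) = 4 * (exp (- x) + x powr (2 * \<gamma>) * exp (- x))"
        by (simp add: algebra_simps)
      also have "\<dots> \<le> 4 * (1 + (2 * \<gamma>) powr (2 * \<gamma>))"
        using powr_exp_le[of "2 * \<gamma>" x] x \<gamma> by (intro mult_left_mono add_mono) auto
      finally show ?thesis .
    qed
    then have "(1 + y) * (1 + y) * exp (- x) * y \<le> C * \<rho> * y"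
      using \<rho> y by (intro mult_right_mono) (auto simp: C_def)
    then have "y * exp (- x) \<le> C * (y * \<rho> / ((1 + y) * (1 + y)))"
      using y by (simp add: field_simps add_pos_pos)
    also have "\<dots> \<le> C * (\<Psi> x - \<Psi> (x / 2))" using 1 C by (intro mult_left_mono) auto
    finally show ?thesis by (simp add: h_def y_def)
  qed
  show ?thesis
  proof (rule that[OF C])
    fix N :: "nat \<Rightarrow> real" and n and \<sigma> :: real
    assume N: "\<And>i. 0 < N i" "\<And>i. 2 * N i \<le> N (Suc i)" and \<sigma>: "0 < \<sigma>"
    have x: "0 < N i * \<sigma>" for i using N(1) \<sigma> by simp
    have tel: "(\<Sum>i<Suc n. h (N i * \<sigma>)) \<le> C * \<Psi> (N n * \<sigma>)" for n
    proof (induction n)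
      case 0
      have "h (N 0 * \<sigma>) \<le> C * (\<Psi> (N 0 * \<sigma>) - \<Psi> (N 0 * \<sigma> / 2))" by (rule key[OF x])
      also have "\<dots> \<le> C * \<Psi> (N 0 * \<sigma>)" using \<Psi>0 C by (intro mult_left_mono) auto
      finally show ?case by simp
    next
      case (Suc n)
      have "h (N (Suc n) * \<sigma>) \<le> C * (\<Psi> (N (Suc n) * \<sigma>) - \<Psi> (N (Suc n) * \<sigma> / 2))" by (rule key[OF x])
      \<comment> \<open>Lacunarity: half of \<open>N (Suc n) * \<sigma>\<close> is still at least
        \<open>N n * \<sigma>\<close>.\<close>
      also have "\<dots> \<le> C * (\<Psi> (N (Suc n) * \<sigma>) - \<Psi> (N n * \<sigma>))"
        using C mult_right_mono[OF N(2)[of n], of \<sigma>] \<sigma> N(1)[of n]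
        by (intro mult_left_mono diff_left_mono \<Psi>mono) (auto simp: field_simps)
      finally show ?case using Suc by (simp add: algebra_simps)
    qed
    have "(\<Sum>i<n. h (N i * \<sigma>)) \<le> C"
    proof (cases n)
      case (Suc k)
      have "C * \<Psi> (N k * \<sigma>) \<le> C * 1" using C \<Psi>1 by (intro mult_left_mono) auto
      then show ?thesis using tel[of k] by (simp add: Suc)
    qed (use C in simp)
    moreover have "h (N i * \<sigma>) = \<sigma> powr \<gamma> * (N i powr \<gamma> * exp (- N i * \<sigma>))" for i
      using N(1)[of i] \<sigma> by (simp add: h_def powr_mult)
    ultimately have "\<sigma> powr \<gamma> * (\<Sum>i<n. N i powr \<gamma> * exp (- N i * \<sigma>)) \<le> C"
      by (simp add: sum_distrib_left)
    then show "(\<Sum>i<n. N i powr \<gamma> * exp (- N i * \<sigma>)) \<le> C * \<sigma> powr (-\<gamma>)"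
      using \<sigma> by (simp add: powr_minus field_simps)
  qed
qed

section \<open>Mixed means of lacunary prime sums\<close>

lemma sum_powr_le_powr_sum:
  fixes x :: "'i \<Rightarrow> real"
  assumes "finite I" "\<And>i. i \<in> I \<Longrightarrow> 0 \<le> x i" "0 < q" "q \<le> 1"
  shows "(\<Sum>i\<in>I. x i) powr q \<le> (\<Sum>i\<in>I. x i powr q)"
  using assms(1,2)
proof (induction I)
  case (insert i I)
  have add: "(a + b) powr q \<le> a powr q + b powr q" if "0 \<le> a" "0 \<le> b" for a b :: real
  proof (cases "a + b = 0")
    case False
    then have ab: "0 < a + b" using that by simp
    have le: "t \<le> t powr q" if "0 \<le> t" "t \<le> 1" for t :: real
    proof (cases "t = 0")
      case False
      then show ?thesis using powr_mono'[of q 1 t] assms that by simp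
    qed simp
    have "1 = a / (a + b) + b / (a + b)" using ab by (simp flip: add_divide_distrib)
    also have "\<dots> \<le> (a / (a + b)) powr q + (b / (a + b)) powr q"
      using that ab by (intro add_mono le) auto
    also have "\<dots> = (a powr q + b powr q) / (a + b) powr q" using that ab by (simp add: powr_divide add_divide_distrib)
    finally show ?thesis using ab by (simp add: field_simps)
  qed (use that in auto)
  have "(x i + (\<Sum>i\<in>I. x i)) powr q \<le> x i powr q + (\<Sum>i\<in>I. x i) powr q"
    using insert.prems by (intro add sum_nonneg) auto
  with insert show ?case by simp
qed (use assms in simp)

text \<open>Concavity of t^(1/q) with respect to the weights b, again through the tangent at 1;
  \<open>Y\<close> is the weighted average of the x i^q.\<close>

lemma sum_powr_Holder:
  fixes x b :: "'i \<Rightarrow> real"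
  assumes I: "finite I" "\<And>i. i \<in> I \<Longrightarrow> 0 \<le> x i" "\<And>i. i \<in> I \<Longrightarrow> 0 \<le> b i" and q: "1 \<le> q"
  shows "(\<Sum>i\<in>I. x i * b i) powr q \<le> (\<Sum>i\<in>I. x i powr q * b i) * (\<Sum>i\<in>I. b i) powr (q - 1)"
proof -
  define X where "X = (\<Sum>i\<in>I. x i powr q * b i)"
  define b' where "b' = (\<Sum>i\<in>I. b i)"
  define S where "S = (\<Sum>i\<in>I. x i * b i)"
  have nonneg: "0 \<le> X" "0 \<le> b'" "0 \<le> S" using I by (auto simp: X_def b'_def S_def intro!: sum_nonneg)
  show ?thesis
  proof (cases "X = 0 \<or> b' = 0")
    case True
    have "x i * b i = 0" if "i \<in> I" for i
      using True
    proof
      assume "X = 0"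
      then have "x i powr q * b i = 0" using I that by (simp add: X_def sum_nonneg_eq_0_iff)
      then show ?thesis by auto
    next
      assume "b' = 0"
      then have "b i = 0" using I that by (simp add: b'_def sum_nonneg_eq_0_iff)
      then show ?thesis by simp
    qed
    then have "S = 0" unfolding S_def by (rule sum.neutral[rule_format])
    then show ?thesis using nonneg by (simp add: S_def[symmetric] X_def[symmetric])
  next
    case False
    then have pos: "0 < X" "0 < b'" using nonneg by auto
    define \<theta> where "\<theta> = 1 / q"
    have \<theta>: "0 < \<theta>" "\<theta> \<le> 1" using q by (auto simp: \<theta>_def)
    have tangent: "t powr \<theta> \<le> \<theta> * t + (1 - \<theta>)" if "0 \<le> t" for t :: real
    proof (cases "t = 0")
      case False
      then show ?thesis using Youngs_inequality_0[of \<theta> "1 - \<theta>" t 1] \<theta> that by simp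
    qed (use \<theta> in simp)
    define Y where "Y = X / b'"
    have Y: "0 < Y" using pos by (simp add: Y_def)
    have "S / Y powr \<theta> = (\<Sum>i\<in>I. (x i powr q / Y) powr \<theta> * b i)"
      unfolding S_def sum_divide_distrib
      using I(2) q Y by (intro sum.cong refl) (simp add: powr_divide powr_powr \<theta>_def)
    also have "\<dots> \<le> (\<Sum>i\<in>I. (\<theta> * (x i powr q / Y) + (1 - \<theta>)) * b i)"
      using I Y by (intro sum_mono mult_right_mono tangent) auto
    also have "\<dots> = \<theta> * (X / Y) + (1 - \<theta>) * b'"
    proof -
      have "(\<Sum>i\<in>I. (\<theta> * (x i powr q / Y) + (1 - \<theta>)) * b i) = (\<Sum>i\<in>I. \<theta> * ((x i powr q * b i) / Y) + (1 - \<theta>) * b i)"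
        by (intro sum.cong refl) (simp add: distrib_right)
      then show ?thesis unfolding sum.distrib X_def b'_def sum_divide_distrib sum_distrib_left .
    qed
    also have "\<dots> = b'" using pos by (simp add: Y_def algebra_simps)
    finally have "S \<le> b' * Y powr \<theta>" using Y by (simp add: field_simps)
    then have "S powr q \<le> (b' * Y powr \<theta>) powr q" using nonneg q by (intro powr_mono2) auto
    also have "\<dots> = b' powr q * Y" using pos Y q by (simp add: powr_mult powr_powr \<theta>_def)
    also have "\<dots> = X * b' powr (q - 1)" using pos by (simp add: Y_def powr_diff)
    finally show ?thesis by (simp add: S_def X_def b'_def)
  qed
qed

text \<open>The prescribed lower bound \<psi> lets powers of the logarithms beat a given decay. At
  the endpoint of the weight condition lacunarity alone is enough.\<close>

lemma exists_lacunary_primes: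
  fixes \<psi> :: "nat \<Rightarrow> real"
  obtains J where "\<And>i. \<psi> i \<le> ln (real (prime_at (J i)))" "\<And>i. 1 \<le> ln (real (prime_at (J i)))"
    "\<And>i. 2 * ln (real (prime_at (J i))) \<le> ln (real (prime_at (J (Suc i))))"
proof -
  have unbounded: "\<exists>j. X \<le> ln (real (prime_at j))" for X :: real
  proof -
    have "exp X \<le> real (prime_at (nat \<lceil>exp X\<rceil>))"
      using le_prime_at[of "nat \<lceil>exp X\<rceil>"] by linarith
    then have "X \<le> ln (real (prime_at (nat \<lceil>exp X\<rceil>)))" by (simp add: ln_ge_iff)
    then show ?thesis ..
  qed
  have "\<exists>J. \<forall>i. (\<psi> i \<le> ln (real (prime_at (J i))) \<and> 1 \<le> ln (real (prime_at (J i)))) \<and>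
    2 * ln (real (prime_at (J i))) \<le> ln (real (prime_at (J (Suc i))))"
  proof (rule dependent_nat_choice)
    show "\<exists>j. \<psi> 0 \<le> ln (real (prime_at j)) \<and> 1 \<le> ln (real (prime_at j))"
      using unbounded[of "max (\<psi> 0) 1"] by auto
    fix x i
    show "\<exists>y. (\<psi> (Suc i) \<le> ln (real (prime_at y)) \<and> 1 \<le> ln (real (prime_at y))) \<and>
      2 * ln (real (prime_at x)) \<le> ln (real (prime_at y))"
      using unbounded[of "max (max (\<psi> (Suc i)) 1) (2 * ln (real (prime_at x)))"] by auto
  qed
  then show ?thesis using that by blast
qed

lemma torus_mean_le_sup:
  assumes "G \<in> torus_polys" "0 < p" "\<And>z. (\<And>j. norm (z j) = 1) \<Longrightarrow> norm (G z) \<le> B"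
  shows "torus_mean p G \<le> B powr p"
proof -
  have "torus_mean p G \<le> (\<integral>z. B powr p \<partial>torus_measure)"
    unfolding torus_mean_def
  proof (rule integral_mono_AE[OF integrable_torus_poly[OF assms(1,2)]])
    show "AE z in torus_measure. norm (G z) powr p \<le> B powr p"
      using AE_torus by eventually_elim (use assms(2,3) in \<open>auto intro!: powr_mono2\<close>)
  qed simp
  then show ?thesis by (simp add: torus.prob_space)
qed

lemma prime_at_powr_eq_exp: "real (prime_at j) powr (-\<sigma>) = exp (- ln (real (prime_at j)) * \<sigma>)"
  by (simp add: powr_def mult.commute)

text \<open>The power of \<open>N i\<close> is the one that the Gamma integral of \<sigma>^\<delta>
  exp (- c N \<sigma>) takes away, so each term contributes at most a fixed multiple of
  \<open>t i\<close>.\<close>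

lemma nn_integral_weight_exp_sum_le:
  fixes N t :: "nat \<Rightarrow> real"
  assumes \<alpha>: "-1 < \<alpha>" "-1 < \<alpha> + \<delta>" and c: "0 < c" and D: "0 \<le> D" and I: "finite I"
    and N: "\<And>i. 0 < N i" and t: "\<And>i. 0 \<le> t i"
  shows "(\<integral>\<^sup>+\<sigma>. ennreal (D * (\<Sum>i\<in>I. t i * (N i powr (\<alpha> + \<delta> + 1) * (\<sigma> powr \<delta> * exp (- (c * N i) * \<sigma>))))) \<partial>weight_measure \<alpha>) \<le>
    ennreal (D * (weight_const \<alpha> * Gamma (\<alpha> + \<delta> + 1) * c powr (-(\<alpha> + \<delta> + 1))) * (\<Sum>i\<in>I. t i))"
proof -
  define \<kappa> where "\<kappa> = \<alpha> + \<delta> + 1"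
  have \<kappa>: "0 < \<kappa>" using \<alpha> by (simp add: \<kappa>_def)
  define W where "W = weight_const \<alpha> * Gamma \<kappa>"
  have W: "0 \<le> W" using weight_const_pos[OF \<alpha>(1)] Gamma_real_pos[OF \<kappa>] by (simp add: W_def)
  have int: "(\<integral>\<^sup>+\<sigma>. ennreal (\<sigma> powr \<delta> * exp (- (c * N i) * \<sigma>)) \<partial>weight_measure \<alpha>) = ennreal (W * (2 + c * N i) powr (-\<kappa>))" for i
    unfolding W_def \<kappa>_def using \<alpha> c N[of i] by (intro nn_integral_weight_powr_exp) auto
  have le: "N i powr \<kappa> * (W * (2 + c * N i) powr (-\<kappa>)) \<le> W * c powr (-\<kappa>)" for i
  proof -
    have "(2 + c * N i) powr (-\<kappa>) \<le> (c * N i) powr (-\<kappa>)"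
      using c N[of i] \<kappa> by (intro powr_mono2') auto
    then have "N i powr \<kappa> * (W * (2 + c * N i) powr (-\<kappa>)) \<le> N i powr \<kappa> * (W * (c * N i) powr (-\<kappa>))"
      using W by (intro mult_left_mono) auto
    also have "\<dots> = W * c powr (-\<kappa>) * (N i powr \<kappa> * N i powr (-\<kappa>))"
      using c N[of i] by (simp add: powr_mult mult_ac)
    also have "N i powr \<kappa> * N i powr (-\<kappa>) = 1" using N[of i] by (simp flip: powr_add)
    also have "W * c powr (-\<kappa>) * 1 = W * c powr (-\<kappa>)" by simp
    finally show ?thesis .
  qed
  have "(\<integral>\<^sup>+\<sigma>. ennreal (D * (\<Sum>i\<in>I. t i * (N i powr \<kappa> * (\<sigma> powr \<delta> * exp (- (c * N i) * \<sigma>))))) \<partial>weight_measure \<alpha>) =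
    (\<integral>\<^sup>+\<sigma>. (\<Sum>i\<in>I. ennreal (D * (t i * N i powr \<kappa>)) * ennreal (\<sigma> powr \<delta> * exp (- (c * N i) * \<sigma>))) \<partial>weight_measure \<alpha>)"
    using D t N by (intro nn_integral_cong) (simp add: sum_distrib_left mult_ac flip: ennreal_mult sum_ennreal)
  also have "\<dots> = (\<Sum>i\<in>I. \<integral>\<^sup>+\<sigma>. ennreal (D * (t i * N i powr \<kappa>)) * ennreal (\<sigma> powr \<delta> * exp (- (c * N i) * \<sigma>)) \<partial>weight_measure \<alpha>)"
    by (rule nn_integral_sum) (simp cong: measurable_cong_sets)
  also have "\<dots> = (\<Sum>i\<in>I. ennreal (D * (t i * N i powr \<kappa>)) * ennreal (W * (2 + c * N i) powr (-\<kappa>)))"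
  proof (rule sum.cong[OF refl])
    fix i
    show "(\<integral>\<^sup>+\<sigma>. ennreal (D * (t i * N i powr \<kappa>)) * ennreal (\<sigma> powr \<delta> * exp (- (c * N i) * \<sigma>)) \<partial>weight_measure \<alpha>) =
      ennreal (D * (t i * N i powr \<kappa>)) * ennreal (W * (2 + c * N i) powr (-\<kappa>))"
      unfolding int[symmetric] by (rule nn_integral_cmult) (simp cong: measurable_cong_sets)
  qed
  also have "\<dots> = ennreal (\<Sum>i\<in>I. D * t i * (N i powr \<kappa> * (W * (2 + c * N i) powr (-\<kappa>))))"
    using D t W by (subst sum_ennreal[symmetric]) (auto simp: mult_ac simp flip: ennreal_mult)
  also have "\<dots> \<le> ennreal (\<Sum>i\<in>I. D * t i * (W * c powr (-\<kappa>)))"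
    using D t le by (intro ennreal_leI sum_mono mult_left_mono) auto
  also have "(\<Sum>i\<in>I. D * t i * (W * c powr (-\<kappa>))) = D * (W * c powr (-\<kappa>)) * (\<Sum>i\<in>I. t i)"
    by (subst sum_distrib_left) (intro sum.cong refl, simp add: mult_ac)
  finally show ?thesis by (simp add: W_def \<kappa>_def)
qed

text \<open>With the factor (ln p)^((\<alpha>+1)/q) the mixed norms of the terms p^(-s) are
  uniformly bounded, and lacunary sums of them are controlled by the l^q norm of their coefficients.
  On the torus the sum is bounded by its absolute sum \<open>S\<close>. For q <= 1 the q-th power is
  taken termwise; for q > 1 Hoelder's inequality is applied with the weights \<open>b\<close>, whose
  total is of order \<sigma>^(-\<gamma>) by lacunarity.\<close>

lemma mixed_mean_prime_sum_le:
  assumes p: "0 < p" and q: "0 < q" and \<alpha>: "-1 < \<alpha>"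
  obtains C where "0 < C" "\<And>J (\<tau> :: nat \<Rightarrow> real) k l.
    (\<And>i. 1 \<le> ln (real (prime_at (J i)))) \<Longrightarrow> (\<And>i. 2 * ln (real (prime_at (J i))) \<le> ln (real (prime_at (J (Suc i))))) \<Longrightarrow>
    (\<And>i. 0 \<le> \<tau> i) \<Longrightarrow>
    mixed_mean p q \<alpha> (\<lambda>z. \<Sum>i=k..<l. of_real (\<tau> i * ln (real (prime_at (J i))) powr ((\<alpha> + 1) / q)) * z (J i))
      \<le> C * (\<Sum>i=k..<l. \<tau> i powr q)"
proof -
  define \<gamma> where "\<gamma> = (\<alpha> + 1) / q"
  have \<gamma>: "0 < \<gamma>" "\<gamma> * q = \<alpha> + 1" using \<alpha> q by (auto simp: \<gamma>_def)
  obtain C0 where C0: "0 < C0" and lac: "\<forall>(N :: nat \<Rightarrow> real) n \<sigma>. (\<forall>i. 0 < N i) \<longrightarrow> (\<forall>i. 2 * N i \<le> N (Suc i)) \<longrightarrow> 0 < \<sigma> \<longrightarrow>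
    (\<Sum>i<n. N i powr \<gamma> * exp (- N i * \<sigma>)) \<le> C0 * \<sigma> powr (-\<gamma>)"
  proof (rule lacunary_exp_sum_le[OF \<gamma>(1)])
    fix C assume C: "0 < C" "\<And>(N :: nat \<Rightarrow> real) n \<sigma>. (\<And>i. 0 < N i) \<Longrightarrow> (\<And>i. 2 * N i \<le> N (Suc i)) \<Longrightarrow> 0 < \<sigma> \<Longrightarrow>
      (\<Sum>i<n. N i powr \<gamma> * exp (- N i * \<sigma>)) \<le> C * \<sigma> powr (-\<gamma>)"
    show thesis by (rule that[OF C(1)]) (intro allI impI C(2), auto)
  qed
  \<comment> \<open>Both cases in one shape. Termwise powers give decay exp (- q N \<sigma>) and no
    extra power of \<sigma>; Hoelder's inequality keeps exp (- N \<sigma>) but leaves the factor (C0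
    \<sigma>^(-\<gamma>))^(q-1).\<close>
  define \<delta> D c where "\<delta> = (if q \<le> 1 then 0 else - \<gamma> * (q - 1))" and "D = (if q \<le> 1 then 1 else C0 powr (q - 1))"
    and "c = (if q \<le> 1 then q else 1)"
  have \<delta>: "\<alpha> + \<delta> + 1 = (if q \<le> 1 then \<gamma> * q else \<gamma>)" using \<gamma> by (auto simp: \<delta>_def algebra_simps)
  then have \<delta>1: "-1 < \<alpha> + \<delta>" using \<gamma> q \<alpha> by (auto split: if_splits)
  have c: "0 < c" using q by (simp add: c_def)
  have D: "0 < D" using C0 by (simp add: D_def)
  let ?C = "D * (weight_const \<alpha> * Gamma (\<alpha> + \<delta> + 1) * c powr (-(\<alpha> + \<delta> + 1)))"
  show ?thesis
  proof (rule that[of ?C])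
    show C: "0 < ?C" using D weight_const_pos[OF \<alpha>] Gamma_real_pos[of "\<alpha> + \<delta> + 1"] \<delta>1 c by simp
    fix J :: "nat \<Rightarrow> nat" and \<tau> :: "nat \<Rightarrow> real" and k l :: nat
    assume N1: "\<And>i. 1 \<le> ln (real (prime_at (J i)))" and N2: "\<And>i. 2 * ln (real (prime_at (J i))) \<le> ln (real (prime_at (J (Suc i))))"
      and \<tau>: "\<And>i. 0 \<le> \<tau> i"
    define N where "N i = ln (real (prime_at (J i)))" for i
    have N: "0 < N i" "2 * N i \<le> N (Suc i)" for i unfolding N_def using N1[of i] N2[of i] by linarith+
    define G where "G z = (\<Sum>i=k..<l. of_real (\<tau> i * N i powr \<gamma>) * z (J i))" for z :: "nat \<Rightarrow> complex"
    have GT: "G \<in> torus_polys" unfolding G_def by (intro torus_polys_sum torus_polys_mult) auto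
    define b where "b \<sigma> i = N i powr \<gamma> * exp (- N i * \<sigma>)" for \<sigma> i
    have b0: "0 \<le> b \<sigma> i" for \<sigma> i by (simp add: b_def)
    define S where "S \<sigma> = (\<Sum>i=k..<l. \<tau> i * b \<sigma> i)" for \<sigma>
    have S0: "0 \<le> S \<sigma>" for \<sigma> using \<tau> b0 by (auto simp: S_def intro: sum_nonneg)
    have hm: "hardy_mean p G \<sigma> powr (q / p) \<le> S \<sigma> powr q" for \<sigma>
    proof -
      have "hardy_mean p G \<sigma> \<le> S \<sigma> powr p"
        unfolding hardy_mean_def
      proof (rule torus_mean_le_sup[OF torus_polys_shift[OF GT] p])
        fix z :: "nat \<Rightarrow> complex" assume z: "\<And>j. norm (z j) = 1"
        have "norm (G (shift_coords \<sigma> z)) \<le> (\<Sum>i=k..<l. \<tau> i * b \<sigma> i)"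
          unfolding G_def
          by (rule sum_norm_le) (use z \<tau> in \<open>simp add: shift_coords_def norm_mult prime_at_powr_eq_exp b_def N_def\<close>)
        then show "norm (G (shift_coords \<sigma> z)) \<le> S \<sigma>" by (simp add: S_def)
      qed
      then have "hardy_mean p G \<sigma> powr (q / p) \<le> (S \<sigma> powr p) powr (q / p)"
        using p q by (intro powr_mono2) auto
      then show ?thesis using p by (simp add: powr_powr)
    qed
    have Sq: "S \<sigma> powr q \<le> D * (\<Sum>i=k..<l. \<tau> i powr q * (N i powr (\<alpha> + \<delta> + 1) * (\<sigma> powr \<delta> * exp (- (c * N i) * \<sigma>))))" if \<sigma>: "0 < \<sigma>" for \<sigma>
    proof (cases "q \<le> 1")
      case True
      have "S \<sigma> powr q \<le> (\<Sum>i=k..<l. (\<tau> i * b \<sigma> i) powr q)"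
        unfolding S_def using True q \<tau> b0 by (intro sum_powr_le_powr_sum) auto
      also have "\<dots> = (\<Sum>i=k..<l. \<tau> i powr q * (N i powr (\<gamma> * q) * exp (- (q * N i) * \<sigma>)))"
        using \<tau> N by (intro sum.cong refl) (simp add: b_def powr_mult powr_powr exp_powr_real mult_ac)
      finally show ?thesis using True \<sigma> unfolding \<delta> by (simp add: \<delta>_def D_def c_def)
    next
      case False
      then have q1: "1 \<le> q" by simp
      have "S \<sigma> powr q \<le> (\<Sum>i=k..<l. \<tau> i powr q * b \<sigma> i) * (\<Sum>i=k..<l. b \<sigma> i) powr (q - 1)"
        unfolding S_def using q1 \<tau> b0 by (intro sum_powr_Holder) auto
      also have "\<dots> \<le> (\<Sum>i=k..<l. \<tau> i powr q * b \<sigma> i) * (C0 * \<sigma> powr (-\<gamma>)) powr (q - 1)"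
      proof (intro mult_left_mono powr_mono2 sum_nonneg)
        have "(\<Sum>i=k..<l. b \<sigma> i) \<le> (\<Sum>i<l. b \<sigma> i)" using b0 by (intro sum_mono2) auto
        also have "\<dots> \<le> C0 * \<sigma> powr (-\<gamma>)" unfolding b_def using lac N \<sigma> by blast
        finally show "(\<Sum>i=k..<l. b \<sigma> i) \<le> C0 * \<sigma> powr (-\<gamma>)" .
      qed (use q1 b0 in \<open>auto intro: sum_nonneg\<close>)
      also have "(C0 * \<sigma> powr (-\<gamma>)) powr (q - 1) = D * \<sigma> powr \<delta>"
        using False C0 by (simp add: powr_mult powr_powr D_def \<delta>_def)
      also have "(\<Sum>i=k..<l. \<tau> i powr q * b \<sigma> i) * (D * \<sigma> powr \<delta>) =
        D * (\<Sum>i=k..<l. \<tau> i powr q * (N i powr \<gamma> * (\<sigma> powr \<delta> * exp (- N i * \<sigma>))))"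
        by (simp add: b_def sum_distrib_left sum_distrib_right mult_ac)
      finally show ?thesis using False unfolding \<delta> by (simp add: c_def)
    qed
    have "ennreal (mixed_mean p q \<alpha> G) = (\<integral>\<^sup>+\<sigma>. ennreal (hardy_mean p G \<sigma> powr (q / p)) \<partial>weight_measure \<alpha>)"
      by (rule nn_integral_hardy_mean[OF GT p q \<alpha>, symmetric])
    also have "\<dots> \<le> (\<integral>\<^sup>+\<sigma>. ennreal (D * (\<Sum>i=k..<l. \<tau> i powr q * (N i powr (\<alpha> + \<delta> + 1) * (\<sigma> powr \<delta> * exp (- (c * N i) * \<sigma>))))) \<partial>weight_measure \<alpha>)"
    proof (rule nn_integral_mono_AE)
      show "AE \<sigma> in weight_measure \<alpha>. ennreal (hardy_mean p G \<sigma> powr (q / p)) \<le>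
         ennreal (D * (\<Sum>i=k..<l. \<tau> i powr q * (N i powr (\<alpha> + \<delta> + 1) * (\<sigma> powr \<delta> * exp (- (c * N i) * \<sigma>)))))"
        using AE_weight_measure by eventually_elim (rule ennreal_leI[OF order_trans[OF hm Sq]])
    qed
    also have "\<dots> \<le> ennreal (?C * (\<Sum>i=k..<l. \<tau> i powr q))"
      by (rule nn_integral_weight_exp_sum_le) (use \<alpha> \<delta>1 c D N in auto)
    finally have "mixed_mean p q \<alpha> G \<le> ?C * (\<Sum>i=k..<l. \<tau> i powr q)"
      using mult_nonneg_nonneg[OF less_imp_le[OF C] sum_nonneg[of "{k..<l}" "\<lambda>i. \<tau> i powr q"]]
      by (subst (asm) ennreal_le_iff) auto
    then show "mixed_mean p q \<alpha> (\<lambda>z. \<Sum>i=k..<l. of_real (\<tau> i * ln (real (prime_at (J i))) powr ((\<alpha> + 1) / q)) * z (J i))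
      \<le> ?C * (\<Sum>i=k..<l. \<tau> i powr q)"
      by (simp add: G_def[abs_def] N_def \<gamma>_def)
  qed
qed

section \<open>Necessity of the condition on the weights\<close>

lemma torus_mean_unimodular:
  assumes "\<And>z. (\<And>j. norm (z j) = 1) \<Longrightarrow> norm (G z) = norm (H z)"
  shows "torus_mean u G = torus_mean u H"
  unfolding torus_mean_def
  by (rule Bochner_Integration.integral_cong) (use assms in \<open>auto simp: space_torus_measure\<close>)

text \<open>\<open>G\<close> dominates each summand separately. The i-th one is still of full size
  up to height 1/\<open>N i\<close>, and by lacunarity the intervals (1/(2 N i), 1/N i] are
  disjoint, so the separate bounds add up in the integral. Each interval contributes its weight, of
  order (N i)^(-(\<beta>+1)).\<close>

lemma prime_sum_lower_bound:
  fixes \<tau> :: "nat \<Rightarrow> real"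
  assumes p: "0 < p" and q: "0 < q" and u: "0 < u" and v: "0 < v" and \<alpha>: "-1 < \<alpha>" and \<beta>: "-1 < \<beta>"
    and maps: "superposition \<phi> ` mixed_space p q \<alpha> \<subseteq> mixed_space u v \<beta>"
    and m: "0 < m" "taylor_coeff \<phi> m \<noteq> 0"
    and J: "\<And>i. 1 \<le> ln (real (prime_at (J i)))" "\<And>i. 2 * ln (real (prime_at (J i))) \<le> ln (real (prime_at (J (Suc i))))"
    and \<tau>: "\<And>i. 0 \<le> \<tau> i" "summable (\<lambda>i. \<tau> i powr q)"
  shows "\<exists>M. \<forall>n. (\<Sum>i<n. (\<tau> i * ln (real (prime_at (J i))) powr ((\<alpha> + 1) / q)) powr (real m * v) *
    ln (real (prime_at (J i))) powr (-(\<beta> + 1))) \<le> M"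
proof -
  define N where "N i = ln (real (prime_at (J i)))" for i
  have N: "1 \<le> N i" "0 < N i" "2 * N i \<le> N (Suc i)" for i unfolding N_def using J(1)[of i] J(2)[of i] by linarith+
  have Nmono: "2 * N i \<le> N j" if "i < j" for i j
    using that
  proof (induction j)
    case (Suc j)
    then show ?case using N(3)[of j] N(2)[of j] by (cases "i = j") auto
  qed simp
  have inj: "J i = J j \<longleftrightarrow> i = j" for i j
  proof
    assume "J i = J j"
    then have e: "N i = N j" by (simp add: N_def)
    show "i = j"
      using Nmono[of i j] Nmono[of j i] N(2)[of i] N(2)[of j] e by (cases i j rule: linorder_cases) auto
  qed simp
  define a where "a i = \<tau> i * N i powr ((\<alpha> + 1) / q)" for i
  have a: "0 \<le> a i" for i using \<tau> by (simp add: a_def)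
  define F where "F i z = of_real (a i) * z (J i)" for i and z :: "nat \<Rightarrow> complex"
  have FT: "F i \<in> torus_polys" for i unfolding F_def by (intro torus_polys_mult) auto
  obtain C where C: "0 < C" "\<And>k l. mixed_mean p q \<alpha> (\<lambda>z. \<Sum>i=k..<l. F i z) \<le> C * (\<Sum>i=k..<l. \<tau> i powr q)"
  proof (rule mixed_mean_prime_sum_le[OF p q \<alpha>])
    fix C assume C: "0 < C" "\<And>J (\<tau> :: nat \<Rightarrow> real) k l.
      (\<And>i. 1 \<le> ln (real (prime_at (J i)))) \<Longrightarrow> (\<And>i. 2 * ln (real (prime_at (J i))) \<le> ln (real (prime_at (J (Suc i))))) \<Longrightarrow>
      (\<And>i. 0 \<le> \<tau> i) \<Longrightarrow>
      mixed_mean p q \<alpha> (\<lambda>z. \<Sum>i=k..<l. of_real (\<tau> i * ln (real (prime_at (J i))) powr ((\<alpha> + 1) / q)) * z (J i))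
      \<le> C * (\<Sum>i=k..<l. \<tau> i powr q)"
    show thesis
      by (rule that[OF C(1)]) (unfold F_def a_def N_def, rule C(2)[of J \<tau>, OF J \<tau>(1)])
  qed
  define e where "e k = C * ((\<Sum>i. \<tau> i powr q) - (\<Sum>i<k. \<tau> i powr q))" for k
  have e0: "e \<longlonglongrightarrow> 0"
  proof -
    have "(\<lambda>k. C * ((\<Sum>i. \<tau> i powr q) - (\<Sum>i<k. \<tau> i powr q))) \<longlonglongrightarrow> C * ((\<Sum>i. \<tau> i powr q) - (\<Sum>i. \<tau> i powr q))"
      by (intro tendsto_intros summable_LIMSEQ \<tau>(2))
    then show ?thesis by (simp add: e_def[abs_def])
  qed
  have e1: "mixed_mean p q \<alpha> (\<lambda>z. \<Sum>i=k..<l. F i z) \<le> e k" if kl: "k \<le> l" for k l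
  proof -
    have "(\<Sum>i=k..<l. \<tau> i powr q) = (\<Sum>i<l. \<tau> i powr q) - (\<Sum>i<k. \<tau> i powr q)"
      by (rule sum_lessThan_diff[OF kl, symmetric])
    also have "\<dots> \<le> (\<Sum>i. \<tau> i powr q) - (\<Sum>i<k. \<tau> i powr q)"
      by (intro diff_right_mono sum_le_suminf \<tau>(2)) auto
    finally have "C * (\<Sum>i=k..<l. \<tau> i powr q) \<le> e k" unfolding e_def using C(1) by (intro mult_left_mono) auto
    then show ?thesis using C(2)[of k l] by linarith
  qed
  obtain A f where A: "mixed_approx p q \<alpha> A f" "\<And>k z. bohr_lift (A k) z = (\<Sum>i<k. F i z)"
    using mixed_approx_series[OF p q \<alpha> FT e0 e1] by metis
  have "\<exists>G\<in>borel_measurable borel. (\<integral>\<^sup>+\<sigma>. G \<sigma> \<partial>weight_measure \<beta>) < \<infinity> \<and>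
    (\<forall>i. \<forall>\<sigma>>0. ennreal ((norm (taylor_coeff \<phi> m) powr u * hardy_mean u (\<lambda>z. F i z ^ m) \<sigma>) powr (v / u)) \<le> G \<sigma>)"
    by (rule superposition_hump_bound[OF p q u v \<alpha> \<beta> maps A, where V = "\<lambda>i. {J i}" and J = J and g = "\<lambda>i z. of_real (a i)"])
       (rule FT | (auto simp: F_def inj)[1])+
  then obtain G where G: "G \<in> borel_measurable borel" "(\<integral>\<^sup>+\<sigma>. G \<sigma> \<partial>weight_measure \<beta>) < \<infinity>"
    "\<And>i \<sigma>. 0 < \<sigma> \<Longrightarrow> ennreal ((norm (taylor_coeff \<phi> m) powr u * hardy_mean u (\<lambda>z. F i z ^ m) \<sigma>) powr (v / u)) \<le> G \<sigma>"
    by blast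
  \<comment> \<open>The exponential factor is the loss from exp (- N i \<sigma>) >= 1/e on the i-th
    interval.\<close>
  define L where "L = norm (taylor_coeff \<phi> m) powr v * exp (- (real m * v))"
  have L: "0 < L" using m(2) by (simp add: L_def)
  define y where "y i = L * a i powr (real m * v)" for i
  have y0: "0 \<le> y i" for i using L by (simp add: y_def)
  have yG: "ennreal (y i) \<le> G \<sigma>" if \<sigma>: "0 < \<sigma>" "\<sigma> \<le> 1 / N i" for i \<sigma>
  proof -
    have "hardy_mean u (\<lambda>z. F i z ^ m) \<sigma> = torus_mean u (\<lambda>z. of_real ((a i * exp (- N i * \<sigma>)) ^ m))"
      unfolding hardy_mean_def
      by (rule torus_mean_unimodular)
         (use a[of i] in \<open>simp add: F_def shift_coords_def norm_mult norm_power prime_at_powr_eq_exp N_def power_mult_distrib\<close>)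
    also have "\<dots> = ((a i * exp (- N i * \<sigma>)) ^ m) powr u"
      unfolding torus_mean_const using a[of i] by (simp add: norm_mult norm_power)
    also have "\<dots> = (a i * exp (- N i * \<sigma>)) powr (real m * u)"
      using a[of i] m(1) by (intro power_powr_eq) auto
    finally have h: "hardy_mean u (\<lambda>z. F i z ^ m) \<sigma> = (a i * exp (- N i * \<sigma>)) powr (real m * u)" .
    have "N i * \<sigma> \<le> 1" using \<sigma> N(2)[of i] by (simp add: field_simps)
    then have "a i * exp (- 1) \<le> a i * exp (- N i * \<sigma>)" using a[of i] by (intro mult_left_mono) auto
    then have "(a i * exp (- 1)) powr (real m * v) \<le> (a i * exp (- N i * \<sigma>)) powr (real m * v)"
      using a[of i] v by (intro powr_mono2) auto
    moreover have "(a i * exp (- 1)) powr (real m * v) = a i powr (real m * v) * exp (- (real m * v))"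
      using a[of i] by (simp add: powr_mult exp_powr_real)
    ultimately have "a i powr (real m * v) * exp (- (real m * v)) \<le> (a i * exp (- N i * \<sigma>)) powr (real m * v)"
      by linarith
    then have "norm (taylor_coeff \<phi> m) powr v * (a i powr (real m * v) * exp (- (real m * v))) \<le>
      norm (taylor_coeff \<phi> m) powr v * (a i * exp (- N i * \<sigma>)) powr (real m * v)"
      by (intro mult_left_mono) auto
    moreover have "y i = norm (taylor_coeff \<phi> m) powr v * (a i powr (real m * v) * exp (- (real m * v)))"
      by (simp add: y_def L_def)
    ultimately have "y i \<le> norm (taylor_coeff \<phi> m) powr v * (a i * exp (- N i * \<sigma>)) powr (real m * v)"
      by linarith
    also have "\<dots> = (norm (taylor_coeff \<phi> m) powr u * hardy_mean u (\<lambda>z. F i z ^ m) \<sigma>) powr (v / u)"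
      unfolding h using u by (simp add: powr_mult powr_powr mult.assoc)
    finally show ?thesis by (rule order_trans[OF ennreal_leI G(3)[OF \<sigma>(1), of i]])
  qed
  define I where "I i = {1 / N i / 2<..1 / N i}" for i
  have disj: "i = j" if "\<sigma> \<in> I i" "\<sigma> \<in> I j" for i j \<sigma>
  proof -
    have False if ij: "i < j" and s: "\<sigma> \<in> I i" "\<sigma> \<in> I j" for i j
    proof -
      have "1 / N j \<le> 1 / (2 * N i)" using Nmono[OF ij] N(2)[of i] by (intro divide_left_mono) (auto intro: mult_pos_pos N)
      then show False using s by (auto simp: I_def)
    qed
    then show ?thesis using that by (cases i j rule: linorder_cases) auto
  qed
  obtain c where c: "0 < c" "\<And>t. 0 < t \<Longrightarrow> t \<le> 1 \<Longrightarrow> ennreal (c * t powr (\<beta> + 1)) \<le> emeasure (weight_measure \<beta>) {t/2<..t}"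
    using emeasure_weight_lower[OF \<beta>] by metis
  obtain M where M: "0 \<le> M" "(\<integral>\<^sup>+\<sigma>. G \<sigma> \<partial>weight_measure \<beta>) = ennreal M"
    using G(2) by (cases "\<integral>\<^sup>+\<sigma>. G \<sigma> \<partial>weight_measure \<beta>") auto
  have bound: "(\<Sum>i<n. y i * (c * N i powr (-(\<beta> + 1)))) \<le> M" for n
  proof -
    have "ennreal (\<Sum>i<n. y i * (c * N i powr (-(\<beta> + 1)))) = (\<Sum>i<n. ennreal (y i) * ennreal (c * (1 / N i) powr (\<beta> + 1)))"
    proof (subst sum_ennreal[symmetric])
      show "(\<Sum>i<n. ennreal (y i * (c * N i powr (-(\<beta> + 1))))) = (\<Sum>i<n. ennreal (y i) * ennreal (c * (1 / N i) powr (\<beta> + 1)))"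
      proof (rule sum.cong[OF refl])
        fix i
        have "N i powr (-(\<beta> + 1)) = (1 / N i) powr (\<beta> + 1)"
          unfolding powr_minus_divide using N(2)[of i] by (simp add: powr_divide)
        then show "ennreal (y i * (c * N i powr (-(\<beta> + 1)))) = ennreal (y i) * ennreal (c * (1 / N i) powr (\<beta> + 1))"
          using y0 by (simp only: ennreal_mult')
      qed
    qed (use y0 c in auto)
    also have "\<dots> \<le> (\<Sum>i<n. ennreal (y i) * emeasure (weight_measure \<beta>) (I i))"
      unfolding I_def using N by (intro sum_mono mult_left_mono c(2)) auto
    also have "\<dots> = (\<Sum>i<n. \<integral>\<^sup>+\<sigma>. ennreal (y i) * indicator (I i) \<sigma> \<partial>weight_measure \<beta>)"
      by (intro sum.cong refl nn_integral_cmult_indicator[symmetric]) (simp add: I_def)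
    also have "\<dots> = (\<integral>\<^sup>+\<sigma>. (\<Sum>i<n. ennreal (y i) * indicator (I i) \<sigma>) \<partial>weight_measure \<beta>)"
      by (rule nn_integral_sum[symmetric]) (simp add: I_def cong: measurable_cong_sets)
    \<comment> \<open>Disjointness: at each height at most one term of the sum is non-zero.\<close>
    also have "\<dots> \<le> (\<integral>\<^sup>+\<sigma>. G \<sigma> \<partial>weight_measure \<beta>)"
    proof (rule nn_integral_mono)
      fix \<sigma>
      show "(\<Sum>i<n. ennreal (y i) * indicator (I i) \<sigma>) \<le> G \<sigma>"
      proof (cases "\<exists>i<n. \<sigma> \<in> I i")
        case True
        then obtain i where i: "i < n" "\<sigma> \<in> I i" by blast
        have "(\<Sum>j<n. ennreal (y j) * indicator (I j) \<sigma>) = (\<Sum>j<n. if j = i then ennreal (y i) else 0)"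
        proof (rule sum.cong[OF refl])
          fix j
          show "ennreal (y j) * indicator (I j) \<sigma> = (if j = i then ennreal (y i) else 0)"
          proof (cases "j = i")
            case True
            then show ?thesis using i(2) by simp
          next
            case False
            then have "\<sigma> \<notin> I j" using disj[OF i(2), of j] by blast
            then show ?thesis using False by simp
          qed
        qed
        also have "\<dots> = ennreal (y i)" using i(1) by (simp add: sum.delta)
        also have "\<dots> \<le> G \<sigma>"
        proof (rule yG)
          have "0 < 1 / N i / 2" using N(2)[of i] by simp
          then show "0 < \<sigma>" using i(2) by (auto simp: I_def intro: less_trans)
        qed (use i(2) in \<open>simp add: I_def\<close>)
        finally show ?thesis .
      next
        case False
        then have "(\<Sum>j<n. ennreal (y j) * indicator (I j) \<sigma>) = 0" by (intro sum.neutral) (auto simp: indicator_def)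
        then show ?thesis by simp
      qed
    qed
    finally show ?thesis unfolding M(2) using M(1) by (simp add: ennreal_le_iff)
  qed
  show ?thesis
  proof (intro exI allI)
    fix n
    have "(\<Sum>i<n. y i * (c * N i powr (-(\<beta> + 1)))) = L * c * (\<Sum>i<n. a i powr (real m * v) * N i powr (-(\<beta> + 1)))"
      by (simp add: y_def sum_distrib_left mult_ac)
    then have "(\<Sum>i<n. a i powr (real m * v) * N i powr (-(\<beta> + 1))) \<le> M / (L * c)"
      using bound[of n] L c(1) by (simp add: pos_le_divide_eq mult.commute)
    then show "(\<Sum>i<n. (\<tau> i * ln (real (prime_at (J i))) powr ((\<alpha> + 1) / q)) powr (real m * v) *
      ln (real (prime_at (J i))) powr (-(\<beta> + 1))) \<le> M / (L * c)"
      by (simp add: a_def N_def)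
  qed
qed

text \<open>The terms of the bounded sums are \<open>\<tau> i powr s\<close> times the \<kappa>-th
  power of ln p. If \<kappa> > 0, large primes make every term at least 1. If \<kappa> = 0, the
  violated condition means \<alpha> > \<beta>, hence s < q, and a sequence in l^q outside l^s
  contradicts the bound.\<close>

lemma superposition_weight_condition:
  assumes p: "0 < p" and q: "0 < q" and u: "0 < u" and v: "0 < v" and \<alpha>: "-1 < \<alpha>" and \<beta>: "-1 < \<beta>"
    and maps: "superposition \<phi> ` mixed_space p q \<alpha> \<subseteq> mixed_space u v \<beta>"
    and m: "0 < m" "taylor_coeff \<phi> m \<noteq> 0"
  shows "real m * v * (\<alpha> + 1) < q * (\<beta> + 1) \<or> \<alpha> \<le> \<beta> \<and> real m * v * (\<alpha> + 1) = q * (\<beta> + 1)"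
proof (rule ccontr)
  assume neg: "\<not> ?thesis"
  define s where "s = real m * v"
  have s: "0 < s" using m v by (simp add: s_def)
  define \<kappa> where "\<kappa> = s * ((\<alpha> + 1) / q) - (\<beta> + 1)"
  have \<kappa>0: "0 \<le> \<kappa>" using neg q by (auto simp: \<kappa>_def s_def field_simps)
  have term_eq: "(t * N powr ((\<alpha> + 1) / q)) powr s * N powr (-(\<beta> + 1)) = t powr s * N powr \<kappa>"
    if "0 \<le> t" "0 < N" for t N :: real
  proof -
    have "(\<alpha> + 1) / q * s + -(\<beta> + 1) = \<kappa>" by (simp add: \<kappa>_def)
    then show ?thesis using that
      by (simp only: powr_mult powr_powr mult.assoc powr_add[symmetric] powr_ge_zero)
  qed
  show False
  proof (cases "0 < \<kappa>")
    case True
    \<comment> \<open>A geometric sequence is q-summable for every q > 0; the primes are then taken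
      so large that the \<kappa>-th power of the logarithm makes up for
      \<open>\<tau> i powr s\<close>.\<close>
    define \<tau> where "\<tau> i = (1/2 :: real) ^ i" for i
    obtain J where J: "\<And>i. (2 ^ i) powr (s / \<kappa>) \<le> ln (real (prime_at (J i)))" "\<And>i. 1 \<le> ln (real (prime_at (J i)))"
      "\<And>i. 2 * ln (real (prime_at (J i))) \<le> ln (real (prime_at (J (Suc i))))"
      using exists_lacunary_primes[of "\<lambda>i. (2 ^ i) powr (s / \<kappa>)"] by metis
    have "summable (\<lambda>i. ((1/2 :: real) powr q) ^ i)"
      using q powr_less_mono2[of q "1/2" 1] by (intro summable_geometric) simp
    then have "summable (\<lambda>i. \<tau> i powr q)"
      by (simp add: \<tau>_def powr_realpow[symmetric] powr_powr mult.commute)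
    then obtain M where M: "\<And>n. (\<Sum>i<n. (\<tau> i * ln (real (prime_at (J i))) powr ((\<alpha> + 1) / q)) powr s *
      ln (real (prime_at (J i))) powr (-(\<beta> + 1))) \<le> M"
      using prime_sum_lower_bound[where J = J and \<tau> = \<tau>, OF p q u v \<alpha> \<beta> maps m J(2,3)] unfolding s_def by (auto simp: \<tau>_def)
    have ge1: "1 \<le> (\<tau> i * ln (real (prime_at (J i))) powr ((\<alpha> + 1) / q)) powr s * ln (real (prime_at (J i))) powr (-(\<beta> + 1))" for i
    proof -
      have "0 < ln (real (prime_at (J i)))" using J(2)[of i] by linarith
      then have "(\<tau> i * ln (real (prime_at (J i))) powr ((\<alpha> + 1) / q)) powr s * ln (real (prime_at (J i))) powr (-(\<beta> + 1)) =
         \<tau> i powr s * ln (real (prime_at (J i))) powr \<kappa>"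
        by (intro term_eq) (auto simp: \<tau>_def)
      also have "\<tau> i powr s * ln (real (prime_at (J i))) powr \<kappa> \<ge> \<tau> i powr s * ((2 ^ i) powr (s / \<kappa>)) powr \<kappa>"
        using True J(1)[of i] by (intro mult_left_mono powr_mono2) auto
      also have "\<tau> i powr s * ((2 ^ i) powr (s / \<kappa>)) powr \<kappa> = (\<tau> i * 2 ^ i) powr s"
        using True by (simp add: powr_powr powr_mult \<tau>_def)
      also have "\<tau> i * 2 ^ i = 1" by (simp add: \<tau>_def power_mult_distrib[symmetric])
      finally show ?thesis by simp
    qed
    obtain n :: nat where n: "M < real n" using reals_Archimedean2 by blast
    have "real n \<le> (\<Sum>i<n. (\<tau> i * ln (real (prime_at (J i))) powr ((\<alpha> + 1) / q)) powr s * ln (real (prime_at (J i))) powr (-(\<beta> + 1)))"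
      using sum_mono[of "{..<n}" "\<lambda>_. 1", OF ge1] by simp
    with M[of n] n show False by linarith
  next
    case False
    with \<kappa>0 have \<kappa>: "\<kappa> = 0" by simp
    then have eq: "s * (\<alpha> + 1) = q * (\<beta> + 1)" using q by (simp add: \<kappa>_def field_simps)
    with neg have "\<beta> < \<alpha>" by (auto simp: s_def)
    then have "s * (\<alpha> + 1) < q * (\<alpha> + 1)" unfolding eq using q by simp
    then have sq: "s < q" using \<alpha> by simp
    \<comment> \<open>The s-th powers form the harmonic series, while the q-th powers have exponent
      -q/s < -1.\<close>
    define \<tau> where "\<tau> i = real (Suc i) powr (- (1 / s))" for i
    obtain J where J: "\<And>i. 1 \<le> ln (real (prime_at (J i)))"
      "\<And>i. 2 * ln (real (prime_at (J i))) \<le> ln (real (prime_at (J (Suc i))))"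
      using exists_lacunary_primes[of "\<lambda>i. 0"] by metis
    have "summable (\<lambda>i. real i powr (- (q / s)))" using s sq by (simp add: summable_real_powr_iff)
    then have "summable (\<lambda>i. real (Suc i) powr (- (q / s)))" by (subst summable_Suc_iff)
    then have "summable (\<lambda>i. \<tau> i powr q)" by (simp add: \<tau>_def powr_powr)
    then obtain M where M: "\<And>n. (\<Sum>i<n. (\<tau> i * ln (real (prime_at (J i))) powr ((\<alpha> + 1) / q)) powr s *
      ln (real (prime_at (J i))) powr (-(\<beta> + 1))) \<le> M"
      using prime_sum_lower_bound[where J = J and \<tau> = \<tau>, OF p q u v \<alpha> \<beta> maps m J] unfolding s_def by (auto simp: \<tau>_def)
    have e: "(\<tau> i * ln (real (prime_at (J i))) powr ((\<alpha> + 1) / q)) powr s * ln (real (prime_at (J i))) powr (-(\<beta> + 1)) = 1 / real (Suc i)" for i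
    proof -
      have N: "0 < ln (real (prime_at (J i)))" using J(1)[of i] by linarith
      then have "(\<tau> i * ln (real (prime_at (J i))) powr ((\<alpha> + 1) / q)) powr s * ln (real (prime_at (J i))) powr (-(\<beta> + 1)) =
         \<tau> i powr s * ln (real (prime_at (J i))) powr \<kappa>"
        by (intro term_eq) (auto simp: \<tau>_def)
      also have "\<dots> = \<tau> i powr s" using N unfolding \<kappa> by simp
      also have "\<dots> = real (Suc i) powr (-1)" using s by (simp add: \<tau>_def powr_powr)
      also have "\<dots> = 1 / real (Suc i)" by (simp add: powr_minus divide_inverse)
      finally show ?thesis .
    qed
    have "(\<Sum>i<n. 1 / real (Suc i)) \<le> M" for n using M[of n] unfolding e .
    then have "summable (\<lambda>i. 1 / real (Suc i))"
      by (intro summableI_nonneg_bounded[of _ M]) auto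
    then have "summable (\<lambda>i. inverse (real i))" by (subst summable_Suc_iff[symmetric]) (simp add: divide_inverse)
    then show False using not_summable_harmonic[where 'a = real] by simp
  qed
qed

section \<open>Concentrated humps\<close>

lemma norm_one_plus_circ_sq: "norm ((1 + circ t) / 2) ^ 2 = 1 - sin (pi * t) ^ 2"
proof -
  have "norm ((1 + circ t) / 2) ^ 2 = ((1 + cos (2 * pi * t)) ^ 2 + sin (2 * pi * t) ^ 2) / 4"
    by (simp add: circ_def norm_divide cmod_power2 power_divide)
  also have "\<dots> = (1 + cos (2 * (pi * t))) / 2"
    using sin_cos_squared_add[of "2 * pi * t"] by (simp add: power2_eq_square algebra_simps)
  also have "\<dots> = 1 - sin (pi * t) ^ 2" unfolding cos_double_sin by (simp add: field_simps)
  finally show ?thesis .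
qed

text \<open>From sin x >= x - x^3/6, which is at least x/3 on [0, 2]. Slope 1 suffices in place of
  the optimal 2.\<close>

lemma sin_pi_lower: "0 \<le> t \<Longrightarrow> t \<le> 1 / 2 \<Longrightarrow> t \<le> sin (pi * t)"
proof -
  assume t: "0 \<le> t" "t \<le> 1 / 2"
  define x where "x = pi * t"
  have x: "0 \<le> x" "x \<le> 2" using t pi_less_4 mult_mono[of pi 4 t "1/2"] by (auto simp: x_def)
  have "\<bar>sin x - (\<Sum>m<3. sin_coeff m * x ^ m)\<bar> \<le> inverse (fact 3) * \<bar>x\<bar> ^ 3" by (rule Maclaurin_sin_bound)
  moreover have "(\<Sum>m<3. sin_coeff m * x ^ m) = x"
    by (simp add: eval_nat_numeral sin_coeff_def)
  ultimately have "\<bar>sin x - x\<bar> \<le> x ^ 3 / 6" using x by (simp add: fact_numeral)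
  then have "x - x ^ 3 / 6 \<le> sin x" by linarith
  moreover have "x ^ 3 / 6 \<le> 2 / 3 * x"
  proof -
    have "x * x \<le> 2 * 2" using x by (intro mult_mono) auto
    then have "x * (x * x) \<le> x * 4" using x by (intro mult_left_mono) auto
    then show ?thesis by (simp add: power3_eq_cube)
  qed
  ultimately have "x / 3 \<le> sin x" by simp
  moreover have "t \<le> x / 3" using t pi_gt3 mult_right_mono[of 3 pi t] by (simp add: x_def)
  ultimately show ?thesis by (simp add: x_def)
qed

lemma integral_arctan:
  assumes k: "0 < (k :: real)"
  shows "((\<lambda>t. 1 / (1 + (k * t)\<^sup>2)) has_integral arctan k / k) {0..1}"
    and "((\<lambda>t. 1 / (1 + (k * (1 - t))\<^sup>2)) has_integral arctan k / k) {0..1}"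
proof -
  have "((\<lambda>t. 1 / (1 + (k * t)\<^sup>2)) has_integral arctan (k * 1) / k - arctan (k * 0) / k) {0..1}"
  proof (rule fundamental_theorem_of_calculus)
    fix t :: real
    have "((\<lambda>t. arctan (k * t) / k) has_real_derivative 1 / (1 + (k * t)\<^sup>2)) (at t within {0..1})"
      using k by (auto intro!: derivative_eq_intros simp: divide_inverse)
    then show "((\<lambda>t. arctan (k * t) / k) has_vector_derivative 1 / (1 + (k * t)\<^sup>2)) (at t within {0..1})"
      by (simp add: has_real_derivative_iff_has_vector_derivative)
  qed simp
  then show "((\<lambda>t. 1 / (1 + (k * t)\<^sup>2)) has_integral arctan k / k) {0..1}" by simp
  have "((\<lambda>t. 1 / (1 + (k * (1 - t))\<^sup>2)) has_integral - arctan (k * (1 - 1)) / k - (- arctan (k * (1 - 0)) / k)) {0..1}"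
  proof (rule fundamental_theorem_of_calculus)
    fix t :: real
    have "((\<lambda>t. - arctan (k * (1 - t)) / k) has_real_derivative 1 / (1 + (k * (1 - t))\<^sup>2)) (at t within {0..1})"
      using k by (auto intro!: derivative_eq_intros simp: divide_inverse)
    then show "((\<lambda>t. - arctan (k * (1 - t)) / k) has_vector_derivative 1 / (1 + (k * (1 - t))\<^sup>2)) (at t within {0..1})"
      by (simp add: has_real_derivative_iff_has_vector_derivative)
  qed simp
  then show "((\<lambda>t. 1 / (1 + (k * (1 - t))\<^sup>2)) has_integral arctan k / k) {0..1}" by simp
qed

lemma continuous_norm_circ_powr:
  "0 < s \<Longrightarrow> continuous_on T (\<lambda>t. norm ((1 + of_real r * circ t) / 2) powr s)"
  by (intro continuous_on_powr' continuous_intros) auto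

text \<open>With c = s/2 the integrand is (1 - sin^2)^c <= exp (- c sin^2) <= 1/(1 + c sin^2). This
  majorant is preferred to a Gaussian because it integrates to an arctangent. There are two summands
  because the peak at t = 0 reappears at t = 1.\<close>

lemma one_plus_circ_mean_upper:
  assumes s: "0 < s"
  shows "integral {0..1} (\<lambda>t. norm ((1 + circ t) / 2) powr s) \<le> pi / sqrt (s / 2)"
proof -
  define c where "c = s / 2"
  have c: "0 < c" using s by (simp add: c_def)
  have pw: "norm ((1 + circ t) / 2) powr s \<le> 1 / (1 + c * t\<^sup>2) + 1 / (1 + c * (1 - t)\<^sup>2)" if t: "t \<in> {0..1}" for t
  proof -
    define y where "y = sin (pi * t) ^ 2"
    have y0: "0 \<le> y" by (simp add: y_def)
    have nn: "norm ((1 + circ t) / 2) ^ 2 = 1 - y" unfolding y_def by (rule norm_one_plus_circ_sq)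
    have "norm ((1 + circ t) / 2) powr s = (norm ((1 + circ t) / 2) ^ 2) powr c"
      by (subst power_powr_eq) (auto simp: c_def)
    also have "\<dots> = (1 - y) powr c" by (simp only: nn)
    also have "\<dots> \<le> exp (- y) powr c"
    proof (rule powr_mono2)
      have "0 \<le> norm ((1 + circ t) / 2) ^ 2" by simp
      then show "0 \<le> 1 - y" unfolding nn .
      show "1 - y \<le> exp (- y)" using exp_ge_add_one_self[of "-y"] by simp
    qed (use c in simp)
    also have "\<dots> = 1 / exp (c * y)" unfolding exp_powr_real by (simp add: exp_minus divide_inverse mult.commute)
    also have "\<dots> \<le> 1 / (1 + c * y)"
    proof -
      have "0 < 1 + c * y" using c y0 by (intro add_pos_nonneg mult_nonneg_nonneg) auto
      then show ?thesis using exp_ge_add_one_self[of "c * y"] by (intro divide_left_mono) auto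
    qed
    finally have 1: "norm ((1 + circ t) / 2) powr s \<le> 1 / (1 + c * y)" .
    have nonneg: "0 \<le> 1 / (1 + c * t\<^sup>2)" "0 \<le> 1 / (1 + c * (1 - t)\<^sup>2)" using c by auto
    show ?thesis
    proof (cases "t \<le> 1/2")
      case True
      then have "t\<^sup>2 \<le> y" unfolding y_def using t sin_pi_lower[of t] by (intro power_mono) auto
      then have "1 / (1 + c * y) \<le> 1 / (1 + c * t\<^sup>2)"
        using c y0 by (intro divide_left_mono add_left_mono mult_left_mono mult_pos_pos add_pos_nonneg) auto
      then show ?thesis using 1 nonneg by linarith
    next
      case False
      have "sin (pi * t) = sin (pi * (1 - t))" using sin_pi_minus[of "pi * t"] by (simp add: right_diff_distrib)
      then have "(1 - t)\<^sup>2 \<le> y" unfolding y_def using t False sin_pi_lower[of "1 - t"] by (intro power_mono) auto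
      then have "1 / (1 + c * y) \<le> 1 / (1 + c * (1 - t)\<^sup>2)"
        using c y0 by (intro divide_left_mono add_left_mono mult_left_mono mult_pos_pos add_pos_nonneg) auto
      then show ?thesis using 1 nonneg by linarith
    qed
  qed
  have hi: "((\<lambda>t. 1 / (1 + c * t\<^sup>2) + 1 / (1 + c * (1 - t)\<^sup>2)) has_integral (arctan (sqrt c) / sqrt c + arctan (sqrt c) / sqrt c)) {0..1}"
  proof -
    have "c * t\<^sup>2 = (sqrt c * t)\<^sup>2" for t using c by (simp add: power_mult_distrib)
    then show ?thesis using c by (simp only:) (intro has_integral_add integral_arctan, auto)
  qed
  have "integral {0..1} (\<lambda>t. norm ((1 + circ t) / 2) powr s) \<le> integral {0..1} (\<lambda>t. 1 / (1 + c * t\<^sup>2) + 1 / (1 + c * (1 - t)\<^sup>2))"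
  proof (rule integral_le[OF _ _ pw])
    show "(\<lambda>t. norm ((1 + circ t) / 2) powr s) integrable_on {0..1}"
      using continuous_norm_circ_powr[OF s, of "{0..1}" 1] by (intro integrable_continuous_real) simp
    show "(\<lambda>t. 1 / (1 + c * t\<^sup>2) + 1 / (1 + c * (1 - t)\<^sup>2)) integrable_on {0..1}"
      using hi by (rule has_integral_integrable)
  qed
  also have "\<dots> = (2 * arctan (sqrt c)) / sqrt c" using hi by (simp add: integral_unique)
  also have "\<dots> \<le> pi / sqrt c" using arctan_ubound[of "sqrt c"] c by (intro divide_right_mono) auto
  finally show ?thesis by (simp add: c_def)
qed

text \<open>On an arc of length of order n^(-1/2) around 1 the modulus is at least 1 - 2/n even
  after the variable is shrunk by r >= 1 - 1/n. Its power of order n therefore stays above a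
  constant.\<close>

lemma one_plus_circ_mean_lower:
  assumes \<mu>: "0 < \<mu>" and n: "4 \<le> n" and r: "1 - 1 / real n \<le> r" "r \<le> 1"
  shows "exp (- 4 * \<mu>) / 4 * real n powr (-(1/2)) \<le> integral {0..1} (\<lambda>t. norm ((1 + of_real r * circ t) / 2) powr (real n * \<mu>))"
proof -
  \<comment> \<open>With this length sin^2 (pi t) is at most 1/n on the arc, by pi < 4.\<close>
  define \<delta> where "\<delta> = 1 / (4 * sqrt (real n))"
  have n0: "0 < real n" using n by simp
  have "1 \<le> sqrt (real n)" using n by simp
  then have "0 < 4 * sqrt (real n)" "1 \<le> 4 * sqrt (real n)" by linarith+
  then have \<delta>: "0 < \<delta>" "\<delta> \<le> 1" unfolding \<delta>_def by (simp_all only: divide_le_eq_1_pos zero_less_divide_1_iff)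
  have s: "0 < real n * \<mu>" using n0 \<mu> by simp
  have cont: "continuous_on T (\<lambda>t. norm ((1 + of_real r * circ t) / 2) powr (real n * \<mu>))" for T
    by (rule continuous_norm_circ_powr[OF s])
  have low: "exp (- 4 * \<mu>) \<le> norm ((1 + of_real r * circ t) / 2) powr (real n * \<mu>)" if t: "t \<in> {0..\<delta>}" for t
  proof -
    define x where "x = 1 / real n"
    have x: "0 < x" "x \<le> 1/4" using n by (auto simp: x_def field_simps)
    have "t * t \<le> \<delta> * \<delta>" using t by (intro mult_mono) auto
    also have "\<delta> * \<delta> = x / 16" using n0 by (simp add: \<delta>_def x_def)
    finally have tt: "t * t \<le> x / 16" .
    have "sin (pi * t) ^ 2 \<le> (pi * t) ^ 2" using abs_sin_x_le_abs_x[of "pi * t"] by (simp add: abs_le_square_iff)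
    also have "\<dots> = (pi * pi) * (t * t)" by (simp add: power2_eq_square mult_ac)
    also have "\<dots> \<le> (4 * 4) * (x / 16)" using tt pi_less_4 by (intro mult_mono) auto
    finally have "1 - 2 * x \<le> cos (2 * pi * t)" using cos_double_sin[of "pi * t"] by (simp add: mult.assoc)
    moreover have "0 \<le> r" using r(1) x unfolding x_def by linarith
    ultimately have "(1 - x) * (1 - 2 * x) \<le> r * cos (2 * pi * t)" using r x by (intro mult_mono) (auto simp: x_def)
    then have "1 - 3 * x \<le> r * cos (2 * pi * t)" using x by (simp add: algebra_simps) (smt (verit) mult_nonneg_nonneg)
    then have "1 - 2 * x \<le> Re ((1 + of_real r * circ t) / 2)" using x by (simp add: circ_def)
    also have "\<dots> \<le> norm ((1 + of_real r * circ t) / 2)" by (rule complex_Re_le_cmod)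
    finally have 1: "1 - 2 * x \<le> norm ((1 + of_real r * circ t) / 2)" .
    have "- (2 * x) - 2 * (2 * x)\<^sup>2 \<le> ln (1 - 2 * x)" using x by (intro ln_one_minus_pos_lower_bound) auto
    moreover have "2 * (2 * x)\<^sup>2 \<le> 2 * x"
      using x mult_left_mono[of x "1/4" "8 * x"] by (simp add: power2_eq_square)
    ultimately have "- 4 * x \<le> ln (1 - 2 * x)" by linarith
    then have "exp (- 4 * x) \<le> 1 - 2 * x" using x by (subst (asm) ln_ge_iff) auto
    then have "exp (- 4 * x) powr (real n * \<mu>) \<le> norm ((1 + of_real r * circ t) / 2) powr (real n * \<mu>)"
      using 1 s by (intro powr_mono2) auto
    moreover have "exp (- 4 * x) powr (real n * \<mu>) = exp (- 4 * \<mu>)"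
      using n0 by (simp add: exp_powr_real x_def)
    ultimately show ?thesis by simp
  qed
  have "exp (- 4 * \<mu>) / 4 * real n powr (-(1/2)) = \<delta> * exp (- 4 * \<mu>)"
    using n0 by (simp add: \<delta>_def powr_minus powr_half_sqrt field_simps)
  also have "\<dots> = integral {0..\<delta>} (\<lambda>t. exp (- 4 * \<mu>))" using \<delta> by simp
  also have "\<dots> \<le> integral {0..\<delta>} (\<lambda>t. norm ((1 + of_real r * circ t) / 2) powr (real n * \<mu>))"
    by (intro integral_le integrable_continuous_real cont low continuous_on_const)
  also have "\<dots> \<le> integral {0..1} (\<lambda>t. norm ((1 + of_real r * circ t) / 2) powr (real n * \<mu>))"
    using \<delta> by (intro integral_subset_le integrable_continuous_real cont) auto
  finally show ?thesis .
qed

text \<open>The coordinates are independent under the Haar measure.\<close>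

lemma torus_mean_prod:
  fixes h :: "nat \<Rightarrow> complex poly"
  assumes S: "finite S" and u: "0 < u"
  shows "torus_mean u (\<lambda>z. \<Prod>j\<in>S. poly (h j) (z j)) = (\<Prod>j\<in>S. integral {0..1} (\<lambda>t. norm (poly (h j) (circ t)) powr u))"
  using S
proof (induction S)
  case (insert j S)
  let ?R = "\<lambda>z. \<Prod>j\<in>S. poly (h j) (z j)" and ?I = "integral {0..1} (\<lambda>t. norm (poly (h j) (circ t)) powr u)"
  have T: "(\<lambda>z. \<Prod>j\<in>S. poly (h j) (z j)) \<in> torus_polys" for S
    by (intro torus_polys_prod torus_polys_poly) auto
  have m: "(\<lambda>z. ennreal (norm (G z) powr u)) \<in> borel_measurable torus_measure" if "G \<in> torus_polys" for G
    using torus_polys_measurable[OF that] by measurable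
  have I0: "0 \<le> ?I" by (rule integral_nonneg) (auto intro!: integrable_continuous_real continuous_poly_powr u continuous_on_circ)
  have R: "?R (z(j := x)) = ?R z" for z x using insert.hyps by (intro prod.cong) auto
  have "ennreal (torus_mean u (\<lambda>z. \<Prod>j\<in>insert j S. poly (h j) (z j))) =
    (\<integral>\<^sup>+z. \<integral>\<^sup>+x. ennreal (norm (\<Prod>i\<in>insert j S. poly (h i) ((z(j := x)) i)) powr u) \<partial>circle_measure \<partial>torus_measure)"
    by (simp only: nn_integral_torus_mean[OF T u, symmetric] torus_Fubini[OF m[OF T], of "insert j S" j])
  also have "\<dots> = (\<integral>\<^sup>+z. ennreal (norm (?R z) powr u) * ennreal ?I \<partial>torus_measure)"
  proof (rule nn_integral_cong)
    fix z
    have "norm (\<Prod>i\<in>insert j S. poly (h i) ((z(j := x)) i)) powr u = norm (?R z) powr u * norm (poly (h j) x) powr u" for x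
    proof -
      have "(\<Prod>i\<in>insert j S. poly (h i) ((z(j := x)) i)) = poly (h j) x * ?R (z(j := x))"
        using insert.hyps by simp
      then show ?thesis unfolding R by (simp add: norm_mult powr_mult)
    qed
    then have "(\<integral>\<^sup>+x. ennreal (norm (\<Prod>i\<in>insert j S. poly (h i) ((z(j := x)) i)) powr u) \<partial>circle_measure) =
      (\<integral>\<^sup>+x. ennreal (norm (?R z) powr u) * ennreal (norm (poly (h j) x) powr u) \<partial>circle_measure)"
      by (simp only: ennreal_mult' powr_ge_zero)
    also have "\<dots> = ennreal (norm (?R z) powr u) * ennreal ?I"
      unfolding nn_integral_circle_poly[OF u, symmetric]
      by (rule nn_integral_cmult) (intro measurable_compose[OF circle_measurable[OF borel_measurable_continuous_onI] measurable_ennreal] continuous_poly_powr u continuous_on_id)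
    finally show "(\<integral>\<^sup>+x. ennreal (norm (\<Prod>i\<in>insert j S. poly (h i) ((z(j := x)) i)) powr u) \<partial>circle_measure) =
      ennreal (norm (?R z) powr u) * ennreal ?I" .
  qed
  also have "\<dots> = ennreal (torus_mean u ?R) * ennreal ?I"
    unfolding nn_integral_torus_mean[OF T u, symmetric] by (rule nn_integral_multc[OF m[OF T]])
  also have "\<dots> = ennreal (torus_mean u ?R * ?I)" by (simp add: ennreal_mult I0)
  finally have "torus_mean u (\<lambda>z. \<Prod>j\<in>insert j S. poly (h j) (z j)) = torus_mean u ?R * ?I"
    using I0 by (subst (asm) ennreal_inj) auto
  with insert show ?case by (simp add: mult.commute)
qed simp

text \<open>The mean of \<open>|(1 + z)/2|\<^sup>n\<^sup>p\<close> over the circle is comparable to \<open>n\<^sup>-\<^sup>1\<^sup>/\<^sup>2\<close> for every \<open>p\<close>, so many factors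
  magnify the gap between the exponents \<open>p\<close> and \<open>m u\<close>. The extra linear factor is what isolates
  Taylor monomials.\<close>

definition hump :: "real \<Rightarrow> nat \<Rightarrow> nat \<Rightarrow> nat set \<Rightarrow> (nat \<Rightarrow> complex) \<Rightarrow> complex" where
  "hump a n J S z = z J * (of_real a * (\<Prod>j\<in>S. ((1 + z j) / 2) ^ n))"

lemma hump_in_torus_polys: "hump a n J S \<in> torus_polys"
proof -
  have "(\<lambda>z. z J * (of_real a * (\<Prod>j\<in>S. poly ([:1/2, 1/2:] ^ n) (z j)))) \<in> torus_polys"
    by (intro torus_polys_mult torus_polys_prod torus_polys_poly) auto
  moreover have "hump a n J S = (\<lambda>z. z J * (of_real a * (\<Prod>j\<in>S. poly ([:1/2, 1/2:] ^ n) (z j))))"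
    by (rule ext) (simp add: hump_def field_simps)
  ultimately show ?thesis by simp
qed

lemma torus_mean_hump_le:
  assumes "0 \<le> a" "0 < n" "finite S" "0 < p"
  shows "torus_mean p (hump a n J S) \<le> a powr p * (pi / sqrt (p / 2) * real n powr (-(1/2))) ^ card S"
proof -
  let ?I = "integral {0..1} (\<lambda>t. norm (poly ([:1/2, 1/2:] ^ n) (circ t)) powr p)"
  have eq: "torus_mean p (hump a n J S) = torus_mean p (\<lambda>z. of_real a * (\<Prod>j\<in>S. poly ([:1/2, 1/2:] ^ n) (z j)))"
    by (rule torus_mean_unimodular) (simp add: hump_def norm_mult add_divide_distrib)
  have I: "?I \<le> pi / sqrt (p / 2) * real n powr (-(1/2))"
  proof -
    have "?I = integral {0..1} (\<lambda>t. norm ((1 + circ t) / 2) powr (real n * p))"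
    proof (rule integral_cong)
      fix t
      have "poly ([:1/2, 1/2:] ^ n) (circ t) = ((1 + circ t) / 2) ^ n" by (simp add: add_divide_distrib)
      then show "norm (poly ([:1/2, 1/2:] ^ n) (circ t)) powr p = norm ((1 + circ t) / 2) powr (real n * p)"
        using assms by (simp only: norm_power power_powr_eq[OF norm_ge_zero])
    qed
    also have "\<dots> \<le> pi / sqrt (real n * p / 2)" using assms by (intro one_plus_circ_mean_upper) auto
    also have "\<dots> = pi / sqrt (p / 2) * real n powr (-(1/2))"
      using assms by (simp add: powr_minus powr_half_sqrt real_sqrt_mult real_sqrt_divide field_simps)
    finally show ?thesis .
  qed
  have I0: "0 \<le> ?I" by (rule integral_nonneg) (auto intro!: integrable_continuous_real continuous_poly_powr assms continuous_on_circ simp del: poly_power)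
  have "torus_mean p (hump a n J S) = a powr p * ?I ^ card S"
    unfolding eq torus_mean_cmult torus_mean_prod[OF assms(3,4)] using assms(1) by simp
  also have "\<dots> \<le> a powr p * (pi / sqrt (p / 2) * real n powr (-(1/2))) ^ card S"
    using I I0 by (intro mult_left_mono power_mono) auto
  finally show ?thesis .
qed

text \<open>Up to height 1/(n \<Lambda>) every coordinate involved shrinks by a factor of at least 1
  - 1/n, which does not yet flatten the factors of the hump. The linear coordinate loses at most a
  factor 2.\<close>

lemma hardy_mean_hump_ge:
  assumes a: "0 \<le> a" and n: "4 \<le> n" and S: "finite S" and u: "0 < u" and m: "0 < m"
    and \<Lambda>: "1 \<le> \<Lambda>" "\<And>j. j \<in> insert J S \<Longrightarrow> ln (real (prime_at j)) \<le> \<Lambda>"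
    and \<sigma>: "0 < \<sigma>" "\<sigma> \<le> 1 / (real n * \<Lambda>)"
  shows "(a / 2) powr (real m * u) * (exp (- 4 * (real m * u)) / 4 * real n powr (-(1/2))) ^ card S \<le>
    hardy_mean u (\<lambda>z. hump a n J S z ^ m) \<sigma>"
proof -
  define r where "r j = real (prime_at j) powr (-\<sigma>)" for j
  have n0: "0 < real n" using n by simp
  have r: "1 - 1 / real n \<le> r j" "r j \<le> 1" if j: "j \<in> insert J S" for j
  proof -
    have "ln (real (prime_at j)) * \<sigma> \<le> \<Lambda> * (1 / (real n * \<Lambda>))"
      using \<Lambda>(1) \<Lambda>(2)[OF j] \<sigma> by (intro mult_mono) auto
    also have "\<dots> = 1 / real n" using \<Lambda>(1) by simp
    finally show "1 - 1 / real n \<le> r j"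
      unfolding r_def prime_at_powr_eq_exp using exp_ge_add_one_self[of "- ln (real (prime_at j)) * \<sigma>"] by simp
    show "r j \<le> 1" unfolding r_def using \<sigma> by (intro prime_at_powr_le_1) simp
  qed
  define b where "b = (a * r J) ^ m"
  have b: "0 \<le> b" using a by (simp add: b_def r_def)
  define h :: "nat \<Rightarrow> complex poly" where "h j = [:1/2, of_real (r j) / 2:] ^ (n * m)" for j
  have eq: "hardy_mean u (\<lambda>z. hump a n J S z ^ m) \<sigma> = torus_mean u (\<lambda>z. of_real b * (\<Prod>j\<in>S. poly (h j) (z j)))"
    unfolding hardy_mean_def
  proof (rule torus_mean_unimodular)
    fix z :: "nat \<Rightarrow> complex" assume z: "\<And>j. norm (z j) = 1"
    have "hump a n J S (shift_coords \<sigma> z) ^ m = z J ^ m * (of_real b * (\<Prod>j\<in>S. poly (h j) (z j)))"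
      by (simp add: hump_def shift_coords_def b_def h_def r_def power_mult_distrib prod_power_distrib[symmetric] power_mult[symmetric] add_divide_distrib mult_ac)
    then show "norm (hump a n J S (shift_coords \<sigma> z) ^ m) = norm (of_real b * (\<Prod>j\<in>S. poly (h j) (z j)))"
      using z by (simp add: norm_mult norm_power)
  qed
  have I: "exp (- 4 * (real m * u)) / 4 * real n powr (-(1/2)) \<le> integral {0..1} (\<lambda>t. norm (poly (h j) (circ t)) powr u)" if j: "j \<in> S" for j
  proof -
    have "exp (- 4 * (real m * u)) / 4 * real n powr (-(1/2)) \<le>
      integral {0..1} (\<lambda>t. norm ((1 + of_real (r j) * circ t) / 2) powr (real n * (real m * u)))"
      using m u n r j by (intro one_plus_circ_mean_lower) auto
    also have "\<dots> = integral {0..1} (\<lambda>t. norm (poly (h j) (circ t)) powr u)"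
    proof (rule integral_cong)
      fix t
      have "poly (h j) (circ t) = ((1 + of_real (r j) * circ t) / 2) ^ (n * m)" by (simp add: h_def add_divide_distrib mult_ac)
      then have "norm (poly (h j) (circ t)) powr u = norm ((1 + of_real (r j) * circ t) / 2) powr (real (n * m) * u)"
        using n m by (simp only: norm_power) (rule power_powr_eq, auto)
      then show "norm ((1 + of_real (r j) * circ t) / 2) powr (real n * (real m * u)) = norm (poly (h j) (circ t)) powr u"
        by (simp add: mult.assoc)
    qed
    finally show ?thesis .
  qed
  have "a / 2 \<le> a * r J"
  proof -
    have "1 / real n \<le> 1 / 4" using n by (intro divide_left_mono) auto
    then have "1 / 2 \<le> r J" using r(1)[of J] by simp
    then show ?thesis using a mult_left_mono[of "1/2" "r J" a] by simp
  qed
  then have "(a / 2) powr (real m * u) \<le> (a * r J) powr (real m * u)" using a m u by (intro powr_mono2) auto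
  also have "\<dots> = b powr u" unfolding b_def using a m by (intro power_powr_eq[symmetric]) (auto simp: r_def)
  finally have 1: "(a / 2) powr (real m * u) \<le> b powr u" .
  have "(exp (- 4 * (real m * u)) / 4 * real n powr (-(1/2))) ^ card S = (\<Prod>j\<in>S. exp (- 4 * (real m * u)) / 4 * real n powr (-(1/2)))"
    by simp
  also have "\<dots> \<le> (\<Prod>j\<in>S. integral {0..1} (\<lambda>t. norm (poly (h j) (circ t)) powr u))"
    using I by (intro prod_mono) auto
  finally have 2: "(exp (- 4 * (real m * u)) / 4 * real n powr (-(1/2))) ^ card S \<le> (\<Prod>j\<in>S. integral {0..1} (\<lambda>t. norm (poly (h j) (circ t)) powr u))" .
  show ?thesis
    unfolding eq torus_mean_cmult torus_mean_prod[OF S u]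
    using 1 2 b by (intro mult_mono) auto
qed

section \<open>Necessity of m u <= p\<close>

lemma exists_nat_powr_ge:
  fixes c e X :: real
  assumes "0 < c" "0 < e"
  obtains n :: nat where "4 \<le> n" "X \<le> c * real n powr e"
proof -
  define Y where "Y = (max X 1 / c) powr (1 / e)"
  define n where "n = max 4 (nat \<lceil>Y\<rceil>)"
  have "Y \<le> real n" unfolding n_def by linarith
  then have "Y powr e \<le> real n powr e" using assms by (intro powr_mono2) (auto simp: Y_def)
  moreover have "Y powr e = max X 1 / c" using assms by (simp add: Y_def powr_powr)
  ultimately have "max X 1 \<le> c * real n powr e" using assms(1) by (simp add: field_simps)
  then have "X \<le> c * real n powr e" by simp
  moreover have "4 \<le> n" by (simp add: n_def)
  ultimately show ?thesis using that by blast
qed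

text \<open>Each hump is normalized in the p-mean, which makes its amplitude of order n^(d/(2p)).
  The u-mean of its m-th power then grows with n when m u > p, and \<open>G\<close> must bear this
  growth on an interval of heights of order 1/n. With n large depending on the hump, the integral of
  \<open>G\<close> exceeds every i. No disjointness of the intervals is needed here.\<close>

lemma superposition_exponent_condition:
  assumes p: "0 < p" and q: "0 < q" and u: "0 < u" and v: "0 < v" and \<alpha>: "-1 < \<alpha>" and \<beta>: "-1 < \<beta>"
    and maps: "superposition \<phi> ` mixed_space p q \<alpha> \<subseteq> mixed_space u v \<beta>"
    and m: "0 < m" "taylor_coeff \<phi> m \<noteq> 0"
  shows "real m * u \<le> p"
proof (rule ccontr)
  assume "\<not> real m * u \<le> p"
  then have \<rho>: "0 < real m / p - 1 / u" using p u by (simp add: field_simps)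
  \<comment> \<open>Makes the net exponent \<open>e\<close> of n positive.\<close>
  obtain d :: nat where d0: "(\<beta> + 1) / (v / 2 * (real m / p - 1 / u)) < real d" using reals_Archimedean2 by blast
  define e where "e = real d * (v / 2 * (real m / p - 1 / u)) - (\<beta> + 1)"
  have e: "0 < e" using d0 \<rho> v by (simp add: e_def pos_divide_less_eq)
  define D where "D = Suc d"
  \<comment> \<open>Consecutive blocks of d + 1 prime indices: the first prime enters linearly, the
    other d carry the hump.\<close>
  define J where "J i = i * D" for i
  define S where "S i = {Suc (i * D)..<Suc i * D}" for i
  have S: "finite (S i)" "card (S i) = d" "J i \<notin> S i" for i by (auto simp: S_def J_def D_def)
  have V: "J j \<in> insert (J i) (S i) \<longleftrightarrow> i = j" for i j
  proof -
    have "J j \<in> insert (J i) (S i) \<longleftrightarrow> i * D \<le> j * D \<and> j * D < Suc i * D" by (auto simp: J_def S_def D_def)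
    also have "\<dots> \<longleftrightarrow> i \<le> j \<and> j < Suc i" unfolding mult_le_cancel2 mult_less_cancel2 by (auto simp: D_def)
    finally show ?thesis by auto
  qed
  \<comment> \<open>A crude common bound for the logarithms of the primes of block i, independent of
    \<open>n i\<close>.\<close>
  define \<Lambda> where "\<Lambda> i = 1 + (\<Sum>j\<in>insert (J i) (S i). ln (real (prime_at j)))" for i
  have lnp: "0 \<le> ln (real (prime_at j))" for j using prime_at_gt_1[of j] by simp
  have \<Lambda>1: "1 \<le> \<Lambda> i" for i unfolding \<Lambda>_def using lnp by (simp add: sum_nonneg)
  have \<Lambda>: "ln (real (prime_at j)) \<le> \<Lambda> i" if "j \<in> insert (J i) (S i)" for i j
  proof -
    have "ln (real (prime_at j)) \<le> (\<Sum>j\<in>insert (J i) (S i). ln (real (prime_at j)))"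
      using S(1) that lnp by (intro member_le_sum) auto
    then show ?thesis by (simp add: \<Lambda>_def)
  qed
  obtain K where K: "1 \<le> K" "\<And>G H. G \<in> torus_polys \<Longrightarrow> H \<in> torus_polys \<Longrightarrow>
    mixed_mean p q \<alpha> (\<lambda>z. G z + H z) \<le> K * (mixed_mean p q \<alpha> G + mixed_mean p q \<alpha> H)"
    using mixed_mean_add_le[OF p q \<alpha>] by metis
  \<comment> \<open>Each addition costs the factor \<open>K\<close>; with these values K (\<eta> k +
    E (Suc k)) = E k, where \<open>E\<close> is the tail bound below.\<close>
  define \<eta> where "\<eta> i = (1 / (2 * K)) ^ Suc i" for i
  have \<eta>: "0 < \<eta> i" for i using K(1) by (simp add: \<eta>_def)
  obtain cb where cb: "0 < cb" "\<And>t. 0 < t \<Longrightarrow> t \<le> 1 \<Longrightarrow> ennreal (cb * t powr (\<beta> + 1)) \<le> emeasure (weight_measure \<beta>) {t/2<..t}"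
    using emeasure_weight_lower[OF \<beta>] by metis
  define C2 where "C2 = pi / sqrt (p / 2)"
  have C2: "0 < C2" using p by (simp add: C2_def)
  define c3 where "c3 = exp (- 4 * (real m * u)) / 4"
  have c3: "0 < c3" by (simp add: c3_def)
  \<comment> \<open>Chosen so that the upper bound for the p-mean of hump i becomes exactly
    \<open>\<eta> i powr (p / q)\<close>; the power of n in \<open>a\<close> cancels the one in that
    bound.\<close>
  define A where "A i = \<eta> i powr (1 / q) * C2 powr (- real d / p)" for i
  have A: "0 < A i" for i unfolding A_def using \<eta>[of i] C2 by (intro mult_pos_pos) (auto dest: less_imp_neq)
  define t where "t = norm (taylor_coeff \<phi> m)"
  have t: "0 < t" using m(2) by (simp add: t_def)
  \<comment> \<open>Collects the factors of the lower bound that are free of \<open>n i\<close>, so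
    that \<open>n i\<close> can be chosen last.\<close>
  define B where "B i = t powr v * (A i / 2) powr (real m * v) * c3 powr (real d * v / u) * cb * \<Lambda> i powr (-(\<beta> + 1))" for i
  have B: "0 < B i" for i
    unfolding B_def using t A[of i] c3 cb(1) \<Lambda>1[of i] by (intro mult_pos_pos) (auto dest: less_imp_neq)
  have "\<forall>i. \<exists>n. 4 \<le> n \<and> real i \<le> B i * real n powr e"
    by (blast intro: exists_nat_powr_ge[OF B e])
  from choice[OF this] obtain n where "\<forall>i. 4 \<le> n i \<and> real i \<le> B i * real (n i) powr e" ..
  then have n: "\<And>i. 4 \<le> n i" "\<And>i. real i \<le> B i * real (n i) powr e" by blast+
  have n0: "0 < real (n i)" "0 < n i" for i using n(1)[of i] by auto
  define a where "a i = A i * real (n i) powr (real d / (2 * p))" for i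
  have a: "0 < a i" for i using A[of i] n0[of i] by (simp add: a_def)
  define F where "F i = hump (a i) (n i) (J i) (S i)" for i
  have FT: "F i \<in> torus_polys" for i unfolding F_def by (rule hump_in_torus_polys)
  have Fle: "mixed_mean p q \<alpha> (F i) \<le> \<eta> i" for i
  proof -
    have "torus_mean p (F i) \<le> a i powr p * (C2 * real (n i) powr (-(1/2))) ^ d"
      unfolding F_def C2_def S(2)[of i, symmetric] by (rule torus_mean_hump_le) (use a n0 S p in \<open>auto intro: less_imp_le\<close>)
    also have "\<dots> = \<eta> i powr (p / q)"
    proof -
      have 1: "a i powr p = \<eta> i powr (p / q) * C2 powr (- real d) * real (n i) powr (real d / 2)"
        using p A[of i] \<eta>[of i] C2 by (simp add: a_def A_def powr_mult powr_powr)
      have 2: "(C2 * real (n i) powr (-(1/2))) ^ d = C2 powr real d * real (n i) powr (- (real d / 2))"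
        using C2 n0[of i] by (simp add: powr_realpow[symmetric] powr_mult powr_powr)
      have "C2 powr (- real d) * C2 powr real d = 1" "real (n i) powr (real d / 2) * real (n i) powr (- (real d / 2)) = 1"
        using C2 n0[of i] by (simp_all flip: powr_add)
      then have "(C2 powr (- real d) * C2 powr real d) * (real (n i) powr (real d / 2) * real (n i) powr (- (real d / 2))) = 1" by simp
      then show ?thesis unfolding 1 2 by (simp add: mult_ac)
    qed
    finally have "torus_mean p (F i) powr (q / p) \<le> (\<eta> i powr (p / q)) powr (q / p)"
      using p q by (intro powr_mono2) auto
    also have "\<dots> = \<eta> i" using p q \<eta>[of i] by (simp add: powr_powr)
    finally show ?thesis using mixed_mean_le_torus_mean[OF FT[of i] p q \<alpha>] by linarith
  qed
  define E where "E k = (1 / (2 * K)) ^ k" for k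
  have E0: "E \<longlonglongrightarrow> 0" unfolding E_def using K(1) by (intro LIMSEQ_power_zero) auto
  have E1: "mixed_mean p q \<alpha> (\<lambda>z. \<Sum>i=k..<l. F i z) \<le> E k" if "k \<le> l" for k l
    using that
  proof (induction k rule: inc_induct)
    case base
    have "mixed_mean p q \<alpha> (\<lambda>z. 0) = 0" using p q by (simp add: mixed_mean_def hardy_mean_def)
    then show ?case using K(1) by (simp add: E_def)
  next
    case (step k)
    have "mixed_mean p q \<alpha> (\<lambda>z. \<Sum>i=k..<l. F i z) = mixed_mean p q \<alpha> (\<lambda>z. F k z + (\<Sum>i=Suc k..<l. F i z))"
      using step.hyps by (simp add: sum.atLeast_Suc_lessThan)
    also have "\<dots> \<le> K * (mixed_mean p q \<alpha> (F k) + mixed_mean p q \<alpha> (\<lambda>z. \<Sum>i=Suc k..<l. F i z))"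
      by (intro K(2) FT torus_polys_sum)
    also have "\<dots> \<le> K * (\<eta> k + E (Suc k))"
      using K(1) Fle step.IH by (intro mult_left_mono add_mono) auto
    also have "\<dots> = E k" using K(1) by (simp add: \<eta>_def E_def)
    finally show ?case .
  qed
  obtain Ak f where Ak: "mixed_approx p q \<alpha> Ak f" "\<And>k z. bohr_lift (Ak k) z = (\<Sum>i<k. F i z)"
    using mixed_approx_series[OF p q \<alpha> FT E0 E1] by metis
  define g where "g i z = of_real (a i) * (\<Prod>j\<in>S i. ((1 + z j) / 2) ^ n i)" for i and z :: "nat \<Rightarrow> complex"
  have g_upd: "g i (z(J i := x)) = g i z" for i z x
    unfolding g_def using S(3)[of i] by (intro arg_cong2[where f = "(*)"] prod.cong refl) auto
  have F_proj: "F i (\<lambda>j. of_real (if j \<in> insert (J i) (S i) then 1 else 0) * z j) = F i z" for i z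
    unfolding F_def hump_def by (intro arg_cong2[where f = "(*)"] prod.cong refl) auto
  have F_eq: "F i z = z (J i) * g i z" for i z by (simp add: F_def hump_def g_def)
  have V': "finite (insert (J i) (S i))" for i using S(1) by simp
  have "\<exists>G\<in>borel_measurable borel. (\<integral>\<^sup>+\<sigma>. G \<sigma> \<partial>weight_measure \<beta>) < \<infinity> \<and>
    (\<forall>i. \<forall>\<sigma>>0. ennreal ((norm (taylor_coeff \<phi> m) powr u * hardy_mean u (\<lambda>z. F i z ^ m) \<sigma>) powr (v / u)) \<le> G \<sigma>)"
    by (rule superposition_hump_bound[OF p q u v \<alpha> \<beta> maps Ak, where V = "\<lambda>i. insert (J i) (S i)" and J = J and g = g])
       (rule V' V FT F_eq g_upd F_proj)+
  then obtain G where G: "G \<in> borel_measurable borel" "(\<integral>\<^sup>+\<sigma>. G \<sigma> \<partial>weight_measure \<beta>) < \<infinity>"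
    "\<And>i \<sigma>. 0 < \<sigma> \<Longrightarrow> ennreal ((t powr u * hardy_mean u (\<lambda>z. F i z ^ m) \<sigma>) powr (v / u)) \<le> G \<sigma>"
    unfolding t_def by blast
  obtain M where M: "0 \<le> M" "(\<integral>\<^sup>+\<sigma>. G \<sigma> \<partial>weight_measure \<beta>) = ennreal M"
    using G(2) by (cases "\<integral>\<^sup>+\<sigma>. G \<sigma> \<partial>weight_measure \<beta>") auto
  have "real i \<le> M" for i
  proof -
    define \<tau> where "\<tau> = 1 / (real (n i) * \<Lambda> i)"
    have nL: "1 \<le> real (n i) * \<Lambda> i" using n(1)[of i] \<Lambda>1[of i] mult_mono[of 1 "real (n i)" 1 "\<Lambda> i"] by simp
    then have \<tau>: "0 < \<tau>" "\<tau> \<le> 1" by (auto simp: \<tau>_def divide_simps)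
    define y where "y = t powr v * (a i / 2) powr (real m * v) * (c3 * real (n i) powr (-(1/2))) powr (real d * v / u)"
    have y0: "0 \<le> y" by (simp add: y_def)
    have yG: "ennreal y \<le> G \<sigma>" if \<sigma>: "0 < \<sigma>" "\<sigma> \<le> \<tau>" for \<sigma>
    proof -
      let ?h = "(a i / 2) powr (real m * u) * (c3 * real (n i) powr (-(1/2))) ^ d"
      have h: "?h \<le> hardy_mean u (\<lambda>z. F i z ^ m) \<sigma>"
        unfolding F_def c3_def S(2)[of i, symmetric]
        by (rule hardy_mean_hump_ge) (use a n S u m \<Lambda>1 \<Lambda> \<sigma> in \<open>auto simp: \<tau>_def intro: less_imp_le\<close>)
      have c0: "0 < c3 * real (n i) powr (-(1/2))" using c3 n0[of i] by simp
      have "y = (t powr u * ?h) powr (v / u)"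
        using u c0 t a[of i] by (simp add: y_def powr_mult powr_powr powr_realpow[symmetric] mult.assoc)
      also have "\<dots> \<le> (t powr u * hardy_mean u (\<lambda>z. F i z ^ m) \<sigma>) powr (v / u)"
        using h u v c0 by (intro powr_mono2 mult_left_mono) auto
      finally show ?thesis by (rule order_trans[OF ennreal_leI G(3)[OF \<sigma>(1), of i]])
    qed
    have "ennreal (y * (cb * \<tau> powr (\<beta> + 1))) \<le> ennreal y * emeasure (weight_measure \<beta>) {\<tau>/2<..\<tau>}"
      using cb(2)[OF \<tau>] y0 by (simp add: ennreal_mult' mult_left_mono)
    also have "\<dots> = (\<integral>\<^sup>+\<sigma>. ennreal y * indicator {\<tau>/2<..\<tau>} \<sigma> \<partial>weight_measure \<beta>)"
      by (rule nn_integral_cmult_indicator[symmetric]) simp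
    also have "\<dots> \<le> (\<integral>\<^sup>+\<sigma>. G \<sigma> \<partial>weight_measure \<beta>)"
      using yG \<tau> by (intro nn_integral_mono) (auto simp: indicator_def)
    finally have "y * (cb * \<tau> powr (\<beta> + 1)) \<le> M" unfolding M(2) using M(1) by (simp add: ennreal_le_iff)
    moreover have "y * (cb * \<tau> powr (\<beta> + 1)) = B i * real (n i) powr e"
    proof -
      let ?n = "real (n i)"
      have 1: "(a i / 2) powr (real m * v) = (A i / 2) powr (real m * v) * ?n powr (real d / (2 * p) * (real m * v))"
      proof -
        have "a i / 2 = A i / 2 * ?n powr (real d / (2 * p))" by (simp add: a_def)
        then show ?thesis using A[of i] by (simp only: powr_mult powr_powr)
      qed
      have 2: "(c3 * ?n powr (-(1/2))) powr (real d * v / u) = c3 powr (real d * v / u) * ?n powr (-(1/2) * (real d * v / u))"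
        using c3 by (simp only: powr_mult powr_powr)
      have 3: "\<tau> powr (\<beta> + 1) = ?n powr (-(\<beta> + 1)) * \<Lambda> i powr (-(\<beta> + 1))"
        using n0[of i] \<Lambda>1[of i] unfolding \<tau>_def powr_minus_divide by (simp add: powr_divide powr_mult)
      have 4: "real d / (2 * p) * (real m * v) + -(1/2) * (real d * v / u) + -(\<beta> + 1) = e"
        using p u by (simp add: e_def field_simps)
      have "y * (cb * \<tau> powr (\<beta> + 1)) = B i * (?n powr (real d / (2 * p) * (real m * v)) * ?n powr (-(1/2) * (real d * v / u)) * ?n powr (-(\<beta> + 1)))"
        unfolding y_def B_def 1 2 3 by (simp only: mult_ac)
      also have "\<dots> = B i * ?n powr e" unfolding powr_add[symmetric] 4 ..
      finally show ?thesis .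
    qed
    ultimately show ?thesis using n(2)[of i] by linarith
  qed
  moreover obtain i :: nat where "M < real i" using reals_Archimedean2 by blast
  ultimately show False by (meson not_le)
qed

section \<open>Conclusion: admissible degrees\<close>

lemma superposition_polynomial:
  assumes p: "0 < p" and q: "0 < q" and u: "0 < u" and v: "0 < v" and \<alpha>: "-1 < \<alpha>" and \<beta>: "-1 < \<beta>"
    and maps: "superposition \<phi> ` mixed_space p q \<alpha> \<subseteq> mixed_space u v \<beta>"
  obtains P where "\<phi> = poly P" "real (degree P) * u \<le> p"
    "real (degree P) * v * (\<alpha> + 1) < q * (\<beta> + 1) \<or> \<alpha> \<le> \<beta> \<and> real (degree P) * v * (\<alpha> + 1) = q * (\<beta> + 1)"
proof -
  have hol: "\<phi> holomorphic_on UNIV" by (rule superposition_entire[OF p q u v \<beta> maps])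
  obtain k :: nat where k: "p / u < real k" using reals_Archimedean2 by blast
  \<comment> \<open>Beyond p/u every Taylor coefficient vanishes, so the power series of \<phi> is a
    finite sum.\<close>
  have zero: "taylor_coeff \<phi> m = 0" if "k \<le> m" for m
  proof (rule ccontr)
    assume nz: "taylor_coeff \<phi> m \<noteq> 0"
    have pk: "p < real k * u" using k u by (simp add: pos_divide_less_eq)
    have "real k * u \<le> real m * u" using that u by (intro mult_right_mono) auto
    moreover have "m \<noteq> 0" using that pk p by (cases "k = 0") auto
    moreover from this have "real m * u \<le> p"
      using superposition_exponent_condition[OF p q u v \<alpha> \<beta> maps _ nz] by simp
    ultimately show False using pk by linarith
  qed
  define P where "P = taylor_poly \<phi> k"
  have coeffP: "coeff P m = (if m < k then taylor_coeff \<phi> m else 0)" for m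
    by (simp add: P_def taylor_poly_def coeff_sum)
  have "poly P x = \<phi> x" for x
  proof -
    have "(\<lambda>n. taylor_coeff \<phi> n * x ^ n) sums (\<Sum>n<k. taylor_coeff \<phi> n * x ^ n)"
      by (rule sums_finite) (auto simp: zero)
    then show ?thesis using taylor_sums[OF hol, of x] sums_unique2 unfolding P_def poly_taylor_poly by blast
  qed
  then have eq: "\<phi> = poly P" by auto
  show ?thesis
  proof (rule that[OF eq])
    show "real (degree P) * u \<le> p"
    proof (cases "degree P = 0")
      case False
      then have "taylor_coeff \<phi> (degree P) \<noteq> 0"
        using coeffP[of "degree P"] by (metis degree_0 leading_coeff_0_iff)
      then show ?thesis using superposition_exponent_condition[OF p q u v \<alpha> \<beta> maps] False by simp
    qed (use p in simp)
    show "real (degree P) * v * (\<alpha> + 1) < q * (\<beta> + 1) \<or> \<alpha> \<le> \<beta> \<and> real (degree P) * v * (\<alpha> + 1) = q * (\<beta> + 1)"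
    proof (cases "degree P = 0")
      case False
      then have "taylor_coeff \<phi> (degree P) \<noteq> 0"
        using coeffP[of "degree P"] by (metis degree_0 leading_coeff_0_iff)
      then show ?thesis using superposition_weight_condition[OF p q u v \<alpha> \<beta> maps] False by simp
    qed (use q \<beta> in simp)
  qed
qed

theorem theorem5p8:
  fixes p q u v \<alpha> \<beta> :: real and \<phi> :: "complex \<Rightarrow> complex"
  assumes "0 < p" "0 < q" "0 < u" "0 < v" and "-1 < \<alpha>" "-1 < \<beta>"
  shows "(superposition \<phi> ` mixed_space p q \<alpha> \<subseteq> mixed_space u v \<beta> \<longleftrightarrow>
           (\<exists>P :: complex poly. (\<forall>z. \<phi> z = poly P z) \<and>
              (\<alpha> \<le> \<beta> \<longrightarrow>
                 real (degree P) \<le> min (p / u) (q * (\<beta> + 1) / (v * (\<alpha> + 1)))) \<and>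
              (\<alpha> > \<beta> \<longrightarrow>
                 real (degree P) \<le> p / u \<and>
                 real (degree P) < q * (\<beta> + 1) / (v * (\<alpha> + 1)))))
       \<and> (superposition \<phi> ` mixed_space p q \<alpha> \<subseteq> mixed_space u v \<beta> \<longrightarrow>
           bounded_operator (mixed_space p q \<alpha>)
             (mixed_space_norm p q \<alpha>) (mixed_space_norm u v \<beta>) (superposition \<phi>) \<and>
           continuous_operator (mixed_space p q \<alpha>)
             (mixed_space_norm p q \<alpha>) (mixed_space_norm u v \<beta>) (superposition \<phi>))"
proof -
  let ?maps = "superposition \<phi> ` mixed_space p q \<alpha> \<subseteq> mixed_space u v \<beta>"
  let ?cond = "\<lambda>P. (\<alpha> \<le> \<beta> \<longrightarrow> real (degree P) \<le> min (p / u) (q * (\<beta> + 1) / (v * (\<alpha> + 1)))) \<and>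
    (\<alpha> > \<beta> \<longrightarrow> real (degree P) \<le> p / u \<and> real (degree P) < q * (\<beta> + 1) / (v * (\<alpha> + 1)))"
  \<comment> \<open>Cleared of denominators, the two cases on \<alpha> and \<beta> merge into a
    strict inequality, or equality together with \<alpha> <= \<beta>.\<close>
  have cond_iff: "?cond P \<longleftrightarrow> real (degree P) * u \<le> p \<and>
    (real (degree P) * v * (\<alpha> + 1) < q * (\<beta> + 1) \<or> \<alpha> \<le> \<beta> \<and> real (degree P) * v * (\<alpha> + 1) = q * (\<beta> + 1))" for P :: "complex poly"
  proof -
    have va: "0 < v * (\<alpha> + 1)" using assms by simp
    show ?thesis
      using assms(3) by (auto simp: pos_le_divide_eq[OF va] pos_less_divide_eq[OF va] pos_le_divide_eq mult.assoc)
  qed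
  have suff: "?maps \<and> bounded_operator (mixed_space p q \<alpha>) (mixed_space_norm p q \<alpha>) (mixed_space_norm u v \<beta>) (superposition \<phi>) \<and>
    continuous_operator (mixed_space p q \<alpha>) (mixed_space_norm p q \<alpha>) (mixed_space_norm u v \<beta>) (superposition \<phi>)"
    if P: "\<phi> = poly P" "?cond P" for P
  proof -
    have "\<exists>t>0. \<forall>\<epsilon>>0. \<exists>C>0. \<forall>X\<in>torus_polys. \<forall>H\<in>torus_polys.
      mixed_mean u v \<beta> (\<lambda>z. poly P (X z + H z) - poly P (X z)) \<le>
      \<epsilon> * (1 + mixed_mean p q \<alpha> X powr t) + C * mixed_mean p q \<alpha> H powr t"
      using P(2) unfolding cond_iff by (intro mixed_mean_poly_diff assms) auto
    then obtain t where t: "0 < t" "\<forall>\<epsilon>>0. \<exists>C>0. \<forall>X\<in>torus_polys. \<forall>H\<in>torus_polys.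
      mixed_mean u v \<beta> (\<lambda>z. poly P (X z + H z) - poly P (X z)) \<le>
      \<epsilon> * (1 + mixed_mean p q \<alpha> X powr t) + C * mixed_mean p q \<alpha> H powr t" by blast
    interpret poly_superposition p q u v \<alpha> \<beta> P t
      by unfold_locales (use assms t in auto)
    show ?thesis unfolding P(1) using maps bounded continuous by blast
  qed
  have nec: "\<exists>P. \<phi> = poly P \<and> ?cond P" if ?maps
    using superposition_polynomial[OF assms that] cond_iff by metis
  have "(\<forall>z. \<phi> z = poly P z) \<longleftrightarrow> \<phi> = poly P" for P by auto
  then show ?thesis using suff nec by metis
qed

end
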